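(* Let $\mathcal{M}_{\mathrm{in}}$ be a $\sigma$-finite von Neumann algebra and let $(\Omega,\Sigma,\mathsf{M})$ be a POVM on $\mathcal{M}_{\mathrm{in}}$. Then the following conditions are equivalent. (i) $\mathsf{M}$ is kernel minimal sufficient. (ii) The QC channel $\Gamma^{\mathsf{M}}$ is minimal sufficient. If we further assume that the predual $\mathcal{M}_{\mathrm{in}\ast}$ is separable and $(\Omega,\Sigma)$ is standard Borel, then the conditions (i) and (ii) are equivalent to (iii) $\mathsf{M}$ is relabeling minimal sufficient.
   Context: A POVM on a von Neumann algebra $\mathcal{M}_{\mathrm{in}}$ is a triple $(\Omega,\Sigma,\mathsf{M})$ with $(\Omega,\Sigma)$ a measurable space and $\mathsf{M}:\Sigma\to\mathcal{M}_{\mathrm{in}}$ such that $\mathsf{M}(E)\ge0$ for all $E\in\Sigma$, $\mathsf{M}(\Omega)=\mathbb{1}$, and $\mathsf{M}(\bigcup_nE_n)=\sum_n\mathsf{M}(E_n)$ (weak operator convergence) for disjoint sequences $(E_n)$ in $\Sigma$. A set $N\in\Sigma$ is $\mathsf{M}$-null if $\mathsf{M}(N)=0$; "$\mathsf{M}$-a.e." refers to $\mathsf{M}$-null sets. For a normal state $\varphi$ on $\mathcal{M}_{\mathrm{in}}$, $P^{\mathsf{M}}_\varphi(E):=\varphi(\mathsf{M}(E))$. Since $\mathcal{M}_{\mathrm{in}}$ is $\sigma$-finite, fix a faithful normal state $\varphi_0$ on it. The QC channel of $\mathsf{M}$ is the normal unital completely positive map $\Gamma^{\mathsf{M}}:L^\infty(P^{\mathsf{M}}_{\varphi_0})\to\mathcal{M}_{\mathrm{in}}$,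 $\Gamma^{\mathsf{M}}([f]):=\int_\Omega f(\omega)\,d\mathsf{M}(\omega)$, where $[f]$ is the class of $f$ modulo $\mathsf{M}$-a.e. (equivalently $P^{\mathsf{M}}_{\varphi_0}$-a.e.) equality; the algebra $L^\infty(P^{\mathsf{M}}_{\varphi_0})$ does not depend on the choice of $\varphi_0$. A CP channel is a normal unital completely positive linear map between von Neumann algebras. A CP channel $\Lambda:\mathcal{M}\to\mathcal{M}_{\mathrm{in}}$ is minimal sufficient if, for every CP channel $\Gamma:\mathcal{M}\to\mathcal{M}$, $\Lambda\circ\Gamma=\Lambda$ implies $\Gamma=\mathrm{id}_{\mathcal{M}}$. Let $(\Omega_1,\Sigma_1,\mathsf{M})$ and $(\Omega_2,\Sigma_2,\mathsf{N})$ be POVMs on $\mathcal{M}_{\mathrm{in}}$. An $\mathsf{M}$-$\mathsf{N}$ weak Markov kernel is a map $\kappa(\cdot|\cdot):\Sigma_1\times\Omega_2\to[0,1]$ such that: $\kappa(E|\cdot)$ is $\Sigma_2$-measurable for each $E\in\Sigma_1$; $\kappa(\Omega_1|\omega_2)=1$ for $\mathsf{N}$-a.e. $\omega_2$; for every disjoint sequence $(E_n)$ in $\Sigma_1$, $\kappa(\bigcup_nE_n|\omega_2)=\sum_n\kappa(E_n|\omega_2)$ for $\mathsf{N}$-a.e. $\omega_2$; and for every $\mathsf{M}$-null $N\in\Sigma_1$, $\kappa(N|\omega_2)=0$ for $\mathsf{N}$-a.e. $\omega_2$. One writes $\mathsf{M}\preceq\mathsf{N}$ if there is an $\mathsf{M}$-$\mathsf{N}$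 weak Markov kernel $\kappa$ with $\mathsf{M}(E)=\int_{\Omega_2}\kappa(E|\omega_2)\,d\mathsf{N}(\omega_2)$ for all $E\in\Sigma_1$. $\mathsf{M}$ and $\mathsf{N}$ are postprocessing equivalent if $\mathsf{M}\preceq\mathsf{N}$ and $\mathsf{N}\preceq\mathsf{M}$. A POVM $(\Omega,\Sigma,\mathsf{M})$ on $\mathcal{M}_{\mathrm{in}}$ is kernel minimal sufficient if for every $\mathsf{M}$-$\mathsf{M}$ weak Markov kernel $\kappa$, the condition $\mathsf{M}(E)=\int_\Omega\kappa(E|\omega)\,d\mathsf{M}(\omega)$ for all $E\in\Sigma$ implies that for every $E\in\Sigma$, $\kappa(E|\omega)=\chi_E(\omega)$ for $\mathsf{M}$-a.e. $\omega$ ($\chi_E$ the indicator function). It is relabeling minimal sufficient if for every POVM $(\Omega_1,\Sigma_1,\mathsf{N})$ on $\mathcal{M}_{\mathrm{in}}$ postprocessing equivalent to $\mathsf{M}$ there is a $\Sigma_1/\Sigma$-measurable map $f:\Omega_1\to\Omega$ with $\mathsf{N}(f^{-1}(E))=\mathsf{M}(E)$ for all $E\in\Sigma$. *)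

theory Defs
  imports "HOL-Analysis.Analysis"
begin

section \<open>Complex Hilbert spaces and von Neumann algebras\<close>

text \<open>Completeness and the real vector space structure come from \<^class>\<open>banach\<close>. The inner product
  is linear in its second argument.\<close>

class chilbert_space = banach +
  fixes scaleC :: "complex \<Rightarrow> 'a \<Rightarrow> 'a"  (infixr \<open>*\<^sub>C\<close> 75)
    and cinner :: "'a \<Rightarrow> 'a \<Rightarrow> complex"
  assumes scaleC_add_right: "c *\<^sub>C (x + y) = c *\<^sub>C x + c *\<^sub>C y"
    and scaleC_add_left: "(c + d) *\<^sub>C x = c *\<^sub>C x + d *\<^sub>C x"
    and scaleC_scaleC: "c *\<^sub>C d *\<^sub>C x = (c * d) *\<^sub>C x"
    and scaleR_scaleC: "r *\<^sub>R x = complex_of_real r *\<^sub>C x"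
    and cinner_commute: "cinner x y = cnj (cinner y x)"
    and cinner_add_right: "cinner x (y + z) = cinner x y + cinner x z"
    and cinner_scaleC_right: "cinner x (c *\<^sub>C y) = c * cinner x y"
    and cinner_norm: "cinner x x = complex_of_real ((norm x)\<^sup>2)"

definition bounded_op :: "('h::chilbert_space \<Rightarrow> 'h) \<Rightarrow> bool" where
  "bounded_op T \<longleftrightarrow> bounded_linear T \<and> (\<forall>c x. T (c *\<^sub>C x) = c *\<^sub>C T x)"

definition is_adjoint :: "('h::chilbert_space \<Rightarrow> 'h) \<Rightarrow> ('h \<Rightarrow> 'h) \<Rightarrow> bool" where
  "is_adjoint S T \<longleftrightarrow> (\<forall>x y. cinner (S x) y = cinner x (T y))"

definition positive_op :: "('h::chilbert_space \<Rightarrow> 'h) \<Rightarrow> bool" where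
  "positive_op T \<longleftrightarrow> bounded_op T \<and> (\<forall>x. cinner x (T x) \<in> \<real>\<^sub>\<ge>\<^sub>0)"

definition projection_op :: "('h::chilbert_space \<Rightarrow> 'h) \<Rightarrow> bool" where
  "projection_op P \<longleftrightarrow> bounded_op P \<and> P \<circ> P = P \<and> is_adjoint P P"

definition commutant :: "('h::chilbert_space \<Rightarrow> 'h) set \<Rightarrow> ('h \<Rightarrow> 'h) set" where
  "commutant A = {T. bounded_op T \<and> (\<forall>S\<in>A. T \<circ> S = S \<circ> T)}"

definition von_neumann_algebra :: "('h::chilbert_space \<Rightarrow> 'h) set \<Rightarrow> bool" where
  "von_neumann_algebra A \<longleftrightarrow>
     (\<forall>T\<in>A. bounded_op T) \<and> (\<forall>T\<in>A. \<exists>S\<in>A. is_adjoint S T) \<and> commutant (commutant A) = A"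

definition sigma_finite_vn :: "('h::chilbert_space \<Rightarrow> 'h) set \<Rightarrow> bool" where
  "sigma_finite_vn A \<longleftrightarrow>
     (\<forall>Q\<subseteq>A. (\<forall>P\<in>Q. projection_op P \<and> P \<noteq> (\<lambda>_. 0)) \<and>
              (\<forall>P\<in>Q. \<forall>P'\<in>Q. P \<noteq> P' \<longrightarrow> P \<circ> P' = (\<lambda>_. 0)) \<longrightarrow> countable Q)"

text \<open>The predual as the space of ultraweakly continuous functionals. Functionals are identified
  when they agree on \<open>A\<close>; separability refers to the norm of the dual of \<open>A\<close>.\<close>

definition predual :: "('h::chilbert_space \<Rightarrow> 'h) set \<Rightarrow> (('h \<Rightarrow> 'h) \<Rightarrow> complex) set" where
  "predual A = {\<phi>. \<exists>\<xi> \<eta>. summable (\<lambda>n::nat. (norm (\<xi> n))\<^sup>2) \<and> summable (\<lambda>n. (norm (\<eta> n))\<^sup>2) \<and>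
                     (\<forall>T\<in>A. (\<lambda>n. cinner (\<xi> n) (T (\<eta> n))) sums \<phi> T)}"

definition separable_predual :: "('h::chilbert_space \<Rightarrow> 'h) set \<Rightarrow> bool" where
  "separable_predual A \<longleftrightarrow>
     (\<exists>D\<subseteq>predual A. countable D \<and>
        (\<forall>\<phi>\<in>predual A. \<forall>e>0. \<exists>\<psi>\<in>D. \<forall>T\<in>A. norm (\<phi> T - \<psi> T) \<le> e * onorm T))"

section \<open>Channels\<close>

text \<open>The data of a von Neumann algebra, represented on a Hilbert space, that enter the notion of a
  normal unital completely positive map. \<open>mcoef A a \<xi> \<eta>\<close> is the matrix coefficient
  \<open>\<langle>\<xi>, a \<eta>\<rangle>\<close>, where \<open>\<xi>\<close> and \<open>\<eta>\<close> range over \<open>vecs A\<close>. Vectors may be given by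
  representatives, as for square integrable functions below.\<close>

record ('a, 'v) represented_algebra =
  elems :: "'a set"
  plus_alg :: "'a \<Rightarrow> 'a \<Rightarrow> 'a"
  scale_alg :: "complex \<Rightarrow> 'a \<Rightarrow> 'a"
  one_alg :: 'a
  vecs :: "'v set"
  mcoef :: "'a \<Rightarrow> 'v \<Rightarrow> 'v \<Rightarrow> complex"

definition operator_alg ::
  "('h::chilbert_space \<Rightarrow> 'h) set \<Rightarrow> ('h \<Rightarrow> 'h, 'h) represented_algebra" where
  "operator_alg A = \<lparr> elems = A, plus_alg = (\<lambda>S T x. S x + T x), scale_alg = (\<lambda>c T x. c *\<^sub>C T x),
     one_alg = id, vecs = UNIV, mcoef = (\<lambda>T x y. cinner x (T y)) \<rparr>"

definition complex_alg :: "(complex, complex) represented_algebra" where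
  "complex_alg = \<lparr> elems = UNIV, plus_alg = (+), scale_alg = (*), one_alg = 1,
     vecs = UNIV, mcoef = (\<lambda>z x y. cnj x * z * y) \<rparr>"

text \<open>Positivity of the matrix \<open>(X i j)\<close>, \<open>i, j < n\<close>, as an operator on the \<open>n\<close>-fold direct sum
  of the Hilbert space.\<close>

definition matrix_positive :: "('a, 'v) represented_algebra \<Rightarrow> nat \<Rightarrow> (nat \<Rightarrow> nat \<Rightarrow> 'a) \<Rightarrow> bool" where
  "matrix_positive A n X \<longleftrightarrow>
     (\<forall>i<n. \<forall>j<n. X i j \<in> elems A) \<and>
     (\<forall>\<xi>. (\<forall>i<n. \<xi> i \<in> vecs A) \<longrightarrow> (\<Sum>i<n. \<Sum>j<n. mcoef A (X i j) (\<xi> i) (\<xi> j)) \<in> \<real>\<^sub>\<ge>\<^sub>0)"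

definition positive_elem :: "('a, 'v) represented_algebra \<Rightarrow> 'a \<Rightarrow> bool" where
  "positive_elem A a \<longleftrightarrow> a \<in> elems A \<and> (\<forall>\<xi>\<in>vecs A. mcoef A a \<xi> \<xi> \<in> \<real>\<^sub>\<ge>\<^sub>0)"

definition selfadjoint_elems :: "('a, 'v) represented_algebra \<Rightarrow> 'a set" where
  "selfadjoint_elems A = {a \<in> elems A. \<forall>\<xi>\<in>vecs A. mcoef A a \<xi> \<xi> \<in> \<real>}"

definition le_alg :: "('a, 'v) represented_algebra \<Rightarrow> 'a \<Rightarrow> 'a \<Rightarrow> bool" where
  "le_alg A a b \<longleftrightarrow> (\<forall>\<xi>\<in>vecs A. mcoef A b \<xi> \<xi> - mcoef A a \<xi> \<xi> \<in> \<real>\<^sub>\<ge>\<^sub>0)"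

definition is_lub_alg :: "('a, 'v) represented_algebra \<Rightarrow> 'a set \<Rightarrow> 'a \<Rightarrow> bool" where
  "is_lub_alg A D s \<longleftrightarrow>
     s \<in> selfadjoint_elems A \<and> (\<forall>d\<in>D. le_alg A d s) \<and>
     (\<forall>u\<in>selfadjoint_elems A. (\<forall>d\<in>D. le_alg A d u) \<longrightarrow> le_alg A s u)"

definition linear_on_alg ::
  "('a, 'v) represented_algebra \<Rightarrow> ('b, 'u) represented_algebra \<Rightarrow> ('a \<Rightarrow> 'b) \<Rightarrow> bool" where
  "linear_on_alg A B \<Lambda> \<longleftrightarrow>
     (\<forall>a\<in>elems A. \<Lambda> a \<in> elems B) \<and>
     (\<forall>a\<in>elems A. \<forall>b\<in>elems A. \<Lambda> (plus_alg A a b) = plus_alg B (\<Lambda> a) (\<Lambda> b)) \<and>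
     (\<forall>c. \<forall>a\<in>elems A. \<Lambda> (scale_alg A c a) = scale_alg B c (\<Lambda> a))"

text \<open>Normality of a positive map: suprema of bounded upward directed sets of self-adjoint elements
  are preserved.\<close>

definition normal_map ::
  "('a, 'v) represented_algebra \<Rightarrow> ('b, 'u) represented_algebra \<Rightarrow> ('a \<Rightarrow> 'b) \<Rightarrow> bool" where
  "normal_map A B \<Lambda> \<longleftrightarrow>
     (\<forall>D s. D \<subseteq> selfadjoint_elems A \<and> D \<noteq> {} \<and>
            (\<forall>a\<in>D. \<forall>b\<in>D. \<exists>c\<in>D. le_alg A a c \<and> le_alg A b c) \<and> is_lub_alg A D s
        \<longrightarrow> is_lub_alg B (\<Lambda> ` D) (\<Lambda> s))"

definition completely_positive ::
  "('a, 'v) represented_algebra \<Rightarrow> ('b, 'u) represented_algebra \<Rightarrow> ('a \<Rightarrow> 'b) \<Rightarrow> bool" where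
  "completely_positive A B \<Lambda> \<longleftrightarrow>
     (\<forall>n X. matrix_positive A n X \<longrightarrow> matrix_positive B n (\<lambda>i j. \<Lambda> (X i j)))"

definition cp_channel ::
  "('a, 'v) represented_algebra \<Rightarrow> ('b, 'u) represented_algebra \<Rightarrow> ('a \<Rightarrow> 'b) \<Rightarrow> bool" where
  "cp_channel A B \<Lambda> \<longleftrightarrow>
     linear_on_alg A B \<Lambda> \<and> \<Lambda> (one_alg A) = one_alg B \<and> completely_positive A B \<Lambda> \<and> normal_map A B \<Lambda>"

definition minimal_sufficient ::
  "('a, 'v) represented_algebra \<Rightarrow> ('b, 'u) represented_algebra \<Rightarrow> ('a \<Rightarrow> 'b) \<Rightarrow> bool" where
  "minimal_sufficient A B \<Lambda> \<longleftrightarrow>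
     cp_channel A B \<Lambda> \<and>
     (\<forall>\<Gamma>. cp_channel A A \<Gamma> \<and> (\<forall>a\<in>elems A. \<Lambda> (\<Gamma> a) = \<Lambda> a) \<longrightarrow> (\<forall>a\<in>elems A. \<Gamma> a = a))"

definition normal_state :: "('a, 'v) represented_algebra \<Rightarrow> ('a \<Rightarrow> complex) \<Rightarrow> bool" where
  "normal_state A \<phi> \<longleftrightarrow>
     linear_on_alg A complex_alg \<phi> \<and> \<phi> (one_alg A) = 1 \<and>
     (\<forall>a. positive_elem A a \<longrightarrow> \<phi> a \<in> \<real>\<^sub>\<ge>\<^sub>0) \<and> normal_map A complex_alg \<phi>"

definition faithful_normal_state ::
  "('h::chilbert_space \<Rightarrow> 'h) set \<Rightarrow> (('h \<Rightarrow> 'h) \<Rightarrow> complex) \<Rightarrow> bool" where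
  "faithful_normal_state A \<phi> \<longleftrightarrow>
     normal_state (operator_alg A) \<phi> \<and> (\<forall>T\<in>A. positive_op T \<and> \<phi> T = 0 \<longrightarrow> T = (\<lambda>_. 0))"

section \<open>POVMs\<close>

text \<open>A measurable space is given by the \<open>space\<close> and \<open>sets\<close> of a term of type \<open>'w measure\<close>;
  its measure is ignored.\<close>

definition povm ::
  "('h::chilbert_space \<Rightarrow> 'h) set \<Rightarrow> 'w measure \<Rightarrow> ('w set \<Rightarrow> 'h \<Rightarrow> 'h) \<Rightarrow> bool" where
  "povm A S M \<longleftrightarrow>
     (\<forall>E\<in>sets S. M E \<in> A \<and> positive_op (M E)) \<and> M (space S) = id \<and>
     (\<forall>E. range E \<subseteq> sets S \<and> disjoint_family E \<longrightarrow>
        (\<forall>x y. (\<lambda>n::nat. cinner x (M (E n) y)) sums cinner x (M (\<Union>n. E n) y)))"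

definition povm_ae ::
  "'w measure \<Rightarrow> ('w set \<Rightarrow> 'h::chilbert_space \<Rightarrow> 'h) \<Rightarrow> ('w \<Rightarrow> bool) \<Rightarrow> bool" where
  "povm_ae S M Q \<longleftrightarrow> (\<exists>N\<in>sets S. M N = (\<lambda>_. 0) \<and> (\<forall>\<omega>\<in>space S - N. Q \<omega>))"

text \<open>The measure \<open>E \<mapsto> \<phi> (M E)\<close> of a normal positive functional \<open>\<phi>\<close>.\<close>

definition povm_measure ::
  "'w measure \<Rightarrow> ('w set \<Rightarrow> 'h::chilbert_space \<Rightarrow> 'h) \<Rightarrow> (('h \<Rightarrow> 'h) \<Rightarrow> complex) \<Rightarrow> 'w measure" where
  "povm_measure S M \<phi> = measure_of (space S) (sets S) (\<lambda>E. ennreal (Re (\<phi> (M E))))"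

text \<open>The weakly defined integral of a bounded measurable function. By polarization, the quadratic
  form determines the operator, so only the positive measures \<open>E \<mapsto> \<langle>x, M E x\<rangle>\<close> are needed.\<close>

definition povm_integral ::
  "'w measure \<Rightarrow> ('w set \<Rightarrow> 'h::chilbert_space \<Rightarrow> 'h) \<Rightarrow> ('w \<Rightarrow> complex) \<Rightarrow> 'h \<Rightarrow> 'h" where
  "povm_integral S M f = (THE T. bounded_op T \<and>
     (\<forall>x. cinner x (T x) = (LINT \<omega>|povm_measure S M (\<lambda>T. cinner x (T x)). f \<omega>)))"

definition weak_markov_kernel ::
  "'v measure \<Rightarrow> ('v set \<Rightarrow> 'h::chilbert_space \<Rightarrow> 'h) \<Rightarrow>
   'w measure \<Rightarrow> ('w set \<Rightarrow> 'h \<Rightarrow> 'h) \<Rightarrow> ('v set \<Rightarrow> 'w \<Rightarrow> real) \<Rightarrow> bool" where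
  "weak_markov_kernel S\<^sub>1 M S\<^sub>2 N \<kappa> \<longleftrightarrow>
     (\<forall>E\<in>sets S\<^sub>1. \<forall>\<omega>\<in>space S\<^sub>2. 0 \<le> \<kappa> E \<omega> \<and> \<kappa> E \<omega> \<le> 1) \<and>
     (\<forall>E\<in>sets S\<^sub>1. \<kappa> E \<in> borel_measurable S\<^sub>2) \<and>
     povm_ae S\<^sub>2 N (\<lambda>\<omega>. \<kappa> (space S\<^sub>1) \<omega> = 1) \<and>
     (\<forall>E. range E \<subseteq> sets S\<^sub>1 \<and> disjoint_family E \<longrightarrow>
        povm_ae S\<^sub>2 N (\<lambda>\<omega>. (\<lambda>n::nat. \<kappa> (E n) \<omega>) sums \<kappa> (\<Union>n. E n) \<omega>)) \<and>
     (\<forall>Z\<in>sets S\<^sub>1. M Z = (\<lambda>_. 0) \<longrightarrow> povm_ae S\<^sub>2 N (\<lambda>\<omega>. \<kappa> Z \<omega> = 0))"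

definition postprocessing ::
  "'v measure \<Rightarrow> ('v set \<Rightarrow> 'h::chilbert_space \<Rightarrow> 'h) \<Rightarrow>
   'w measure \<Rightarrow> ('w set \<Rightarrow> 'h \<Rightarrow> 'h) \<Rightarrow> ('v set \<Rightarrow> 'w \<Rightarrow> real) \<Rightarrow> bool" where
  "postprocessing S\<^sub>1 M S\<^sub>2 N \<kappa> \<longleftrightarrow>
     weak_markov_kernel S\<^sub>1 M S\<^sub>2 N \<kappa> \<and>
     (\<forall>E\<in>sets S\<^sub>1. M E = povm_integral S\<^sub>2 N (\<lambda>\<omega>. complex_of_real (\<kappa> E \<omega>)))"

definition postprocessing_le ::
  "'v measure \<Rightarrow> ('v set \<Rightarrow> 'h::chilbert_space \<Rightarrow> 'h) \<Rightarrow>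
   'w measure \<Rightarrow> ('w set \<Rightarrow> 'h \<Rightarrow> 'h) \<Rightarrow> bool" where
  "postprocessing_le S\<^sub>1 M S\<^sub>2 N \<longleftrightarrow> (\<exists>\<kappa>. postprocessing S\<^sub>1 M S\<^sub>2 N \<kappa>)"

definition postprocessing_equivalent ::
  "'v measure \<Rightarrow> ('v set \<Rightarrow> 'h::chilbert_space \<Rightarrow> 'h) \<Rightarrow>
   'w measure \<Rightarrow> ('w set \<Rightarrow> 'h \<Rightarrow> 'h) \<Rightarrow> bool" where
  "postprocessing_equivalent S\<^sub>1 M S\<^sub>2 N \<longleftrightarrow>
     postprocessing_le S\<^sub>1 M S\<^sub>2 N \<and> postprocessing_le S\<^sub>2 N S\<^sub>1 M"

definition kernel_minimal_sufficient ::
  "'w measure \<Rightarrow> ('w set \<Rightarrow> 'h::chilbert_space \<Rightarrow> 'h) \<Rightarrow> bool" where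
  "kernel_minimal_sufficient S M \<longleftrightarrow>
     (\<forall>\<kappa>. postprocessing S M S M \<kappa> \<longrightarrow>
        (\<forall>E\<in>sets S. povm_ae S M (\<lambda>\<omega>. \<kappa> E \<omega> = indicator E \<omega>)))"

text \<open>The type argument is the type of the points of the competing outcome spaces: a formula of HOL
  cannot quantify over all types.\<close>

definition relabeling_minimal_sufficient ::
  "'v itself \<Rightarrow> ('h::chilbert_space \<Rightarrow> 'h) set \<Rightarrow> 'w measure \<Rightarrow> ('w set \<Rightarrow> 'h \<Rightarrow> 'h) \<Rightarrow> bool" where
  "relabeling_minimal_sufficient _ A S M \<longleftrightarrow>
     (\<forall>(S\<^sub>1 :: 'v measure) N. povm A S\<^sub>1 N \<and> postprocessing_equivalent S\<^sub>1 N S M \<longrightarrow>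
        (\<exists>f\<in>measurable S\<^sub>1 S. \<forall>E\<in>sets S. N (f -` E \<inter> space S\<^sub>1) = M E))"

definition standard_borel :: "'w measure \<Rightarrow> bool" where
  "standard_borel S \<longleftrightarrow>
     (\<exists>T. topspace T = space S \<and> completely_metrizable_space T \<and> second_countable T \<and>
          sets S = sigma_sets (space S) {U. openin T U})"

section \<open>The QC channel\<close>

definition Linf_funs :: "'w measure \<Rightarrow> ('w \<Rightarrow> complex) set" where
  "Linf_funs P = {f \<in> borel_measurable P. \<exists>C. AE \<omega> in P. norm (f \<omega>) \<le> C}"

definition Linf_rel :: "'w measure \<Rightarrow> (('w \<Rightarrow> complex) \<times> ('w \<Rightarrow> complex)) set" where
  "Linf_rel P = {(f, g). f \<in> Linf_funs P \<and> g \<in> Linf_funs P \<and> (AE \<omega> in P. f \<omega> = g \<omega>)}"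

definition Linf_class :: "'w measure \<Rightarrow> ('w \<Rightarrow> complex) \<Rightarrow> ('w \<Rightarrow> complex) set" where
  "Linf_class P f = Linf_rel P `` {f}"

definition Linf_rep :: "('w \<Rightarrow> complex) set \<Rightarrow> 'w \<Rightarrow> complex" where
  "Linf_rep c = (SOME f. f \<in> c)"

text \<open>\<open>L\<^sup>\<infinity>(P)\<close> acting by multiplication on \<open>L\<^sup>2(P)\<close>.\<close>

definition Linf_alg ::
  "'w measure \<Rightarrow> (('w \<Rightarrow> complex) set, 'w \<Rightarrow> complex) represented_algebra" where
  "Linf_alg P =
    \<lparr> elems = Linf_funs P // Linf_rel P,
      plus_alg = (\<lambda>c d. Linf_class P (\<lambda>\<omega>. Linf_rep c \<omega> + Linf_rep d \<omega>)),
      scale_alg = (\<lambda>z c. Linf_class P (\<lambda>\<omega>. z * Linf_rep c \<omega>)),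
      one_alg = Linf_class P (\<lambda>_. 1),
      vecs = {\<xi> \<in> borel_measurable P. integrable P (\<lambda>\<omega>. (norm (\<xi> \<omega>))\<^sup>2)},
      mcoef = (\<lambda>c \<xi> \<eta>. LINT \<omega>|P. cnj (\<xi> \<omega>) * Linf_rep c \<omega> * \<eta> \<omega>) \<rparr>"

definition qc_channel ::
  "'w measure \<Rightarrow> ('w set \<Rightarrow> 'h::chilbert_space \<Rightarrow> 'h) \<Rightarrow> ('w \<Rightarrow> complex) set \<Rightarrow> 'h \<Rightarrow> 'h" where
  "qc_channel S M c = povm_integral S M (Linf_rep c)"

end

theory Submission
  imports Defs
begin

text \<open>Write \<open>P = \<phi>\<^sub>0 \<circ> M\<close>, whose null sets are those of \<open>M\<close>, and \<open>dens x\<close> for the density of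
  \<open>\<langle>x, M(\<cdot>) x\<rangle>\<close> with respect to \<open>P\<close>. A weak Markov kernel acts on bounded functions by expanding them
  in binary digits, which gives a channel of \<open>L\<^sup>\<infinity>(P)\<close>; conversely a channel of \<open>L\<^sup>\<infinity>(P)\<close>
  restricts to a kernel on indicators and is determined by it. This yields (i) \<open>\<longleftrightarrow>\<close> (ii).

  For (i) \<open>\<longrightarrow>\<close> (iii), if \<open>N\<close> is equivalent to \<open>M\<close>, the composite kernel from \<open>M\<close> through \<open>N\<close> to \<open>M\<close> is
  trivial, so the kernel from \<open>M\<close> to \<open>N\<close> has values in \<open>{0, 1}\<close> and is realized by a point map since
  the outcome space is standard Borel. For (iii) \<open>\<longrightarrow>\<close> (i), countably many densities \<open>dens x\<close> form a
  sufficient statistic by separability; every kernel preserving \<open>M\<close> fixes it, and relabeling shows that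
  it generates the \<open>\<sigma>\<close>-algebra up to null sets.\<close>

section \<open>Operators on complex Hilbert spaces\<close>

text \<open>A weak kernel is countably additive only almost everywhere, with an exceptional set that
  depends on the sequence of sets. Hence \<open>\<kappa> _ \<omega>\<close> need not be a measure at
  any point \<open>\<omega>\<close>, and a function cannot simply be integrated against it. Binary
  digits avoid this by reducing a function to countably many sets. Conversely, integrating
  \<open>\<kappa> E\<close> against a weight \<open>g\<close> gives an honest measure in
  \<open>E\<close> (\<open>kernel_measure\<close>), so identities between kernels are tested against
  all weights, and a kernel acts on densities as well. Channels are treated through diagonal matrix
  coefficients only. These determine the elements of both algebras involved, and each is integration
  against a nonnegative density, so that complete positivity becomes a statement about matrices of
  densities at almost every point. The relabeling condition is used through a single competitor,
  whose outcome space is the real line. This is why the whole statistic is packed into one real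
  number.\<close>

lemma cinner_add_left: "cinner (x + y) z = cinner x z + cinner (y::'h::chilbert_space) z"
  by (metis cinner_add_right cinner_commute complex_cnj_add)

lemma cinner_scaleC_left: "cinner (c *\<^sub>C x) y = cnj c * cinner x (y::'h::chilbert_space)"
  by (metis cinner_commute cinner_scaleC_right complex_cnj_mult)

lemma cinner_scaleR_right: "cinner x (r *\<^sub>R y) = of_real r * cinner x (y::'h::chilbert_space)"
  by (simp add: scaleR_scaleC cinner_scaleC_right)

lemma cinner_scaleR_left: "cinner (r *\<^sub>R x) y = of_real r * cinner x (y::'h::chilbert_space)"
  by (simp add: scaleR_scaleC cinner_scaleC_left)

lemma cinner_zero_right [simp]: "cinner x (0::'h::chilbert_space) = 0"
  using cinner_add_right[of x 0 0] by simp

lemma cinner_zero_left [simp]: "cinner (0::'h::chilbert_space) x = 0"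
  using cinner_add_left[of 0 0 x] by simp

lemma cinner_minus_right: "cinner x (- y) = - cinner x (y::'h::chilbert_space)"
  using cinner_scaleR_right[of x "-1" y] by simp

lemma cinner_minus_left: "cinner (- x) y = - cinner x (y::'h::chilbert_space)"
  using cinner_scaleR_left[of "-1" x y] by simp

lemma cinner_diff_right: "cinner x (y - z) = cinner x y - cinner x (z::'h::chilbert_space)"
  using cinner_add_right[of x y "-z"] by (simp add: cinner_minus_right)

lemma cinner_diff_left: "cinner (x - y) z = cinner x z - cinner y (z::'h::chilbert_space)"
  using cinner_add_left[of x "-y" z] by (simp add: cinner_minus_left)

lemma cinner_sum_right: "cinner x (\<Sum>i\<in>I. f i) = (\<Sum>i\<in>I. cinner x (f i :: 'h::chilbert_space))"
  by (induction I rule: infinite_finite_induct) (simp_all add: cinner_add_right)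

lemma cinner_sum_left: "cinner (\<Sum>i\<in>I. f i) x = (\<Sum>i\<in>I. cinner (f i :: 'h::chilbert_space) x)"
  by (induction I rule: infinite_finite_induct) (simp_all add: cinner_add_left)

lemma scaleC_zero_right [simp]: "c *\<^sub>C (0::'h::chilbert_space) = 0"
  using scaleC_add_right[of c 0 "0::'h"] by simp

lemma norm_scaleC: "norm (c *\<^sub>C x) = cmod c * norm (x::'h::chilbert_space)"
proof -
  have "complex_of_real ((norm (c *\<^sub>C x))\<^sup>2) = cinner (c *\<^sub>C x) (c *\<^sub>C x)"
    by (rule cinner_norm[symmetric])
  also have "\<dots> = (c * cnj c) * cinner x x"
    by (simp add: cinner_scaleC_left cinner_scaleC_right)
  also have "\<dots> = complex_of_real ((cmod c * norm x)\<^sup>2)"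
    by (simp add: cinner_norm power_mult_distrib complex_norm_square[symmetric] del: complex_mult_cnj)
  finally have "(norm (c *\<^sub>C x))\<^sup>2 = (cmod c * norm x)\<^sup>2"
    using of_real_eq_iff by blast
  then show ?thesis by (simp add: power2_eq_iff_nonneg)
qed

lemma cinner_eqI:
  assumes "\<And>x. cinner x y = cinner x (z::'h::chilbert_space)" shows "y = z"
proof -
  have "cinner (y - z) (y - z) = 0" using assms[of "y - z"] by (simp add: cinner_diff_right)
  then show ?thesis by (simp add: cinner_norm)
qed

section \<open>Operators and their quadratic forms\<close>

lemma bounded_op_add: "bounded_op T \<Longrightarrow> T (x + y) = T x + T y"
  unfolding bounded_op_def by (simp add: bounded_linear_def linear_add)

lemma bounded_op_diff: "bounded_op T \<Longrightarrow> T (x - y) = T x - T y"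
  unfolding bounded_op_def by (simp add: bounded_linear_def linear_diff)

lemma bounded_op_scaleC: "bounded_op T \<Longrightarrow> T (c *\<^sub>C x) = c *\<^sub>C T x"
  unfolding bounded_op_def by simp

lemma bounded_op_sum: "bounded_op T \<Longrightarrow> T (\<Sum>i\<in>I. f i) = (\<Sum>i\<in>I. T (f i))"
  unfolding bounded_op_def by (simp add: bounded_linear_def linear_sum)

lemma polarization:
  assumes "bounded_op T"
  shows "4 * cinner x (T y) = cinner (x + y) (T (x + y)) - cinner (x - y) (T (x - y))
    - \<i> * cinner (x + \<i> *\<^sub>C y) (T (x + \<i> *\<^sub>C y)) + \<i> * cinner (x - \<i> *\<^sub>C y) (T (x - \<i> *\<^sub>C y))"
  using assms
  by (simp add: bounded_op_add bounded_op_diff bounded_op_scaleC cinner_add_left cinner_add_right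
     cinner_diff_left cinner_diff_right cinner_scaleC_left cinner_scaleC_right algebra_simps)

text \<open>Over the complex numbers, polarization recovers every matrix coefficient from the
  diagonal ones. For this reason operator identities are later checked on the diagonal only, where
  POVMs give positive measures.\<close>

lemma bounded_op_eqI:
  assumes "bounded_op T" "bounded_op T'" "\<And>x. cinner x (T x) = cinner x (T' x)"
  shows "T = T'"
proof
  fix y
  show "T y = T' y"
  proof (rule cinner_eqI)
    fix x
    show "cinner x (T y) = cinner x (T' y)"
      using polarization[OF assms(1), of x y] polarization[OF assms(2), of x y]
      unfolding assms(3) by (metis mult_cancel_left zero_neq_numeral)
  qed
qed

lemma parallelogram_law:
  "(norm (x + y))\<^sup>2 + (norm (x - y))\<^sup>2 = 2 * (norm x)\<^sup>2 + 2 * (norm (y::'h::chilbert_space))\<^sup>2"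
proof -
  have "complex_of_real ((norm (x + y))\<^sup>2 + (norm (x - y))\<^sup>2)
      = complex_of_real (2 * (norm x)\<^sup>2 + 2 * (norm y)\<^sup>2)"
    unfolding of_real_add of_real_mult cinner_norm[symmetric]
    by (simp add: cinner_add_left cinner_add_right cinner_diff_left cinner_diff_right)
  then show ?thesis using of_real_eq_iff by blast
qed

text \<open>Polarization at two vectors of equal length, followed by the parallelogram law. The
  factor 2 comes from the four polarization terms; later only the existence of some bound
  matters.\<close>

lemma norm_bound_of_quadratic_form:
  assumes T: "bounded_op T" and C: "\<And>x. cmod (cinner x (T x)) \<le> C * (norm x)\<^sup>2"
  shows "norm (T y) \<le> 2 * C * norm (y::'h::chilbert_space)"
proof (cases "T y = 0 \<or> y = 0")
  case True
  have "0 \<le> C * (norm y)\<^sup>2" using C[of y] norm_ge_zero order_trans by blast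
  then have "0 \<le> C * norm y" by (auto simp: zero_le_mult_iff)
  moreover have "T 0 = 0" using bounded_op_diff[OF T, of 0 0] by simp
  ultimately show ?thesis using True by auto
next
  case False
  \<comment> \<open>The factor makes \<open>x\<close> as long as \<open>y\<close>, so that the
    bounds from the parallelogram law collapse, while \<open>x\<close> stays parallel to
    \<open>T y\<close>, so that the inner product of \<open>x\<close> and \<open>T y\<close> is the
    product of norms.\<close>
  define t where "t = norm y / norm (T y)"
  have t: "t > 0" using False by (simp add: t_def)
  define x where "x = t *\<^sub>R T y"
  have nx: "norm x = norm y" using False by (simp add: x_def t_def)
  have "4 * cmod (cinner x (T y)) = cmod (4 * cinner x (T y))" by (simp add: norm_mult)
  also have "\<dots> \<le> cmod (cinner (x + y) (T (x + y))) + cmod (cinner (x - y) (T (x - y)))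
    + cmod (cinner (x + \<i> *\<^sub>C y) (T (x + \<i> *\<^sub>C y))) + cmod (cinner (x - \<i> *\<^sub>C y) (T (x - \<i> *\<^sub>C y)))"
    unfolding polarization[OF T]
    by (intro order_trans[OF norm_triangle_ineq] order_trans[OF norm_triangle_ineq4] add_mono)
      (simp_all add: norm_mult)
  also have "\<dots> \<le> C * (norm (x + y))\<^sup>2 + C * (norm (x - y))\<^sup>2
     + C * (norm (x + \<i> *\<^sub>C y))\<^sup>2 + C * (norm (x - \<i> *\<^sub>C y))\<^sup>2"
    by (intro add_mono C)
  also have "\<dots> = C * ((norm (x + y))\<^sup>2 + (norm (x - y))\<^sup>2)
     + C * ((norm (x + \<i> *\<^sub>C y))\<^sup>2 + (norm (x - \<i> *\<^sub>C y))\<^sup>2)"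
    by (simp add: algebra_simps)
  also have "\<dots> = 8 * (C * (norm y)\<^sup>2)"
    by (simp only: parallelogram_law norm_scaleC nx) (simp add: algebra_simps)
  finally have 1: "cmod (cinner x (T y)) \<le> 2 * (C * (norm y)\<^sup>2)" by simp
  have "cinner x (T y) = of_real (t * (norm (T y))\<^sup>2)"
    by (simp add: x_def cinner_scaleR_left cinner_norm)
  then have "cmod (cinner x (T y)) = t * (norm (T y))\<^sup>2" using t by (simp only: norm_of_real) auto
  also have "\<dots> = norm y * norm (T y)" using False by (simp add: t_def power2_eq_square)
  finally have "norm y * norm (T y) \<le> norm y * (2 * C * norm y)"
    using 1 by (simp add: power2_eq_square algebra_simps)
  then show ?thesis using False by simp
qed

text \<open>A crude form of the Cauchy-Schwarz inequality, by the same polarization argument applied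
  to the identity operator. It serves only to make the inner product continuous.\<close>

lemma norm_cinner_le: "cmod (cinner x y) \<le> 2 * norm x * norm (y::'h::chilbert_space)"
proof (cases "x = 0 \<or> y = 0")
  case True then show ?thesis by auto
next
  case False
  define t where "t = norm y / norm x"
  define u where "u = t *\<^sub>R x"
  have t: "t > 0" and nu: "norm u = norm y" using False by (simp_all add: u_def t_def)
  have id: "bounded_op (\<lambda>x::'h. x)" by (simp add: bounded_op_def)
  have "4 * cmod (cinner u y) = cmod (4 * cinner u y)" by (simp add: norm_mult)
  also have "\<dots> \<le> cmod (cinner (u + y) (u + y)) + cmod (cinner (u - y) (u - y))
    + cmod (cinner (u + \<i> *\<^sub>C y) (u + \<i> *\<^sub>C y)) + cmod (cinner (u - \<i> *\<^sub>C y) (u - \<i> *\<^sub>C y))"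
    unfolding polarization[OF id]
    by (intro order_trans[OF norm_triangle_ineq] order_trans[OF norm_triangle_ineq4] add_mono)
      (simp_all add: norm_mult)
  also have "\<dots> = ((norm (u + y))\<^sup>2 + (norm (u - y))\<^sup>2)
     + ((norm (u + \<i> *\<^sub>C y))\<^sup>2 + (norm (u - \<i> *\<^sub>C y))\<^sup>2)"
    by (simp add: cinner_norm norm_power)
  also have "\<dots> = 8 * (norm y)\<^sup>2"
    by (simp add: parallelogram_law norm_scaleC nu)
  finally have "cmod (cinner u y) \<le> 2 * (norm y)\<^sup>2" by simp
  moreover have "cmod (cinner u y) = t * cmod (cinner x y)"
    using t by (simp add: u_def cinner_scaleR_left norm_mult)
  ultimately have "norm y / norm x * cmod (cinner x y) \<le> 2 * (norm y)\<^sup>2" by (simp add: t_def)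
  then show ?thesis using False by (simp add: field_simps power2_eq_square)
qed

lemma bounded_linear_cinner: "bounded_linear (cinner (x::'h::chilbert_space))"
  by (rule bounded_linear_intro[where K = "2 * norm x"])
    (simp_all add: cinner_add_right cinner_scaleR_right scaleR_conv_of_real mult.commute
      norm_cinner_le[of x, simplified mult.commute])

section \<open>Positive matrices\<close>

text \<open>Hermitian symmetry is not demanded, since it follows from the form being real on complex
  vectors (\<open>psd_hermitian\<close>).\<close>

definition psd :: "nat \<Rightarrow> (nat \<Rightarrow> nat \<Rightarrow> complex) \<Rightarrow> bool" where
  "psd n a \<longleftrightarrow> (\<forall>v. (\<Sum>i<n. \<Sum>j<n. cnj (v i) * a i j * v j) \<in> \<real>\<^sub>\<ge>\<^sub>0)"

lemma psdD: "psd n a \<Longrightarrow> (\<Sum>i<n. \<Sum>j<n. cnj (v i) * a i j * v j) \<in> \<real>\<^sub>\<ge>\<^sub>0"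
  by (simp add: psd_def)

lemma psd_two_entries:
  assumes "psd n a" "i < n" "j < n" "i \<noteq> j"
  shows "cnj s * a i i * s + cnj s * a i j * t + cnj t * a j i * s + cnj t * a j j * t \<in> \<real>\<^sub>\<ge>\<^sub>0"
proof -
  define v where "v k = (if k = i then s else if k = j then t else 0)" for k
  have S: "(\<Sum>k<n. f k * v k) = f i * s + f j * t" for f
  proof -
    have "(\<Sum>k<n. f k * v k) = (\<Sum>k\<in>{i, j}. f k * v k)"
      using assms by (intro sum.mono_neutral_right) (auto simp: v_def)
    also have "\<dots> = f i * s + f j * t" using assms by (simp add: v_def)
    finally show ?thesis .
  qed
  have S': "(\<Sum>k<n. cnj (v k) * f k) = cnj s * f i + cnj t * f j" for f
  proof -
    have "(\<Sum>k<n. cnj (v k) * f k) = (\<Sum>k\<in>{i, j}. cnj (v k) * f k)"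
      using assms by (intro sum.mono_neutral_right) (auto simp: v_def)
    also have "\<dots> = cnj s * f i + cnj t * f j" using assms by (simp add: v_def)
    finally show ?thesis .
  qed
  have "(\<Sum>k<n. \<Sum>l<n. cnj (v k) * a k l * v l) = (\<Sum>k<n. cnj (v k) * (\<Sum>l<n. a k l * v l))"
    by (simp only: sum_distrib_left mult.assoc)
  also have "\<dots> = cnj s * (a i i * s + a i j * t) + cnj t * (a j i * s + a j j * t)"
    by (simp add: S S')
  finally have "cnj s * (a i i * s + a i j * t) + cnj t * (a j i * s + a j j * t) \<in> \<real>\<^sub>\<ge>\<^sub>0"
    using psdD[OF assms(1), of v] by (simp only:)
  then show ?thesis by (simp add: algebra_simps)
qed

lemma psd_diag:
  assumes "psd n a" "i < n" shows "a i i \<in> \<real>\<^sub>\<ge>\<^sub>0"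
proof -
  define v where "v k = (if k = i then 1 else 0 :: complex)" for k
  have S: "(\<Sum>k<n. f k * v k) = f i" "(\<Sum>k<n. cnj (v k) * f k) = f i" for f
    using assms(2) sum.remove[of "{..<n}" i "\<lambda>k. f k * v k"]
      sum.remove[of "{..<n}" i "\<lambda>k. cnj (v k) * f k"] by (auto simp: v_def)
  have "(\<Sum>k<n. \<Sum>l<n. cnj (v k) * a k l * v l) = (\<Sum>k<n. cnj (v k) * (\<Sum>l<n. a k l * v l))"
    by (simp only: sum_distrib_left mult.assoc)
  then show ?thesis using psdD[OF assms(1), of v] by (simp only: S)
qed

text \<open>The form is real at (1, 1) and at (1, i) on the two coordinates. The first fixes the
  imaginary part of the sum of the off-diagonal entries, the second the real part of their
  difference.\<close>

lemma psd_hermitian: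
  assumes "psd n a" "i < n" "j < n" shows "a j i = cnj (a i j)"
proof (cases "i = j")
  case True
  then show ?thesis using psd_diag[OF assms(1,2)] by (simp add: complex_nonneg_Reals_iff complex_eq_iff)
next
  case False
  have d: "Im (a i i) = 0" "Im (a j j) = 0"
    using psd_diag assms by (auto simp: complex_nonneg_Reals_iff)
  have "Im (a i j + a j i) = 0"
    using psd_two_entries[OF assms False, of 1 1] d by (simp add: complex_nonneg_Reals_iff)
  moreover have "Re (a i j) = Re (a j i)"
    using psd_two_entries[OF assms False, of 1 \<i>] d by (simp add: complex_nonneg_Reals_iff)
  ultimately show ?thesis by (simp add: complex_eq_iff)
qed

text \<open>With a zero diagonal entry, the form along a suitable line of vectors is affine in the
  parameter, so it can stay nonnegative only if its slope vanishes. The slope is a multiple of the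
  squared modulus of the off-diagonal entry.\<close>

lemma psd_zero_diag:
  assumes "psd n a" "i < n" "j < n" "a i i = 0" shows "a i j = 0"
proof (cases "i = j")
  case False
  define r where "r = Re (a j j)"
  define z where "z = a i j"
  have zz: "z * cnj z = of_real ((cmod z)\<^sup>2)" by (simp only: complex_norm_square)
  have r: "a j j = of_real r" "r \<ge> 0"
    using psd_diag[OF assms(1,3)] by (auto simp: complex_nonneg_Reals_iff r_def complex_eq_iff)
  have *: "0 \<le> - 2 * t * (cmod z)\<^sup>2 + r" for t :: real
  proof -
    have "cnj (- (of_real t * z)) * a i i * (- (of_real t * z)) + cnj (- (of_real t * z)) * a i j * 1
      + cnj 1 * a j i * (- (of_real t * z)) + cnj 1 * a j j * 1 \<in> \<real>\<^sub>\<ge>\<^sub>0"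
      by (rule psd_two_entries[OF assms(1-3) False])
    also have "cnj (- (of_real t * z)) * a i i * (- (of_real t * z)) + cnj (- (of_real t * z)) * a i j * 1
      + cnj 1 * a j i * (- (of_real t * z)) + cnj 1 * a j j * 1
      = of_real r - 2 * of_real t * (z * cnj z)"
      by (simp add: assms(4) psd_hermitian[OF assms(1-3)] r z_def[symmetric] algebra_simps)
    also have "\<dots> = of_real (- 2 * t * (cmod z)\<^sup>2 + r)" by (simp add: zz)
    finally show ?thesis by (simp only: nonneg_Reals_of_real_iff)
  qed
  have "z = 0"
  proof (rule ccontr)
    assume "z \<noteq> 0"
    \<comment> \<open>At this value of \<open>t\<close> the affine function equals - r - 2, which is
      negative.\<close>
    then have "(r + 1) / (cmod z)\<^sup>2 * (cmod z)\<^sup>2 = r + 1" by simp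
    then show False using *[of "(r + 1) / (cmod z)\<^sup>2"] r(2) by (simp only: mult.assoc) simp
  qed
  then show ?thesis by (simp add: z_def)
qed (use assms in auto)

text \<open>One step of the Cholesky decomposition removes the last row and column of \<open>a\<close>.\<close>

lemma psd_schur_sum:
  assumes "psd n a" "psd n b" shows "(\<Sum>i<n. \<Sum>j<n. a i j * b i j) \<in> \<real>\<^sub>\<ge>\<^sub>0"
  using assms
proof (induction n arbitrary: a)
  case 0 then show ?case by simp
next
  case (Suc n)
  have restrict: "psd n c" if "psd (Suc n) c" for c
    unfolding psd_def
  proof
    fix v
    have "(\<Sum>i<Suc n. \<Sum>j<Suc n. cnj ((v(n := 0)) i) * c i j * (v(n := 0)) j) \<in> \<real>\<^sub>\<ge>\<^sub>0"
      using that unfolding psd_def by blast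
    then show "(\<Sum>i<n. \<Sum>j<n. cnj (v i) * c i j * v j) \<in> \<real>\<^sub>\<ge>\<^sub>0" by simp
  qed
  have herm: "a j i = cnj (a i j)" if "i < Suc n" "j < Suc n" for i j
    using psd_hermitian[OF Suc.prems(1)] that by blast
  show ?case
  proof (cases "a n n = 0")
    case True
    have "a n j = 0" "a j n = 0" if "j < Suc n" for j
      using psd_zero_diag[OF Suc.prems(1), of n j] herm[of n j] that True by auto
    then have "(\<Sum>i<Suc n. \<Sum>j<Suc n. a i j * b i j) = (\<Sum>i<n. \<Sum>j<n. a i j * b i j)" by simp
    then show ?thesis using Suc.IH[OF restrict[OF Suc.prems(1)] restrict[OF Suc.prems(2)]] by (simp only:)
  next
    case False
    define \<alpha> where "\<alpha> = Re (a n n)"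
    have \<alpha>: "a n n = of_real \<alpha>" "\<alpha> > 0"
      using psd_diag[OF Suc.prems(1), of n] False
      by (auto simp: complex_nonneg_Reals_iff \<alpha>_def complex_eq_iff)
    define c where "c i j = a i j - a i n * a n j / of_real \<alpha>" for i j
    have "psd n c"
      unfolding psd_def
    proof
      fix v
      define s where "s = (\<Sum>j<n. a n j * v j)"
      \<comment> \<open>This last coordinate completes the square: it minimizes the form of
        \<open>a\<close> for the given \<open>v\<close>, and the minimum is the form of the Schur
        complement \<open>c\<close>.\<close>
      define w where "w = v(n := - s / of_real \<alpha>)"
      have s': "(\<Sum>i<n. cnj (v i) * a i n) = cnj s"
        by (simp add: s_def cnj_sum) (intro sum.cong refl, simp add: herm[of n])
      have "(\<Sum>i<Suc n. \<Sum>j<Suc n. cnj (w i) * a i j * w j)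
        = (\<Sum>i<n. \<Sum>j<n. cnj (v i) * a i j * v j) + (\<Sum>i<n. cnj (v i) * a i n) * (- s / of_real \<alpha>)
          + cnj (- s / of_real \<alpha>) * (\<Sum>j<n. a n j * v j) + cnj (- s / of_real \<alpha>) * a n n * (- s / of_real \<alpha>)"
        by (simp only: sum.lessThan_Suc sum.distrib)
          (simp add: w_def sum_distrib_left sum_distrib_right mult.assoc sum_negf sum_divide_distrib)
      also have "\<dots> = (\<Sum>i<n. \<Sum>j<n. cnj (v i) * a i j * v j) - cnj s * s / of_real \<alpha>"
        unfolding s' s_def[symmetric] using \<alpha> by (simp add: field_simps)
      also have "cnj s * s / of_real \<alpha> = (\<Sum>i<n. cnj (v i) * a i n) * (\<Sum>j<n. a n j * v j) / of_real \<alpha>"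
        unfolding s' s_def[symmetric] ..
      also have "\<dots> = (\<Sum>i<n. \<Sum>j<n. cnj (v i) * (a i n * a n j / of_real \<alpha>) * v j)"
        by (simp only: sum_product sum_divide_distrib) (intro sum.cong refl, simp)
      also have "(\<Sum>i<n. \<Sum>j<n. cnj (v i) * a i j * v j) - \<dots> = (\<Sum>i<n. \<Sum>j<n. cnj (v i) * c i j * v j)"
        by (simp add: c_def sum_subtractf[symmetric] algebra_simps)
      finally show "(\<Sum>i<n. \<Sum>j<n. cnj (v i) * c i j * v j) \<in> \<real>\<^sub>\<ge>\<^sub>0"
        using psdD[OF Suc.prems(1), of w] by (simp only:)
    qed
    then have 1: "(\<Sum>i<n. \<Sum>j<n. c i j * b i j) \<in> \<real>\<^sub>\<ge>\<^sub>0"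
      using Suc.IH restrict[OF Suc.prems(2)] by blast
    \<comment> \<open>The rank one part of \<open>a\<close> that was split off contributes the form
      of \<open>b\<close> at the last row of \<open>a\<close>.\<close>
    have "(\<Sum>i<Suc n. \<Sum>j<Suc n. cnj (a n i) * b i j * a n j) \<in> \<real>\<^sub>\<ge>\<^sub>0"
      using Suc.prems(2) unfolding psd_def by blast
    also have "(\<Sum>i<Suc n. \<Sum>j<Suc n. cnj (a n i) * b i j * a n j)
       = (\<Sum>i<Suc n. \<Sum>j<Suc n. a i n * a n j * b i j)"
      by (intro sum.cong refl) (simp add: herm[of n] mult_ac)
    finally have 2: "(\<Sum>i<Suc n. \<Sum>j<Suc n. a i n * a n j * b i j) \<in> \<real>\<^sub>\<ge>\<^sub>0" .
    have "(\<Sum>i<Suc n. \<Sum>j<Suc n. a i j * b i j)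
       = (\<Sum>i<Suc n. \<Sum>j<Suc n. c i j * b i j + a i n * a n j * b i j / of_real \<alpha>)"
      by (simp add: c_def algebra_simps)
    also have "\<dots> = (\<Sum>i<Suc n. \<Sum>j<Suc n. c i j * b i j)
         + (\<Sum>i<Suc n. \<Sum>j<Suc n. a i n * a n j * b i j) / of_real \<alpha>"
      by (simp only: sum.distrib sum_divide_distrib)
    also have "(\<Sum>i<Suc n. \<Sum>j<Suc n. c i j * b i j) = (\<Sum>i<n. \<Sum>j<n. c i j * b i j)"
      using \<alpha> by (simp add: c_def)
    finally show ?thesis
      using nonneg_Reals_add_I[OF 1 nonneg_Reals_divide_I[OF 2, of "of_real \<alpha>"]] \<alpha> by (simp only:) simp
  qed
qed

lemma psdI_dense:
  assumes D: "\<And>U. open U \<Longrightarrow> U \<noteq> {} \<Longrightarrow> \<exists>d\<in>D. d \<in> (U :: complex set)"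
    and pos: "\<And>v. v \<in> {..<n} \<rightarrow>\<^sub>E D \<Longrightarrow> (\<Sum>i<n. \<Sum>j<n. cnj (v i) * a i j * v j) \<in> \<real>\<^sub>\<ge>\<^sub>0"
  shows "psd n a"
  unfolding psd_def
proof
  fix v :: "nat \<Rightarrow> complex"
  have "\<exists>d\<in>D. d \<in> ball (v i) (1 / Suc m)" for i m by (rule D) auto
  then obtain w where w: "\<And>i m. w i m \<in> D" "\<And>i m. w i m \<in> ball (v i) (1 / Suc m)" by metis
  have "(\<lambda>m. w i m) \<longlonglongrightarrow> v i" for i
  proof (rule LIMSEQ_I)
    fix r :: real assume "r > 0"
    then obtain N where N: "N \<noteq> 0" "inverse (real N) < r" using real_arch_inverse[of r] by auto
    have "norm (w i m - v i) < r" if "m \<ge> N" for m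
    proof -
      have "norm (w i m - v i) < 1 / Suc m" using w(2)[of i m] by (simp add: dist_norm norm_minus_commute)
      also have "\<dots> \<le> inverse (real N)" using that N by (simp add: field_simps)
      finally show ?thesis using N by simp
    qed
    then show "\<exists>no. \<forall>m\<ge>no. norm (w i m - v i) < r" by blast
  qed
  then have "(\<lambda>m. \<Sum>i<n. \<Sum>j<n. cnj (w i m) * a i j * w j m)
      \<longlonglongrightarrow> (\<Sum>i<n. \<Sum>j<n. cnj (v i) * a i j * v j)"
    by (intro tendsto_sum tendsto_mult tendsto_cnj tendsto_const) auto
  moreover have "(\<Sum>i<n. \<Sum>j<n. cnj (w i m) * a i j * w j m) \<in> \<real>\<^sub>\<ge>\<^sub>0" for m
  proof -
    have "(\<Sum>i<n. \<Sum>j<n. cnj ((\<lambda>i\<in>{..<n}. w i m) i) * a i j * (\<lambda>i\<in>{..<n}. w i m) j) \<in> \<real>\<^sub>\<ge>\<^sub>0"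
      by (rule pos) (use w(1) in \<open>auto simp: PiE_iff extensional_def\<close>)
    then show ?thesis by simp
  qed
  ultimately show "(\<Sum>i<n. \<Sum>j<n. cnj (v i) * a i j * v j) \<in> \<real>\<^sub>\<ge>\<^sub>0"
    by (rule closed_sequentially[OF closed_nonneg_Reals_complex, rotated])
qed

text \<open>The exceptional null set may depend on \<open>v\<close>, so only countably many test
  vectors can be treated at once. Vectors with entries in a countable dense set suffice by
  continuity of the form.\<close>

lemma AE_psdI:
  assumes "\<And>v. AE \<omega> in P. (\<Sum>i<n. \<Sum>j<n. cnj (v i) * a \<omega> i j * v j) \<in> \<real>\<^sub>\<ge>\<^sub>0"
  shows "AE \<omega> in P. psd n (a \<omega>)"
proof -
  obtain D :: "complex set" where D: "countable D" "\<And>U. open U \<Longrightarrow> U \<noteq> {} \<Longrightarrow> \<exists>d\<in>D. d \<in> U"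
    using countable_dense_exists[where 'a = complex] by auto
  have "countable ({..<n} \<rightarrow>\<^sub>E D)" using D by (intro countable_PiE) auto
  then have "AE \<omega> in P. \<forall>v\<in>{..<n} \<rightarrow>\<^sub>E D. (\<Sum>i<n. \<Sum>j<n. cnj (v i) * a \<omega> i j * v j) \<in> \<real>\<^sub>\<ge>\<^sub>0"
    using assms by (subst AE_ball_countable) auto
  then show ?thesis by eventually_elim (rule psdI_dense[OF D(2)], auto)
qed

section \<open>Dyadic approximation\<close>

text \<open>The greedy algorithm: \<open>B k\<close> is where the remainder is still at least
  2^(-k-1), and the remainder after \<open>n\<close> digits lies between 0 and 2^(-n). The error
  bound is uniform in the point, which later allows positive maps to be compared on \<open>f\<close>
  and on its partial sums.\<close>

lemma dyadic_expansion:
  assumes f: "f \<in> borel_measurable S" "\<And>\<omega>. \<omega> \<in> space S \<Longrightarrow> 0 \<le> f \<omega> \<and> f \<omega> \<le> (1::real)"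
  shows "\<exists>B. (\<forall>k::nat. B k \<in> sets S) \<and> (\<forall>\<omega>\<in>space S. \<forall>n.
    0 \<le> f \<omega> - (\<Sum>k<n. (1/2)^(k+1) * indicator (B k) \<omega>) \<and>
    f \<omega> - (\<Sum>k<n. (1/2)^(k+1) * indicator (B k) \<omega>) \<le> (1/2)^n)"
proof -
  define r where "r = rec_nat f (\<lambda>n g \<omega>. if g \<omega> \<ge> (1/2)^(n+1) then g \<omega> - (1/2)^(n+1) else g \<omega>)"
  have r: "r 0 = f" "\<And>n \<omega>. r (Suc n) \<omega> = (if r n \<omega> \<ge> (1/2)^(n+1) then r n \<omega> - (1/2)^(n+1) else r n \<omega>)"
    by (simp_all add: r_def)
  have meas: "r n \<in> borel_measurable S" for n
  proof (induction n)
    case (Suc n)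
    note [measurable] = Suc
    show ?case unfolding r(2)[abs_def] by measurable
  qed (use f r in simp)
  define B where "B k = {\<omega>\<in>space S. r k \<omega> \<ge> (1/2)^(k+1)}" for k
  have eq: "f \<omega> - (\<Sum>k<n. (1/2)^(k+1) * indicator (B k) \<omega>) = r n \<omega>" if "\<omega> \<in> space S" for n \<omega>
    using that by (induction n) (auto simp: r B_def indicator_def split: if_splits)
  have bnd: "0 \<le> r n \<omega> \<and> r n \<omega> \<le> (1/2)^n" if "\<omega> \<in> space S" for n \<omega>
    using that f(2) by (induction n) (auto simp: r)
  have "B k \<in> sets S" for k unfolding B_def using meas by measurable
  then show ?thesis by (intro exI[of _ B]) (use eq bnd in auto)
qed

lemma dyadic_sums:
  assumes "\<And>n. 0 \<le> x - (\<Sum>k<n. (1/2)^(k+1) * c k)" "\<And>n. x - (\<Sum>k<n. (1/2)^(k+1) * c k) \<le> (1/2)^n"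
  shows "(\<lambda>k. (1/2)^(k+1) * c k) sums (x::real)"
proof -
  have "(\<lambda>n. x - (\<Sum>k<n. (1/2)^(k+1) * c k)) \<longlonglongrightarrow> 0"
    by (rule tendsto_sandwich[where f = "\<lambda>_. 0" and h = "\<lambda>n. (1/2)^n"])
      (use assms in \<open>auto intro!: LIMSEQ_power_zero\<close>)
  then have "(\<lambda>n. x - (x - (\<Sum>k<n. (1/2)^(k+1) * c k))) \<longlonglongrightarrow> x - 0"
    by (intro tendsto_diff tendsto_const)
  then show ?thesis by (simp add: sums_def)
qed

section \<open>The algebra of essentially bounded functions\<close>

text \<open>The integral of a function that is not integrable is 0 by convention, and 0 lies in the
  cone as well.\<close>

lemma integral_nonneg_Reals:
  assumes "AE \<omega> in P. f \<omega> \<in> (\<real>\<^sub>\<ge>\<^sub>0 :: complex set)" shows "integral\<^sup>L P f \<in> \<real>\<^sub>\<ge>\<^sub>0"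
proof (cases "integrable P f")
  case True
  have "0 \<le> (LINT \<omega>|P. Re (f \<omega>))"
    using assms by (intro integral_nonneg_AE) (auto simp: complex_nonneg_Reals_iff)
  moreover have "(LINT \<omega>|P. Im (f \<omega>)) = 0"
    using assms by (intro integral_eq_zero_AE) (auto simp: complex_nonneg_Reals_iff)
  ultimately show ?thesis using True by (simp add: complex_nonneg_Reals_iff)
qed (simp add: not_integrable_integral_eq)

lemma AE_nonneg_of_set_integrals:
  fixes g :: "'w \<Rightarrow> real"
  assumes g: "integrable P g" and pos: "\<And>E. E \<in> sets P \<Longrightarrow> 0 \<le> (LINT \<omega>|P. g \<omega> * indicator E \<omega>)"
  shows "AE \<omega> in P. 0 \<le> g \<omega>"
proof -
  define E where "E = {\<omega>\<in>space P. g \<omega> < 0}"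
  have [measurable]: "g \<in> borel_measurable P" using g by simp
  have E: "E \<in> sets P" unfolding E_def by measurable
  have int: "integrable P (\<lambda>\<omega>. - (g \<omega> * indicator E \<omega>))"
    using g E by (intro integrable_minus integrable_real_mult_indicator)
  have nonneg: "AE \<omega> in P. 0 \<le> - (g \<omega> * indicator E \<omega>)"
    by (intro AE_I2) (auto simp: E_def indicator_def)
  have "(LINT \<omega>|P. - (g \<omega> * indicator E \<omega>)) \<le> 0" using pos[OF E] by simp
  moreover have "0 \<le> (LINT \<omega>|P. - (g \<omega> * indicator E \<omega>))" by (rule integral_nonneg_AE[OF nonneg])
  ultimately have "AE \<omega> in P. - (g \<omega> * indicator E \<omega>) = 0"
    using integral_nonneg_eq_0_iff_AE[OF int nonneg] by linarith
  then show ?thesis using AE_space by eventually_elim (auto simp: E_def indicator_def split: if_splits)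
qed

lemma integrable_complex_mult_indicator:
  fixes g :: "'w \<Rightarrow> complex"
  assumes "integrable P g" "E \<in> sets P" shows "integrable P (\<lambda>\<omega>. g \<omega> * indicator E \<omega>)"
proof -
  have "(\<lambda>\<omega>. g \<omega> * indicator E \<omega>) = (\<lambda>\<omega>. indicator E \<omega> *\<^sub>R g \<omega>)"
    by (auto simp: fun_eq_iff indicator_def)
  then show ?thesis using integrable_mult_indicator[OF assms(2,1)] by simp
qed

lemma AE_nonneg_Reals_of_set_integrals:
  fixes g :: "'w \<Rightarrow> complex"
  assumes g: "integrable P g"
    and pos: "\<And>E. E \<in> sets P \<Longrightarrow> (LINT \<omega>|P. g \<omega> * indicator E \<omega>) \<in> \<real>\<^sub>\<ge>\<^sub>0"
  shows "AE \<omega> in P. g \<omega> \<in> \<real>\<^sub>\<ge>\<^sub>0"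
proof -
  have i: "integrable P (\<lambda>\<omega>. g \<omega> * indicator E \<omega>)" if "E \<in> sets P" for E
    using integrable_complex_mult_indicator[OF g that] .
  have part: "Re (g \<omega> * indicator E \<omega>) = Re (g \<omega>) * indicator E \<omega>"
    "Im (g \<omega> * indicator E \<omega>) = Im (g \<omega>) * indicator E \<omega>" for \<omega> E
    by (auto simp: indicator_def)
  have 1: "0 \<le> (LINT \<omega>|P. Re (g \<omega>) * indicator E \<omega>)" "(LINT \<omega>|P. Im (g \<omega>) * indicator E \<omega>) = 0"
    if E: "E \<in> sets P" for E
    using pos[OF E] integral_Re[OF i[OF E]] integral_Im[OF i[OF E]]
    by (simp_all only: part complex_nonneg_Reals_iff)
  have "AE \<omega> in P. 0 \<le> Re (g \<omega>)"
    using g 1 by (intro AE_nonneg_of_set_integrals) auto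
  moreover have "AE \<omega> in P. 0 \<le> Im (g \<omega>)"
    using g 1 by (intro AE_nonneg_of_set_integrals) auto
  moreover have "AE \<omega> in P. 0 \<le> - Im (g \<omega>)"
    using g 1 by (intro AE_nonneg_of_set_integrals) auto
  ultimately show ?thesis by eventually_elim (simp add: complex_nonneg_Reals_iff)
qed

section \<open>Essentially bounded functions and their classes\<close>

lemma borel_measurable_cnj [measurable (raw)]:
  assumes "f \<in> borel_measurable P" shows "(\<lambda>\<omega>. cnj (f \<omega>)) \<in> borel_measurable P"
  by (rule measurable_compose[OF assms]) (intro borel_measurable_continuous_onI continuous_intros)

lemma Linf_funs_measurable [measurable_dest]: "f \<in> Linf_funs P \<Longrightarrow> f \<in> borel_measurable P"
  by (simp add: Linf_funs_def)

lemma Linf_funsE: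
  assumes "f \<in> Linf_funs P"
  obtains C where "C \<ge> 0" "AE \<omega> in P. norm (f \<omega>) \<le> C"
proof -
  obtain C where "AE \<omega> in P. norm (f \<omega>) \<le> C" using assms by (auto simp: Linf_funs_def)
  then have "AE \<omega> in P. norm (f \<omega>) \<le> max C 0" by eventually_elim auto
  then show thesis using that[of "max C 0"] by simp
qed

lemma Linf_funsI:
  assumes "f \<in> borel_measurable P" "AE \<omega> in P. norm (f \<omega>) \<le> C" shows "f \<in> Linf_funs P"
  using assms by (auto simp: Linf_funs_def)

lemma Linf_funs_const [simp, intro]: "(\<lambda>_. z) \<in> Linf_funs P"
  by (rule Linf_funsI[where C = "norm z"]) auto

lemma Linf_funs_indicator [simp, intro]: "E \<in> sets P \<Longrightarrow> indicator E \<in> Linf_funs P"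
  by (rule Linf_funsI[where C = 1]) (auto simp: indicator_def)

lemma Linf_funs_of_real:
  assumes "f \<in> borel_measurable P" "AE \<omega> in P. \<bar>f \<omega>\<bar> \<le> C"
  shows "(\<lambda>\<omega>. complex_of_real (f \<omega>)) \<in> Linf_funs P"
  using assms by (intro Linf_funsI[where C = C]) auto

lemma Linf_funs_add:
  assumes "f \<in> Linf_funs P" "g \<in> Linf_funs P" shows "(\<lambda>\<omega>. f \<omega> + g \<omega>) \<in> Linf_funs P"
proof -
  note [measurable] = assms
  obtain C where "AE \<omega> in P. norm (f \<omega>) \<le> C" using assms(1) by (rule Linf_funsE)
  moreover obtain D where "AE \<omega> in P. norm (g \<omega>) \<le> D" using assms(2) by (rule Linf_funsE)
  ultimately have "AE \<omega> in P. norm (f \<omega> + g \<omega>) \<le> C + D"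
    by eventually_elim (rule norm_triangle_mono)
  then show ?thesis by (intro Linf_funsI) auto
qed

lemma Linf_funs_mult:
  assumes "f \<in> Linf_funs P" "g \<in> Linf_funs P" shows "(\<lambda>\<omega>. f \<omega> * g \<omega>) \<in> Linf_funs P"
proof -
  note [measurable] = assms
  obtain C where "C \<ge> 0" and C: "AE \<omega> in P. norm (f \<omega>) \<le> C" using assms(1) by (rule Linf_funsE)
  obtain D where D: "AE \<omega> in P. norm (g \<omega>) \<le> D" using assms(2) by (rule Linf_funsE)
  from C D have "AE \<omega> in P. norm (f \<omega> * g \<omega>) \<le> C * D"
    by eventually_elim (use \<open>C \<ge> 0\<close> in \<open>simp add: norm_mult mult_mono\<close>)
  then show ?thesis by (intro Linf_funsI) auto
qed

lemma Linf_funs_scale: "f \<in> Linf_funs P \<Longrightarrow> (\<lambda>\<omega>. z * f \<omega>) \<in> Linf_funs P"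
  by (rule Linf_funs_mult) auto

lemma integrable_Linf_mult:
  fixes g :: "'w \<Rightarrow> complex"
  assumes f: "f \<in> Linf_funs P" and g: "integrable P g" shows "integrable P (\<lambda>\<omega>. f \<omega> * g \<omega>)"
proof -
  note [measurable] = f borel_measurable_integrable[OF g]
  obtain C where C: "C \<ge> 0" "AE \<omega> in P. norm (f \<omega>) \<le> C" using f by (rule Linf_funsE)
  show ?thesis
  proof (rule Bochner_Integration.integrable_bound)
    show "integrable P (\<lambda>\<omega>. C *\<^sub>R g \<omega>)" using g by simp
    show "AE \<omega> in P. norm (f \<omega> * g \<omega>) \<le> norm (C *\<^sub>R g \<omega>)"
      using C(2) by eventually_elim (use C(1) in \<open>simp add: norm_mult mult_right_mono\<close>)
  qed simp
qed

lemma Linf_equiv: "equiv (Linf_funs P) (Linf_rel P)"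
proof (rule equivI)
  show "Linf_rel P \<subseteq> Linf_funs P \<times> Linf_funs P" by (auto simp: Linf_rel_def)
  show "refl_on (Linf_funs P) (Linf_rel P)" by (auto simp: Linf_rel_def refl_on_def)
  show "sym (Linf_rel P)" by (auto simp: Linf_rel_def sym_def elim: eventually_mono)
  show "trans (Linf_rel P)"
    by (auto simp: Linf_rel_def trans_def elim: eventually_elim2)
qed

lemma Linf_class_eq_iff:
  assumes "f \<in> Linf_funs P" "g \<in> Linf_funs P"
  shows "Linf_class P f = Linf_class P g \<longleftrightarrow> (AE \<omega> in P. f \<omega> = g \<omega>)"
  using eq_equiv_class_iff[OF Linf_equiv assms] assms by (simp add: Linf_class_def Linf_rel_def)

lemma elems_Linf: "elems (Linf_alg P) = Linf_class P ` Linf_funs P"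
  by (auto simp: Linf_alg_def quotient_def Linf_class_def)

lemma Linf_class_in [simp, intro]: "f \<in> Linf_funs P \<Longrightarrow> Linf_class P f \<in> elems (Linf_alg P)"
  by (simp add: elems_Linf)

lemma Linf_rep_class:
  assumes "f \<in> Linf_funs P"
  shows "Linf_rep (Linf_class P f) \<in> Linf_funs P" "AE \<omega> in P. Linf_rep (Linf_class P f) \<omega> = f \<omega>"
proof -
  have "f \<in> Linf_class P f" using assms by (simp add: Linf_class_def Linf_rel_def)
  then have "Linf_rep (Linf_class P f) \<in> Linf_class P f" using someI[of "\<lambda>g. g \<in> Linf_class P f" f] by (simp add: Linf_rep_def)
  then show "Linf_rep (Linf_class P f) \<in> Linf_funs P" "AE \<omega> in P. Linf_rep (Linf_class P f) \<omega> = f \<omega>"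
    by (auto simp: Linf_class_def Linf_rel_def elim: eventually_mono)
qed

lemma Linf_rep_in [simp]: "c \<in> elems (Linf_alg P) \<Longrightarrow> Linf_rep c \<in> Linf_funs P"
  by (auto simp: elems_Linf intro: Linf_rep_class)

lemma Linf_class_rep:
  assumes "c \<in> elems (Linf_alg P)" shows "Linf_class P (Linf_rep c) = c"
proof -
  obtain f where f: "f \<in> Linf_funs P" "c = Linf_class P f" using assms by (auto simp: elems_Linf)
  show ?thesis using Linf_class_eq_iff[OF Linf_rep_class(1) f(1), OF f(1)] Linf_rep_class(2)[OF f(1)]
    by (simp add: f(2))
qed

lemma Linf_eqI:
  assumes "c \<in> elems (Linf_alg P)" "d \<in> elems (Linf_alg P)" "AE \<omega> in P. Linf_rep c \<omega> = Linf_rep d \<omega>"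
  shows "c = d"
  using Linf_class_eq_iff[of "Linf_rep c" P "Linf_rep d"] assms by (simp add: Linf_class_rep)

lemma plus_Linf: "plus_alg (Linf_alg P) c d = Linf_class P (\<lambda>\<omega>. Linf_rep c \<omega> + Linf_rep d \<omega>)"
  and scale_Linf: "scale_alg (Linf_alg P) z c = Linf_class P (\<lambda>\<omega>. z * Linf_rep c \<omega>)"
  and one_Linf: "one_alg (Linf_alg P) = Linf_class P (\<lambda>_. 1)"
  and mcoef_Linf: "mcoef (Linf_alg P) c \<xi> \<eta> = (LINT \<omega>|P. cnj (\<xi> \<omega>) * Linf_rep c \<omega> * \<eta> \<omega>)"
  and vecs_Linf: "vecs (Linf_alg P) = {\<xi> \<in> borel_measurable P. integrable P (\<lambda>\<omega>. (norm (\<xi> \<omega>))\<^sup>2)}"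
  by (simp_all add: Linf_alg_def)

lemma plus_Linf_class:
  assumes "f \<in> Linf_funs P" "g \<in> Linf_funs P"
  shows "plus_alg (Linf_alg P) (Linf_class P f) (Linf_class P g) = Linf_class P (\<lambda>\<omega>. f \<omega> + g \<omega>)"
proof -
  have "AE \<omega> in P. Linf_rep (Linf_class P f) \<omega> + Linf_rep (Linf_class P g) \<omega> = f \<omega> + g \<omega>"
    using Linf_rep_class(2)[OF assms(1)] Linf_rep_class(2)[OF assms(2)] by eventually_elim simp
  then show ?thesis unfolding plus_Linf using assms
    by (subst Linf_class_eq_iff) (auto intro!: Linf_funs_add Linf_rep_class)
qed

lemma scale_Linf_class:
  assumes "f \<in> Linf_funs P"
  shows "scale_alg (Linf_alg P) z (Linf_class P f) = Linf_class P (\<lambda>\<omega>. z * f \<omega>)"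
proof -
  have "AE \<omega> in P. z * Linf_rep (Linf_class P f) \<omega> = z * f \<omega>"
    using Linf_rep_class(2)[OF assms(1)] by eventually_elim simp
  then show ?thesis unfolding scale_Linf using assms
    by (subst Linf_class_eq_iff) (auto intro!: Linf_funs_scale Linf_rep_class)
qed

lemma plus_Linf_in: "\<lbrakk>c \<in> elems (Linf_alg P); d \<in> elems (Linf_alg P)\<rbrakk> \<Longrightarrow> plus_alg (Linf_alg P) c d \<in> elems (Linf_alg P)"
  and scale_Linf_in: "c \<in> elems (Linf_alg P) \<Longrightarrow> scale_alg (Linf_alg P) z c \<in> elems (Linf_alg P)"
  and one_Linf_in: "one_alg (Linf_alg P) \<in> elems (Linf_alg P)"
  unfolding plus_Linf scale_Linf one_Linf by (auto intro!: Linf_funs_add Linf_funs_scale)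

lemma AE_rep_plus:
  assumes "c \<in> elems (Linf_alg P)" "d \<in> elems (Linf_alg P)"
  shows "AE \<omega> in P. Linf_rep (plus_alg (Linf_alg P) c d) \<omega> = Linf_rep c \<omega> + Linf_rep d \<omega>"
  unfolding plus_Linf using assms by (intro Linf_rep_class Linf_funs_add) auto

lemma AE_rep_scale:
  assumes "c \<in> elems (Linf_alg P)"
  shows "AE \<omega> in P. Linf_rep (scale_alg (Linf_alg P) z c) \<omega> = z * Linf_rep c \<omega>"
  unfolding scale_Linf using assms by (intro Linf_rep_class Linf_funs_scale) auto

text \<open>Real and imaginary parts reduce to real functions, and an affine change of scale reduces
  these to values in [0, 1]. This is the range on which binary digits are available, so linear
  constructions on L^infinity are carried out there first.\<close>

lemma elems_Linf_span:
  assumes V: "\<And>c d. c \<in> V \<Longrightarrow> d \<in> V \<Longrightarrow> plus_alg (Linf_alg P) c d \<in> V"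
      "\<And>z c. c \<in> V \<Longrightarrow> scale_alg (Linf_alg P) z c \<in> V"
    and unit: "\<And>f. f \<in> borel_measurable P \<Longrightarrow> (\<And>\<omega>. 0 \<le> f \<omega> \<and> f \<omega> \<le> (1::real)) \<Longrightarrow>
       Linf_class P (\<lambda>\<omega>. of_real (f \<omega>)) \<in> V"
    and sub: "V \<subseteq> elems (Linf_alg P)" and c: "c \<in> elems (Linf_alg P)"
  shows "c \<in> V"
proof -
  have add: "Linf_class P (\<lambda>\<omega>. f \<omega> + g \<omega>) \<in> V"
    if "f \<in> Linf_funs P" "g \<in> Linf_funs P" "Linf_class P f \<in> V" "Linf_class P g \<in> V" for f g
    using V(1)[OF that(3,4)] that plus_Linf_class by metis
  have scale: "Linf_class P (\<lambda>\<omega>. z * f \<omega>) \<in> V" if "f \<in> Linf_funs P" "Linf_class P f \<in> V" for f z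
    using V(2)[OF that(2)] that scale_Linf_class by metis
  have real: "Linf_class P (\<lambda>\<omega>. of_real (f \<omega>)) \<in> V"
    if f: "f \<in> borel_measurable P" "AE \<omega> in P. \<bar>f \<omega>\<bar> \<le> C" and C: "C > 0" for f C
  proof -
    \<comment> \<open>The bound on \<open>f\<close> holds only almost everywhere. Clamping puts
      \<open>g\<close> into [0, 1] at every point and changes it on a null set only.\<close>
    define g where "g \<omega> = min 1 (max 0 ((f \<omega> + C) / (2 * C)))" for \<omega>
    have g: "g \<in> borel_measurable P" unfolding g_def using f by measurable
    have g': "(\<lambda>\<omega>. complex_of_real (g \<omega>)) \<in> Linf_funs P"
      by (intro Linf_funs_of_real[where C = 1] g AE_I2) (auto simp: g_def)
    have g'': "(\<lambda>\<omega>. of_real (2 * C) * complex_of_real (g \<omega>)) \<in> Linf_funs P"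
      using g' by (rule Linf_funs_scale)
    have 1: "Linf_class P (\<lambda>\<omega>. complex_of_real (g \<omega>)) \<in> V"
      by (intro unit g) (auto simp: g_def)
    have 2: "Linf_class P (\<lambda>\<omega>. of_real (2 * C) * complex_of_real (g \<omega>)) \<in> V"
      using scale[OF g' 1] .
    have "Linf_class P (\<lambda>\<omega>. complex_of_real 1) \<in> V" by (intro unit) auto
    from scale[OF _ this, of "- of_real C"] have 3: "Linf_class P (\<lambda>\<omega>. - of_real C) \<in> V" by simp
    have "AE \<omega> in P. of_real (2 * C) * complex_of_real (g \<omega>) + (- of_real C) = of_real (f \<omega>)"
      using f(2)
    proof eventually_elim
      case (elim \<omega>)
      then have "g \<omega> = (f \<omega> + C) / (2 * C)" using C by (auto simp: g_def field_simps)
      then have "2 * C * g \<omega> - C = f \<omega>" using C by simp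
      then show ?case by (metis of_real_diff of_real_mult add_uminus_conv_diff)
    qed
    then have "Linf_class P (\<lambda>\<omega>. of_real (2 * C) * complex_of_real (g \<omega>) + (- of_real C))
       = Linf_class P (\<lambda>\<omega>. of_real (f \<omega>))"
      using f by (subst Linf_class_eq_iff[OF Linf_funs_add[OF g'' Linf_funs_const]])
        (auto intro!: Linf_funs_of_real[where C = C])
    then show ?thesis using add[OF g'' _ 2 3] by simp
  qed
  define f where "f = Linf_rep c"
  have f: "f \<in> Linf_funs P" using c by (simp add: f_def)
  note [measurable] = f
  obtain C where "AE \<omega> in P. norm (f \<omega>) \<le> C" using f by (rule Linf_funsE)
  then have *: "AE \<omega> in P. norm (f \<omega>) \<le> max C 1" by eventually_elim simp
  have re: "AE \<omega> in P. \<bar>Re (f \<omega>)\<bar> \<le> max C 1" using * by eventually_elim (rule order_trans[OF abs_Re_le_cmod])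
  have im: "AE \<omega> in P. \<bar>Im (f \<omega>)\<bar> \<le> max C 1" using * by eventually_elim (rule order_trans[OF abs_Im_le_cmod])
  have "Linf_class P (\<lambda>\<omega>. of_real (Re (f \<omega>)) + \<i> * of_real (Im (f \<omega>))) \<in> V"
    using re im by (intro add scale real Linf_funs_scale) (auto intro!: Linf_funs_of_real)
  then show ?thesis using Linf_class_rep[OF c] by (simp add: f_def complex_eq[symmetric])
qed

section \<open>Matrix coefficients of multiplication operators\<close>

lemma vecs_Linf_integrable:
  assumes "\<xi> \<in> vecs (Linf_alg P)" "\<eta> \<in> vecs (Linf_alg P)"
  shows "integrable P (\<lambda>\<omega>. cnj (\<xi> \<omega>) * \<eta> \<omega>)"
proof -
  have [measurable]: "\<xi> \<in> borel_measurable P" "\<eta> \<in> borel_measurable P"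
    using assms by (simp_all add: vecs_Linf)
  show ?thesis
  proof (rule Bochner_Integration.integrable_bound)
    show "integrable P (\<lambda>\<omega>. (norm (\<xi> \<omega>))\<^sup>2 + (norm (\<eta> \<omega>))\<^sup>2)" using assms by (simp add: vecs_Linf)
    show "AE \<omega> in P. norm (cnj (\<xi> \<omega>) * \<eta> \<omega>) \<le> norm ((norm (\<xi> \<omega>))\<^sup>2 + (norm (\<eta> \<omega>))\<^sup>2)"
    proof (intro AE_I2)
      fix \<omega>
      have "0 \<le> (norm (\<xi> \<omega>) - norm (\<eta> \<omega>))\<^sup>2" by simp
      then have "2 * (norm (\<xi> \<omega>) * norm (\<eta> \<omega>)) \<le> (norm (\<xi> \<omega>))\<^sup>2 + (norm (\<eta> \<omega>))\<^sup>2"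
        by (simp add: power2_diff)
      moreover have "0 \<le> norm (\<xi> \<omega>) * norm (\<eta> \<omega>)" by simp
      ultimately show "norm (cnj (\<xi> \<omega>) * \<eta> \<omega>) \<le> norm ((norm (\<xi> \<omega>))\<^sup>2 + (norm (\<eta> \<omega>))\<^sup>2)"
        unfolding norm_mult complex_mod_cnj real_norm_def by linarith
    qed
  qed simp
qed

lemma mcoef_Linf': "mcoef (Linf_alg P) c \<xi> \<eta> = (LINT \<omega>|P. Linf_rep c \<omega> * (cnj (\<xi> \<omega>) * \<eta> \<omega>))"
  unfolding mcoef_Linf by (simp add: mult_ac)

lemma mcoef_Linf_diag: "mcoef (Linf_alg P) c \<xi> \<xi> = (LINT \<omega>|P. Linf_rep c \<omega> * of_real ((norm (\<xi> \<omega>))\<^sup>2))"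
  unfolding mcoef_Linf' by (simp only: complex_norm_square mult.commute[of "cnj _"])

text \<open>The common features of an operator algebra and of L^infinity acting on square integrable
  functions, so that channels into both are obtained by one argument. Only diagonal coefficients
  occur in the axioms. The represented algebras carry no vector operations, so
  \<open>combine\<close> asserts that some vector \<open>\<zeta>\<close> has the form of the linear
  combination of the \<open>\<xi> i\<close> with coefficients \<open>v i\<close>; this gives access
  to off-diagonal coefficients.\<close>

locale quadratic_algebra =
  fixes B :: "('b, 'u) represented_algebra"
  assumes plus_in: "\<lbrakk>a \<in> elems B; b \<in> elems B\<rbrakk> \<Longrightarrow> plus_alg B a b \<in> elems B"
    and scale_in: "a \<in> elems B \<Longrightarrow> scale_alg B z a \<in> elems B"
    and one_in: "one_alg B \<in> elems B"
    and mcoef_plus: "\<lbrakk>a \<in> elems B; b \<in> elems B; \<zeta> \<in> vecs B\<rbrakk> \<Longrightarrow>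
      mcoef B (plus_alg B a b) \<zeta> \<zeta> = mcoef B a \<zeta> \<zeta> + mcoef B b \<zeta> \<zeta>"
    and mcoef_scale: "\<lbrakk>a \<in> elems B; \<zeta> \<in> vecs B\<rbrakk> \<Longrightarrow> mcoef B (scale_alg B z a) \<zeta> \<zeta> = z * mcoef B a \<zeta> \<zeta>"
    and eqI: "\<lbrakk>a \<in> elems B; b \<in> elems B; \<And>\<zeta>. \<zeta> \<in> vecs B \<Longrightarrow> mcoef B a \<zeta> \<zeta> = mcoef B b \<zeta> \<zeta>\<rbrakk> \<Longrightarrow> a = b"
    and combine: "(\<And>i. i < (n::nat) \<Longrightarrow> \<xi> i \<in> vecs B) \<Longrightarrow> \<exists>\<zeta>\<in>vecs B. \<forall>b\<in>elems B.
      (\<Sum>i<n. \<Sum>j<n. cnj (v i) * mcoef B b (\<xi> i) (\<xi> j) * v j) = mcoef B b \<zeta> \<zeta>"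

lemma (in finite_measure) vecs_LinfI: "f \<in> Linf_funs M \<Longrightarrow> f \<in> vecs (Linf_alg M)"
proof -
  assume f: "f \<in> Linf_funs M"
  note [measurable] = f
  obtain C where C: "AE \<omega> in M. norm (f \<omega>) \<le> C" using f by (rule Linf_funsE)
  have "integrable M (\<lambda>\<omega>. (norm (f \<omega>))\<^sup>2)"
    by (rule integrable_const_bound[where B = "C\<^sup>2"])
      (use C in \<open>auto elim!: eventually_mono intro: power_mono\<close>)
  then show ?thesis by (simp add: vecs_Linf)
qed

lemma integral_double_sum:
  fixes f :: "nat \<Rightarrow> nat \<Rightarrow> 'w \<Rightarrow> complex"
  assumes "\<And>i j. i < n \<Longrightarrow> j < n \<Longrightarrow> integrable P (f i j)"
  shows "(LINT \<omega>|P. (\<Sum>i<n. \<Sum>j<n. f i j \<omega>)) = (\<Sum>i<n. \<Sum>j<n. LINT \<omega>|P. f i j \<omega>)"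
proof -
  have "(LINT \<omega>|P. (\<Sum>i<n. \<Sum>j<n. f i j \<omega>)) = (\<Sum>i<n. LINT \<omega>|P. (\<Sum>j<n. f i j \<omega>))"
    using assms by (intro Bochner_Integration.integral_sum Bochner_Integration.integrable_sum) auto
  also have "\<dots> = (\<Sum>i<n. \<Sum>j<n. LINT \<omega>|P. f i j \<omega>)"
    using assms by (intro sum.cong refl Bochner_Integration.integral_sum) auto
  finally show ?thesis .
qed

lemma cnj_indicator_mult: "cnj (indicator E \<omega>) * indicator E \<omega> = (indicator E \<omega> :: complex)"
  by (auto simp: indicator_def)

text \<open>On a finite measure space indicators are square integrable, and as test vectors they
  already separate classes. For \<open>combine\<close> the pointwise linear combination is the
  required vector.\<close>

lemma (in finite_measure) quadratic_algebra_Linf: "quadratic_algebra (Linf_alg M)"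
proof
  let ?A = "Linf_alg M"
  fix a b z \<zeta>
  assume a: "a \<in> elems ?A" and z: "\<zeta> \<in> vecs ?A"
  have i: "integrable M (\<lambda>\<omega>. Linf_rep c \<omega> * (cnj (\<zeta> \<omega>) * \<zeta> \<omega>))" if "c \<in> elems ?A" for c
    using that z by (intro integrable_Linf_mult vecs_Linf_integrable) auto
  have [measurable]: "\<zeta> \<in> borel_measurable M" using z by (simp add: vecs_Linf)
  have m: "Linf_rep c \<in> borel_measurable M" if "c \<in> elems ?A" for c
    using that by (intro Linf_funs_measurable) auto
  show "mcoef ?A (scale_alg ?A z a) \<zeta> \<zeta> = z * mcoef ?A a \<zeta> \<zeta>"
  proof -
    have "mcoef ?A (scale_alg ?A z a) \<zeta> \<zeta> = (LINT \<omega>|M. z * (Linf_rep a \<omega> * (cnj (\<zeta> \<omega>) * \<zeta> \<omega>)))"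
      unfolding mcoef_Linf'
    proof (rule integral_cong_AE)
      show "AE \<omega> in M. Linf_rep (scale_alg ?A z a) \<omega> * (cnj (\<zeta> \<omega>) * \<zeta> \<omega>) = z * (Linf_rep a \<omega> * (cnj (\<zeta> \<omega>) * \<zeta> \<omega>))"
        using AE_rep_scale[OF a, of z] by eventually_elim simp
    qed (use m[OF a] m[OF scale_Linf_in[OF a]] in measurable)
    then show ?thesis by (simp add: mcoef_Linf')
  qed
  assume b: "b \<in> elems ?A"
  show "mcoef ?A (plus_alg ?A a b) \<zeta> \<zeta> = mcoef ?A a \<zeta> \<zeta> + mcoef ?A b \<zeta> \<zeta>"
  proof -
    have "mcoef ?A (plus_alg ?A a b) \<zeta> \<zeta>
        = (LINT \<omega>|M. Linf_rep a \<omega> * (cnj (\<zeta> \<omega>) * \<zeta> \<omega>) + Linf_rep b \<omega> * (cnj (\<zeta> \<omega>) * \<zeta> \<omega>))"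
      unfolding mcoef_Linf'
    proof (rule integral_cong_AE)
      show "AE \<omega> in M. Linf_rep (plus_alg ?A a b) \<omega> * (cnj (\<zeta> \<omega>) * \<zeta> \<omega>)
         = Linf_rep a \<omega> * (cnj (\<zeta> \<omega>) * \<zeta> \<omega>) + Linf_rep b \<omega> * (cnj (\<zeta> \<omega>) * \<zeta> \<omega>)"
        using AE_rep_plus[OF a b] by eventually_elim (simp add: algebra_simps)
    qed (use m[OF a] m[OF b] m[OF plus_Linf_in[OF a b]] in measurable)
    then show ?thesis using i a b by (simp add: mcoef_Linf')
  qed
next
  let ?A = "Linf_alg M"
  fix a b
  assume a: "a \<in> elems ?A" and b: "b \<in> elems ?A"
    and eq: "\<And>\<zeta>. \<zeta> \<in> vecs ?A \<Longrightarrow> mcoef ?A a \<zeta> \<zeta> = mcoef ?A b \<zeta> \<zeta>"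
  have i: "integrable M (Linf_rep c)" if "c \<in> elems ?A" for c
    using integrable_Linf_mult[of "Linf_rep c" M "\<lambda>_. 1"] that by simp
  have 0: "(LINT \<omega>|M. (Linf_rep a \<omega> - Linf_rep b \<omega>) * indicator E \<omega>) = 0" if E: "E \<in> sets M" for E
  proof -
    have "(LINT \<omega>|M. Linf_rep a \<omega> * indicator E \<omega>) = (LINT \<omega>|M. Linf_rep b \<omega> * indicator E \<omega>)"
      using eq[OF vecs_LinfI[OF Linf_funs_indicator[OF E]]]
      by (simp only: mcoef_Linf' cnj_indicator_mult)
    then show ?thesis
      using integrable_complex_mult_indicator[OF i[OF a] E] integrable_complex_mult_indicator[OF i[OF b] E]
      by (simp add: left_diff_distrib)
  qed
  have "AE \<omega> in M. Linf_rep a \<omega> - Linf_rep b \<omega> \<in> \<real>\<^sub>\<ge>\<^sub>0"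
    by (rule AE_nonneg_Reals_of_set_integrals) (use i a b 0 in auto)
  moreover have "(LINT \<omega>|M. (Linf_rep b \<omega> - Linf_rep a \<omega>) * indicator E \<omega>) = 0" if E: "E \<in> sets M" for E
  proof -
    have "(LINT \<omega>|M. (Linf_rep b \<omega> - Linf_rep a \<omega>) * indicator E \<omega>)
       = (LINT \<omega>|M. - ((Linf_rep a \<omega> - Linf_rep b \<omega>) * indicator E \<omega>))" by (simp add: algebra_simps)
    then show ?thesis using 0[OF E] by simp
  qed
  then have "AE \<omega> in M. Linf_rep b \<omega> - Linf_rep a \<omega> \<in> \<real>\<^sub>\<ge>\<^sub>0"
    by (intro AE_nonneg_Reals_of_set_integrals) (use i a b in auto)
  ultimately have "AE \<omega> in M. Linf_rep a \<omega> = Linf_rep b \<omega>"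
    by eventually_elim (simp add: complex_nonneg_Reals_iff complex_eq_iff)
  then show "a = b" using a b by (rule Linf_eqI[rotated 2])
next
  let ?A = "Linf_alg M"
  fix n :: nat and \<xi> and v :: "nat \<Rightarrow> complex"
  assume \<xi>: "\<And>i. i < n \<Longrightarrow> \<xi> i \<in> vecs ?A"
  define \<zeta> where "\<zeta> \<omega> = (\<Sum>j<n. v j * \<xi> j \<omega>)" for \<omega>
  have ij: "integrable M (\<lambda>\<omega>. cnj (\<xi> i \<omega>) * \<xi> j \<omega>)" if "i < n" "j < n" for i j
    using that \<xi> by (intro vecs_Linf_integrable)
  have sq: "cnj (\<zeta> \<omega>) * \<zeta> \<omega> = (\<Sum>i<n. \<Sum>j<n. cnj (v i) * v j * (cnj (\<xi> i \<omega>) * \<xi> j \<omega>))" for \<omega>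
    unfolding \<zeta>_def cnj_sum sum_product by (intro sum.cong refl) simp
  have "integrable M (\<lambda>\<omega>. cnj (\<zeta> \<omega>) * \<zeta> \<omega>)"
    unfolding sq using ij by (intro Bochner_Integration.integrable_sum integrable_mult_right) auto
  then have "integrable M (\<lambda>\<omega>. norm (cnj (\<zeta> \<omega>) * \<zeta> \<omega>))" by (rule integrable_norm)
  moreover have "\<xi> i \<in> borel_measurable M" if "i < n" for i using \<xi>[OF that] by (simp add: vecs_Linf)
  then have "\<zeta> \<in> borel_measurable M" unfolding \<zeta>_def by measurable
  ultimately have \<zeta>: "\<zeta> \<in> vecs ?A" by (simp add: vecs_Linf norm_mult power2_eq_square)
  have "(\<Sum>i<n. \<Sum>j<n. cnj (v i) * mcoef ?A b (\<xi> i) (\<xi> j) * v j) = mcoef ?A b \<zeta> \<zeta>" if b: "b \<in> elems ?A" for b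
  proof -
    have i: "integrable M (\<lambda>\<omega>. Linf_rep b \<omega> * (cnj (\<xi> i \<omega>) * \<xi> j \<omega>))" if "i < n" "j < n" for i j
      by (rule integrable_Linf_mult[OF Linf_rep_in[OF b] ij[OF that]])
    have "mcoef ?A b \<zeta> \<zeta> = (LINT \<omega>|M. (\<Sum>i<n. \<Sum>j<n. cnj (v i) * v j * (Linf_rep b \<omega> * (cnj (\<xi> i \<omega>) * \<xi> j \<omega>))))"
      unfolding mcoef_Linf' sq sum_distrib_left
      by (intro Bochner_Integration.integral_cong sum.cong refl) simp
    also have "\<dots> = (\<Sum>i<n. \<Sum>j<n. cnj (v i) * v j * mcoef ?A b (\<xi> i) (\<xi> j))"
      using i by (subst integral_double_sum) (auto simp: mcoef_Linf' intro!: sum.cong)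
    finally show ?thesis by (simp add: mult_ac)
  qed
  with \<zeta> show "\<exists>\<zeta>\<in>vecs ?A. \<forall>b\<in>elems ?A.
      (\<Sum>i<n. \<Sum>j<n. cnj (v i) * mcoef ?A b (\<xi> i) (\<xi> j) * v j) = mcoef ?A b \<zeta> \<zeta>" by blast
qed (auto intro: plus_Linf_in scale_Linf_in one_Linf_in)

section \<open>The order on L^infinity and suprema of directed sets\<close>

lemma integrable_Re_rep:
  assumes "finite_measure P" "c \<in> elems (Linf_alg P)"
  shows "integrable P (Linf_rep c)" "integrable P (\<lambda>\<omega>. Re (Linf_rep c \<omega>))"
proof -
  interpret finite_measure P by fact
  show i: "integrable P (Linf_rep c)"
    using integrable_Linf_mult[of "Linf_rep c" P "\<lambda>_. 1"] assms(2) by simp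
  show "integrable P (\<lambda>\<omega>. Re (Linf_rep c \<omega>))" using i by simp
qed

text \<open>The quadratic form at \<open>\<xi>\<close> is integration against the squared modulus of
  \<open>\<xi>\<close>. Choosing indicators for \<open>\<xi>\<close> forces nonnegativity almost
  everywhere, and nonnegativity almost everywhere makes all forms nonnegative.\<close>

lemma le_Linf_iff:
  assumes "finite_measure P" "c \<in> elems (Linf_alg P)" "d \<in> elems (Linf_alg P)"
  shows "le_alg (Linf_alg P) c d \<longleftrightarrow> (AE \<omega> in P. Linf_rep d \<omega> - Linf_rep c \<omega> \<in> \<real>\<^sub>\<ge>\<^sub>0)"
proof -
  interpret finite_measure P by fact
  have diff: "mcoef (Linf_alg P) d \<xi> \<xi> - mcoef (Linf_alg P) c \<xi> \<xi>
      = (LINT \<omega>|P. (Linf_rep d \<omega> - Linf_rep c \<omega>) * (cnj (\<xi> \<omega>) * \<xi> \<omega>))"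
    if "\<xi> \<in> vecs (Linf_alg P)" for \<xi>
  proof -
    have "integrable P (\<lambda>\<omega>. Linf_rep b \<omega> * (cnj (\<xi> \<omega>) * \<xi> \<omega>))" if "b \<in> elems (Linf_alg P)" for b
      using that \<open>\<xi> \<in> _\<close> by (intro integrable_Linf_mult vecs_Linf_integrable) auto
    then show ?thesis using assms by (simp add: mcoef_Linf' left_diff_distrib)
  qed
  show ?thesis
  proof
    assume le: "le_alg (Linf_alg P) c d"
    show "AE \<omega> in P. Linf_rep d \<omega> - Linf_rep c \<omega> \<in> \<real>\<^sub>\<ge>\<^sub>0"
    proof (rule AE_nonneg_Reals_of_set_integrals)
      show "integrable P (\<lambda>\<omega>. Linf_rep d \<omega> - Linf_rep c \<omega>)"
        using integrable_Re_rep(1) assms by (intro Bochner_Integration.integrable_diff) auto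
      fix E assume E: "E \<in> sets P"
      show "(LINT \<omega>|P. (Linf_rep d \<omega> - Linf_rep c \<omega>) * indicator E \<omega>) \<in> \<real>\<^sub>\<ge>\<^sub>0"
        using le diff[OF vecs_LinfI[OF Linf_funs_indicator[OF E]]] vecs_LinfI[OF Linf_funs_indicator[OF E]]
        unfolding le_alg_def cnj_indicator_mult by auto
    qed
  next
    assume "AE \<omega> in P. Linf_rep d \<omega> - Linf_rep c \<omega> \<in> \<real>\<^sub>\<ge>\<^sub>0"
    then have "(LINT \<omega>|P. (Linf_rep d \<omega> - Linf_rep c \<omega>) * (cnj (\<xi> \<omega>) * \<xi> \<omega>)) \<in> \<real>\<^sub>\<ge>\<^sub>0" for \<xi>
      by (intro integral_nonneg_Reals, eventually_elim)
        (auto intro!: nonneg_Reals_mult_I simp: mult.commute[of "cnj _"] complex_norm_square[symmetric])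
    then show "le_alg (Linf_alg P) c d" unfolding le_alg_def using diff by simp
  qed
qed

lemma selfadjoint_Linf_iff:
  assumes "finite_measure P"
  shows "c \<in> selfadjoint_elems (Linf_alg P) \<longleftrightarrow> c \<in> elems (Linf_alg P) \<and> (AE \<omega> in P. Im (Linf_rep c \<omega>) = 0)"
proof -
  interpret finite_measure P by fact
  show ?thesis
  proof (intro iffI conjI; (elim conjE)?)
    assume c: "c \<in> selfadjoint_elems (Linf_alg P)"
    then show c': "c \<in> elems (Linf_alg P)" by (simp add: selfadjoint_elems_def)
    have i: "integrable P (Linf_rep c)" using integrable_Re_rep(1)[OF assms c'] .
    have *: "(LINT \<omega>|P. Im (Linf_rep c \<omega>) * indicator E \<omega>) = 0" if E: "E \<in> sets P" for E
    proof -
      have "(LINT \<omega>|P. Linf_rep c \<omega> * (cnj (indicator E \<omega>) * indicator E \<omega>)) \<in> \<real>"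
        using c vecs_LinfI[OF Linf_funs_indicator[OF E]] unfolding selfadjoint_elems_def mcoef_Linf' by blast
      then have "(LINT \<omega>|P. Linf_rep c \<omega> * indicator E \<omega>) \<in> \<real>" by (simp only: cnj_indicator_mult)
      then have "Im (LINT \<omega>|P. Linf_rep c \<omega> * indicator E \<omega>) = 0" by (simp add: complex_is_Real_iff)
      moreover have "Im (Linf_rep c \<omega> * indicator E \<omega>) = Im (Linf_rep c \<omega>) * indicator E \<omega>" for \<omega>
        by (auto simp: indicator_def)
      ultimately show ?thesis using integral_Im[OF integrable_complex_mult_indicator[OF i E]] by simp
    qed
    have "AE \<omega> in P. 0 \<le> Im (Linf_rep c \<omega>)"
      by (rule AE_nonneg_of_set_integrals) (use i * in auto)
    moreover have "AE \<omega> in P. 0 \<le> - Im (Linf_rep c \<omega>)"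
      by (rule AE_nonneg_of_set_integrals) (use i * in auto)
    ultimately show "AE \<omega> in P. Im (Linf_rep c \<omega>) = 0" by eventually_elim simp
  next
    assume c: "c \<in> elems (Linf_alg P)" and im: "AE \<omega> in P. Im (Linf_rep c \<omega>) = 0"
    have "mcoef (Linf_alg P) c \<xi> \<xi> \<in> \<real>" if x: "\<xi> \<in> vecs (Linf_alg P)" for \<xi>
    proof -
      have i: "integrable P (\<lambda>\<omega>. Linf_rep c \<omega> * of_real ((norm (\<xi> \<omega>))\<^sup>2))"
        using integrable_Linf_mult[OF Linf_rep_in[OF c] vecs_Linf_integrable[OF x x]]
        by (simp only: complex_norm_square mult.commute[of "cnj _"])
      have "(LINT \<omega>|P. Im (Linf_rep c \<omega> * of_real ((norm (\<xi> \<omega>))\<^sup>2))) = 0"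
        using im by (intro integral_eq_zero_AE, eventually_elim) simp
      then show ?thesis using integral_Im[OF i] by (simp add: mcoef_Linf_diag complex_is_Real_iff)
    qed
    then show "c \<in> selfadjoint_elems (Linf_alg P)" using c by (simp add: selfadjoint_elems_def)
  qed
qed

lemma le_Linf_iff_Re:
  assumes "finite_measure P" "c \<in> selfadjoint_elems (Linf_alg P)" "d \<in> selfadjoint_elems (Linf_alg P)"
  shows "le_alg (Linf_alg P) c d \<longleftrightarrow> (AE \<omega> in P. Re (Linf_rep c \<omega>) \<le> Re (Linf_rep d \<omega>))"
proof -
  have cd: "c \<in> elems (Linf_alg P)" "d \<in> elems (Linf_alg P)"
    and im: "AE \<omega> in P. Im (Linf_rep c \<omega>) = 0" "AE \<omega> in P. Im (Linf_rep d \<omega>) = 0"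
    using assms(2,3) by (simp_all add: selfadjoint_Linf_iff[OF assms(1)])
  have "(AE \<omega> in P. Linf_rep d \<omega> - Linf_rep c \<omega> \<in> \<real>\<^sub>\<ge>\<^sub>0) \<longleftrightarrow> (AE \<omega> in P. Re (Linf_rep c \<omega>) \<le> Re (Linf_rep d \<omega>))"
    by (rule eventually_subst) (use im in eventually_elim, simp add: complex_nonneg_Reals_iff)
  then show ?thesis using le_Linf_iff[OF assms(1) cd] by simp
qed

lemma Linf_of_real_selfadjoint:
  assumes "finite_measure P" "f \<in> borel_measurable P" "AE \<omega> in P. \<bar>f \<omega>\<bar> \<le> C"
  shows "Linf_class P (\<lambda>\<omega>. of_real (f \<omega>)) \<in> selfadjoint_elems (Linf_alg P)"
    "AE \<omega> in P. Re (Linf_rep (Linf_class P (\<lambda>\<omega>. of_real (f \<omega>))) \<omega>) = f \<omega>"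
proof -
  have f: "(\<lambda>\<omega>. complex_of_real (f \<omega>)) \<in> Linf_funs P" using assms by (intro Linf_funs_of_real)
  then show "Linf_class P (\<lambda>\<omega>. of_real (f \<omega>)) \<in> selfadjoint_elems (Linf_alg P)"
    using Linf_rep_class(2)[OF f] unfolding selfadjoint_Linf_iff[OF assms(1)]
    by (auto elim!: eventually_mono)
  show "AE \<omega> in P. Re (Linf_rep (Linf_class P (\<lambda>\<omega>. of_real (f \<omega>))) \<omega>) = f \<omega>"
    using Linf_rep_class(2)[OF f] by eventually_elim simp
qed

text \<open>The supremum of a directed set is reached along a sequence whose integrals increase to the
  supremum of all integrals.\<close>

lemma directed_lub_sequence:
  fixes P :: "'w measure"
  assumes P: "finite_measure P" and D: "D \<subseteq> selfadjoint_elems (Linf_alg P)" "D \<noteq> {}"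
    and dir: "\<And>a b. a \<in> D \<Longrightarrow> b \<in> D \<Longrightarrow> \<exists>c\<in>D. le_alg (Linf_alg P) a c \<and> le_alg (Linf_alg P) b c"
    and lub: "is_lub_alg (Linf_alg P) D s"
  obtains d where "\<And>n::nat. d n \<in> D"
    "AE \<omega> in P. \<forall>n. Re (Linf_rep (d n) \<omega>) \<le> Re (Linf_rep (d (Suc n)) \<omega>)"
    "AE \<omega> in P. (\<lambda>n. Re (Linf_rep (d n) \<omega>)) \<longlonglongrightarrow> Re (Linf_rep s \<omega>)"
proof -
  interpret finite_measure P by fact
  define r where "r c \<omega> = Re (Linf_rep c \<omega>)" for c :: "('w \<Rightarrow> complex) set" and \<omega>
  define J where "J c = (LINT \<omega>|P. r c \<omega>)" for c
  have s: "s \<in> selfadjoint_elems (Linf_alg P)" and ub: "\<And>d. d \<in> D \<Longrightarrow> le_alg (Linf_alg P) d s"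
    and least: "\<And>u. u \<in> selfadjoint_elems (Linf_alg P) \<Longrightarrow> (\<And>d. d \<in> D \<Longrightarrow> le_alg (Linf_alg P) d u)
      \<Longrightarrow> le_alg (Linf_alg P) s u"
    using lub by (auto simp: is_lub_alg_def)
  have el: "c \<in> elems (Linf_alg P)" if "c \<in> selfadjoint_elems (Linf_alg P)" for c
    using that by (simp add: selfadjoint_elems_def)
  have le: "le_alg (Linf_alg P) c d \<longleftrightarrow> (AE \<omega> in P. r c \<omega> \<le> r d \<omega>)"
    if "c \<in> selfadjoint_elems (Linf_alg P)" "d \<in> selfadjoint_elems (Linf_alg P)" for c d
    using le_Linf_iff_Re[OF P that] by (simp add: r_def)
  have ri: "integrable P (r c)" if "c \<in> selfadjoint_elems (Linf_alg P)" for c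
    using integrable_Re_rep(2)[OF P el[OF that]] by (simp add: r_def[abs_def])
  have mono: "J c \<le> J d"
    if "c \<in> selfadjoint_elems (Linf_alg P)" "d \<in> selfadjoint_elems (Linf_alg P)" "le_alg (Linf_alg P) c d" for c d
    unfolding J_def using that le by (intro integral_mono_AE ri) auto
  define I where "I = Sup (J ` D)"
  have bdd: "bdd_above (J ` D)" using D ub s mono by (intro bdd_aboveI[of _ "J s"]) auto
  have I: "J d \<le> I" if "d \<in> D" for d unfolding I_def using bdd that by (intro cSup_upper) auto
  have "\<exists>d\<in>D. I - 1 / (real n + 1) < J d" for n
  proof -
    have "I - 1 / (real n + 1) < I" by simp
    then show ?thesis unfolding I_def using less_cSup_iff[of "J ` D"] bdd D(2) by auto
  qed
  then obtain e where e: "\<And>n. e n \<in> D" "\<And>n. I - 1 / (real n + 1) < J (e n)" by metis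
  obtain up where up: "\<And>a b. a \<in> D \<Longrightarrow> b \<in> D \<Longrightarrow> up a b \<in> D \<and> le_alg (Linf_alg P) a (up a b) \<and> le_alg (Linf_alg P) b (up a b)"
    using dir by metis
  \<comment> \<open>Each term dominates its predecessor and the next almost maximizing element, so
    the sequence increases and its integrals still approach \<open>I\<close>.\<close>
  define d where "d = rec_nat (e 0) (\<lambda>n x. up x (e (Suc n)))"
  have dD: "d n \<in> D" for n by (induction n) (auto simp: d_def e up)
  have d_simps: "d 0 = e 0" "d (Suc n) = up (d n) (e (Suc n))" for n by (auto simp: d_def)
  have step: "le_alg (Linf_alg P) (d n) (d (Suc n))" for n using up dD e by (auto simp: d_simps)
  have Jd: "I - 1 / (real n + 1) < J (d n)" for n
  proof (cases n)
    case (Suc m)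
    have "le_alg (Linf_alg P) (e n) (d n)" using up dD e by (auto simp: d_simps Suc)
    then have "J (e n) \<le> J (d n)" using e dD D(1) by (intro mono) auto
    then show ?thesis using e(2)[of n] by linarith
  qed (use e(2)[of 0] in \<open>simp add: d_simps\<close>)
  have sa: "c \<in> selfadjoint_elems (Linf_alg P)" if "c \<in> D" for c using that D by auto
  have inc: "AE \<omega> in P. \<forall>n. r (d n) \<omega> \<le> r (d (Suc n)) \<omega>"
    unfolding AE_all_countable using step le sa[OF dD] by blast
  have bnd: "AE \<omega> in P. \<forall>n. r (d n) \<omega> \<le> r s \<omega>"
    unfolding AE_all_countable using ub[OF dD] le sa[OF dD] s by blast
  define t where "t \<omega> = lim (\<lambda>n. r (d n) \<omega>)" for \<omega>
  have [measurable]: "r c \<in> borel_measurable P" if "c \<in> selfadjoint_elems (Linf_alg P)" for c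
    using ri[OF that] by simp
  have [measurable]: "r (d n) \<in> borel_measurable P" for n using sa[OF dD] by measurable
  have tm [measurable]: "t \<in> borel_measurable P" unfolding t_def by measurable
  have conv: "AE \<omega> in P. (\<lambda>n. r (d n) \<omega>) \<longlonglongrightarrow> t \<omega> \<and> (\<forall>n. r (d n) \<omega> \<le> t \<omega>) \<and> t \<omega> \<le> r s \<omega>"
    using inc bnd
  proof eventually_elim
    case (elim \<omega>)
    have i: "incseq (\<lambda>n. r (d n) \<omega>)" using elim by (intro incseq_SucI) auto
    obtain L where L: "(\<lambda>n. r (d n) \<omega>) \<longlonglongrightarrow> L" "\<forall>n. r (d n) \<omega> \<le> L"
      using incseq_convergent[OF i, of "r s \<omega>"] elim by auto
    then have "t \<omega> = L" unfolding t_def by (intro limI)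
    moreover have "L \<le> r s \<omega>" using L elim by (intro LIMSEQ_le_const2[OF L(1)]) auto
    ultimately show ?case using L by simp
  qed
  obtain C where C: "AE \<omega> in P. norm (Linf_rep (d 0) \<omega>) \<le> C"
    using Linf_rep_in[OF el[OF sa[OF dD[of 0]]]] by (rule Linf_funsE)
  obtain C' where C': "AE \<omega> in P. norm (Linf_rep s \<omega>) \<le> C'"
    using Linf_rep_in[OF el[OF s]] by (rule Linf_funsE)
  have tb: "AE \<omega> in P. \<bar>t \<omega>\<bar> \<le> C + C'"
    using conv C C'
  proof eventually_elim
    case (elim \<omega>)
    have "\<bar>r (d 0) \<omega>\<bar> \<le> C" "\<bar>r s \<omega>\<bar> \<le> C'"
      using elim abs_Re_le_cmod order_trans unfolding r_def by blast+
    then show ?case using elim(1) by (smt (verit))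
  qed
  define tc where "tc = Linf_class P (\<lambda>\<omega>. of_real (t \<omega>))"
  have tc: "tc \<in> selfadjoint_elems (Linf_alg P)" "AE \<omega> in P. r tc \<omega> = t \<omega>"
    using Linf_of_real_selfadjoint[OF P tm tb] by (simp_all add: tc_def r_def)
  have ti: "integrable P t" using tb tm by (intro integrable_const_bound[where B = "C + C'"]) auto
  have "le_alg (Linf_alg P) x tc" if x: "x \<in> D" for x
  proof -
    have xi: "integrable P (\<lambda>\<omega>. max (r x \<omega> - t \<omega>) 0)"
      using ri[OF sa[OF x]] ti by (intro integrable_max) auto
    have small: "(LINT \<omega>|P. max (r x \<omega> - t \<omega>) 0) \<le> 1 / (real n + 1)" for n
    proof -
      \<comment> \<open>An element of \<open>D\<close> above both \<open>x\<close> and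
        \<open>d n\<close> has integral at most \<open>I\<close>, while that of \<open>d n\<close>
        is within 1/(n+1) of \<open>I\<close>. As \<open>t\<close> is at least \<open>d n\<close>,
        the excess of \<open>x\<close> over \<open>t\<close> is at most \<open>f - d n\<close> and
        hence has small integral. So \<open>t\<close> bounds all of \<open>D\<close>, including
        elements outside the sequence.\<close>
      define f where "f = up x (d n)"
      have f: "f \<in> D" "le_alg (Linf_alg P) x f" "le_alg (Linf_alg P) (d n) f"
        using up[OF x dD[of n]] by (auto simp: f_def)
      have "AE \<omega> in P. r x \<omega> \<le> r f \<omega>" "AE \<omega> in P. r (d n) \<omega> \<le> r f \<omega>"
        using le[OF sa[OF x] sa[OF f(1)]] le[OF sa[OF dD] sa[OF f(1)]] f by auto
      then have "AE \<omega> in P. max (r x \<omega> - t \<omega>) 0 \<le> r f \<omega> - r (d n) \<omega>"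
        using conv
      proof eventually_elim
        case (elim \<omega>)
        then have "r (d n) \<omega> \<le> t \<omega>" by blast
        then show ?case using elim(1,2) unfolding max_def by (simp split: if_split)
      qed
      then have "(LINT \<omega>|P. max (r x \<omega> - t \<omega>) 0) \<le> (LINT \<omega>|P. r f \<omega> - r (d n) \<omega>)"
        using xi ri[OF sa[OF f(1)]] ri[OF sa[OF dD]] by (intro integral_mono_AE) auto
      also have "\<dots> = J f - J (d n)"
        using ri[OF sa[OF f(1)]] ri[OF sa[OF dD]] by (simp add: J_def)
      finally show ?thesis using Jd[of n] I[OF f(1)] by linarith
    qed
    have "(LINT \<omega>|P. max (r x \<omega> - t \<omega>) 0) \<le> 0"
    proof (rule field_le_epsilon)
      fix \<epsilon> :: real assume "\<epsilon> > 0"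
      then obtain n where "inverse (real (Suc n)) < \<epsilon>" using reals_Archimedean by blast
      then show "(LINT \<omega>|P. max (r x \<omega> - t \<omega>) 0) \<le> 0 + \<epsilon>"
        using small[of n] by (simp add: inverse_eq_divide add.commute)
    qed
    moreover have "0 \<le> (LINT \<omega>|P. max (r x \<omega> - t \<omega>) 0)" by (intro integral_nonneg_AE) auto
    ultimately have "AE \<omega> in P. max (r x \<omega> - t \<omega>) 0 = 0"
      using integral_nonneg_eq_0_iff_AE[OF xi] by auto
    then have "AE \<omega> in P. r x \<omega> \<le> r tc \<omega>"
      using tc(2) by eventually_elim auto
    then show ?thesis using le[OF sa[OF x] tc(1)] by blast
  qed
  \<comment> \<open>The converse inequality is part of \<open>conv\<close>, because every
    \<open>d n\<close> lies below \<open>s\<close>.\<close>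
  then have "AE \<omega> in P. r s \<omega> \<le> r tc \<omega>" using least[OF tc(1)] le[OF s tc(1)] by blast
  then have "AE \<omega> in P. (\<lambda>n. r (d n) \<omega>) \<longlonglongrightarrow> r s \<omega>"
    using tc(2) conv by eventually_elim (metis order_antisym)
  then show thesis using dD inc by (intro that[of d]) (auto simp: r_def)
qed

text \<open>The sequence from \<open>directed_lub_sequence\<close> converges to \<open>s\<close> but
  may visit the elements \<open>c n\<close> in any order. Its terms are all bounded by the limit of
  \<open>c\<close>, which in turn is bounded by \<open>s\<close>.\<close>

lemma increasing_lub:
  assumes P: "finite_measure P" and c: "\<And>n::nat. c n \<in> selfadjoint_elems (Linf_alg P)"
    and inc: "\<And>n. le_alg (Linf_alg P) (c n) (c (Suc n))"
    and lub: "is_lub_alg (Linf_alg P) (range c) s"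
  shows "AE \<omega> in P. (\<lambda>n. Re (Linf_rep (c n) \<omega>)) \<longlonglongrightarrow> Re (Linf_rep s \<omega>)"
proof -
  have s: "s \<in> selfadjoint_elems (Linf_alg P)" "\<And>n. le_alg (Linf_alg P) (c n) s"
    using lub by (auto simp: is_lub_alg_def)
  have inc': "AE \<omega> in P. \<forall>n. Re (Linf_rep (c n) \<omega>) \<le> Re (Linf_rep (c (Suc n)) \<omega>)"
    unfolding AE_all_countable using inc le_Linf_iff_Re[OF P c c] by blast
  have mono: "le_alg (Linf_alg P) (c m) (c n)" if "m \<le> n" for m n
  proof -
    have "AE \<omega> in P. Re (Linf_rep (c m) \<omega>) \<le> Re (Linf_rep (c n) \<omega>)"
      using inc'
    proof eventually_elim
      case (elim \<omega>)
      then show ?case using lift_Suc_mono_le[of "\<lambda>n. Re (Linf_rep (c n) \<omega>)" m n] that by simp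
    qed
    then show ?thesis using le_Linf_iff_Re[OF P c c] by blast
  qed
  obtain d where d: "\<And>n::nat. d n \<in> range c"
    "AE \<omega> in P. (\<lambda>n. Re (Linf_rep (d n) \<omega>)) \<longlonglongrightarrow> Re (Linf_rep s \<omega>)"
  proof (rule directed_lub_sequence[OF P _ _ _ lub])
    show "\<exists>x\<in>range c. le_alg (Linf_alg P) a x \<and> le_alg (Linf_alg P) b x"
      if "a \<in> range c" "b \<in> range c" for a b
    proof -
      obtain m n where "a = c m" "b = c n" using \<open>a \<in> range c\<close> \<open>b \<in> range c\<close> by blast
      then show ?thesis using mono[of m "max m n"] mono[of n "max m n"] by auto
    qed
  qed (use c in auto)
  have "AE \<omega> in P. \<forall>n. Re (Linf_rep (c n) \<omega>) \<le> Re (Linf_rep s \<omega>)"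
    unfolding AE_all_countable using s le_Linf_iff_Re[OF P c s(1)] by blast
  with inc' d(2) show ?thesis
  proof eventually_elim
    case (elim \<omega>)
    define x where "x n = Re (Linf_rep (c n) \<omega>)" for n
    have i: "incseq x" using elim by (intro incseq_SucI) (auto simp: x_def)
    obtain L where L: "x \<longlonglongrightarrow> L" "\<forall>n. x n \<le> L"
      using incseq_convergent[OF i, of "Re (Linf_rep s \<omega>)"] elim by (auto simp: x_def)
    have "L \<le> Re (Linf_rep s \<omega>)" using elim by (intro LIMSEQ_le_const2[OF L(1)]) (auto simp: x_def)
    moreover have "Re (Linf_rep (d n) \<omega>) \<le> L" for n
      using d(1)[of n] L(2) by (auto simp: x_def)
    then have "Re (Linf_rep s \<omega>) \<le> L" by (intro LIMSEQ_le_const2[OF elim(2)]) auto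
    ultimately show ?case using L(1) by (simp add: x_def[abs_def])
  qed
qed

text \<open>It lets normality act: preservation of this supremum is what makes the values of a
  channel on indicators countably additive.\<close>

lemma is_lub_increasing_indicators:
  assumes P: "finite_measure P" and F: "\<And>n::nat. F n \<in> sets P" "incseq F"
  shows "is_lub_alg (Linf_alg P) (range (\<lambda>n. Linf_class P (indicator (F n)))) (Linf_class P (indicator (\<Union>n. F n)))"
proof -
  have ind: "(indicator E :: _ \<Rightarrow> complex) = (\<lambda>\<omega>. of_real (indicator E \<omega>))" for E :: "'a set"
    by (auto simp: indicator_def fun_eq_iff)
  have sa: "Linf_class P (indicator E) \<in> selfadjoint_elems (Linf_alg P)"
    "AE \<omega> in P. Re (Linf_rep (Linf_class P (indicator E)) \<omega>) = indicator E \<omega>" if "E \<in> sets P" for E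
    unfolding ind using that
    by (intro Linf_of_real_selfadjoint[OF P, where C = 1]; auto simp: indicator_def)+
  have U: "(\<Union>n. F n) \<in> sets P" using F by auto
  show ?thesis
    unfolding is_lub_alg_def
  proof (intro conjI ballI impI)
    show "Linf_class P (indicator (\<Union>n. F n)) \<in> selfadjoint_elems (Linf_alg P)" using sa U by blast
    fix d assume "d \<in> range (\<lambda>n. Linf_class P (indicator (F n)))"
    then obtain n where d: "d = Linf_class P (indicator (F n))" by auto
    have "AE \<omega> in P. Re (Linf_rep d \<omega>) \<le> Re (Linf_rep (Linf_class P (indicator (\<Union>n. F n))) \<omega>)"
      using sa(2)[OF F(1)[of n]] sa(2)[OF U] unfolding d by eventually_elim (auto simp: indicator_def)
    then show "le_alg (Linf_alg P) d (Linf_class P (indicator (\<Union>n. F n)))"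
      using le_Linf_iff_Re[OF P] sa F U d by blast
  next
    fix u assume u: "u \<in> selfadjoint_elems (Linf_alg P)"
      and "\<forall>d\<in>range (\<lambda>n. Linf_class P (indicator (F n))). le_alg (Linf_alg P) d u"
    then have "AE \<omega> in P. Re (Linf_rep (Linf_class P (indicator (F n))) \<omega>) \<le> Re (Linf_rep u \<omega>)" for n
      using le_Linf_iff_Re[OF P sa(1)[OF F(1)] u] by blast
    then have "AE \<omega> in P. \<forall>n. Re (Linf_rep (Linf_class P (indicator (F n))) \<omega>) \<le> Re (Linf_rep u \<omega>)"
      unfolding AE_all_countable by blast
    moreover have "AE \<omega> in P. \<forall>n. Re (Linf_rep (Linf_class P (indicator (F n))) \<omega>) = indicator (F n) \<omega>"
      unfolding AE_all_countable using sa(2) F by blast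
    ultimately have "AE \<omega> in P. Re (Linf_rep (Linf_class P (indicator (\<Union>n. F n))) \<omega>) \<le> Re (Linf_rep u \<omega>)"
      using sa(2)[OF U]
    proof eventually_elim
      case (elim \<omega>)
      then have *: "indicator (F n) \<omega> \<le> Re (Linf_rep u \<omega>)" for n by metis
      show ?case
      proof (cases "\<omega> \<in> (\<Union>n. F n)")
        case True then show ?thesis using * elim(3) by (auto simp: indicator_def) (metis of_bool_eq(2))
      next
        case False then show ?thesis using *[of 0] elim(3) by (auto simp: indicator_def)
      qed
    qed
    then show "le_alg (Linf_alg P) (Linf_class P (indicator (\<Union>n. F n))) u"
      using le_Linf_iff_Re[OF P sa(1)[OF U] u] by blast
  qed
qed

section \<open>Channels given by families of nonnegative densities\<close>

text \<open>Complete positivity becomes the Schur product theorem, applied pointwise to the densities of the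
  matrix coefficients.\<close>

theorem cp_channelI:
  fixes B :: "('b, 'u) represented_algebra" and h :: "'u \<Rightarrow> 'w \<Rightarrow> real"
  assumes P: "finite_measure P" and B: "quadratic_algebra B"
    and h: "\<And>\<zeta>. \<zeta> \<in> vecs B \<Longrightarrow> integrable P (h \<zeta>)" "\<And>\<zeta> \<omega>. \<zeta> \<in> vecs B \<Longrightarrow> 0 \<le> h \<zeta> \<omega>"
    and \<Lambda>: "\<And>c. c \<in> elems (Linf_alg P) \<Longrightarrow> \<Lambda> c \<in> elems B"
    and rep: "\<And>c \<zeta>. \<lbrakk>c \<in> elems (Linf_alg P); \<zeta> \<in> vecs B\<rbrakk> \<Longrightarrow>
      mcoef B (\<Lambda> c) \<zeta> \<zeta> = (LINT \<omega>|P. Linf_rep c \<omega> * of_real (h \<zeta> \<omega>))"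
    and one: "\<And>\<zeta>. \<zeta> \<in> vecs B \<Longrightarrow> mcoef B (one_alg B) \<zeta> \<zeta> = of_real (integral\<^sup>L P (h \<zeta>))"
  shows "cp_channel (Linf_alg P) B \<Lambda>"
proof -
  interpret finite_measure P by fact
  interpret B: quadratic_algebra B by fact
  let ?A = "Linf_alg P"
  have hm: "(\<lambda>\<omega>. complex_of_real (h \<zeta> \<omega>)) \<in> borel_measurable P" if "\<zeta> \<in> vecs B" for \<zeta>
    using borel_measurable_integrable[OF h(1)[OF that]] by measurable
  have int: "integrable P (\<lambda>\<omega>. f \<omega> * complex_of_real (h \<zeta> \<omega>))" if "\<zeta> \<in> vecs B" "f \<in> Linf_funs P" for \<zeta> f
    using h(1)[OF that(1)] that(2) by (intro integrable_Linf_mult) auto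
  have rep': "mcoef B (\<Lambda> c) \<zeta> \<zeta> = (LINT \<omega>|P. f \<omega> * of_real (h \<zeta> \<omega>))"
    if c: "c \<in> elems ?A" and z: "\<zeta> \<in> vecs B" and f: "f \<in> borel_measurable P"
      and eq: "AE \<omega> in P. Linf_rep c \<omega> = f \<omega>" for c \<zeta> f
    unfolding rep[OF c z]
    by (rule integral_cong_AE)
      (use eq f hm[OF z] Linf_funs_measurable[OF Linf_rep_in[OF c]] in \<open>auto elim!: eventually_mono\<close>)
  have "linear_on_alg ?A B \<Lambda>"
    unfolding linear_on_alg_def
  proof (intro conjI ballI allI)
    fix a b assume a: "a \<in> elems ?A" and b: "b \<in> elems ?A"
    show "\<Lambda> (plus_alg ?A a b) = plus_alg B (\<Lambda> a) (\<Lambda> b)"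
    proof (rule B.eqI)
      fix \<zeta> assume z: "\<zeta> \<in> vecs B"
      have "mcoef B (\<Lambda> (plus_alg ?A a b)) \<zeta> \<zeta> = (LINT \<omega>|P. (Linf_rep a \<omega> + Linf_rep b \<omega>) * of_real (h \<zeta> \<omega>))"
        using a b z by (intro rep' plus_Linf_in AE_rep_plus Linf_funs_measurable Linf_funs_add) auto
      then show "mcoef B (\<Lambda> (plus_alg ?A a b)) \<zeta> \<zeta> = mcoef B (plus_alg B (\<Lambda> a) (\<Lambda> b)) \<zeta> \<zeta>"
        using a b z \<Lambda> int by (simp add: B.mcoef_plus rep distrib_right)
    qed (use a b \<Lambda> plus_Linf_in B.plus_in in auto)
  next
    fix z a assume a: "a \<in> elems ?A"
    show "\<Lambda> (scale_alg ?A z a) = scale_alg B z (\<Lambda> a)"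
    proof (rule B.eqI)
      fix \<zeta> assume z: "\<zeta> \<in> vecs B"
      have "mcoef B (\<Lambda> (scale_alg ?A z a)) \<zeta> \<zeta> = (LINT \<omega>|P. (z * Linf_rep a \<omega>) * of_real (h \<zeta> \<omega>))"
        using a z by (intro rep' scale_Linf_in AE_rep_scale Linf_funs_measurable Linf_funs_scale) auto
      then show "mcoef B (\<Lambda> (scale_alg ?A z a)) \<zeta> \<zeta> = mcoef B (scale_alg B z (\<Lambda> a)) \<zeta> \<zeta>"
        using a z \<Lambda> int by (simp add: B.mcoef_scale rep mult.assoc)
    qed (use a \<Lambda> scale_Linf_in B.scale_in in auto)
  qed (use \<Lambda> in auto)
  moreover have "\<Lambda> (one_alg ?A) = one_alg B"
  proof (rule B.eqI)
    fix \<zeta> assume z: "\<zeta> \<in> vecs B"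
    have "mcoef B (\<Lambda> (one_alg ?A)) \<zeta> \<zeta> = (LINT \<omega>|P. 1 * of_real (h \<zeta> \<omega>))"
      unfolding one_Linf using z by (intro rep' Linf_rep_class) auto
    then show "mcoef B (\<Lambda> (one_alg ?A)) \<zeta> \<zeta> = mcoef B (one_alg B) \<zeta> \<zeta>" using one[OF z] by simp
  qed (use \<Lambda> one_Linf_in B.one_in in auto)
  moreover have "completely_positive ?A B \<Lambda>"
    unfolding completely_positive_def
  proof (intro allI impI)
    fix n :: nat and X assume X: "matrix_positive ?A n X"
    then have Xe: "X i j \<in> elems ?A" if "i < n" "j < n" for i j using that by (simp add: matrix_positive_def)
    have psdX: "AE \<omega> in P. psd n (\<lambda>i j. Linf_rep (X i j) \<omega>)"
    proof (rule AE_psdI, rule AE_nonneg_Reals_of_set_integrals)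
      fix v
      have i: "integrable P (\<lambda>\<omega>. cnj (v i) * Linf_rep (X i j) \<omega> * v j)" if "i < n" "j < n" for i j
        using integrable_Re_rep(1)[OF P Xe[OF that]] by auto
      then show "integrable P (\<lambda>\<omega>. \<Sum>i<n. \<Sum>j<n. cnj (v i) * Linf_rep (X i j) \<omega> * v j)"
        by (intro Bochner_Integration.integrable_sum) auto
      fix E assume E: "E \<in> sets P"
      \<comment> \<open>These vectors localize matrix positivity to the set \<open>E\<close>; as
        \<open>E\<close> varies, the form at \<open>v\<close> becomes nonnegative at almost every
        point.\<close>
      define \<xi> where "\<xi> i \<omega> = v i * indicator E \<omega>" for i \<omega>
      have "\<xi> i \<in> vecs ?A" for i
        unfolding \<xi>_def using E by (intro vecs_LinfI Linf_funs_scale Linf_funs_indicator)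
      then have "(\<Sum>i<n. \<Sum>j<n. mcoef ?A (X i j) (\<xi> i) (\<xi> j)) \<in> \<real>\<^sub>\<ge>\<^sub>0"
        using X by (simp add: matrix_positive_def)
      also have "(\<Sum>i<n. \<Sum>j<n. mcoef ?A (X i j) (\<xi> i) (\<xi> j))
         = (\<Sum>i<n. \<Sum>j<n. LINT \<omega>|P. cnj (v i) * Linf_rep (X i j) \<omega> * v j * indicator E \<omega>)"
        unfolding mcoef_Linf
        by (intro sum.cong Bochner_Integration.integral_cong refl) (auto simp: \<xi>_def indicator_def)
      also have "\<dots> = (LINT \<omega>|P. (\<Sum>i<n. \<Sum>j<n. cnj (v i) * Linf_rep (X i j) \<omega> * v j * indicator E \<omega>))"
        by (rule integral_double_sum[symmetric]) (rule integrable_complex_mult_indicator[OF i E])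
      finally show "(LINT \<omega>|P. (\<Sum>i<n. \<Sum>j<n. cnj (v i) * Linf_rep (X i j) \<omega> * v j) * indicator E \<omega>) \<in> \<real>\<^sub>\<ge>\<^sub>0"
        by (simp only: sum_distrib_right)
    qed
    have "(\<Sum>i<n. \<Sum>j<n. mcoef B (\<Lambda> (X i j)) (\<xi> i) (\<xi> j)) \<in> \<real>\<^sub>\<ge>\<^sub>0"
      if \<xi>: "\<And>i. i < n \<Longrightarrow> \<xi> i \<in> vecs B" for \<xi>
    proof -
      have "\<exists>H. integrable P H \<and> (\<forall>c\<in>elems ?A. mcoef B (\<Lambda> c) (\<xi> i) (\<xi> j) = (LINT \<omega>|P. Linf_rep c \<omega> * H \<omega>))"
        if ij: "i < n" "j < n" for i j
      proof -
        \<comment> \<open>The vector obtained here stands for \<open>\<xi> i\<close> plus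
          \<open>w\<close> times \<open>\<xi> j\<close>. The four values 1, -1, i, -i of
          \<open>w\<close> then polarize, which yields a complex density \<open>H\<close> for the
          off-diagonal coefficient.\<close>
        have "\<exists>\<zeta>\<in>vecs B. \<forall>b\<in>elems B. (\<Sum>k<2::nat. \<Sum>l<2::nat. cnj (if k = 0 then 1 else w) *
            mcoef B b (if k = 0 then \<xi> i else \<xi> j) (if l = 0 then \<xi> i else \<xi> j) * (if l = 0 then 1 else w)) = mcoef B b \<zeta> \<zeta>" for w :: complex
          by (rule B.combine[of 2 "\<lambda>k::nat. if k = 0 then \<xi> i else \<xi> j" "\<lambda>k. if k = 0 then 1 else w"]) (use ij \<xi> in auto)
        then have "\<exists>\<zeta>\<in>vecs B. \<forall>b\<in>elems B. mcoef B b (\<xi> i) (\<xi> i) + w * mcoef B b (\<xi> i) (\<xi> j)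
            + cnj w * mcoef B b (\<xi> j) (\<xi> i) + cnj w * w * mcoef B b (\<xi> j) (\<xi> j) = mcoef B b \<zeta> \<zeta>" for w
          by (simp add: numeral_2_eq_2 algebra_simps) 
        then obtain Z where Z: "\<And>w. Z w \<in> vecs B" "\<And>w b. b \<in> elems B \<Longrightarrow> mcoef B b (\<xi> i) (\<xi> i) + w * mcoef B b (\<xi> i) (\<xi> j)
            + cnj w * mcoef B b (\<xi> j) (\<xi> i) + cnj w * w * mcoef B b (\<xi> j) (\<xi> j) = mcoef B b (Z w) (Z w)"
          by metis
        define H where "H \<omega> = (of_real (h (Z 1) \<omega>) - of_real (h (Z (-1)) \<omega>)
          - \<i> * of_real (h (Z \<i>) \<omega>) + \<i> * of_real (h (Z (-\<i>)) \<omega>)) / (4 :: complex)" for \<omega>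
        have "integrable P H" unfolding H_def using h(1) Z(1) by auto
        moreover have "mcoef B (\<Lambda> c) (\<xi> i) (\<xi> j) = (LINT \<omega>|P. Linf_rep c \<omega> * H \<omega>)" if c: "c \<in> elems ?A" for c
        proof -
          have I: "integrable P (\<lambda>\<omega>. Linf_rep c \<omega> * of_real (h (Z w) \<omega>))" for w
            using int[OF Z(1) Linf_rep_in[OF c]] .
          have "mcoef B (\<Lambda> c) (\<xi> i) (\<xi> j) = (mcoef B (\<Lambda> c) (Z 1) (Z 1) - mcoef B (\<Lambda> c) (Z (-1)) (Z (-1))
            - \<i> * mcoef B (\<Lambda> c) (Z \<i>) (Z \<i>) + \<i> * mcoef B (\<Lambda> c) (Z (-\<i>)) (Z (-\<i>))) / 4"
            unfolding Z(2)[OF \<Lambda>[OF c], symmetric] by (simp add: algebra_simps)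
          also have "\<dots> = (LINT \<omega>|P. Linf_rep c \<omega> * H \<omega>)"
            unfolding rep[OF c Z(1)] H_def using I
            by (simp add: algebra_simps add_divide_distrib diff_divide_distrib)
          finally show ?thesis .
        qed
        ultimately show ?thesis by blast
      qed
      then obtain H where H: "\<And>i j. i < n \<Longrightarrow> j < n \<Longrightarrow> integrable P (H i j)"
        "\<And>i j c. i < n \<Longrightarrow> j < n \<Longrightarrow> c \<in> elems ?A \<Longrightarrow> mcoef B (\<Lambda> c) (\<xi> i) (\<xi> j) = (LINT \<omega>|P. Linf_rep c \<omega> * H i j \<omega>)"
        by metis
      \<comment> \<open>For a fixed \<open>v\<close> the form of the matrix of densities, integrated
        over \<open>E\<close>, is the diagonal coefficient of the image of the indicator of
        \<open>E\<close> at one combined vector, and this is nonnegative because \<open>h\<close>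
        is.\<close>
      have psdH: "AE \<omega> in P. psd n (\<lambda>i j. H i j \<omega>)"
      proof (rule AE_psdI, rule AE_nonneg_Reals_of_set_integrals)
        fix v
        have i: "integrable P (\<lambda>\<omega>. cnj (v i) * H i j \<omega> * v j)" if "i < n" "j < n" for i j
          using H(1)[OF that] by auto
        then show "integrable P (\<lambda>\<omega>. \<Sum>i<n. \<Sum>j<n. cnj (v i) * H i j \<omega> * v j)"
          by (intro Bochner_Integration.integrable_sum) auto
        fix E assume E: "E \<in> sets P"
        define c where "c = Linf_class P (indicator E)"
        have c: "c \<in> elems ?A" "AE \<omega> in P. Linf_rep c \<omega> = indicator E \<omega>"
          using E unfolding c_def by (auto intro!: Linf_rep_class)
        obtain \<zeta> where \<zeta>: "\<zeta> \<in> vecs B"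
          "(\<Sum>i<n. \<Sum>j<n. cnj (v i) * mcoef B (\<Lambda> c) (\<xi> i) (\<xi> j) * v j) = mcoef B (\<Lambda> c) \<zeta> \<zeta>"
          using B.combine[of n \<xi> v] \<xi> \<Lambda>[OF c(1)] by blast
        have "mcoef B (\<Lambda> c) \<zeta> \<zeta> \<in> \<real>\<^sub>\<ge>\<^sub>0"
          unfolding rep[OF c(1) \<zeta>(1)] using c(2)
          by (intro integral_nonneg_Reals, eventually_elim) (use h(2)[OF \<zeta>(1)] in \<open>auto simp: indicator_def\<close>)
        also have "mcoef B (\<Lambda> c) \<zeta> \<zeta> = (\<Sum>i<n. \<Sum>j<n. LINT \<omega>|P. cnj (v i) * H i j \<omega> * v j * indicator E \<omega>)"
          unfolding \<zeta>(2)[symmetric]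
        proof (intro sum.cong refl)
          fix i j assume "i \<in> {..<n}" "j \<in> {..<n}"
          then have ij: "i < n" "j < n" by auto
          note [measurable] = borel_measurable_integrable[OF H(1)[OF ij]] Linf_rep_in[OF c(1)] E
          have "(LINT \<omega>|P. Linf_rep c \<omega> * H i j \<omega>) = (LINT \<omega>|P. H i j \<omega> * indicator E \<omega>)"
            by (rule integral_cong_AE) (use c(2) in \<open>auto elim!: eventually_mono\<close>)
          then have "cnj (v i) * mcoef B (\<Lambda> c) (\<xi> i) (\<xi> j) * v j = cnj (v i) * (LINT \<omega>|P. H i j \<omega> * indicator E \<omega>) * v j"
            using H(2)[OF ij c(1)] by simp
          also have "\<dots> = (LINT \<omega>|P. cnj (v i) * (H i j \<omega> * indicator E \<omega>) * v j)"
            by simp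
          finally show "cnj (v i) * mcoef B (\<Lambda> c) (\<xi> i) (\<xi> j) * v j = (LINT \<omega>|P. cnj (v i) * H i j \<omega> * v j * indicator E \<omega>)"
            by (simp add: mult_ac)
        qed
        also have "\<dots> = (LINT \<omega>|P. (\<Sum>i<n. \<Sum>j<n. cnj (v i) * H i j \<omega> * v j * indicator E \<omega>))"
          by (rule integral_double_sum[symmetric]) (rule integrable_complex_mult_indicator[OF i E])
        finally show "(LINT \<omega>|P. (\<Sum>i<n. \<Sum>j<n. cnj (v i) * H i j \<omega> * v j) * indicator E \<omega>) \<in> \<real>\<^sub>\<ge>\<^sub>0"
          by (simp only: sum_distrib_right)
      qed
      have i: "integrable P (\<lambda>\<omega>. Linf_rep (X i j) \<omega> * H i j \<omega>)" if "i < n" "j < n" for i j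
        using that H(1) Xe by (intro integrable_Linf_mult) auto
      have "(\<Sum>i<n. \<Sum>j<n. mcoef B (\<Lambda> (X i j)) (\<xi> i) (\<xi> j))
         = (LINT \<omega>|P. (\<Sum>i<n. \<Sum>j<n. Linf_rep (X i j) \<omega> * H i j \<omega>))"
        by (subst integral_double_sum) (auto intro!: i sum.cong simp: H(2) Xe)
      also have "\<dots> \<in> \<real>\<^sub>\<ge>\<^sub>0"
        using psdX psdH by (intro integral_nonneg_Reals, eventually_elim) (rule psd_schur_sum)
      finally show ?thesis .
    qed
    then show "matrix_positive B n (\<lambda>i j. \<Lambda> (X i j))"
      unfolding matrix_positive_def using Xe \<Lambda> by auto
  qed
  moreover have "normal_map ?A B \<Lambda>"
    unfolding normal_map_def
  proof (intro allI impI, elim conjE)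
    fix D s
    assume D: "D \<subseteq> selfadjoint_elems ?A" "D \<noteq> {}" and dir: "\<forall>a\<in>D. \<forall>b\<in>D. \<exists>c\<in>D. le_alg ?A a c \<and> le_alg ?A b c"
      and lub: "is_lub_alg ?A D s"
    have s: "s \<in> selfadjoint_elems ?A" "\<And>d. d \<in> D \<Longrightarrow> le_alg ?A d s"
      using lub by (auto simp: is_lub_alg_def)
    have el: "c \<in> elems ?A" if "c \<in> selfadjoint_elems ?A" for c
      using that by (simp add: selfadjoint_elems_def)
    have real: "mcoef B (\<Lambda> c) \<zeta> \<zeta> = of_real (LINT \<omega>|P. Re (Linf_rep c \<omega>) * h \<zeta> \<omega>)"
      if c: "c \<in> selfadjoint_elems ?A" and z: "\<zeta> \<in> vecs B" for c \<zeta>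
    proof -
      have "AE \<omega> in P. Linf_rep c \<omega> = of_real (Re (Linf_rep c \<omega>))"
        using c by (auto simp: selfadjoint_Linf_iff[OF P] complex_eq_iff elim: eventually_mono)
      then have "mcoef B (\<Lambda> c) \<zeta> \<zeta> = (LINT \<omega>|P. of_real (Re (Linf_rep c \<omega>)) * of_real (h \<zeta> \<omega>))"
        using el[OF c] z Linf_funs_measurable[OF Linf_rep_in[OF el[OF c]]] by (intro rep') auto
      then show ?thesis by (simp only: of_real_mult[symmetric] integral_complex_of_real)
    qed
    have ri: "integrable P (\<lambda>\<omega>. Re (Linf_rep c \<omega>) * h \<zeta> \<omega>)"
      if c: "c \<in> selfadjoint_elems ?A" and z: "\<zeta> \<in> vecs B" for c \<zeta>
      using integrable_Re[OF int[OF z Linf_rep_in[OF el[OF c]]]] by simp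
    \<comment> \<open>The directed set may be uncountable. Dominated convergence becomes available
      only after passing to an increasing sequence, whose terms lie between \<open>d 0\<close> and
      \<open>s\<close>.\<close>
    obtain d where d: "\<And>n::nat. d n \<in> D" "AE \<omega> in P. \<forall>n. Re (Linf_rep (d n) \<omega>) \<le> Re (Linf_rep (d (Suc n)) \<omega>)"
      "AE \<omega> in P. (\<lambda>n. Re (Linf_rep (d n) \<omega>)) \<longlonglongrightarrow> Re (Linf_rep s \<omega>)"
      using directed_lub_sequence[OF P D _ lub] dir by blast
    have dsa: "d n \<in> selfadjoint_elems ?A" for n using d(1) D by auto
    have lim: "(\<lambda>n. LINT \<omega>|P. Re (Linf_rep (d n) \<omega>) * h \<zeta> \<omega>) \<longlonglongrightarrow> (LINT \<omega>|P. Re (Linf_rep s \<omega>) * h \<zeta> \<omega>)"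
      if z: "\<zeta> \<in> vecs B" for \<zeta>
    proof (rule integral_dominated_convergence)
      show "AE \<omega> in P. (\<lambda>n. Re (Linf_rep (d n) \<omega>) * h \<zeta> \<omega>) \<longlonglongrightarrow> Re (Linf_rep s \<omega>) * h \<zeta> \<omega>"
        using d(3) by eventually_elim (intro tendsto_mult tendsto_const)
      show "integrable P (\<lambda>\<omega>. norm (Re (Linf_rep (d 0) \<omega>) * h \<zeta> \<omega>) + norm (Re (Linf_rep s \<omega>) * h \<zeta> \<omega>))"
        using ri[OF dsa z] ri[OF s(1) z] by auto
      show "AE \<omega> in P. norm (Re (Linf_rep (d n) \<omega>) * h \<zeta> \<omega>)
          \<le> norm (Re (Linf_rep (d 0) \<omega>) * h \<zeta> \<omega>) + norm (Re (Linf_rep s \<omega>) * h \<zeta> \<omega>)" for n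
      proof -
        have "AE \<omega> in P. Re (Linf_rep (d n) \<omega>) \<le> Re (Linf_rep s \<omega>)"
          using s(2)[OF d(1)] le_Linf_iff_Re[OF P dsa s(1)] by blast
        then show ?thesis using d(2)
        proof eventually_elim
          case (elim \<omega>)
          have "Re (Linf_rep (d 0) \<omega>) \<le> Re (Linf_rep (d n) \<omega>)"
            using elim(2) by (induction n) (auto intro: order_trans)
          with elim(1) have "\<bar>Re (Linf_rep (d n) \<omega>)\<bar> \<le> \<bar>Re (Linf_rep (d 0) \<omega>)\<bar> + \<bar>Re (Linf_rep s \<omega>)\<bar>" by linarith
          then have "\<bar>Re (Linf_rep (d n) \<omega>)\<bar> * h \<zeta> \<omega> \<le> (\<bar>Re (Linf_rep (d 0) \<omega>)\<bar> + \<bar>Re (Linf_rep s \<omega>)\<bar>) * h \<zeta> \<omega>"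
            using h(2)[OF z] by (intro mult_right_mono)
          then show ?case using h(2)[OF z] by (simp add: abs_mult distrib_right)
        qed
      qed
    qed (use ri[OF dsa z] ri[OF s(1) z] in auto)
    show "is_lub_alg B (\<Lambda> ` D) (\<Lambda> s)"
      unfolding is_lub_alg_def
    proof (intro conjI ballI impI)
      show "\<Lambda> s \<in> selfadjoint_elems B"
        unfolding selfadjoint_elems_def using \<Lambda>[OF el[OF s(1)]] real[OF s(1)] by simp
      fix x assume "x \<in> \<Lambda> ` D"
      then obtain a where a: "a \<in> D" "x = \<Lambda> a" by auto
      then have asa: "a \<in> selfadjoint_elems ?A" using D by auto
      have le: "AE \<omega> in P. Re (Linf_rep a \<omega>) \<le> Re (Linf_rep s \<omega>)"
        using s(2)[OF a(1)] le_Linf_iff_Re[OF P asa s(1)] by blast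
      show "le_alg B x (\<Lambda> s)"
        unfolding le_alg_def
      proof
        fix \<zeta> assume z: "\<zeta> \<in> vecs B"
        have "(LINT \<omega>|P. Re (Linf_rep a \<omega>) * h \<zeta> \<omega>) \<le> (LINT \<omega>|P. Re (Linf_rep s \<omega>) * h \<zeta> \<omega>)"
          using le by (intro integral_mono_AE ri asa s z, eventually_elim) (intro mult_right_mono h(2) z)
        then show "mcoef B (\<Lambda> s) \<zeta> \<zeta> - mcoef B x \<zeta> \<zeta> \<in> \<real>\<^sub>\<ge>\<^sub>0"
          unfolding a(2) real[OF s(1) z] real[OF asa z] by (simp add: complex_nonneg_Reals_iff)
      qed
    next
      fix u assume u: "u \<in> selfadjoint_elems B" and ub: "\<forall>x\<in>\<Lambda> ` D. le_alg B x u"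
      show "le_alg B (\<Lambda> s) u"
        unfolding le_alg_def
      proof
        fix \<zeta> assume z: "\<zeta> \<in> vecs B"
        have im: "Im (mcoef B u \<zeta> \<zeta>) = 0" using u z by (simp add: selfadjoint_elems_def complex_is_Real_iff)
        have "(LINT \<omega>|P. Re (Linf_rep (d n) \<omega>) * h \<zeta> \<omega>) \<le> Re (mcoef B u \<zeta> \<zeta>)" for n
        proof -
          have "mcoef B u \<zeta> \<zeta> - mcoef B (\<Lambda> (d n)) \<zeta> \<zeta> \<in> \<real>\<^sub>\<ge>\<^sub>0"
            using ub d(1) z by (auto simp: le_alg_def)
          then show ?thesis unfolding real[OF dsa z] by (simp add: complex_nonneg_Reals_iff)
        qed
        then have "(LINT \<omega>|P. Re (Linf_rep s \<omega>) * h \<zeta> \<omega>) \<le> Re (mcoef B u \<zeta> \<zeta>)"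
          by (intro LIMSEQ_le_const2[OF lim[OF z]]) auto
        then show "mcoef B u \<zeta> \<zeta> - mcoef B (\<Lambda> s) \<zeta> \<zeta> \<in> \<real>\<^sub>\<ge>\<^sub>0"
          unfolding real[OF s(1) z] using im by (simp add: complex_nonneg_Reals_iff)
      qed
    qed
  qed
  ultimately show ?thesis by (simp add: cp_channel_def)
qed

section \<open>Weak kernels between measures\<close>

text \<open>Of \<open>Q\<close> only the measurable space enters. For fixed \<open>g\<close> the
  exceptional sets of the kernel disappear under the integral, so this is countably additive without
  exception; it is the image of the weight \<open>g\<close> under the kernel.\<close>

definition kernel_measure ::
  "'v measure \<Rightarrow> 'w measure \<Rightarrow> ('v set \<Rightarrow> 'w \<Rightarrow> real) \<Rightarrow> ('w \<Rightarrow> ennreal) \<Rightarrow> 'v measure" where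
  "kernel_measure Q P \<kappa> g = measure_of (space Q) (sets Q) (\<lambda>E. \<integral>\<^sup>+\<omega>. ennreal (\<kappa> E \<omega>) * g \<omega> \<partial>P)"

lemma indicator_sums_disjoint:
  assumes "disjoint_family F"
  shows "(\<lambda>n::nat. indicator (F n) x :: real) sums indicator (\<Union>n. F n) x"
proof (cases "x \<in> (\<Union>n. F n)")
  case True
  then obtain m where m: "x \<in> F m" by auto
  have "x \<notin> F n" if "n \<noteq> m" for n using assms m that by (auto simp: disjoint_family_on_def)
  then have "(\<lambda>n. indicator (F n) x :: real) = (\<lambda>n. if n = m then 1 else 0)"
    using m by (auto simp: fun_eq_iff)
  then show ?thesis using True sums_single[of m "\<lambda>_. 1::real"] by simp
next
  case False
  then have "(\<lambda>n. indicator (F n) x :: real) = (\<lambda>n. 0)" by auto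
  then show ?thesis using False by simp
qed

text \<open>Weak Markov kernels expressed by scalar measures in place of POVMs;
  \<open>weak_markov_kernel_iff\<close> makes the translation. The null set in
  \<open>sigma_additive\<close> depends on \<open>F\<close>.\<close>

locale ae_kernel =
  fixes Q :: "'v measure" and P :: "'w measure" and \<kappa> :: "'v set \<Rightarrow> 'w \<Rightarrow> real"
  assumes bounds: "E \<in> sets Q \<Longrightarrow> \<omega> \<in> space P \<Longrightarrow> 0 \<le> \<kappa> E \<omega>" "E \<in> sets Q \<Longrightarrow> \<omega> \<in> space P \<Longrightarrow> \<kappa> E \<omega> \<le> 1"
    and meas [measurable]: "E \<in> sets Q \<Longrightarrow> \<kappa> E \<in> borel_measurable P"
    and total: "AE \<omega> in P. \<kappa> (space Q) \<omega> = 1"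
    and sigma_additive: "range F \<subseteq> sets Q \<Longrightarrow> disjoint_family F \<Longrightarrow>
        AE \<omega> in P. (\<lambda>n::nat. \<kappa> (F n) \<omega>) sums \<kappa> (\<Union>n. F n) \<omega>"
    and null: "Z \<in> null_sets Q \<Longrightarrow> AE \<omega> in P. \<kappa> Z \<omega> = 0"
begin

lemma empty: "AE \<omega> in P. \<kappa> {} \<omega> = 0"
  by (rule null) simp

lemma additive:
  assumes "E \<in> sets Q" "F \<in> sets Q" "E \<inter> F = {}"
  shows "AE \<omega> in P. \<kappa> (E \<union> F) \<omega> = \<kappa> E \<omega> + \<kappa> F \<omega>"
proof -
  have "AE \<omega> in P. (\<lambda>n. \<kappa> (binaryset E F n) \<omega>) sums \<kappa> (\<Union>n. binaryset E F n) \<omega>"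
    using assms by (intro sigma_additive) (auto simp: range_binaryset_eq disjoint_family_on_def binaryset_def)
  then show ?thesis using empty
  proof eventually_elim
    case (elim \<omega>)
    have "(\<lambda>n. \<kappa> (binaryset E F n) \<omega>) sums (\<kappa> E \<omega> + \<kappa> F \<omega>)"
      using sums_finite[of "{0, 1::nat}" "\<lambda>n. \<kappa> (binaryset E F n) \<omega>"] elim(2)
      by (auto simp: binaryset_def)
    then show ?case using elim(1) sums_unique2 by (fastforce simp: UN_binaryset_eq)
  qed
qed

lemma mono:
  assumes "E \<in> sets Q" "F \<in> sets Q" "E \<subseteq> F" shows "AE \<omega> in P. \<kappa> E \<omega> \<le> \<kappa> F \<omega>"
proof -
  have "E \<union> (F - E) = F" using assms by auto
  then have "AE \<omega> in P. \<kappa> F \<omega> = \<kappa> E \<omega> + \<kappa> (F - E) \<omega>"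
    using additive[OF assms(1) sets.Diff[OF assms(2,1)] Diff_disjoint] by simp
  then show ?thesis using AE_space
    by eventually_elim (use bounds(1)[of "F - E"] assms in auto)
qed

lemma compl:
  assumes "E \<in> sets Q" shows "AE \<omega> in P. \<kappa> (space Q - E) \<omega> = 1 - \<kappa> E \<omega>"
proof -
  have "E \<union> (space Q - E) = space Q" using assms sets.sets_into_space by auto
  then have "AE \<omega> in P. \<kappa> (space Q) \<omega> = \<kappa> E \<omega> + \<kappa> (space Q - E) \<omega>"
    using additive[OF assms sets.compl_sets[OF assms] Diff_disjoint] by simp
  then show ?thesis using total by eventually_elim auto
qed

lemma not_both_one:
  assumes "E \<in> sets Q" "F \<in> sets Q" "E \<inter> F = {}"
  shows "AE \<omega> in P. \<not> (\<kappa> E \<omega> = 1 \<and> \<kappa> F \<omega> = 1)"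
  using additive[OF assms] AE_space
proof eventually_elim
  case (elim \<omega>)
  then show ?case using bounds(2)[of "E \<union> F" \<omega>] assms by auto
qed

text \<open>It allows a point map to be checked on generators only. The intersection step uses that
  the values on \<open>E \<inter> F\<close> and on \<open>E - F\<close> add up to that on
  \<open>E\<close>, are bounded by those on \<open>F\<close> and on its complement, and are
  therefore forced once \<open>E\<close> and \<open>F\<close> are known. With \<open>f\<close> the
  identity it describes the sets fixed by a kernel.\<close>

lemma sigma_algebra_realized:
  assumes f: "\<And>\<omega>. \<omega> \<in> space P \<Longrightarrow> f \<omega> \<in> space Q"
  shows "sigma_algebra (space Q) {E \<in> sets Q. AE \<omega> in P. \<kappa> E \<omega> = indicator E (f \<omega>)}"
    (is "sigma_algebra _ ?G")
  unfolding sigma_algebra_disjoint_iff algebra_iff_Int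
proof (intro conjI ballI allI impI)
  show "?G \<subseteq> Pow (space Q)" using sets.sets_into_space by auto
  show "{} \<in> ?G" using empty by simp
next
  fix E assume "E \<in> ?G"
  then have E: "E \<in> sets Q" "AE \<omega> in P. \<kappa> E \<omega> = indicator E (f \<omega>)" by auto
  have "AE \<omega> in P. \<kappa> (space Q - E) \<omega> = indicator (space Q - E) (f \<omega>)"
    using compl[OF E(1)] E(2) AE_space by eventually_elim (use f in \<open>auto simp: indicator_def\<close>)
  then show "space Q - E \<in> ?G" using E by auto
next
  fix E F assume "E \<in> ?G" "F \<in> ?G"
  then have E: "E \<in> sets Q" "AE \<omega> in P. \<kappa> E \<omega> = indicator E (f \<omega>)"
    and F: "F \<in> sets Q" "AE \<omega> in P. \<kappa> F \<omega> = indicator F (f \<omega>)" by auto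
  have "(E \<inter> F) \<union> (E - F) = E" "(E \<inter> F) \<inter> (E - F) = {}" by auto
  then have "AE \<omega> in P. \<kappa> E \<omega> = \<kappa> (E \<inter> F) \<omega> + \<kappa> (E - F) \<omega>"
    using additive[OF sets.Int[OF E(1) F(1)] sets.Diff[OF E(1) F(1)]] by simp
  moreover have "AE \<omega> in P. \<kappa> (E \<inter> F) \<omega> \<le> \<kappa> F \<omega>" "AE \<omega> in P. \<kappa> (E - F) \<omega> \<le> \<kappa> (space Q - F) \<omega>"
    using mono[OF sets.Int[OF E(1) F(1)] F(1) Int_lower2]
      mono[OF sets.Diff[OF E(1) F(1)] sets.compl_sets[OF F(1)] Diff_mono[OF sets.sets_into_space[OF E(1)] order_refl]]
    by this+
  ultimately have "AE \<omega> in P. \<kappa> (E \<inter> F) \<omega> = indicator (E \<inter> F) (f \<omega>)"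
    using compl[OF F(1)] E(2) F(2) AE_space
  proof eventually_elim
    case (elim \<omega>)
    then show ?case using bounds(1)[of "E \<inter> F" \<omega>] bounds(1)[of "E - F" \<omega>] E F
      by (auto simp: indicator_def split: if_splits)
  qed
  then show "E \<inter> F \<in> ?G" using E F by auto
next
  fix A :: "nat \<Rightarrow> 'v set" assume A: "range A \<subseteq> ?G" "disjoint_family A"
  then have sets: "range A \<subseteq> sets Q" by auto
  have "AE \<omega> in P. \<forall>n. \<kappa> (A n) \<omega> = indicator (A n) (f \<omega>)"
    unfolding AE_all_countable using A by auto
  then have "AE \<omega> in P. \<kappa> (\<Union>n. A n) \<omega> = indicator (\<Union>n. A n) (f \<omega>)"
    using sigma_additive[OF sets A(2)]
  proof eventually_elim
    case (elim \<omega>)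
    have "(\<lambda>n. indicator (A n) (f \<omega>) :: real) sums indicator (\<Union>n. A n) (f \<omega>)"
      by (rule indicator_sums_disjoint[OF A(2)])
    moreover have "(\<lambda>n. \<kappa> (A n) \<omega>) = (\<lambda>n. indicator (A n) (f \<omega>))" using elim(1) by auto
    ultimately show ?case using elim(2) sums_unique2 by metis
  qed
  then show "(\<Union>n. A n) \<in> ?G" using sets by auto
qed

text \<open>Countable subadditivity in the only case needed later: for a kernel with values 0 and 1,
  some member of a countable cover must have value 1. Disjointing the sets makes additivity
  applicable.\<close>

lemma UN_zero:
  assumes "\<And>n::nat. E n \<in> sets Q"
  shows "AE \<omega> in P. (\<forall>n. \<kappa> (E n) \<omega> = 0) \<longrightarrow> \<kappa> (\<Union>n. E n) \<omega> = 0"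
proof -
  have d: "range (disjointed E) \<subseteq> sets Q" using assms by (intro sets.range_disjointed_sets) auto
  have "AE \<omega> in P. \<forall>n. \<kappa> (disjointed E n) \<omega> \<le> \<kappa> (E n) \<omega>"
    unfolding AE_all_countable using d assms by (auto intro!: mono disjointed_subset)
  moreover have "AE \<omega> in P. (\<lambda>n. \<kappa> (disjointed E n) \<omega>) sums \<kappa> (\<Union>n. disjointed E n) \<omega>"
    using d disjoint_family_disjointed by (rule sigma_additive)
  ultimately show ?thesis using AE_space
  proof eventually_elim
    case (elim \<omega>)
    show ?case
    proof
      assume 0: "\<forall>n. \<kappa> (E n) \<omega> = 0"
      have "\<kappa> (disjointed E n) \<omega> = 0" for n
        using elim(1,3) 0 d bounds(1)[of "disjointed E n" \<omega>] by (metis order_antisym range_subsetD)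
      then show "\<kappa> (\<Union>n. E n) \<omega> = 0" using elim(2) by (simp add: UN_disjointed_eq sums_iff)
    qed
  qed
qed

lemma emeasure_kernel_measure:
  assumes g [measurable]: "g \<in> borel_measurable P" and E: "E \<in> sets Q"
  shows "emeasure (kernel_measure Q P \<kappa> g) E = (\<integral>\<^sup>+\<omega>. ennreal (\<kappa> E \<omega>) * g \<omega> \<partial>P)"
  unfolding kernel_measure_def
proof (rule emeasure_measure_of_sigma)
  show "positive (sets Q) (\<lambda>E. \<integral>\<^sup>+\<omega>. ennreal (\<kappa> E \<omega>) * g \<omega> \<partial>P)"
    unfolding positive_def using empty
    by (subst nn_integral_0_iff_AE) (auto elim!: eventually_mono)
  show "countably_additive (sets Q) (\<lambda>E. \<integral>\<^sup>+\<omega>. ennreal (\<kappa> E \<omega>) * g \<omega> \<partial>P)"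
    unfolding countably_additive_def
  proof (intro allI impI)
    fix A :: "nat \<Rightarrow> 'v set" assume A: "range A \<subseteq> sets Q" "disjoint_family A" "(\<Union>i. A i) \<in> sets Q"
    have [measurable]: "A n \<in> sets Q" for n using A by auto
    have "(\<Sum>i. \<integral>\<^sup>+\<omega>. ennreal (\<kappa> (A i) \<omega>) * g \<omega> \<partial>P) = (\<integral>\<^sup>+\<omega>. (\<Sum>i. ennreal (\<kappa> (A i) \<omega>) * g \<omega>) \<partial>P)"
      by (rule nn_integral_suminf[symmetric]) measurable
    also have "\<dots> = (\<integral>\<^sup>+\<omega>. ennreal (\<kappa> (\<Union>i. A i) \<omega>) * g \<omega> \<partial>P)"
    proof (rule nn_integral_cong_AE)
      show "AE \<omega> in P. (\<Sum>i. ennreal (\<kappa> (A i) \<omega>) * g \<omega>) = ennreal (\<kappa> (\<Union>i. A i) \<omega>) * g \<omega>"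
        using sigma_additive[OF A(1,2)] AE_space
      proof eventually_elim
        case (elim \<omega>)
        then have "(\<Sum>i. ennreal (\<kappa> (A i) \<omega>)) = ennreal (\<kappa> (\<Union>i. A i) \<omega>)"
          by (intro suminf_ennreal_eq) (auto intro: bounds)
        then show ?case by (simp add: ennreal_suminf_multc)
      qed
    qed
    finally show "(\<Sum>i. \<integral>\<^sup>+\<omega>. ennreal (\<kappa> (A i) \<omega>) * g \<omega> \<partial>P) = (\<integral>\<^sup>+\<omega>. ennreal (\<kappa> (\<Union>i. A i) \<omega>) * g \<omega> \<partial>P)" .
  qed
qed (use E sets.sigma_algebra_axioms in auto)

lemma sets_kernel_measure [simp, measurable_cong]: "sets (kernel_measure Q P \<kappa> g) = sets Q"
  and space_kernel_measure [simp]: "space (kernel_measure Q P \<kappa> g) = space Q"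
  by (simp_all add: kernel_measure_def sets.space_closed sets.sigma_sets_eq)

lemma absolutely_continuous_kernel_measure:
  assumes g: "g \<in> borel_measurable P" shows "absolutely_continuous Q (kernel_measure Q P \<kappa> g)"
  unfolding absolutely_continuous_def
proof
  fix Z assume Z: "Z \<in> null_sets Q"
  then have [measurable]: "Z \<in> sets Q" by auto
  have "emeasure (kernel_measure Q P \<kappa> g) Z = 0"
    using null[OF Z] g by (subst emeasure_kernel_measure) (auto simp: nn_integral_0_iff_AE elim!: eventually_mono)
  then show "Z \<in> null_sets (kernel_measure Q P \<kappa> g)" using Z by (auto simp: null_sets_def)
qed

lemma emeasure_space_kernel_measure:
  assumes g: "g \<in> borel_measurable P"
  shows "emeasure (kernel_measure Q P \<kappa> g) (space Q) = (\<integral>\<^sup>+\<omega>. g \<omega> \<partial>P)"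
  using total g by (subst emeasure_kernel_measure) (auto intro!: nn_integral_cong_AE elim!: eventually_mono)

text \<open>The kernel acts on functions through their binary digits.\<close>

lemma apply_function:
  assumes f: "f \<in> borel_measurable Q" "\<And>q. q \<in> space Q \<Longrightarrow> 0 \<le> f q \<and> f q \<le> 1"
  obtains u where "u \<in> borel_measurable P" "\<And>\<omega>. \<omega> \<in> space P \<Longrightarrow> 0 \<le> u \<omega> \<and> u \<omega> \<le> (1::real)"
    "\<And>g. g \<in> borel_measurable P \<Longrightarrow>
      (\<integral>\<^sup>+\<omega>. ennreal (u \<omega>) * g \<omega> \<partial>P) = (\<integral>\<^sup>+q. ennreal (f q) \<partial>kernel_measure Q P \<kappa> g)"
proof -
  obtain B where B: "\<And>k::nat. B k \<in> sets Q"
    "\<And>q n. q \<in> space Q \<Longrightarrow> 0 \<le> f q - (\<Sum>k<n. (1/2)^(k+1) * indicator (B k) q)"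
    "\<And>q n. q \<in> space Q \<Longrightarrow> f q - (\<Sum>k<n. (1/2)^(k+1) * indicator (B k) q) \<le> (1/2)^n"
    using dyadic_expansion[OF f] by blast
  note [measurable] = B(1)
  have half: "(\<lambda>k. (1/2)^(k+1)) sums (1::real)"
    using power_half_series by simp
  \<comment> \<open>Kernel values are bounded at every point, so this series converges everywhere
    and no exceptional set has to be handled in the definition.\<close>
  define u where "u \<omega> = (\<Sum>k. (1/2)^(k+1) * \<kappa> (B k) \<omega>)" for \<omega>
  have u_sums: "(\<lambda>k. (1/2)^(k+1) * \<kappa> (B k) \<omega>) sums u \<omega>" if "\<omega> \<in> space P" for \<omega>
  proof -
    have "summable (\<lambda>k. (1/2)^(k+1) * \<kappa> (B k) \<omega>)"
      by (rule summable_comparison_test'[OF sums_summable[OF half], of 0])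
        (use bounds[OF B(1) that] in \<open>auto simp: abs_mult intro!: mult_left_le\<close>)
    then show ?thesis unfolding u_def by (rule summable_sums)
  qed
  show thesis
  proof (rule that[of u])
    show "u \<in> borel_measurable P" unfolding u_def by measurable
    show "0 \<le> u \<omega> \<and> u \<omega> \<le> 1" if "\<omega> \<in> space P" for \<omega>
    proof
      show "0 \<le> u \<omega>" by (rule sums_le[OF _ sums_zero u_sums[OF that]]) (use bounds[OF B(1) that] in auto)
      show "u \<omega> \<le> 1" by (rule sums_le[OF _ u_sums[OF that] half]) (use bounds[OF B(1) that] in \<open>auto intro!: mult_left_le\<close>)
    qed
    fix g :: "'w \<Rightarrow> ennreal" assume g [measurable]: "g \<in> borel_measurable P"
    have "(\<integral>\<^sup>+\<omega>. ennreal (u \<omega>) * g \<omega> \<partial>P) = (\<integral>\<^sup>+\<omega>. (\<Sum>k. ennreal ((1/2)^(k+1)) * (ennreal (\<kappa> (B k) \<omega>) * g \<omega>)) \<partial>P)"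
    proof (rule nn_integral_cong)
      fix \<omega> assume w: "\<omega> \<in> space P"
      have "ennreal (u \<omega>) = (\<Sum>k. ennreal ((1/2)^(k+1) * \<kappa> (B k) \<omega>))"
        using u_sums[OF w] bounds[OF B(1) w] by (intro suminf_ennreal_eq[symmetric]) auto
      also have "\<dots> = (\<Sum>k. ennreal ((1/2)^(k+1)) * ennreal (\<kappa> (B k) \<omega>))"
        using bounds[OF B(1) w] by (intro suminf_cong ennreal_mult) auto
      finally show "ennreal (u \<omega>) * g \<omega> = (\<Sum>k. ennreal ((1/2)^(k+1)) * (ennreal (\<kappa> (B k) \<omega>) * g \<omega>))"
        by (simp only: ennreal_suminf_multc[symmetric] mult.assoc)
    qed
    also have "\<dots> = (\<Sum>k. ennreal ((1/2)^(k+1)) * (\<integral>\<^sup>+\<omega>. ennreal (\<kappa> (B k) \<omega>) * g \<omega> \<partial>P))"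
      by (subst nn_integral_suminf) (auto intro!: suminf_cong nn_integral_cmult)
    also have "\<dots> = (\<Sum>k. ennreal ((1/2)^(k+1)) * emeasure (kernel_measure Q P \<kappa> g) (B k))"
      by (simp add: emeasure_kernel_measure B(1))
    also have "\<dots> = (\<integral>\<^sup>+q. (\<Sum>k. ennreal ((1/2)^(k+1)) * indicator (B k) q) \<partial>kernel_measure Q P \<kappa> g)"
      by (subst nn_integral_suminf) (auto intro!: suminf_cong simp: nn_integral_cmult_indicator)
    also have "\<dots> = (\<integral>\<^sup>+q. ennreal (f q) \<partial>kernel_measure Q P \<kappa> g)"
    proof (rule nn_integral_cong)
      fix q assume "q \<in> space (kernel_measure Q P \<kappa> g)"
      then have q: "q \<in> space Q" by simp
      have "(\<lambda>k. (1/2)^(k+1) * indicator (B k) q) sums f q"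
        using B(2,3)[OF q] by (rule dyadic_sums)
      then have "(\<Sum>k. ennreal ((1/2)^(k+1) * indicator (B k) q)) = ennreal (f q)"
        by (intro suminf_ennreal_eq) auto
      moreover have "ennreal ((1/2)^(k+1) * indicator (B k) q) = ennreal ((1/2)^(k+1)) * indicator (B k) q" for k
        by (auto simp: indicator_def)
      ultimately show "(\<Sum>k. ennreal ((1/2)^(k+1)) * indicator (B k) q) = ennreal (f q)" by simp
    qed
    finally show "(\<integral>\<^sup>+\<omega>. ennreal (u \<omega>) * g \<omega> \<partial>P) = (\<integral>\<^sup>+q. ennreal (f q) \<partial>kernel_measure Q P \<kappa> g)" .
  qed
qed

end

text \<open>The integrand \<open>(1\<^sub>B - \<kappa> B) (h - c)\<close>, with \<open>B = {h > c}\<close>, is nonnegative and has integral zero.\<close>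

lemma fixes_level_set:
  assumes P: "finite_measure P" and \<kappa>: "ae_kernel P P \<kappa>"
    and inv: "\<And>E. E \<in> sets P \<Longrightarrow> (LINT \<omega>|P. \<kappa> E \<omega>) = measure P E"
    and h: "integrable P (h :: 'w \<Rightarrow> real)"
    and invh: "\<And>E. E \<in> sets P \<Longrightarrow> (LINT \<omega>|P. \<kappa> E \<omega> * h \<omega>) = (LINT \<omega>|P. indicator E \<omega> * h \<omega>)"
  shows "AE \<omega> in P. \<kappa> {\<omega>\<in>space P. c < h \<omega>} \<omega> = indicator {\<omega>\<in>space P. c < h \<omega>} \<omega>"
proof -
  interpret finite_measure P by fact
  interpret ae_kernel P P \<kappa> by fact
  define B where "B = {\<omega>\<in>space P. c < h \<omega>}"
  note [measurable] = borel_measurable_integrable[OF h]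
  have B [measurable]: "B \<in> sets P" unfolding B_def by measurable
  have bb: "AE \<omega> in P. \<bar>\<kappa> B \<omega>\<bar> \<le> 1" using AE_space by eventually_elim (use bounds[OF B] in auto)
  have i1: "integrable P (\<kappa> B)" using bb by (intro integrable_const_bound[where B = 1]) auto
  have i2: "integrable P (\<lambda>\<omega>. \<kappa> B \<omega> * h \<omega>)"
    by (rule Bochner_Integration.integrable_bound[OF h])
      (use bb in \<open>auto simp: abs_mult elim!: eventually_mono intro!: mult_left_le_one_le\<close>)
  have i3: "integrable P (indicator B :: _ \<Rightarrow> real)" using B by (simp add: emeasure_eq_measure)
  have i4: "integrable P (\<lambda>\<omega>. indicator B \<omega> * h \<omega>)"
    using integrable_real_mult_indicator[OF B h] by (simp add: mult.commute)
  have nn: "0 \<le> (indicator B \<omega> - \<kappa> B \<omega>) * (h \<omega> - c)" if "\<omega> \<in> space P" for \<omega>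
    using bounds[OF B that] that by (auto simp: B_def indicator_def mult_nonneg_nonneg mult_nonneg_nonpos)
  have eq: "(indicator B \<omega> - \<kappa> B \<omega>) * (h \<omega> - c)
      = indicator B \<omega> * h \<omega> - \<kappa> B \<omega> * h \<omega> - (c * indicator B \<omega> - c * \<kappa> B \<omega>)" for \<omega>
    by (simp add: algebra_simps)
  have int: "integrable P (\<lambda>\<omega>. (indicator B \<omega> - \<kappa> B \<omega>) * (h \<omega> - c))"
    unfolding eq using i1 i2 i3 i4 by (intro Bochner_Integration.integrable_diff integrable_mult_right)
  have "(LINT \<omega>|P. (indicator B \<omega> - \<kappa> B \<omega>) * (h \<omega> - c)) = 0"
    unfolding eq using i1 i2 i3 i4 inv[OF B] invh[OF B] B by simp
  then have "AE \<omega> in P. (indicator B \<omega> - \<kappa> B \<omega>) * (h \<omega> - c) = 0"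
    using integral_nonneg_eq_0_iff_AE[OF int] nn by (auto intro: AE_I2)
  \<comment> \<open>Where \<open>h\<close> equals \<open>c\<close> the product vanishes for any
    value of \<open>\<kappa> B\<close>, so only an inequality follows at this point. Equality of the
    integrals of both sides closes the gap.\<close>
  then have 1: "AE \<omega> in P. indicator B \<omega> \<le> \<kappa> B \<omega>"
    using AE_space by eventually_elim (use bounds[OF B] in \<open>auto simp: B_def indicator_def\<close>)
  then have "AE \<omega> in P. 0 \<le> \<kappa> B \<omega> - indicator B \<omega>" by eventually_elim simp
  moreover have "(LINT \<omega>|P. \<kappa> B \<omega> - indicator B \<omega>) = 0"
    using i1 i3 inv[OF B] B by simp
  ultimately have "AE \<omega> in P. \<kappa> B \<omega> - indicator B \<omega> = 0"
    using integral_nonneg_eq_0_iff_AE[of P "\<lambda>\<omega>. \<kappa> B \<omega> - indicator B \<omega>"] i1 i3 by auto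
  then show ?thesis unfolding B_def[symmetric] by eventually_elim simp
qed

section \<open>Point realization on standard Borel spaces\<close>

text \<open>One point chosen from each nonempty member of a countable base gives the dense
  sequence.\<close>

lemma standard_borel_metric:
  assumes "standard_borel Q" "space Q \<noteq> {}"
  obtains d and a :: "nat \<Rightarrow> 'v" where "Metric_space (space Q) d" "Metric_space.mcomplete (space Q) d"
    "sets Q = sigma_sets (space Q) {U. openin (Metric_space.mtopology (space Q) d) U}"
    "range a \<subseteq> space Q" "\<And>x r. x \<in> space Q \<Longrightarrow> r > 0 \<Longrightarrow> \<exists>n. d (a n) x < r"
proof -
  obtain T where T: "topspace T = space Q" "completely_metrizable_space T" "second_countable T"
    "sets Q = sigma_sets (space Q) {U. openin T U}"
    using assms(1) unfolding standard_borel_def by blast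
  obtain X d where Xd: "Metric_space X d" "Metric_space.mcomplete X d" "T = Metric_space.mtopology X d"
    using T(2) unfolding completely_metrizable_space_def by blast
  have X: "X = space Q" using Metric_space.topspace_mtopology[OF Xd(1)] T(1) Xd(3) by simp
  interpret Metric_space "space Q" d using Xd(1) X by simp
  obtain \<B> where \<B>: "countable \<B>" "\<And>V. V \<in> \<B> \<Longrightarrow> openin T V"
    "\<And>U x. openin T U \<Longrightarrow> x \<in> U \<Longrightarrow> \<exists>V\<in>\<B>. x \<in> V \<and> V \<subseteq> U"
    using T(3) unfolding second_countable_def by metis
  define p where "p V = (SOME x. x \<in> V)" for V :: "'v set"
  have p: "p V \<in> V" if "V \<noteq> {}" for V unfolding p_def using that some_in_eq by blast
  define C where "C = p ` {V\<in>\<B>. V \<noteq> {}}"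
  have C: "C \<subseteq> space Q"
  proof
    fix x assume "x \<in> C"
    then obtain V where V: "V \<in> \<B>" "x \<in> V" using p unfolding C_def by auto
    then show "x \<in> space Q" using openin_subset[OF \<B>(2)[OF V(1)]] T(1) by auto
  qed
  have near: "\<exists>c\<in>C. d c x < r" if x: "x \<in> space Q" "r > 0" for x r
  proof -
    have "openin T (mball x r)" using Xd(3) X openin_mball by simp
    then obtain V where V: "V \<in> \<B>" "x \<in> V" "V \<subseteq> mball x r" using \<B>(3) x centre_in_mball_iff by metis
    then have "p V \<in> mball x r" using p by blast
    then have "d (p V) x < r" by (simp add: commute)
    then show ?thesis using V unfolding C_def by blast
  qed
  have ne: "C \<noteq> {}" using near assms(2) zero_less_one by blast
  have "countable C" using \<B>(1) unfolding C_def by auto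
  then have range: "range (from_nat_into C) = C" using ne by (simp add: range_from_nat_into)
  show thesis
  proof (rule that[of d "from_nat_into C"])
    show "\<exists>n. d (from_nat_into C n) x < r" if "x \<in> space Q" "r > 0" for x r
      using near[OF that] range by (metis rangeE)
  qed (use Xd X T(4) C range Metric_space_axioms in auto)
qed

text \<open>For almost every \<open>\<omega>\<close> the kernel behaves like a 0-1 measure on a
  countable class of sets. At each scale exactly one cell of a partition has value 1, cells of value
  1 meet each other, so their centres form a Cauchy sequence, and its limit is the point assigned to
  \<open>\<omega>\<close>.\<close>

theorem (in ae_kernel) point_realization:
  assumes Q: "standard_borel Q" "space Q \<noteq> {}"
    and two: "\<And>E. E \<in> sets Q \<Longrightarrow> AE \<omega> in P. \<kappa> E \<omega> = 0 \<or> \<kappa> E \<omega> = 1"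
  obtains f where "f \<in> measurable P Q" "\<And>E. E \<in> sets Q \<Longrightarrow> AE \<omega> in P. \<kappa> E \<omega> = indicator E (f \<omega>)"
proof -
  obtain d and a :: "nat \<Rightarrow> 'v" where M: "Metric_space (space Q) d" "Metric_space.mcomplete (space Q) d"
    and setsQ: "sets Q = sigma_sets (space Q) {U. openin (Metric_space.mtopology (space Q) d) U}"
    and a: "range a \<subseteq> space Q" "\<And>x r. x \<in> space Q \<Longrightarrow> r > 0 \<Longrightarrow> \<exists>n. d (a n) x < r"
    using standard_borel_metric[OF Q] by blast
  interpret Metric_space "space Q" d by fact
  have opens: "U \<in> sets Q" if "openin mtopology U" for U using that setsQ by auto
  have ball [measurable]: "mball x r \<in> sets Q" for x r by (intro opens openin_mball)
  have aQ [simp]: "a n \<in> space Q" for n using a by auto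
  define \<epsilon> where "\<epsilon> n = 1 / (real n + 1)" for n
  have \<epsilon>: "\<epsilon> n > 0" for n by (simp add: \<epsilon>_def)
  have \<epsilon>0: "\<exists>n. \<epsilon> n < r" if "r > 0" for r
    using reals_Archimedean[OF that] by (auto simp: \<epsilon>_def inverse_eq_divide add.commute)
  \<comment> \<open>For each \<open>n\<close> a countable measurable partition whose cells lie in
    balls of radius \<open>\<epsilon> n\<close>.\<close>
  define D where "D n = disjointed (\<lambda>k. mball (a k) (\<epsilon> n))" for n
  have D: "D n k \<subseteq> mball (a k) (\<epsilon> n)" "D n k \<in> sets Q" "disjoint_family (D n)" "(\<Union>k. D n k) = space Q" for n k
  proof -
    show "D n k \<subseteq> mball (a k) (\<epsilon> n)" unfolding D_def by (rule disjointed_subset)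
    have "range (D n) \<subseteq> sets Q" unfolding D_def by (intro sets.range_disjointed_sets) auto
    then show "D n k \<in> sets Q" by auto
    show "disjoint_family (D n)" unfolding D_def by (rule disjoint_family_disjointed)
    have "(\<Union>k. mball (a k) (\<epsilon> n)) = space Q" using a(2) \<epsilon> aQ by (fastforce simp: in_mball)
    then show "(\<Union>k. D n k) = space Q" unfolding D_def by (simp add: UN_disjointed_eq)
  qed
  \<comment> \<open>Only countably many sets are kept, so that all their almost sure relations hold
    outside one common null set. Balls of rational radius around the \<open>a i\<close> generate the
    topology.\<close>
  define \<C> where "\<C> = range (\<lambda>(n, k). D n k) \<union> range (\<lambda>(i, q). mball (a i) (of_rat q))"
  have \<C>: "countable \<C>" "\<And>E. E \<in> \<C> \<Longrightarrow> E \<in> sets Q" unfolding \<C>_def using D(2) ball by auto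
  have DC: "D n k \<in> \<C>" and BC: "mball (a i) (of_rat q) \<in> \<C>" for n k i q unfolding \<C>_def by force+
  have A1: "AE \<omega> in P. \<forall>E\<in>\<C>. \<forall>F\<in>\<C>. E \<inter> F = {} \<longrightarrow> \<not> (\<kappa> E \<omega> = 1 \<and> \<kappa> F \<omega> = 1)"
    using \<C> not_both_one by (auto simp: AE_ball_countable)
  have A2: "AE \<omega> in P. \<forall>E\<in>\<C>. \<forall>F\<in>\<C>. E \<subseteq> F \<longrightarrow> \<kappa> E \<omega> \<le> \<kappa> F \<omega>"
    using \<C> mono by (auto simp: AE_ball_countable)
  have A3: "AE \<omega> in P. \<forall>E\<in>\<C>. \<kappa> E \<omega> = 0 \<or> \<kappa> E \<omega> = 1"
    using \<C> two by (auto simp: AE_ball_countable)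
  have A4: "AE \<omega> in P. \<forall>n. \<exists>k. \<kappa> (D n k) \<omega> = 1"
    unfolding AE_all_countable
  proof
    fix n
    have "AE \<omega> in P. (\<forall>k. \<kappa> (D n k) \<omega> = 0) \<longrightarrow> \<kappa> (space Q) \<omega> = 0"
      using UN_zero[of "D n", OF D(2)] unfolding D(4) .
    then show "AE \<omega> in P. \<exists>k. \<kappa> (D n k) \<omega> = 1"
      using total A3 by eventually_elim (use DC in \<open>metis zero_neq_one\<close>)
  qed
  \<comment> \<open>Continuity from below for open balls: a ball of value 1 contains a smaller
    concentric ball of value 1. Otherwise the limit point could end up on the boundary of the
    ball.\<close>
  have A5: "AE \<omega> in P. \<forall>i. \<forall>q. \<kappa> (mball (a i) (of_rat q)) \<omega> = 1 \<longrightarrow>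
      (\<exists>m. \<kappa> (mball (a i) (of_rat (q - 1 / of_nat (Suc m)))) \<omega> = 1)"
    unfolding AE_all_countable
  proof (intro allI)
    fix i q
    have "(\<Union>m. mball (a i) (of_rat (q - 1 / of_nat (Suc m)))) = mball (a i) (of_rat q)"
    proof (intro equalityI subsetI)
      fix x assume "x \<in> (\<Union>m. mball (a i) (of_rat (q - 1 / of_nat (Suc m))))"
      then obtain m where m: "x \<in> space Q" "d (a i) x < of_rat (q - 1 / of_nat (Suc m))" by auto
      have "(of_rat (q - 1 / of_nat (Suc m)) :: real) \<le> of_rat q" by (simp add: of_rat_less_eq)
      with m show "x \<in> mball (a i) (of_rat q)" by simp
    next
      fix x assume "x \<in> mball (a i) (of_rat q)"
      then have x: "x \<in> space Q" "0 < of_rat q - d (a i) x" by auto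
      obtain m where "inverse (real (Suc m)) < of_rat q - d (a i) x" using reals_Archimedean[OF x(2)] by blast
      then have "d (a i) x < of_rat (q - 1 / of_nat (Suc m))"
        by (simp add: of_rat_diff of_rat_divide inverse_eq_divide of_rat_add)
      then show "x \<in> (\<Union>m. mball (a i) (of_rat (q - 1 / of_nat (Suc m))))" using x(1) by auto
    qed
    then have "AE \<omega> in P. (\<forall>m. \<kappa> (mball (a i) (of_rat (q - 1 / of_nat (Suc m)))) \<omega> = 0) \<longrightarrow> \<kappa> (mball (a i) (of_rat q)) \<omega> = 0"
      using UN_zero[of "\<lambda>m. mball (a i) (of_rat (q - 1 / of_nat (Suc m)))", OF ball] by simp
    then show "AE \<omega> in P. \<kappa> (mball (a i) (of_rat q)) \<omega> = 1 \<longrightarrow>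
      (\<exists>m. \<kappa> (mball (a i) (of_rat (q - 1 / of_nat (Suc m)))) \<omega> = 1)"
      using A3 by eventually_elim (use BC in \<open>metis zero_neq_one\<close>)
  qed
  define G where "G \<omega> \<longleftrightarrow> (\<forall>E\<in>\<C>. \<forall>F\<in>\<C>. E \<inter> F = {} \<longrightarrow> \<not> (\<kappa> E \<omega> = 1 \<and> \<kappa> F \<omega> = 1))
    \<and> (\<forall>E\<in>\<C>. \<forall>F\<in>\<C>. E \<subseteq> F \<longrightarrow> \<kappa> E \<omega> \<le> \<kappa> F \<omega>) \<and> (\<forall>E\<in>\<C>. \<kappa> E \<omega> = 0 \<or> \<kappa> E \<omega> = 1)
    \<and> (\<forall>n. \<exists>k. \<kappa> (D n k) \<omega> = 1)
    \<and> (\<forall>i. \<forall>q. \<kappa> (mball (a i) (of_rat q)) \<omega> = 1 \<longrightarrow>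
      (\<exists>m. \<kappa> (mball (a i) (of_rat (q - 1 / of_nat (Suc m)))) \<omega> = 1))" for \<omega>
  have "AE \<omega> in P. G \<omega>" using A1 A2 A3 A4 A5 unfolding G_def by (intro AE_conjI)
  then obtain N where N: "N \<in> null_sets P" "{\<omega> \<in> space P. \<not> G \<omega>} \<subseteq> N"
    unfolding eventually_ae_filter by blast
  have NG: "G \<omega>" if "\<omega> \<in> space P - N" for \<omega> using N(2) that by blast
  have good1: "E \<inter> F \<noteq> {}" if "E \<in> \<C>" "F \<in> \<C>" "\<kappa> E \<omega> = 1" "\<kappa> F \<omega> = 1" "\<omega> \<in> space P - N" for \<omega> E F
    using that NG[OF that(5), unfolded G_def, THEN conjunct1] by metis
  have good2: "\<kappa> E \<omega> \<le> \<kappa> F \<omega>" if "E \<in> \<C>" "F \<in> \<C>" "E \<subseteq> F" "\<omega> \<in> space P - N" for \<omega> E F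
    using that NG[OF that(4), unfolded G_def, THEN conjunct2, THEN conjunct1] by metis
  have good3: "\<kappa> E \<omega> = 0 \<or> \<kappa> E \<omega> = 1" if "\<omega> \<in> space P - N" "E \<in> \<C>" for \<omega> E
    using that(2) NG[OF that(1), unfolded G_def, THEN conjunct2, THEN conjunct2, THEN conjunct1] by metis
  have good4: "\<exists>k. \<kappa> (D n k) \<omega> = 1" if "\<omega> \<in> space P - N" for \<omega> n
    using NG[OF that, unfolded G_def, THEN conjunct2, THEN conjunct2, THEN conjunct2, THEN conjunct1] by (rule spec)
  have good5: "\<exists>m. \<kappa> (mball (a i) (of_rat (q - 1 / of_nat (Suc m)))) \<omega> = 1"
    if "\<omega> \<in> space P - N" "\<kappa> (mball (a i) (of_rat q)) \<omega> = 1" for \<omega> i q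
    using NG[OF that(1), unfolded G_def, THEN conjunct2, THEN conjunct2, THEN conjunct2, THEN conjunct2,
      THEN spec, THEN spec, THEN mp, OF that(2)] .
  \<comment> \<open>The index of the cell of value 1 at scale \<open>n\<close>. Taking the least one
    keeps the choice measurable in \<open>\<omega>\<close>.\<close>
  define k where "k n \<omega> = (LEAST k. \<kappa> (D n k) \<omega> = 1)" for n \<omega>
  define \<sigma> where "\<sigma> \<omega> n = a (k n \<omega>)" for \<omega> n
  have km [measurable]: "k n \<in> measurable P (count_space UNIV)" for n
    unfolding k_def using D(2) by measurable
  have k: "\<kappa> (D n (k n \<omega>)) \<omega> = 1" if "\<omega> \<in> space P - N" for n \<omega>
    unfolding k_def using good4[OF that] by (rule LeastI_ex)
  have close: "d (\<sigma> \<omega> n) (\<sigma> \<omega> m) < \<epsilon> n + \<epsilon> m" if w: "\<omega> \<in> space P - N" for \<omega> n m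
  proof -
    have "D n (k n \<omega>) \<inter> D m (k m \<omega>) \<noteq> {}" using good1[OF DC DC k[OF w] k[OF w] w] .
    then obtain y where "y \<in> mball (\<sigma> \<omega> n) (\<epsilon> n)" "y \<in> mball (\<sigma> \<omega> m) (\<epsilon> m)"
      using D(1) unfolding \<sigma>_def by blast
    then show ?thesis using triangle[of "\<sigma> \<omega> n" y "\<sigma> \<omega> m"] by (auto simp: commute)
  qed
  have \<epsilon>_mono: "\<epsilon> m \<le> \<epsilon> n" if "n \<le> m" for n m using that by (simp add: \<epsilon>_def frac_le)
  have "\<exists>x. x \<in> space Q \<and> (\<forall>n. d (\<sigma> \<omega> n) x \<le> \<epsilon> n)" if w: "\<omega> \<in> space P - N" for \<omega>
  proof -
    have "MCauchy (\<sigma> \<omega>)"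
      unfolding MCauchy_def
    proof (intro conjI allI impI)
      show "range (\<sigma> \<omega>) \<subseteq> space Q" by (auto simp: \<sigma>_def)
      fix r :: real assume "r > 0"
      then obtain N where N: "\<epsilon> N < r / 2" using \<epsilon>0[of "r / 2"] by auto
      have "d (\<sigma> \<omega> n) (\<sigma> \<omega> n') < r" if "N \<le> n" "N \<le> n'" for n n'
        using close[OF w, of n n'] \<epsilon>_mono[OF that(1)] \<epsilon>_mono[OF that(2)] N by linarith
      then show "\<exists>N. \<forall>n n'. N \<le> n \<longrightarrow> N \<le> n' \<longrightarrow> d (\<sigma> \<omega> n) (\<sigma> \<omega> n') < r" by blast
    qed
    then obtain x where "limitin mtopology (\<sigma> \<omega>) x sequentially" using M(2) unfolding mcomplete_def by blast
    then have x: "x \<in> space Q" "\<And>e. e > 0 \<Longrightarrow> \<exists>N. \<forall>n\<ge>N. \<sigma> \<omega> n \<in> space Q \<and> d (\<sigma> \<omega> n) x < e"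
      unfolding limit_metric_sequentially by blast+
    have "d (\<sigma> \<omega> n) x \<le> \<epsilon> n" for n
    proof (rule field_le_epsilon)
      fix e :: real assume "e > 0"
      then obtain N1 where N1: "\<forall>m\<ge>N1. d (\<sigma> \<omega> m) x < e / 2" using x(2)[of "e / 2"] by auto
      obtain N2 where N2: "\<epsilon> N2 < e / 2" using \<epsilon>0[of "e / 2"] \<open>e > 0\<close> by auto
      define m where "m = max N1 N2"
      have "d (\<sigma> \<omega> n) x \<le> d (\<sigma> \<omega> n) (\<sigma> \<omega> m) + d (\<sigma> \<omega> m) x"
        using x(1) by (intro triangle) (auto simp: \<sigma>_def)
      moreover have "d (\<sigma> \<omega> m) x < e / 2" using N1 by (simp add: m_def)
      moreover have "\<epsilon> m < e / 2" using N2 \<epsilon>_mono[of N2 m] by (simp add: m_def)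
      ultimately show "d (\<sigma> \<omega> n) x \<le> \<epsilon> n + e" using close[OF w, of n m] by linarith
    qed
    with x(1) show ?thesis by blast
  qed
  then obtain g where g: "\<And>\<omega>. \<omega> \<in> space P - N \<Longrightarrow> g \<omega> \<in> space Q"
    "\<And>\<omega> n. \<omega> \<in> space P - N \<Longrightarrow> d (\<sigma> \<omega> n) (g \<omega>) \<le> \<epsilon> n" by metis
  \<comment> \<open>On the null set \<open>N\<close> the centres may fail to converge, and any fixed
    point of the space will do.\<close>
  define f where "f \<omega> = (if \<omega> \<in> N then a 0 else g \<omega>)" for \<omega>
  have fQ: "f \<omega> \<in> space Q" if "\<omega> \<in> space P" for \<omega> using g(1) that by (simp add: f_def)
  have f: "d (\<sigma> \<omega> n) (f \<omega>) \<le> \<epsilon> n" if "\<omega> \<in> space P - N" for \<omega> n using g(2) that by (simp add: f_def)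
  \<comment> \<open>The limit was obtained by choice. This criterion describes membership in a ball
    by countably many conditions on the measurable centres, which gives measurability of
    \<open>f\<close>.\<close>
  have in_ball: "f \<omega> \<in> mball (a i) r \<longleftrightarrow> (\<exists>n. d (a i) (\<sigma> \<omega> n) + \<epsilon> n < r)"
    if w: "\<omega> \<in> space P - N" for \<omega> i r
  proof
    have fw: "f \<omega> \<in> space Q" using fQ w by auto
    assume "f \<omega> \<in> mball (a i) r"
    then have "0 < (r - d (a i) (f \<omega>)) / 2" by simp
    then obtain n where n: "\<epsilon> n < (r - d (a i) (f \<omega>)) / 2" using \<epsilon>0 by blast
    have "d (a i) (\<sigma> \<omega> n) \<le> d (a i) (f \<omega>) + d (f \<omega>) (\<sigma> \<omega> n)" using fw by (intro triangle) (auto simp: \<sigma>_def)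
    moreover have "d (f \<omega>) (\<sigma> \<omega> n) \<le> \<epsilon> n" using f[OF w] by (simp add: commute)
    moreover have "2 * \<epsilon> n < r - d (a i) (f \<omega>)" using n by simp
    ultimately have "d (a i) (\<sigma> \<omega> n) + \<epsilon> n < r" by linarith
    then show "\<exists>n. d (a i) (\<sigma> \<omega> n) + \<epsilon> n < r" by blast
  next
    have fw: "f \<omega> \<in> space Q" using fQ w by auto
    assume "\<exists>n. d (a i) (\<sigma> \<omega> n) + \<epsilon> n < r"
    then obtain n where n: "d (a i) (\<sigma> \<omega> n) + \<epsilon> n < r" by blast
    have "d (a i) (f \<omega>) \<le> d (a i) (\<sigma> \<omega> n) + d (\<sigma> \<omega> n) (f \<omega>)" using fw by (intro triangle) (auto simp: \<sigma>_def)
    then have "d (a i) (f \<omega>) < r" using n f[OF w, of n] by linarith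
    then show "f \<omega> \<in> mball (a i) r" using fw by simp
  qed
  have Nsets [measurable]: "N \<in> sets P" using N(1) by auto
  have pre_ball: "f -` mball (a i) r \<inter> space P \<in> sets P" for i r
  proof -
    have "{\<omega> \<in> space P. \<exists>n. d (a i) (a (k n \<omega>)) + \<epsilon> n < r} \<in> sets P" by measurable
    then have "({\<omega> \<in> space P. \<exists>n. d (a i) (\<sigma> \<omega> n) + \<epsilon> n < r} - N) \<union> (if a 0 \<in> mball (a i) r then N else {}) \<in> sets P"
      unfolding \<sigma>_def by auto
    also have "({\<omega> \<in> space P. \<exists>n. d (a i) (\<sigma> \<omega> n) + \<epsilon> n < r} - N) \<union> (if a 0 \<in> mball (a i) r then N else {})
       = f -` mball (a i) r \<inter> space P"
      using in_ball sets.sets_into_space[OF Nsets] by (auto simp: f_def split: if_splits)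
    finally show ?thesis .
  qed
  have open_balls: "U = (\<Union>(i, q)\<in>{(i, q). mball (a i) (of_rat q) \<subseteq> U}. mball (a i) (of_rat q))"
    if U: "openin mtopology U" for U
  proof (intro equalityI subsetI)
    fix x assume x: "x \<in> U"
    then obtain r where r: "r > 0" "mball x r \<subseteq> U" using U unfolding openin_mtopology by blast
    have xQ: "x \<in> space Q" using U x openin_subset by fastforce
    obtain n where n: "d (a n) x < r / 2" using a(2)[OF xQ, of "r / 2"] r by auto
    obtain q where q: "d (a n) x < of_rat q" "of_rat q < r / 2" using of_rat_dense[OF n] by blast
    have "mball (a n) (of_rat q) \<subseteq> mball x r"
    proof
      fix y assume y: "y \<in> mball (a n) (of_rat q)"
      have "d x y \<le> d x (a n) + d (a n) y" using y xQ by (intro triangle) auto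
      then show "y \<in> mball x r" using y xQ n q by (auto simp: commute)
    qed
    then show "x \<in> (\<Union>(i, q)\<in>{(i, q). mball (a i) (of_rat q) \<subseteq> U}. mball (a i) (of_rat q))"
      using r q xQ by (intro UN_I[of "(n, q)"]) auto
  qed auto
  have fm: "f \<in> measurable P Q"
  proof (rule measurable_sigma_sets[OF setsQ])
    show "{U. openin mtopology U} \<subseteq> Pow (space Q)" using openin_subset by fastforce
    show "f \<in> space P \<rightarrow> space Q" using fQ by auto
    fix U assume "U \<in> {U. openin mtopology U}"
    then have U: "openin mtopology U" by auto
    have "f -` U \<inter> space P = (\<Union>(i, q)\<in>{(i, q). mball (a i) (of_rat q) \<subseteq> U}. f -` mball (a i) (of_rat q) \<inter> space P)"
      by (subst open_balls[OF U]) blast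
    also have "\<dots> \<in> sets P" using pre_ball by (intro sets.countable_UN'') auto
    finally show "f -` U \<inter> space P \<in> sets P" .
  qed
  let ?G = "{E \<in> sets Q. AE \<omega> in P. \<kappa> E \<omega> = indicator E (f \<omega>)}"
  interpret G: sigma_algebra "space Q" ?G by (rule sigma_algebra_realized[OF fQ])
  have ball_G: "mball (a i) (of_rat q) \<in> ?G" for i q
  proof -
    have "AE \<omega> in P. \<omega> \<notin> N" using N(1) by (rule AE_not_in)
    then have "AE \<omega> in P. \<kappa> (mball (a i) (of_rat q)) \<omega> = indicator (mball (a i) (of_rat q)) (f \<omega>)"
      using AE_space
    proof eventually_elim
      case (elim \<omega>)
      then have w: "\<omega> \<in> space P - N" by auto
      have "\<kappa> (mball (a i) (of_rat q)) \<omega> = 1 \<longleftrightarrow> f \<omega> \<in> mball (a i) (of_rat q)"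
      proof
        assume "f \<omega> \<in> mball (a i) (of_rat q)"
        then obtain n where n: "d (a i) (\<sigma> \<omega> n) + \<epsilon> n < of_rat q" using in_ball[OF w] by blast
        have "mball (\<sigma> \<omega> n) (\<epsilon> n) \<subseteq> mball (a i) (of_rat q)"
        proof
          fix y assume y: "y \<in> mball (\<sigma> \<omega> n) (\<epsilon> n)"
          then have "d (a i) y \<le> d (a i) (\<sigma> \<omega> n) + d (\<sigma> \<omega> n) y" by (intro triangle) auto
          then show "y \<in> mball (a i) (of_rat q)" using y n by auto
        qed
        then have "D n (k n \<omega>) \<subseteq> mball (a i) (of_rat q)" using D(1) unfolding \<sigma>_def by blast
        then have "1 \<le> \<kappa> (mball (a i) (of_rat q)) \<omega>" using good2[OF DC BC _ w] k[OF w] by metis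
        then show "\<kappa> (mball (a i) (of_rat q)) \<omega> = 1" using good3[OF w BC[of i q]] by auto
      next
        assume "\<kappa> (mball (a i) (of_rat q)) \<omega> = 1"
        then obtain m where m: "\<kappa> (mball (a i) (of_rat (q - 1 / of_nat (Suc m)))) \<omega> = 1"
          using good5[OF w] by blast
        \<comment> \<open>The gap between the two radii. It absorbs twice
          \<open>\<epsilon> n\<close>: once for the distance from a common point of cell and smaller
          ball to the centre of the cell, once for the margin required by
          \<open>in_ball\<close>.\<close>
        define e where "e = 1 / real (Suc m)"
        then have "0 < e / 2" by simp
        then obtain n where n: "\<epsilon> n < e / 2" using \<epsilon>0 by blast
        have "D n (k n \<omega>) \<inter> mball (a i) (of_rat (q - 1 / of_nat (Suc m))) \<noteq> {}"
          using good1[OF DC BC k[OF w] m w] .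
        then obtain y where y: "y \<in> mball (\<sigma> \<omega> n) (\<epsilon> n)" "y \<in> mball (a i) (of_rat (q - 1 / of_nat (Suc m)))"
          using D(1) unfolding \<sigma>_def by blast
        have r: "of_rat (q - 1 / of_nat (Suc m)) = of_rat q - 1 / real (Suc m)"
          by (simp add: of_rat_diff of_rat_divide of_rat_add)
        have "d (a i) (\<sigma> \<omega> n) \<le> d (a i) y + d y (\<sigma> \<omega> n)" using y by (intro triangle) auto
        moreover have "d (a i) y < of_rat q - e" using y(2) unfolding e_def r[symmetric] by simp
        moreover have "d y (\<sigma> \<omega> n) < \<epsilon> n" using y(1) by (simp add: commute)
        ultimately have "d (a i) (\<sigma> \<omega> n) + \<epsilon> n < of_rat q" using n by linarith
        then show "f \<omega> \<in> mball (a i) (of_rat q)" using in_ball[OF w] by blast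
      qed
      then show ?case using good3[OF w BC[of i q]] by (auto simp: indicator_def)
    qed
    then show ?thesis using ball by blast
  qed
  have "sigma_sets (space Q) {U. openin mtopology U} \<subseteq> ?G"
  proof (rule G.sigma_sets_subset, rule subsetI)
    fix U assume "U \<in> {U. openin mtopology U}"
    then have U: "openin mtopology U" by auto
    show "U \<in> ?G" by (subst open_balls[OF U]) (rule G.countable_UN'', use ball_G in auto)
  qed
  then show thesis using that[OF fm] setsQ by auto
qed

section \<open>Von Neumann algebras and POVMs\<close>

lemma von_neumann_algebra_iff:
  assumes "von_neumann_algebra A"
  shows "T \<in> A \<longleftrightarrow> bounded_op T \<and> (\<forall>R\<in>commutant A. T \<circ> R = R \<circ> T)"
proof -
  have "A = commutant (commutant A)" using assms by (simp add: von_neumann_algebra_def)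
  then show ?thesis unfolding commutant_def[of "commutant A"] by blast
qed

lemma bounded_op_plus:
  assumes "bounded_op T" "bounded_op T'" shows "bounded_op (\<lambda>x. T x + T' x)"
  using assms bounded_linear_add by (auto simp: bounded_op_def scaleC_add_right)

lemma bounded_linear_scaleC: "bounded_linear (\<lambda>x::'h::chilbert_space. c *\<^sub>C x)"
proof (rule bounded_linear_intro[where K = "cmod c"])
  show "c *\<^sub>C r *\<^sub>R x = r *\<^sub>R c *\<^sub>C x" for r and x :: 'h
    by (simp add: scaleR_scaleC scaleC_scaleC mult.commute)
qed (simp_all add: scaleC_add_right norm_scaleC mult.commute)

lemma bounded_op_scale:
  assumes "bounded_op T" shows "bounded_op (\<lambda>x. c *\<^sub>C T x)"
  using assms bounded_linear_compose[OF bounded_linear_scaleC]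
  by (auto simp: bounded_op_def scaleC_scaleC mult.commute)

lemma bounded_op_id: "bounded_op id" by (simp add: bounded_op_def id_def)

lemma scaleC_zero_left [simp]: "0 *\<^sub>C x = (0::'h::chilbert_space)"
  using scaleR_scaleC[of 0 x] by simp

lemma scaleC_minus1: "(-1) *\<^sub>C x = - (x::'h::chilbert_space)"
  using scaleR_scaleC[of "-1" x] by simp

locale von_neumann =
  fixes A :: "('h::chilbert_space \<Rightarrow> 'h) set"
  assumes vn: "von_neumann_algebra A"
begin

lemma bounded: "T \<in> A \<Longrightarrow> bounded_op T" using von_neumann_algebra_iff[OF vn] by blast

lemma plus_closed: "T \<in> A \<Longrightarrow> T' \<in> A \<Longrightarrow> (\<lambda>x. T x + T' x) \<in> A"
  and scale_closed: "T \<in> A \<Longrightarrow> (\<lambda>x. c *\<^sub>C T x) \<in> A"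
  and id_closed: "id \<in> A"
  unfolding von_neumann_algebra_iff[OF vn]
  by (auto simp: bounded_op_plus bounded_op_scale bounded_op_id commutant_def fun_eq_iff
      bounded_op_add bounded_op_scaleC)

lemma diff_closed: "T \<in> A \<Longrightarrow> T' \<in> A \<Longrightarrow> (\<lambda>x. T x - T' x) \<in> A"
  using plus_closed[OF _ scale_closed[of T' "-1"]] by (simp add: scaleC_minus1)

text \<open>Commuting with a bounded operator passes to pointwise limits, so an algebra equal to its
  bicommutant is closed under strong limits of sequences whose limit is bounded.\<close>

lemma limit_closed:
  assumes "\<And>n. T n \<in> A" "bounded_op L" "\<And>x. (\<lambda>n. T n x) \<longlonglongrightarrow> L x" shows "L \<in> A"
  unfolding von_neumann_algebra_iff[OF vn]
proof (intro conjI ballI)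
  fix R assume R: "R \<in> commutant A"
  then have bl: "bounded_linear R" by (simp add: commutant_def bounded_op_def)
  show "L \<circ> R = R \<circ> L"
  proof
    fix x
    have "(\<lambda>n. R (T n x)) \<longlonglongrightarrow> R (L x)" by (rule bounded_linear.tendsto[OF bl assms(3)])
    moreover have "R (T n x) = T n (R x)" for n
      using R assms(1)[of n] by (auto simp: commutant_def fun_eq_iff)
    ultimately show "(L \<circ> R) x = (R \<circ> L) x" using assms(3)[of "R x"] LIMSEQ_unique by fastforce
  qed
qed fact

lemma eqI: "T \<in> A \<Longrightarrow> T' \<in> A \<Longrightarrow> (\<And>x. cinner x (T x) = cinner x (T' x)) \<Longrightarrow> T = T'"
  using bounded bounded_op_eqI by metis

lemma op_simps: "elems (operator_alg A) = A" "plus_alg (operator_alg A) = (\<lambda>S T x. S x + T x)"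
  "scale_alg (operator_alg A) = (\<lambda>c T x. c *\<^sub>C T x)" "one_alg (operator_alg A) = id"
  "vecs (operator_alg A) = UNIV" "mcoef (operator_alg A) = (\<lambda>T x y. cinner x (T y))"
  by (simp_all add: operator_alg_def)

lemma quadratic_algebra_operators: "quadratic_algebra (operator_alg A)"
proof (standard, unfold op_simps)
  fix n :: nat and \<xi> :: "nat \<Rightarrow> 'h" and v
  have "(\<Sum>i<n. \<Sum>j<n. cnj (v i) * cinner (\<xi> i) (b (\<xi> j)) * v j)
     = cinner (\<Sum>i<n. v i *\<^sub>C \<xi> i) (b (\<Sum>i<n. v i *\<^sub>C \<xi> i))" if "b \<in> A" for b
    using bounded[OF that]
    by (simp add: bounded_op_sum bounded_op_scaleC cinner_sum_left cinner_sum_right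
        cinner_scaleC_left cinner_scaleC_right sum_distrib_left mult.assoc mult.commute) (rule sum.swap)
  then show "\<exists>\<zeta>\<in>UNIV. \<forall>b\<in>A. (\<Sum>i<n. \<Sum>j<n. cnj (v i) * cinner (\<xi> i) (b (\<xi> j)) * v j) = cinner \<zeta> (b \<zeta>)"
    by blast
qed (auto simp: plus_closed scale_closed id_closed cinner_add_right cinner_scaleC_right intro: eqI)

end

section \<open>The scalar measures of a POVM and their densities\<close>

locale vn_povm = von_neumann A for A :: "('h::chilbert_space \<Rightarrow> 'h) set" +
  fixes \<phi>\<^sub>0 :: "('h \<Rightarrow> 'h) \<Rightarrow> complex" and S :: "'w measure" and M :: "'w set \<Rightarrow> 'h \<Rightarrow> 'h"
  assumes state: "faithful_normal_state A \<phi>\<^sub>0" and povm: "povm A S M"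
begin

abbreviation "P \<equiv> povm_measure S M \<phi>\<^sub>0"
abbreviation "\<mu> x \<equiv> povm_measure S M (\<lambda>T. cinner x (T x))"

lemma sets_P [simp, measurable_cong]: "sets (povm_measure S M \<phi>) = sets S"
  and space_P [simp]: "space (povm_measure S M \<phi>) = space S"
  by (simp_all add: povm_measure_def sets.space_closed sets.sigma_sets_eq)

lemma M_in: "E \<in> sets S \<Longrightarrow> M E \<in> A"
  and M_nonneg: "E \<in> sets S \<Longrightarrow> cinner x (M E x) \<in> \<real>\<^sub>\<ge>\<^sub>0"
  and M_space: "M (space S) = id"
  and M_sums: "range F \<subseteq> sets S \<Longrightarrow> disjoint_family F \<Longrightarrow>
      (\<lambda>n::nat. cinner x (M (F n) y)) sums cinner x (M (\<Union>n. F n) y)"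
  using povm by (auto simp: povm_def positive_op_def)

lemma emeasure_povm_measure:
  assumes nonneg: "\<And>E. E \<in> sets S \<Longrightarrow> 0 \<le> Re (\<phi> (M E))"
    and sums: "\<And>F. range F \<subseteq> sets S \<Longrightarrow> disjoint_family F \<Longrightarrow>
      (\<lambda>n::nat. Re (\<phi> (M (F n)))) sums Re (\<phi> (M (\<Union>n. F n)))"
    and E: "E \<in> sets S"
  shows "emeasure (povm_measure S M \<phi>) E = ennreal (Re (\<phi> (M E)))"
  unfolding povm_measure_def
proof (rule emeasure_measure_of_sigma)
  have "(\<lambda>n::nat. Re (\<phi> (M {}))) sums Re (\<phi> (M {}))"
    using sums[of "\<lambda>_. {}"] by (simp add: disjoint_family_on_def)
  then have "summable (\<lambda>n::nat. Re (\<phi> (M {})))" by (rule sums_summable)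
  then have "Re (\<phi> (M {})) = 0" by (simp add: summable_const_iff)
  then show "positive (sets S) (\<lambda>E. ennreal (Re (\<phi> (M E))))" by (simp add: positive_def)
  show "countably_additive (sets S) (\<lambda>E. ennreal (Re (\<phi> (M E))))"
    unfolding countably_additive_def
  proof (intro allI impI)
    fix F :: "nat \<Rightarrow> 'w set" assume F: "range F \<subseteq> sets S" "disjoint_family F"
    show "(\<Sum>i. ennreal (Re (\<phi> (M (F i))))) = ennreal (Re (\<phi> (M (\<Union>i. F i))))"
      using F(1) by (intro suminf_ennreal_eq sums[OF F] nonneg) auto
  qed
qed (use E sets.sigma_algebra_axioms in auto)

lemma emeasure_mu: "E \<in> sets S \<Longrightarrow> emeasure (\<mu> x) E = ennreal (Re (cinner x (M E x)))"
  by (rule emeasure_povm_measure)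
    (use M_nonneg in \<open>auto simp: complex_nonneg_Reals_iff intro: sums_Re M_sums\<close>)

lemma finite_mu: "finite_measure (\<mu> x)"
  by (rule finite_measureI) (simp add: emeasure_mu)

lemma cinner_M: "E \<in> sets S \<Longrightarrow> cinner x (M E x) = of_real (measure (\<mu> x) E)"
  using M_nonneg[of E x] by (simp add: measure_def emeasure_mu complex_nonneg_Reals_iff complex_eq_iff)

lemma measure_mu_space: "measure (\<mu> x) (space S) = (norm x)\<^sup>2"
  using cinner_M[of "space S" x] of_real_eq_iff by (simp add: M_space cinner_norm del: of_real_power)

lemma norm_M: assumes "E \<in> sets S" shows "norm (M E x) \<le> 2 * norm x"
proof -
  have "cmod (cinner y (M E y)) \<le> 1 * (norm y)\<^sup>2" for y
  proof -
    have "measure (\<mu> y) E \<le> measure (\<mu> y) (space (\<mu> y))" by (rule finite_measure.bounded_measure[OF finite_mu])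
    then show ?thesis using assms by (simp add: cinner_M measure_mu_space)
  qed
  then show ?thesis using norm_bound_of_quadratic_form[OF bounded[OF M_in[OF assms]], of 1 x] by simp
qed

lemma state_linear: "T \<in> A \<Longrightarrow> T' \<in> A \<Longrightarrow> \<phi>\<^sub>0 (\<lambda>x. T x + T' x) = \<phi>\<^sub>0 T + \<phi>\<^sub>0 T'"
    "T \<in> A \<Longrightarrow> \<phi>\<^sub>0 (\<lambda>x. c *\<^sub>C T x) = c * \<phi>\<^sub>0 T"
  and state_id: "\<phi>\<^sub>0 id = 1"
  and state_pos: "T \<in> A \<Longrightarrow> (\<And>x. cinner x (T x) \<in> \<real>\<^sub>\<ge>\<^sub>0) \<Longrightarrow> \<phi>\<^sub>0 T \<in> \<real>\<^sub>\<ge>\<^sub>0"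
  and state_normal: "normal_map (operator_alg A) complex_alg \<phi>\<^sub>0"
  and state_faithful: "T \<in> A \<Longrightarrow> positive_op T \<Longrightarrow> \<phi>\<^sub>0 T = 0 \<Longrightarrow> T = (\<lambda>_. 0)"
  using state
  by (auto simp: faithful_normal_state_def normal_state_def linear_on_alg_def op_simps complex_alg_def
      positive_elem_def)

lemma state_diff: "T \<in> A \<Longrightarrow> T' \<in> A \<Longrightarrow> \<phi>\<^sub>0 (\<lambda>x. T x - T' x) = \<phi>\<^sub>0 T - \<phi>\<^sub>0 T'"
  using state_linear(1)[OF _ scale_closed[of T' "-1"], of T] state_linear(2)[of T' "-1"]
  by (simp add: scaleC_minus1)

lemma M_Un:
  assumes "E \<in> sets S" "F \<in> sets S" "E \<inter> F = {}" shows "M (E \<union> F) = (\<lambda>x. M E x + M F x)"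
proof (rule eqI)
  fix x
  have "measure (\<mu> x) (E \<union> F) = measure (\<mu> x) E + measure (\<mu> x) F"
    using assms by (intro finite_measure.finite_measure_Union[OF finite_mu]) auto
  then show "cinner x (M (E \<union> F) x) = cinner x (M E x + M F x)"
    using assms by (simp add: cinner_M cinner_add_right)
qed (use assms in \<open>auto intro: M_in plus_closed\<close>)

lemma M_empty: "M {} = (\<lambda>_. 0)"
  by (rule bounded_op_eqI[OF bounded[OF M_in[OF sets.empty_sets]]]) (simp_all add: cinner_M bounded_op_def)

lemma state_zero: "\<phi>\<^sub>0 (\<lambda>_. 0) = 0"
  using state_linear(2)[OF id_closed, of 0] by simp

text \<open>Normality of the state is given in terms of order. The operators of the partial unions
  increase with supremum the operator of the whole union, since this holds for each quadratic form;
  the state preserves the supremum, which turns into convergence of the partial sums.\<close>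

lemma emeasure_P: 
  assumes "E \<in> sets S" shows "emeasure P E = ennreal (Re (\<phi>\<^sub>0 (M E)))"
proof (rule emeasure_povm_measure[OF _ _ assms])
  show nonneg: "0 \<le> Re (\<phi>\<^sub>0 (M E))" if "E \<in> sets S" for E
    using state_pos[OF M_in[OF that] M_nonneg[OF that]] by (simp add: complex_nonneg_Reals_iff)
  fix F :: "nat \<Rightarrow> 'w set" assume F: "range F \<subseteq> sets S" "disjoint_family F"
  then have Fn: "F n \<in> sets S" for n by auto
  define G where "G n = (\<Union>i<n. F i)" for n
  have G [measurable]: "G n \<in> sets S" for n using Fn by (auto simp: G_def)
  have UG: "(\<Union>n. G n) = (\<Union>n. F n)" by (auto simp: G_def)
  have UF: "(\<Union>n. F n) \<in> sets S" using Fn by auto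
  have incG: "incseq G" unfolding G_def incseq_def by (intro allI impI UN_mono) auto
  have sumG: "\<phi>\<^sub>0 (M (G n)) = (\<Sum>i<n. \<phi>\<^sub>0 (M (F i)))" for n
  proof (induction n)
    case 0 show ?case by (simp add: G_def M_empty state_zero)
  next
    case (Suc n)
    have "G (Suc n) = G n \<union> F n" by (auto simp: G_def lessThan_Suc)
    moreover have "F i \<inter> F n = {}" if "i < n" for i
      using F(2) that unfolding disjoint_family_on_def by (metis UNIV_I less_irrefl)
    then have "G n \<inter> F n = {}" by (auto simp: G_def)
    ultimately have "M (G (Suc n)) = (\<lambda>x. M (G n) x + M (F n) x)" using M_Un[OF G Fn] by simp
    then show ?case using Suc state_linear(1)[OF M_in[OF G] M_in[OF Fn]] by simp
  qed
  have mono: "le_alg (operator_alg A) (M E) (M E')" if "E \<in> sets S" "E' \<in> sets S" "E \<subseteq> E'" for E E'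
  proof -
    have "measure (\<mu> x) E \<le> measure (\<mu> x) E'" for x
      using that by (intro finite_measure.finite_measure_mono[OF finite_mu]) auto
    then show ?thesis using that by (simp add: le_alg_def op_simps cinner_M complex_nonneg_Reals_iff)
  qed
  have sa: "M E \<in> selfadjoint_elems (operator_alg A)" if "E \<in> sets S" for E
    using that by (simp add: selfadjoint_elems_def op_simps M_in cinner_M)
  have lubM: "is_lub_alg (operator_alg A) (range (\<lambda>n. M (G n))) (M (\<Union>n. F n))"
    unfolding is_lub_alg_def
  proof (intro conjI ballI impI)
    show "M (\<Union>n. F n) \<in> selfadjoint_elems (operator_alg A)" using sa UF .
    show "le_alg (operator_alg A) d (M (\<Union>n. F n))" if d: "d \<in> range (\<lambda>n. M (G n))" for d
    proof -
      obtain n where "d = M (G n)" using d by auto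
      then show ?thesis using mono[OF G[of n] UF] by (auto simp: G_def)
    qed
    fix u assume u: "u \<in> selfadjoint_elems (operator_alg A)"
      and ub: "\<forall>d\<in>range (\<lambda>n. M (G n)). le_alg (operator_alg A) d u"
    show "le_alg (operator_alg A) (M (\<Union>n. F n)) u"
      unfolding le_alg_def op_simps
    proof
      fix x
      have "cinner x (u x) - cinner x (M (G n) x) \<in> \<real>\<^sub>\<ge>\<^sub>0" for n
        using ub by (auto simp: le_alg_def op_simps)
      then have *: "measure (\<mu> x) (G n) \<le> Re (cinner x (u x)) \<and> Im (cinner x (u x)) = 0" for n
        by (simp add: cinner_M complex_nonneg_Reals_iff)
      have "(\<lambda>n. measure (\<mu> x) (G n)) \<longlonglongrightarrow> measure (\<mu> x) (\<Union>n. G n)"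
        using incG by (intro finite_measure.finite_Lim_measure_incseq[OF finite_mu]) auto
      then have "measure (\<mu> x) (\<Union>n. F n) \<le> Re (cinner x (u x))"
        unfolding UG using * by (intro LIMSEQ_le_const2) auto
      then show "cinner x (u x) - cinner x (M (\<Union>n. F n) x) \<in> \<real>\<^sub>\<ge>\<^sub>0"
        using * UF by (simp add: cinner_M complex_nonneg_Reals_iff)
    qed
  qed
  have dir: "\<exists>c\<in>range (\<lambda>n. M (G n)). le_alg (operator_alg A) a c \<and> le_alg (operator_alg A) b c"
    if ab: "a \<in> range (\<lambda>n. M (G n))" "b \<in> range (\<lambda>n. M (G n))" for a b
  proof -
    obtain m n where mn: "a = M (G m)" "b = M (G n)" using ab by auto
    show ?thesis unfolding mn
      by (intro bexI[of _ "M (G (max m n))"] conjI mono G incseqD[OF incG]) auto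
  qed
  have "is_lub_alg complex_alg (\<phi>\<^sub>0 ` range (\<lambda>n. M (G n))) (\<phi>\<^sub>0 (M (\<Union>n. F n)))"
    by (rule state_normal[unfolded normal_map_def, THEN spec, THEN spec, THEN mp])
      (intro conjI ballI dir lubM; use sa[OF G] in auto)
  then have lub: "le_alg complex_alg (\<phi>\<^sub>0 (M (G n))) (\<phi>\<^sub>0 (M (\<Union>n. F n)))"
    "u \<in> selfadjoint_elems complex_alg \<Longrightarrow> (\<And>n. le_alg complex_alg (\<phi>\<^sub>0 (M (G n))) u) \<Longrightarrow>
       le_alg complex_alg (\<phi>\<^sub>0 (M (\<Union>n. F n))) u" for n u
    unfolding is_lub_alg_def by auto
  \<comment> \<open>The order on the complex numbers is stated through forms over all vectors
    \<open>x\<close>, each of which only adds the factor \<open>(cmod x)\<^sup>2\<close>.\<close>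
  have cle: "le_alg complex_alg a b \<longleftrightarrow> Re a \<le> Re b" if "Im a = 0" "Im b = 0" for a b
  proof -
    have "cnj x * b * x - cnj x * a * x = of_real ((cmod x)\<^sup>2 * (Re b - Re a))" for x
    proof -
      have "cnj x * b * x - cnj x * a * x = (x * cnj x) * (b - a)" by (simp add: algebra_simps)
      also have "b - a = of_real (Re b - Re a)" using that by (simp add: complex_eq_iff)
      finally show ?thesis by (simp only: complex_norm_square of_real_mult)
    qed
    then have "le_alg complex_alg a b \<longleftrightarrow> (\<forall>x. 0 \<le> (cmod x)\<^sup>2 * (Re b - Re a))"
      by (simp only: le_alg_def complex_alg_def represented_algebra.simps nonneg_Reals_of_real_iff ball_UNIV)
    also have "\<dots> \<longleftrightarrow> Re a \<le> Re b"
    proof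
      assume "\<forall>x. 0 \<le> (cmod x)\<^sup>2 * (Re b - Re a)"
      from spec[OF this, of 1] show "Re a \<le> Re b" by simp
    qed auto
    finally show ?thesis .
  qed
  have im: "Im (\<phi>\<^sub>0 (M E)) = 0" if "E \<in> sets S" for E
    using state_pos[OF M_in[OF that] M_nonneg[OF that]] by (simp add: complex_nonneg_Reals_iff)
  define y where "y n = Re (\<phi>\<^sub>0 (M (G n)))" for n
  have yle: "y n \<le> Re (\<phi>\<^sub>0 (M (\<Union>n. F n)))" for n
    using lub(1)[of n] cle[OF im[OF G] im[OF UF]] by (simp add: y_def)
  have "incseq y"
    by (rule incseq_SucI) (simp add: y_def sumG nonneg[OF Fn])
  then obtain L where L: "y \<longlonglongrightarrow> L" "\<forall>n. y n \<le> L" using incseq_convergent yle by blast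
  \<comment> \<open>The limit of the partial sums is used as a competing upper bound, against which
    the supremum provided by normality is compared.\<close>
  have sL: "complex_of_real L \<in> selfadjoint_elems complex_alg"
  proof -
    have "cnj x * complex_of_real L * x \<in> \<real>" for x
    proof -
      have "cnj x * complex_of_real L * x = (x * cnj x) * of_real L" by simp
      also have "\<dots> = of_real ((cmod x)\<^sup>2 * L)" by (simp only: complex_norm_square of_real_mult)
      finally show ?thesis by (simp only: Reals_of_real)
    qed
    then show ?thesis by (simp add: selfadjoint_elems_def complex_alg_def)
  qed
  have "le_alg complex_alg (\<phi>\<^sub>0 (M (\<Union>n. F n))) (of_real L)"
    using L(2) by (intro lub(2) sL) (auto simp: cle im y_def)
  then have "Re (\<phi>\<^sub>0 (M (\<Union>n. F n))) \<le> L" by (simp add: cle im[OF UF])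
  moreover have "L \<le> Re (\<phi>\<^sub>0 (M (\<Union>n. F n)))" using yle by (intro LIMSEQ_le_const2[OF L(1)]) auto
  ultimately have "L = Re (\<phi>\<^sub>0 (M (\<Union>n. F n)))" by simp
  then show "(\<lambda>n. Re (\<phi>\<^sub>0 (M (F n)))) sums Re (\<phi>\<^sub>0 (M (\<Union>n. F n)))"
    using L(1) by (simp add: sums_def y_def[abs_def] sumG)
qed

sublocale P: finite_measure P
  by (rule finite_measureI) (simp add: emeasure_P)

lemma state_M: "E \<in> sets S \<Longrightarrow> \<phi>\<^sub>0 (M E) = of_real (measure P E)"
  using state_pos[of "M E"] M_in[of E] M_nonneg[of E]
  by (simp add: measure_def emeasure_P complex_nonneg_Reals_iff complex_eq_iff)

lemma measure_P_space: "measure P (space S) = 1"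
  using state_M[of "space S"] by (simp add: M_space state_id)

text \<open>Here faithfulness of the state enters. From now on almost everywhere statements refer to
  one finite measure in place of the operators.\<close>

lemma null_sets_P: "E \<in> null_sets P \<longleftrightarrow> E \<in> sets S \<and> M E = (\<lambda>_. 0)"
proof (intro iffI conjI; (elim conjE)?)
  assume E: "E \<in> null_sets P"
  then show E': "E \<in> sets S" by auto
  have "\<phi>\<^sub>0 (M E) = 0" using E E' by (simp add: state_M measure_def null_setsD1)
  then show "M E = (\<lambda>_. 0)" using M_in[OF E'] M_nonneg[OF E'] bounded
    by (intro state_faithful) (auto simp: positive_op_def)
next
  assume "E \<in> sets S" "M E = (\<lambda>_. 0)"
  then show "E \<in> null_sets P" by (auto simp: null_sets_def emeasure_P state_zero)
qed

lemma povm_ae_iff: "povm_ae S M R \<longleftrightarrow> (AE \<omega> in P. R \<omega>)"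
  unfolding povm_ae_def eventually_ae_filter
  by (auto simp: null_sets_P Bex_def)

lemma absolutely_continuous_mu: "absolutely_continuous P (\<mu> x)"
  unfolding absolutely_continuous_def by (auto simp: null_sets_P null_sets_def[of "\<mu> x"] emeasure_mu)

text \<open>A representative of the Radon-Nikodym derivative that is finite and nonnegative at every
  point, available because \<open>\<mu> x\<close> is a finite measure.\<close>

definition dens :: "'h \<Rightarrow> 'w \<Rightarrow> real" where
  "dens x = (SOME h. h \<in> borel_measurable P \<and> (\<forall>\<omega>. 0 \<le> h \<omega>) \<and> density P (\<lambda>\<omega>. ennreal (h \<omega>)) = \<mu> x)"

lemma dens_measurable [measurable]: "dens x \<in> borel_measurable P"
  and dens_nonneg: "0 \<le> dens x \<omega>"
  and density_dens: "density P (\<lambda>\<omega>. ennreal (dens x \<omega>)) = \<mu> x"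
proof -
  obtain h where h: "h \<in> borel_measurable P" "AE \<omega> in P. RN_deriv P (\<mu> x) \<omega> = ennreal (h \<omega>)" "\<And>\<omega>. 0 \<le> h \<omega>"
    using P.real_RN_deriv[OF finite_mu[of x] absolutely_continuous_mu[of x]] by (auto simp: sets_P)
  have "density P (\<lambda>\<omega>. ennreal (h \<omega>)) = density P (RN_deriv P (\<mu> x))"
    using h by (intro density_cong) (auto elim: eventually_mono)
  also have "\<dots> = \<mu> x" by (rule P.density_RN_deriv[OF absolutely_continuous_mu]) simp
  finally have "\<exists>h. h \<in> borel_measurable P \<and> (\<forall>\<omega>. 0 \<le> h \<omega>) \<and> density P (\<lambda>\<omega>. ennreal (h \<omega>)) = \<mu> x"
    using h by blast
  from someI_ex[OF this] show "dens x \<in> borel_measurable P" "0 \<le> dens x \<omega>" "density P (\<lambda>\<omega>. ennreal (dens x \<omega>)) = \<mu> x"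
    unfolding dens_def[symmetric] by auto
qed

lemma nn_integral_mu: "f \<in> borel_measurable S \<Longrightarrow> (\<integral>\<^sup>+\<omega>. f \<omega> \<partial>\<mu> x) = (\<integral>\<^sup>+\<omega>. f \<omega> * ennreal (dens x \<omega>) \<partial>P)"
  unfolding density_dens[symmetric] by (subst nn_integral_density) (auto simp: mult.commute)

lemma dens_integrable: "integrable P (dens x)"
proof (rule integrableI_nonneg)
  have "(\<integral>\<^sup>+\<omega>. ennreal (dens x \<omega>) \<partial>P) = emeasure (\<mu> x) (space S)"
    using nn_integral_mu[of "\<lambda>_. 1" x] by simp
  then show "(\<integral>\<^sup>+\<omega>. ennreal (dens x \<omega>) \<partial>P) < \<infinity>"
    using finite_measure.emeasure_finite[OF finite_mu[of x], of "space S"] by (simp add: top.not_eq_extremum)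
qed (auto simp: dens_nonneg)

lemma integral_mu:
  fixes f :: "'w \<Rightarrow> complex"
  assumes "f \<in> borel_measurable S" shows "(LINT \<omega>|\<mu> x. f \<omega>) = (LINT \<omega>|P. f \<omega> * of_real (dens x \<omega>))"
  unfolding density_dens[symmetric]
  using assms by (subst integral_density) (auto simp: dens_nonneg scaleR_conv_of_real mult.commute)

lemma integral_mu_real:
  fixes f :: "'w \<Rightarrow> real"
  assumes "f \<in> borel_measurable S" shows "(LINT \<omega>|\<mu> x. f \<omega>) = (LINT \<omega>|P. f \<omega> * dens x \<omega>)"
  unfolding density_dens[symmetric]
  using assms by (subst integral_density) (auto simp: dens_nonneg mult.commute)

text \<open>The integral is the series over the binary digits of \<open>f\<close>, which converges
  strongly and so stays in \<open>A\<close>. The state is carried to the limit by order alone: the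
  error \<open>T - Tn n\<close> lies between 0 and 2^(-n) times the identity, and positivity of the
  state preserves these bounds.\<close>

lemma unit_operator:
  assumes f: "f \<in> borel_measurable S" "\<And>\<omega>. \<omega> \<in> space S \<Longrightarrow> 0 \<le> f \<omega> \<and> f \<omega> \<le> (1::real)"
  obtains T where "T \<in> A" "\<And>x. cinner x (T x) = of_real (LINT \<omega>|\<mu> x. f \<omega>)" "\<phi>\<^sub>0 T = of_real (LINT \<omega>|P. f \<omega>)"
proof -
  obtain B where B: "\<And>k::nat. B k \<in> sets S"
    "\<And>q n. q \<in> space S \<Longrightarrow> 0 \<le> f q - (\<Sum>k<n. (1/2)^(k+1) * indicator (B k) q)"
    "\<And>q n. q \<in> space S \<Longrightarrow> f q - (\<Sum>k<n. (1/2)^(k+1) * indicator (B k) q) \<le> (1/2)^n"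
    using dyadic_expansion[OF f] by blast
  have half: "(\<lambda>k. (1/2)^(k+1)) sums (1::real)" using power_half_series by simp
  \<comment> \<open>The measure is left general because the estimate is used for every
    \<open>\<mu> x\<close> and again for \<open>P\<close>.\<close>
  have tail: "0 \<le> (LINT \<omega>|N. f \<omega>) - (\<Sum>k<n. (1/2)^(k+1) * measure N (B k))
      \<and> (LINT \<omega>|N. f \<omega>) - (\<Sum>k<n. (1/2)^(k+1) * measure N (B k)) \<le> (1/2)^n * measure N (space N)"
    if N: "finite_measure N" "sets N = sets S" for N :: "'w measure" and n
  proof -
    interpret finite_measure N by fact
    have sp: "space N = space S" using N(2) by (rule sets_eq_imp_space_eq)
    have fi: "integrable N f"
      using f N(2) sp by (intro integrable_const_bound[where B = 1]) (auto cong: measurable_cong_sets)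
    have Bi: "integrable N (indicator (B k) :: _ \<Rightarrow> real)" for k using B(1) N(2) by (simp add: emeasure_eq_measure)
    have eq: "(LINT \<omega>|N. f \<omega> - (\<Sum>k<n. (1/2)^(k+1) * indicator (B k) \<omega>))
        = (LINT \<omega>|N. f \<omega>) - (\<Sum>k<n. (1/2)^(k+1) * measure N (B k))"
      using fi Bi B(1) N(2) by (simp add: Bochner_Integration.integral_sum)
    have i: "integrable N (\<lambda>\<omega>. f \<omega> - (\<Sum>k<n. (1/2)^(k+1) * indicator (B k) \<omega>))"
      using fi Bi by auto
    have "0 \<le> (LINT \<omega>|N. f \<omega> - (\<Sum>k<n. (1/2)^(k+1) * indicator (B k) \<omega>))"
      using B(2) sp by (intro integral_nonneg_AE AE_I2) auto
    moreover have "(LINT \<omega>|N. f \<omega> - (\<Sum>k<n. (1/2)^(k+1) * indicator (B k) \<omega>)) \<le> (LINT \<omega>|N. (1/2)^n)"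
      using B(3) sp i by (intro integral_mono) auto
    ultimately show ?thesis unfolding eq by (simp add: mult.commute)
  qed
  have tm: "norm (((1/2)^(k+1) :: real) *\<^sub>R M (B k) x) \<le> (1/2)^(k+1) * (2 * norm x)" for k x
    using norm_M[OF B(1)[of k], of x] by (simp add: mult_left_mono)
  have hs: "(\<lambda>k. (1/2)^(k+1) * (2 * norm x)) sums (2 * norm x)" for x :: 'h
    using sums_mult2[OF half, of "2 * norm x"] by simp
  have sm: "summable (\<lambda>k. ((1/2)^(k+1) :: real) *\<^sub>R M (B k) x)" for x
    by (rule summable_comparison_test'[OF sums_summable[OF hs[of x]], of 0]) (rule tm)
  define T where "T x = (\<Sum>k. ((1/2)^(k+1) :: real) *\<^sub>R M (B k) x)" for x
  have Tsums: "(\<lambda>k. ((1/2)^(k+1) :: real) *\<^sub>R M (B k) x) sums T x" for x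
    unfolding T_def using sm by (rule summable_sums)
  have bM: "bounded_op (M (B k))" for k using bounded[OF M_in[OF B(1)]] .
  have bT: "bounded_op T"
    unfolding bounded_op_def
  proof (intro conjI allI)
    show "bounded_linear T"
    proof (rule bounded_linear_intro[where K = 2])
      show "T (x + y) = T x + T y" for x y
        using sums_unique2[OF Tsums[of "x + y"]] sums_add[OF Tsums[of x] Tsums[of y]]
        by (simp add: bounded_op_add[OF bM] scaleR_add_right)
      show "T (r *\<^sub>R x) = r *\<^sub>R T x" for r x
        using sums_unique2[OF Tsums[of "r *\<^sub>R x"]] sums_scaleR_right[OF Tsums[of x], of r]
        by (simp add: bounded_op_scaleC[OF bM] scaleR_scaleC[of r] scaleR_scaleC[of "_ / _"] scaleC_scaleC mult.commute scaleR_scaleC)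
      show "norm (T x) \<le> norm x * 2" for x
      proof -
        have "norm (T x) \<le> (\<Sum>k. norm (((1/2)^(k+1) :: real) *\<^sub>R M (B k) x))"
          unfolding T_def by (rule summable_norm)
            (rule summable_comparison_test'[OF sums_summable[OF hs[of x]], of 0], use tm in simp)
        also have "\<dots> \<le> (\<Sum>k. (1/2)^(k+1) * (2 * norm x))"
          by (intro suminf_le tm sums_summable[OF hs])
            (rule summable_comparison_test'[OF sums_summable[OF hs[of x]], of 0], use tm in simp)
        also have "\<dots> = 2 * norm x" using hs[of x] by (simp add: sums_iff)
        finally show ?thesis by simp
      qed
    qed
    show "T (c *\<^sub>C x) = c *\<^sub>C T x" for c x
    proof -
      have "(\<lambda>k. c *\<^sub>C (((1/2)^(k+1) :: real) *\<^sub>R M (B k) x)) sums (c *\<^sub>C T x)"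
        by (rule bounded_linear.sums[OF bounded_linear_scaleC Tsums])
      moreover have "c *\<^sub>C (((1/2)^(k+1) :: real) *\<^sub>R M (B k) x) = ((1/2)^(k+1) :: real) *\<^sub>R M (B k) (c *\<^sub>C x)" for k
        by (simp add: bounded_op_scaleC[OF bM] scaleR_scaleC scaleC_scaleC mult.commute)
      ultimately show ?thesis using Tsums[of "c *\<^sub>C x"] sums_unique2 by fastforce
    qed
  qed
  define Tn where "Tn n x = (\<Sum>k<n. ((1/2)^(k+1) :: real) *\<^sub>R M (B k) x)" for n x
  have Tn: "Tn n \<in> A \<and> \<phi>\<^sub>0 (Tn n) = of_real (\<Sum>k<n. (1/2)^(k+1) * measure P (B k))" for n
  proof (induction n)
    case 0
    have "Tn 0 = M {}" by (auto simp: Tn_def M_empty)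
    then show ?case using M_in[of "{}"] by (simp add: M_empty state_zero)
  next
    case (Suc n)
    have eq: "Tn (Suc n) = (\<lambda>x. Tn n x + of_real ((1/2)^(n+1)) *\<^sub>C M (B n) x)"
      by (simp add: Tn_def fun_eq_iff scaleR_scaleC)
    have mem: "(\<lambda>x. of_real ((1/2)^(n+1)) *\<^sub>C M (B n) x) \<in> A" using scale_closed[OF M_in[OF B(1)]] .
    show ?case
      unfolding eq state_linear(1)[OF conjunct1[OF Suc] mem] state_linear(2)[OF M_in[OF B(1)]]
      using plus_closed[OF conjunct1[OF Suc] mem] Suc B(1) by (simp add: state_M)
  qed
  have lim: "(\<lambda>n. Tn n x) \<longlonglongrightarrow> T x" for x using Tsums[of x] by (simp add: sums_def Tn_def)
  have TA: "T \<in> A" by (rule limit_closed[OF _ bT lim]) (use Tn in blast)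
  have Tnx: "cinner x (Tn n x) = of_real (\<Sum>k<n. (1/2)^(k+1) * measure (\<mu> x) (B k))" for n x
    using B(1) by (simp add: Tn_def cinner_sum_right cinner_scaleR_right cinner_M)
  have conv: "(\<lambda>n. \<Sum>k<n. (1/2)^(k+1) * measure N (B k)) \<longlonglongrightarrow> (LINT \<omega>|N. f \<omega>)"
    if N: "finite_measure N" "sets N = sets S" for N :: "'w measure"
  proof -
    have "(\<lambda>n. (1/2)^n * measure N (space N)) \<longlonglongrightarrow> 0 * measure N (space N)"
      by (intro tendsto_mult tendsto_const LIMSEQ_power_zero) auto
    then have z: "(\<lambda>n. (1/2)^n * measure N (space N)) \<longlonglongrightarrow> 0" by (simp only: mult_zero_left)
    have "(\<lambda>n. (LINT \<omega>|N. f \<omega>) - (\<Sum>k<n. (1/2)^(k+1) * measure N (B k))) \<longlonglongrightarrow> 0"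
      by (rule tendsto_sandwich[OF always_eventually always_eventually tendsto_const z])
        (intro allI conjunct1[OF tail[OF N]] conjunct2[OF tail[OF N]])+
    then have "(\<lambda>n. (LINT \<omega>|N. f \<omega>) - ((LINT \<omega>|N. f \<omega>) - (\<Sum>k<n. (1/2)^(k+1) * measure N (B k)))) \<longlonglongrightarrow> (LINT \<omega>|N. f \<omega>) - 0"
      by (intro tendsto_diff tendsto_const)
    then show ?thesis by simp
  qed
  have Tx: "cinner x (T x) = of_real (LINT \<omega>|\<mu> x. f \<omega>)" for x
  proof (rule LIMSEQ_unique)
    show "(\<lambda>n. cinner x (Tn n x)) \<longlonglongrightarrow> cinner x (T x)"
      by (rule bounded_linear.tendsto[OF bounded_linear_cinner lim])
    show "(\<lambda>n. cinner x (Tn n x)) \<longlonglongrightarrow> of_real (LINT \<omega>|\<mu> x. f \<omega>)"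
      unfolding Tnx by (intro tendsto_of_real conv finite_mu) simp
  qed
  have d: "(\<lambda>x. T x - Tn n x) \<in> A" for n using diff_closed TA Tn by blast
  have q: "cinner x (T x - Tn n x) = of_real ((LINT \<omega>|\<mu> x. f \<omega>) - (\<Sum>k<n. (1/2)^(k+1) * measure (\<mu> x) (B k)))" for n x
    by (simp only: cinner_diff_right Tx Tnx of_real_diff)
  \<comment> \<open>The error of the state on the \<open>n\<close>-th partial sum. \<open>D1\<close>
    and \<open>D2\<close> place it between 0 and 2^(-n).\<close>
  define D where "D n = \<phi>\<^sub>0 T - \<phi>\<^sub>0 (Tn n)" for n
  have D1: "D n \<in> \<real>\<^sub>\<ge>\<^sub>0" for n
  proof -
    have "\<phi>\<^sub>0 (\<lambda>x. T x - Tn n x) \<in> \<real>\<^sub>\<ge>\<^sub>0"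
      using tail[OF finite_mu] by (intro state_pos d) (simp only: q nonneg_Reals_of_real_iff sets_P)
    then show ?thesis using state_diff[OF TA conjunct1[OF Tn]] by (simp add: D_def)
  qed
  have D2: "of_real ((1/2)^n) - D n \<in> \<real>\<^sub>\<ge>\<^sub>0" for n
  proof -
    have m: "(\<lambda>x. of_real ((1/2)^n) *\<^sub>C id x) \<in> A" using scale_closed[OF id_closed] .
    have "\<phi>\<^sub>0 (\<lambda>x. of_real ((1/2)^n) *\<^sub>C id x - (T x - Tn n x)) \<in> \<real>\<^sub>\<ge>\<^sub>0"
    proof (rule state_pos)
      show "(\<lambda>x. of_real ((1/2)^n) *\<^sub>C id x - (T x - Tn n x)) \<in> A" using diff_closed[OF m d] .
      fix x
      have "cinner x (of_real ((1/2)^n) *\<^sub>C id x) = of_real ((1/2)^n * measure (\<mu> x) (space S))"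
        by (simp add: cinner_scaleC_right cinner_norm measure_mu_space)
      then have "cinner x (of_real ((1/2)^n) *\<^sub>C id x - (T x - Tn n x))
        = of_real ((1/2)^n * measure (\<mu> x) (space S) - ((LINT \<omega>|\<mu> x. f \<omega>) - (\<Sum>k<n. (1/2)^(k+1) * measure (\<mu> x) (B k))))"
        by (simp only: cinner_diff_right[of x "_ *\<^sub>C _"] q of_real_diff)
      then show "cinner x (of_real ((1/2)^n) *\<^sub>C id x - (T x - Tn n x)) \<in> \<real>\<^sub>\<ge>\<^sub>0"
        using tail[OF finite_mu[of x], of n] by (simp only: nonneg_Reals_of_real_iff sets_P space_P) simp
    qed
    also have "\<phi>\<^sub>0 (\<lambda>x. of_real ((1/2)^n) *\<^sub>C id x - (T x - Tn n x)) = of_real ((1/2)^n) - D n"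
      unfolding state_diff[OF m d] state_diff[OF TA conjunct1[OF Tn]] state_linear(2)[OF id_closed] state_id D_def by simp
    finally show ?thesis .
  qed
  have "cmod (D n) \<le> (1/2)^n" for n
  proof -
    have "Im (D n) = 0" "0 \<le> Re (D n)" using D1[of n] by (simp_all add: complex_nonneg_Reals_iff)
    moreover have "0 \<le> Re (of_real ((1/2)^n) - D n)" using D2[of n] unfolding complex_nonneg_Reals_iff by blast
    then have "Re (D n) \<le> (1/2)^n" by (simp only: minus_complex.sel Re_complex_of_real)
    ultimately show ?thesis by (simp only: cmod_eq_Re abs_of_nonneg)
  qed
  then have "D \<longlonglongrightarrow> 0"
    by (intro Lim_null_comparison[where g = "\<lambda>n. (1/2)^n" and f = D]) (auto intro!: LIMSEQ_power_zero)
  then have "(\<lambda>n. \<phi>\<^sub>0 T - D n) \<longlonglongrightarrow> \<phi>\<^sub>0 T - 0" by (intro tendsto_diff tendsto_const)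
  moreover have "(\<lambda>n. \<phi>\<^sub>0 T - D n) \<longlonglongrightarrow> of_real (LINT \<omega>|P. f \<omega>)"
  proof -
    have "\<phi>\<^sub>0 T - D n = \<phi>\<^sub>0 (Tn n)" for n by (simp add: D_def)
    then show ?thesis unfolding conjunct2[OF Tn]
      by (simp only:) (intro tendsto_of_real conv P.finite_measure_axioms sets_P)
  qed
  ultimately have "\<phi>\<^sub>0 T = of_real (LINT \<omega>|P. f \<omega>)" using LIMSEQ_unique by fastforce
  with TA Tx show thesis by (rule that)
qed

end

section \<open>Kernels and channels\<close>

text \<open>A family of densities indexed by vectors need not come from a linear map. If functions
  with values in [0, 1] are represented by elements of \<open>B\<close>, then by linearity all
  classes are; this produces the values of the maps to which \<open>cp_channelI\<close> is
  applied.\<close>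

lemma represent_all:
  fixes B :: "('b, 'u) represented_algebra" and h :: "'u \<Rightarrow> 'w \<Rightarrow> real"
  assumes B: "quadratic_algebra B"
    and h: "\<And>\<zeta>. \<zeta> \<in> vecs B \<Longrightarrow> integrable P (h \<zeta>)"
    and unit: "\<And>f. f \<in> borel_measurable P \<Longrightarrow> (\<And>\<omega>. 0 \<le> f \<omega> \<and> f \<omega> \<le> 1) \<Longrightarrow>
      \<exists>b\<in>elems B. \<forall>\<zeta>\<in>vecs B. mcoef B b \<zeta> \<zeta> = of_real (LINT \<omega>|P. f \<omega> * h \<zeta> \<omega>)"
    and c: "c \<in> elems (Linf_alg P)"
  shows "\<exists>b\<in>elems B. \<forall>\<zeta>\<in>vecs B. mcoef B b \<zeta> \<zeta> = (LINT \<omega>|P. Linf_rep c \<omega> * of_real (h \<zeta> \<omega>))"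
proof -
  interpret B: quadratic_algebra B by fact
  define V where "V = {c \<in> elems (Linf_alg P). \<exists>b\<in>elems B. \<forall>\<zeta>\<in>vecs B.
     mcoef B b \<zeta> \<zeta> = (LINT \<omega>|P. Linf_rep c \<omega> * of_real (h \<zeta> \<omega>))}"
  have hm: "(\<lambda>\<omega>. complex_of_real (h \<zeta> \<omega>)) \<in> borel_measurable P" if "\<zeta> \<in> vecs B" for \<zeta>
    using borel_measurable_integrable[OF h[OF that]] by measurable
  have int: "integrable P (\<lambda>\<omega>. Linf_rep c \<omega> * complex_of_real (h \<zeta> \<omega>))"
    if "\<zeta> \<in> vecs B" "c \<in> elems (Linf_alg P)" for \<zeta> c
    using h[OF that(1)] that(2) by (intro integrable_Linf_mult) auto
  have cong: "(LINT \<omega>|P. Linf_rep c \<omega> * of_real (h \<zeta> \<omega>)) = (LINT \<omega>|P. f \<omega> * of_real (h \<zeta> \<omega>))"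
    if "c \<in> elems (Linf_alg P)" "\<zeta> \<in> vecs B" "f \<in> Linf_funs P" "AE \<omega> in P. Linf_rep c \<omega> = f \<omega>" for c \<zeta> f
    by (rule integral_cong_AE)
      (use that(4) hm[OF that(2)] Linf_funs_measurable[OF that(3)] Linf_funs_measurable[OF Linf_rep_in[OF that(1)]]
       in \<open>auto elim!: eventually_mono\<close>)
  have "c \<in> V"
  proof (rule elems_Linf_span[OF _ _ _ _ c])
    fix c d assume "c \<in> V" "d \<in> V"
    then obtain b b' where c: "c \<in> elems (Linf_alg P)" "d \<in> elems (Linf_alg P)" and b: "b \<in> elems B" "b' \<in> elems B"
      "\<And>\<zeta>. \<zeta> \<in> vecs B \<Longrightarrow> mcoef B b \<zeta> \<zeta> = (LINT \<omega>|P. Linf_rep c \<omega> * of_real (h \<zeta> \<omega>))"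
      "\<And>\<zeta>. \<zeta> \<in> vecs B \<Longrightarrow> mcoef B b' \<zeta> \<zeta> = (LINT \<omega>|P. Linf_rep d \<omega> * of_real (h \<zeta> \<omega>))"
      unfolding V_def by blast
    have "mcoef B (plus_alg B b b') \<zeta> \<zeta> = (LINT \<omega>|P. Linf_rep (plus_alg (Linf_alg P) c d) \<omega> * of_real (h \<zeta> \<omega>))"
      if z: "\<zeta> \<in> vecs B" for \<zeta>
      using cong[OF plus_Linf_in[OF c] z Linf_funs_add[OF Linf_rep_in[OF c(1)] Linf_rep_in[OF c(2)]] AE_rep_plus[OF c]]
        int[OF z c(1)] int[OF z c(2)]
      by (simp add: B.mcoef_plus[OF b(1,2) z] b(3,4)[OF z] distrib_right)
    then show "plus_alg (Linf_alg P) c d \<in> V"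
      using plus_Linf_in[OF c] B.plus_in[OF b(1,2)] unfolding V_def by blast
  next
    fix w c assume "c \<in> V"
    then obtain b where c: "c \<in> elems (Linf_alg P)" and b: "b \<in> elems B"
      "\<And>\<zeta>. \<zeta> \<in> vecs B \<Longrightarrow> mcoef B b \<zeta> \<zeta> = (LINT \<omega>|P. Linf_rep c \<omega> * of_real (h \<zeta> \<omega>))"
      unfolding V_def by blast
    have "mcoef B (scale_alg B w b) \<zeta> \<zeta> = (LINT \<omega>|P. Linf_rep (scale_alg (Linf_alg P) w c) \<omega> * of_real (h \<zeta> \<omega>))"
      if z: "\<zeta> \<in> vecs B" for \<zeta>
      using cong[OF scale_Linf_in[OF c] z Linf_funs_scale[OF Linf_rep_in[OF c]] AE_rep_scale[OF c], of w]
      by (simp add: B.mcoef_scale[OF b(1) z] b(2)[OF z] mult.assoc)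
    then show "scale_alg (Linf_alg P) w c \<in> V"
      using scale_Linf_in[OF c] B.scale_in[OF b(1)] unfolding V_def by blast
  next
    fix f :: "'w \<Rightarrow> real" assume f: "f \<in> borel_measurable P" "\<And>\<omega>. 0 \<le> f \<omega> \<and> f \<omega> \<le> 1"
    obtain b where b: "b \<in> elems B" "\<And>\<zeta>. \<zeta> \<in> vecs B \<Longrightarrow> mcoef B b \<zeta> \<zeta> = of_real (LINT \<omega>|P. f \<omega> * h \<zeta> \<omega>)"
      using unit[OF f] by blast
    have fL: "(\<lambda>\<omega>. complex_of_real (f \<omega>)) \<in> Linf_funs P"
      using f by (intro Linf_funs_of_real[where C = 1]) auto
    have "mcoef B b \<zeta> \<zeta> = (LINT \<omega>|P. Linf_rep (Linf_class P (\<lambda>\<omega>. of_real (f \<omega>))) \<omega> * of_real (h \<zeta> \<omega>))"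
      if z: "\<zeta> \<in> vecs B" for \<zeta>
      using cong[OF Linf_class_in[OF fL] z fL Linf_rep_class(2)[OF fL]]
      by (simp only: b(2)[OF z] of_real_mult[symmetric] integral_complex_of_real)
    then show "Linf_class P (\<lambda>\<omega>. of_real (f \<omega>)) \<in> V" using b(1) fL unfolding V_def by blast
  qed (auto simp: V_def)
  then show ?thesis by (simp add: V_def)
qed

lemma nn_integral_eq_integral_unit:
  assumes "finite_measure R" "k \<in> borel_measurable R" "\<And>\<omega>. \<omega> \<in> space R \<Longrightarrow> 0 \<le> k \<omega> \<and> k \<omega> \<le> (1::real)"
  shows "(\<integral>\<^sup>+\<omega>. ennreal (k \<omega>) \<partial>R) = ennreal (LINT \<omega>|R. k \<omega>)"
proof (rule nn_integral_eq_integral)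
  show "integrable R k"
    using assms(2,3) by (intro finite_measure.integrable_const_bound[OF assms(1), where B = 1]) auto
  show "AE \<omega> in R. 0 \<le> k \<omega>" using assms(3) by (intro AE_I2) auto
qed

text \<open>The predual action of the kernel: a weight on the source side becomes a density with
  respect to \<open>Q\<close>. The condition on null sets in the notion of a weak kernel is exactly
  what makes the derivative exist.\<close>

lemma (in ae_kernel) ex_density:
  assumes Q: "finite_measure Q" and g: "g \<in> borel_measurable P" "(\<integral>\<^sup>+\<omega>. g \<omega> \<partial>P) < \<infinity>"
  obtains h where "h \<in> borel_measurable Q" "\<And>q. 0 \<le> h q" "density Q (\<lambda>q. ennreal (h q)) = kernel_measure Q P \<kappa> g"
    "integrable Q h"
proof -
  interpret Q: finite_measure Q by fact
  let ?\<nu> = "kernel_measure Q P \<kappa> g"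
  have fin: "finite_measure ?\<nu>"
    by (rule finite_measureI) (use emeasure_space_kernel_measure[OF g(1)] g(2) in \<open>simp add: top.not_eq_extremum\<close>)
  obtain h where h: "h \<in> borel_measurable Q" "AE q in Q. RN_deriv Q ?\<nu> q = ennreal (h q)" "\<And>q. 0 \<le> h q"
    using Q.real_RN_deriv[OF fin absolutely_continuous_kernel_measure[OF g(1)]] by (auto simp: sets_kernel_measure)
  have "density Q (\<lambda>q. ennreal (h q)) = density Q (RN_deriv Q ?\<nu>)"
    using h by (intro density_cong) (auto elim: eventually_mono)
  also have "\<dots> = ?\<nu>" by (rule Q.density_RN_deriv[OF absolutely_continuous_kernel_measure[OF g(1)]]) simp
  finally have d: "density Q (\<lambda>q. ennreal (h q)) = ?\<nu>" .
  have "integrable Q h"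
  proof (rule integrableI_nonneg)
    have "(\<integral>\<^sup>+q. ennreal (h q) \<partial>Q) = emeasure (density Q (\<lambda>q. ennreal (h q))) (space Q)"
      using h(1) by (subst emeasure_density) (auto intro!: nn_integral_cong)
    then show "(\<integral>\<^sup>+q. ennreal (h q) \<partial>Q) < \<infinity>"
      using emeasure_space_kernel_measure[OF g(1)] g(2) by (simp add: d)
  qed (use h in auto)
  then show thesis using that h d by blast
qed

section \<open>POVM integrals and the QC channel in terms of densities\<close>

context vn_povm
begin

lemma Linf_operator:
  assumes "c \<in> elems (Linf_alg P)"
  shows "\<exists>T\<in>A. \<forall>x. cinner x (T x) = (LINT \<omega>|P. Linf_rep c \<omega> * of_real (dens x \<omega>))"
proof -
  have "\<exists>b\<in>elems (operator_alg A). \<forall>\<zeta>\<in>vecs (operator_alg A). mcoef (operator_alg A) b \<zeta> \<zeta>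
      = (LINT \<omega>|P. Linf_rep c \<omega> * of_real (dens \<zeta> \<omega>))"
  proof (rule represent_all[OF quadratic_algebra_operators _ _ assms])
    fix f :: "'w \<Rightarrow> real" assume f: "f \<in> borel_measurable P" "\<And>\<omega>. 0 \<le> f \<omega> \<and> f \<omega> \<le> 1"
    then have fS: "f \<in> borel_measurable S" by simp
    obtain T where "T \<in> A" "\<And>x. cinner x (T x) = of_real (LINT \<omega>|\<mu> x. f \<omega>)"
      using unit_operator[OF fS] f(2) by blast
    then show "\<exists>b\<in>elems (operator_alg A). \<forall>\<zeta>\<in>vecs (operator_alg A).
        mcoef (operator_alg A) b \<zeta> \<zeta> = of_real (LINT \<omega>|P. f \<omega> * dens \<zeta> \<omega>)"
      unfolding op_simps integral_mu_real[OF fS] by blast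
  qed (rule dens_integrable)
  then show ?thesis by (simp only: op_simps) blast
qed

lemma povm_integral_eqI:
  assumes "f \<in> borel_measurable S" "bounded_op T" "\<And>x. cinner x (T x) = (LINT \<omega>|P. f \<omega> * of_real (dens x \<omega>))"
  shows "povm_integral S M f = T"
  unfolding povm_integral_def
  by (rule the_equality) (use assms integral_mu in \<open>auto intro: bounded_op_eqI\<close>)

lemma povm_integral:
  assumes f: "f \<in> Linf_funs P"
  shows "povm_integral S M f \<in> A"
    "cinner x (povm_integral S M f x) = (LINT \<omega>|P. f \<omega> * of_real (dens x \<omega>))"
proof -
  have fm: "f \<in> borel_measurable S" using Linf_funs_measurable[OF f] by simp
  obtain T where T: "T \<in> A" "\<And>x. cinner x (T x) = (LINT \<omega>|P. Linf_rep (Linf_class P f) \<omega> * of_real (dens x \<omega>))"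
    using Linf_operator[OF Linf_class_in[OF f]] by blast
  have eq: "(LINT \<omega>|P. Linf_rep (Linf_class P f) \<omega> * of_real (dens x \<omega>)) = (LINT \<omega>|P. f \<omega> * of_real (dens x \<omega>))" for x
  proof (rule integral_cong_AE)
    show "AE \<omega> in P. Linf_rep (Linf_class P f) \<omega> * complex_of_real (dens x \<omega>) = f \<omega> * of_real (dens x \<omega>)"
      using Linf_rep_class(2)[OF f] by eventually_elim simp
  qed (use Linf_funs_measurable[OF f] Linf_funs_measurable[OF Linf_rep_class(1)[OF f]] in measurable)
  have "povm_integral S M f = T"
    using povm_integral_eqI[OF fm bounded[OF T(1)]] T(2) eq by simp
  then show "povm_integral S M f \<in> A" "cinner x (povm_integral S M f x) = (LINT \<omega>|P. f \<omega> * of_real (dens x \<omega>))"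
    using T eq by auto
qed

lemma qc_channel:
  assumes "c \<in> elems (Linf_alg P)"
  shows "qc_channel S M c \<in> A"
    "cinner x (qc_channel S M c x) = (LINT \<omega>|P. Linf_rep c \<omega> * of_real (dens x \<omega>))"
  using povm_integral[OF Linf_rep_in[OF assms]] by (simp_all add: qc_channel_def)

lemma integral_dens: "(LINT \<omega>|P. dens x \<omega>) = (norm x)\<^sup>2"
  using integral_mu_real[of "\<lambda>_. 1" x] measure_mu_space[of x] by simp

text \<open>The densities \<open>dens x\<close> are the family that \<open>cp_channelI\<close> asks
  for. Its condition on the unit holds because \<open>dens x\<close> integrates to the squared norm
  of \<open>x\<close>.\<close>

lemma cp_channel_qc: "cp_channel (Linf_alg P) (operator_alg A) (qc_channel S M)"
  by (rule cp_channelI[OF P.finite_measure_axioms quadratic_algebra_operators, where h = dens])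
    (use dens_integrable dens_nonneg qc_channel integral_dens in \<open>auto simp: op_simps cinner_norm\<close>)

lemma unit_real:
  fixes f :: "'w \<Rightarrow> real"
  assumes f: "f \<in> borel_measurable S" "\<And>\<omega>. \<omega> \<in> space S \<Longrightarrow> 0 \<le> f \<omega> \<and> f \<omega> \<le> 1"
  shows "povm_integral S M (\<lambda>\<omega>. of_real (f \<omega>)) \<in> A"
    "cinner x (povm_integral S M (\<lambda>\<omega>. of_real (f \<omega>)) x) = of_real (LINT \<omega>|\<mu> x. f \<omega>)"
    "\<phi>\<^sub>0 (povm_integral S M (\<lambda>\<omega>. of_real (f \<omega>))) = of_real (LINT \<omega>|P. f \<omega>)"
proof -
  obtain T where T: "T \<in> A" "\<And>x. cinner x (T x) = of_real (LINT \<omega>|\<mu> x. f \<omega>)" "\<phi>\<^sub>0 T = of_real (LINT \<omega>|P. f \<omega>)"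
    using unit_operator[OF f] by blast
  have "povm_integral S M (\<lambda>\<omega>. of_real (f \<omega>)) = T"
    using f T(2) by (intro povm_integral_eqI bounded[OF T(1)])
      (simp_all only: integral_mu_real of_real_mult[symmetric] integral_complex_of_real, measurable)
  then show "povm_integral S M (\<lambda>\<omega>. of_real (f \<omega>)) \<in> A"
    "cinner x (povm_integral S M (\<lambda>\<omega>. of_real (f \<omega>)) x) = of_real (LINT \<omega>|\<mu> x. f \<omega>)"
    "\<phi>\<^sub>0 (povm_integral S M (\<lambda>\<omega>. of_real (f \<omega>))) = of_real (LINT \<omega>|P. f \<omega>)"
    using T by auto
qed

end

section \<open>Postprocessing in terms of scalar measures\<close>

locale two_povms = X: vn_povm A \<phi>\<^sub>0 S\<^sub>1 M + Y: vn_povm A \<phi>\<^sub>0 S\<^sub>2 N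
  for A :: "('h::chilbert_space \<Rightarrow> 'h) set" and \<phi>\<^sub>0
    and S\<^sub>1 :: "'v measure" and M and S\<^sub>2 :: "'w measure" and N
begin

lemma weak_markov_kernel_iff: "weak_markov_kernel S\<^sub>1 M S\<^sub>2 N \<kappa> \<longleftrightarrow> ae_kernel X.P Y.P \<kappa>"
proof
  assume w: "weak_markov_kernel S\<^sub>1 M S\<^sub>2 N \<kappa>"
  note w = w[unfolded weak_markov_kernel_def Y.povm_ae_iff]
  show "ae_kernel X.P Y.P \<kappa>"
  proof
    fix E \<omega> assume "E \<in> sets X.P" "\<omega> \<in> space Y.P"
    then show "0 \<le> \<kappa> E \<omega>" "\<kappa> E \<omega> \<le> 1" using conjunct1[OF w] unfolding X.sets_P Y.space_P by blast+
  next
    fix E assume "E \<in> sets X.P"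
    then have "\<kappa> E \<in> borel_measurable S\<^sub>2" using w unfolding X.sets_P by blast
    then show "\<kappa> E \<in> borel_measurable Y.P" by (simp only: measurable_cong_sets[OF Y.sets_P refl])
  next
    show "AE \<omega> in Y.P. \<kappa> (space X.P) \<omega> = 1" unfolding X.space_P using w by blast
  next
    fix F :: "nat \<Rightarrow> 'v set" assume "range F \<subseteq> sets X.P" "disjoint_family F"
    then show "AE \<omega> in Y.P. (\<lambda>n. \<kappa> (F n) \<omega>) sums \<kappa> (\<Union>n. F n) \<omega>" using w unfolding X.sets_P by blast
  next
    fix Z assume "Z \<in> null_sets X.P"
    then show "AE \<omega> in Y.P. \<kappa> Z \<omega> = 0" using w unfolding X.null_sets_P by blast
  qed
next
  assume "ae_kernel X.P Y.P \<kappa>"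
  then interpret ae_kernel X.P Y.P \<kappa> .
  show "weak_markov_kernel S\<^sub>1 M S\<^sub>2 N \<kappa>"
    unfolding weak_markov_kernel_def Y.povm_ae_iff
  proof (intro conjI ballI allI impI; (elim conjE)?)
    fix E \<omega> assume "E \<in> sets S\<^sub>1" "\<omega> \<in> space S\<^sub>2"
    then show "0 \<le> \<kappa> E \<omega>" "\<kappa> E \<omega> \<le> 1" using bounds[of E \<omega>] by simp_all
  next
    fix E assume "E \<in> sets S\<^sub>1"
    then show "\<kappa> E \<in> borel_measurable S\<^sub>2" using meas[of E] by simp
  next
    show "AE \<omega> in Y.P. \<kappa> (space S\<^sub>1) \<omega> = 1" using total by simp
  next
    fix F :: "nat \<Rightarrow> 'v set" assume "range F \<subseteq> sets S\<^sub>1" "disjoint_family F"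
    then show "AE \<omega> in Y.P. (\<lambda>n. \<kappa> (F n) \<omega>) sums \<kappa> (\<Union>n. F n) \<omega>" using sigma_additive[of F] by simp
  next
    fix Z assume "Z \<in> sets S\<^sub>1" "M Z = (\<lambda>_. 0)"
    then show "AE \<omega> in Y.P. \<kappa> Z \<omega> = 0" using null[of Z] by (simp add: X.null_sets_P)
  qed
qed

lemma postprocessing_iff:
  "postprocessing S\<^sub>1 M S\<^sub>2 N \<kappa> \<longleftrightarrow> ae_kernel X.P Y.P \<kappa> \<and>
     (\<forall>E\<in>sets S\<^sub>1. \<forall>x. measure (X.\<mu> x) E = (LINT \<omega>|Y.\<mu> x. \<kappa> E \<omega>))"
proof -
  have "M E = povm_integral S\<^sub>2 N (\<lambda>\<omega>. complex_of_real (\<kappa> E \<omega>)) \<longleftrightarrow> (\<forall>x. measure (X.\<mu> x) E = (LINT \<omega>|Y.\<mu> x. \<kappa> E \<omega>))"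
    if \<kappa>: "ae_kernel X.P Y.P \<kappa>" and E: "E \<in> sets S\<^sub>1" for E
  proof -
    interpret ae_kernel X.P Y.P \<kappa> by fact
    have k: "\<kappa> E \<in> borel_measurable S\<^sub>2" "\<And>\<omega>. \<omega> \<in> space S\<^sub>2 \<Longrightarrow> 0 \<le> \<kappa> E \<omega> \<and> \<kappa> E \<omega> \<le> 1"
      using meas[of E] bounds[of E] E by auto
    have "M E = povm_integral S\<^sub>2 N (\<lambda>\<omega>. complex_of_real (\<kappa> E \<omega>)) \<longleftrightarrow>
      (\<forall>x. cinner x (M E x) = cinner x (povm_integral S\<^sub>2 N (\<lambda>\<omega>. complex_of_real (\<kappa> E \<omega>)) x))"
      by (auto intro: X.eqI[OF X.M_in[OF E] Y.unit_real(1)[OF k]])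
    moreover have "cinner x (povm_integral S\<^sub>2 N (\<lambda>\<omega>. complex_of_real (\<kappa> E \<omega>)) x) = of_real (LINT \<omega>|Y.\<mu> x. \<kappa> E \<omega>)" for x
      by (rule Y.unit_real(2)) (use k in auto)
    ultimately show ?thesis unfolding X.cinner_M[OF E] by (simp only: of_real_eq_iff)
  qed
  then show ?thesis unfolding postprocessing_def weak_markov_kernel_iff by blast
qed

text \<open>The state is not assumed to be a vector state, so this is not an instance of the
  identities for \<open>\<mu> x\<close>. It comes from applying the state to the operator identity,
  through the third part of \<open>unit_real\<close>.\<close>

lemma postprocessing_state:
  assumes "postprocessing S\<^sub>1 M S\<^sub>2 N \<kappa>" "E \<in> sets S\<^sub>1"
  shows "measure X.P E = (LINT \<omega>|Y.P. \<kappa> E \<omega>)"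
proof -
  interpret ae_kernel X.P Y.P \<kappa> using assms(1) by (simp add: postprocessing_iff)
  have k: "\<kappa> E \<in> borel_measurable S\<^sub>2" "\<And>\<omega>. \<omega> \<in> space S\<^sub>2 \<Longrightarrow> 0 \<le> \<kappa> E \<omega> \<and> \<kappa> E \<omega> \<le> 1"
    using meas[of E] bounds[of E] assms(2) by auto
  have "M E = povm_integral S\<^sub>2 N (\<lambda>\<omega>. complex_of_real (\<kappa> E \<omega>))"
    using assms by (simp add: postprocessing_def)
  then have "complex_of_real (measure X.P E) = of_real (LINT \<omega>|Y.P. \<kappa> E \<omega>)"
    using X.state_M[OF assms(2)] Y.unit_real(3)[OF k] by simp
  then show ?thesis using of_real_eq_iff by blast
qed

text \<open>Postprocessing as transport of measures: the kernel carries every scalar measure of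
  \<open>N\<close> to that of \<open>M\<close>. In this form the condition composes;
  \<open>postprocessingI\<close> is the way back.\<close>

lemma postprocessing_kernel_measure:
  assumes "postprocessing S\<^sub>1 M S\<^sub>2 N \<kappa>"
  shows "kernel_measure X.P Y.P \<kappa> (\<lambda>\<omega>. ennreal (Y.dens x \<omega>)) = X.\<mu> x"
    "kernel_measure X.P Y.P \<kappa> (\<lambda>\<omega>. 1) = X.P"
proof -
  interpret ae_kernel X.P Y.P \<kappa> using assms(1) by (simp add: postprocessing_iff)
  have nn: "(\<integral>\<^sup>+\<omega>. ennreal (\<kappa> E \<omega>) \<partial>R) = ennreal (LINT \<omega>|R. \<kappa> E \<omega>)"
    if E: "E \<in> sets S\<^sub>1" and R: "finite_measure R" "sets R = sets S\<^sub>2" for E and R :: "'w measure"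
  proof (rule nn_integral_eq_integral_unit[OF R(1)])
    have "\<kappa> E \<in> borel_measurable S\<^sub>2" using meas[of E] E by auto
    then show "\<kappa> E \<in> borel_measurable R" by (simp only: measurable_cong_sets[OF R(2) refl])
    show "0 \<le> \<kappa> E \<omega> \<and> \<kappa> E \<omega> \<le> 1" if "\<omega> \<in> space R" for \<omega>
      using bounds[of E \<omega>] E that unfolding sets_eq_imp_space_eq[OF R(2)] by auto
  qed
  show "kernel_measure X.P Y.P \<kappa> (\<lambda>\<omega>. ennreal (Y.dens x \<omega>)) = X.\<mu> x"
  proof (rule measure_eqI)
    fix E assume "E \<in> sets (kernel_measure X.P Y.P \<kappa> (\<lambda>\<omega>. ennreal (Y.dens x \<omega>)))"
    then have E: "E \<in> sets S\<^sub>1" by simp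
    have "emeasure (kernel_measure X.P Y.P \<kappa> (\<lambda>\<omega>. ennreal (Y.dens x \<omega>))) E = (\<integral>\<^sup>+\<omega>. ennreal (\<kappa> E \<omega>) \<partial>Y.\<mu> x)"
      using E meas[of E] by (subst emeasure_kernel_measure) (auto simp: Y.nn_integral_mu)
    also have "\<dots> = ennreal (measure (X.\<mu> x) E)"
      using assms E by (subst nn) (auto simp: postprocessing_iff Y.finite_mu)
    also have "\<dots> = emeasure (X.\<mu> x) E"
      by (rule finite_measure.emeasure_eq_measure[OF X.finite_mu, symmetric])
    finally show "emeasure (kernel_measure X.P Y.P \<kappa> (\<lambda>\<omega>. ennreal (Y.dens x \<omega>))) E = emeasure (X.\<mu> x) E" .
  qed simp
  show "kernel_measure X.P Y.P \<kappa> (\<lambda>\<omega>. 1) = X.P"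
  proof (rule measure_eqI)
    fix E assume "E \<in> sets (kernel_measure X.P Y.P \<kappa> (\<lambda>\<omega>. 1))"
    then have E: "E \<in> sets S\<^sub>1" by simp
    show "emeasure (kernel_measure X.P Y.P \<kappa> (\<lambda>\<omega>. 1)) E = emeasure X.P E"
      using E nn[OF E Y.P.finite_measure_axioms] postprocessing_state[OF assms E]
      by (simp add: emeasure_kernel_measure X.P.emeasure_eq_measure)
  qed simp
qed

lemma postprocessingI:
  assumes "ae_kernel X.P Y.P \<kappa>"
    and "\<And>x. kernel_measure X.P Y.P \<kappa> (\<lambda>\<omega>. ennreal (Y.dens x \<omega>)) = X.\<mu> x"
  shows "postprocessing S\<^sub>1 M S\<^sub>2 N \<kappa>"
  unfolding postprocessing_iff
proof (intro conjI ballI allI)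
  interpret ae_kernel X.P Y.P \<kappa> by fact
  fix E x assume E: "E \<in> sets S\<^sub>1"
  have m: "\<kappa> E \<in> borel_measurable (Y.\<mu> x)" using meas[of E] E by auto
  have "(\<integral>\<^sup>+\<omega>. ennreal (\<kappa> E \<omega>) \<partial>Y.\<mu> x) = emeasure (X.\<mu> x) E"
    using E meas[of E] by (subst assms(2)[symmetric], subst emeasure_kernel_measure) (auto simp: Y.nn_integral_mu)
  then have "measure (X.\<mu> x) E = enn2real (\<integral>\<^sup>+\<omega>. ennreal (\<kappa> E \<omega>) \<partial>Y.\<mu> x)" by (simp add: measure_def)
  also have "\<dots> = (LINT \<omega>|Y.\<mu> x. \<kappa> E \<omega>)"
    using m bounds[of E] E by (intro integral_eq_nn_integral[symmetric] AE_I2) auto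
  finally show "measure (X.\<mu> x) E = (LINT \<omega>|Y.\<mu> x. \<kappa> E \<omega>)" .
qed (fact assms(1))

end

section \<open>Channels of an \<open>L\<^sup>\<infinity>\<close> algebra\<close>

locale Linf_channel = finite_measure P for P :: "'w measure" +
  fixes \<Gamma>
  assumes channel: "cp_channel (Linf_alg P) (Linf_alg P) \<Gamma>"
begin

abbreviation "alg \<equiv> Linf_alg P"
abbreviation "cls \<equiv> Linf_class P"

lemma lin: "a \<in> elems alg \<Longrightarrow> \<Gamma> a \<in> elems alg"
   "a \<in> elems alg \<Longrightarrow> b \<in> elems alg \<Longrightarrow> \<Gamma> (plus_alg alg a b) = plus_alg alg (\<Gamma> a) (\<Gamma> b)"
   "a \<in> elems alg \<Longrightarrow> \<Gamma> (scale_alg alg z a) = scale_alg alg z (\<Gamma> a)"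
  and unital: "\<Gamma> (cls (\<lambda>_. 1)) = cls (\<lambda>_. 1)"
  and cp: "completely_positive alg alg \<Gamma>" and normal: "normal_map alg alg \<Gamma>"
  using channel by (auto simp: cp_channel_def linear_on_alg_def one_Linf)

lemma AE_add:
  assumes "f \<in> Linf_funs P" "g \<in> Linf_funs P"
  shows "AE \<omega> in P. Linf_rep (\<Gamma> (cls (\<lambda>\<omega>. f \<omega> + g \<omega>))) \<omega> = Linf_rep (\<Gamma> (cls f)) \<omega> + Linf_rep (\<Gamma> (cls g)) \<omega>"
proof -
  have "\<Gamma> (cls (\<lambda>\<omega>. f \<omega> + g \<omega>)) = plus_alg alg (\<Gamma> (cls f)) (\<Gamma> (cls g))"
    using assms by (simp add: plus_Linf_class[symmetric] lin(2))
  then show ?thesis using AE_rep_plus[of "\<Gamma> (cls f)" P "\<Gamma> (cls g)"] assms lin(1) by simp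
qed

text \<open>Positivity is complete positivity for matrices of size one. Comparison with the zero
  class translates it into a pointwise statement.\<close>

lemma AE_nonneg:
  assumes f: "f \<in> Linf_funs P" and nn: "AE \<omega> in P. f \<omega> \<in> \<real>\<^sub>\<ge>\<^sub>0"
  shows "AE \<omega> in P. Linf_rep (\<Gamma> (cls f)) \<omega> \<in> \<real>\<^sub>\<ge>\<^sub>0"
proof -
  have "0 \<in> \<real>\<^sub>\<ge>\<^sub>0" by simp
  have zero: "cls (\<lambda>_. 0) \<in> elems alg" by auto
  have "AE \<omega> in P. Linf_rep (cls (\<lambda>_. 0)) \<omega> = 0" by (rule Linf_rep_class) auto
  then have z: "mcoef alg (cls (\<lambda>_. 0)) \<xi> \<xi> = 0" for \<xi>
    unfolding mcoef_Linf by (intro integral_eq_zero_AE) (auto elim: eventually_mono)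
  have iff: "(\<forall>\<xi>\<in>vecs alg. mcoef alg c \<xi> \<xi> \<in> \<real>\<^sub>\<ge>\<^sub>0) \<longleftrightarrow> (AE \<omega> in P. Linf_rep c \<omega> \<in> \<real>\<^sub>\<ge>\<^sub>0)" if c: "c \<in> elems alg" for c
  proof -
    have "(\<forall>\<xi>\<in>vecs alg. mcoef alg c \<xi> \<xi> \<in> \<real>\<^sub>\<ge>\<^sub>0) \<longleftrightarrow> le_alg alg (cls (\<lambda>_. 0)) c" by (simp add: le_alg_def z)
    also have "\<dots> \<longleftrightarrow> (AE \<omega> in P. Linf_rep c \<omega> - Linf_rep (cls (\<lambda>_. 0)) \<omega> \<in> \<real>\<^sub>\<ge>\<^sub>0)"
      by (rule le_Linf_iff[OF finite_measure_axioms zero c])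
    also have "\<dots> \<longleftrightarrow> (AE \<omega> in P. Linf_rep c \<omega> \<in> \<real>\<^sub>\<ge>\<^sub>0)"
      by (rule eventually_subst) (use \<open>AE \<omega> in P. Linf_rep (cls (\<lambda>_. 0)) \<omega> = 0\<close> in eventually_elim, simp)
    finally show ?thesis .
  qed
  have "AE \<omega> in P. Linf_rep (cls f) \<omega> \<in> \<real>\<^sub>\<ge>\<^sub>0"
    using nn Linf_rep_class(2)[OF f] by eventually_elim simp
  then have p: "\<forall>\<xi>\<in>vecs alg. mcoef alg (cls f) \<xi> \<xi> \<in> \<real>\<^sub>\<ge>\<^sub>0" using iff f by auto
  have "matrix_positive alg 1 (\<lambda>_ _. cls f)"
    using f p unfolding matrix_positive_def by auto
  then have m: "matrix_positive alg 1 (\<lambda>_ _. \<Gamma> (cls f))" using cp unfolding completely_positive_def by blast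
  have "mcoef alg (\<Gamma> (cls f)) \<xi> \<xi> \<in> \<real>\<^sub>\<ge>\<^sub>0" if "\<xi> \<in> vecs alg" for \<xi>
    using m that unfolding matrix_positive_def by (auto dest!: spec[of _ "\<lambda>_. \<xi>"])
  then show ?thesis using iff lin(1) f by auto
qed

text \<open>Both \<open>f\<close> and \<open>r - f\<close> are nonnegative, and a unital map fixes
  the constant \<open>r\<close>. The bound \<open>r\<close> is left general because the dyadic
  errors, of size 2^(-n), are treated in this way too.\<close>

lemma AE_unit_interval:
  assumes f: "f \<in> borel_measurable P" "AE \<omega> in P. 0 \<le> f \<omega> \<and> f \<omega> \<le> r"
  shows "AE \<omega> in P. Im (Linf_rep (\<Gamma> (cls (\<lambda>\<omega>. complex_of_real (f \<omega>)))) \<omega>) = 0 \<and>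
    0 \<le> Re (Linf_rep (\<Gamma> (cls (\<lambda>\<omega>. complex_of_real (f \<omega>)))) \<omega>) \<and>
    Re (Linf_rep (\<Gamma> (cls (\<lambda>\<omega>. complex_of_real (f \<omega>)))) \<omega>) \<le> r"
proof -
  have f1: "(\<lambda>\<omega>. complex_of_real (f \<omega>)) \<in> Linf_funs P"
    by (rule Linf_funs_of_real[OF f(1), of r]) (use f(2) in eventually_elim, simp)
  have f2: "(\<lambda>\<omega>. complex_of_real (r - f \<omega>)) \<in> Linf_funs P"
    by (rule Linf_funs_of_real[of _ _ r]) (use f(1) in measurable, use f(2) in eventually_elim, simp)
  have one: "(\<lambda>\<omega>. 1) \<in> Linf_funs P" by simp
  have "\<Gamma> (cls (\<lambda>\<omega>. of_real r * 1)) = cls (\<lambda>\<omega>. of_real r * 1)"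
    using lin(3)[OF Linf_class_in[OF one], of "of_real r"] unfolding unital scale_Linf_class[OF one] .
  then have r: "\<Gamma> (cls (\<lambda>\<omega>. complex_of_real (f \<omega>) + complex_of_real (r - f \<omega>))) = cls (\<lambda>_. of_real r)" by simp
  have 1: "AE \<omega> in P. Linf_rep (\<Gamma> (cls (\<lambda>\<omega>. complex_of_real (f \<omega>)))) \<omega> \<in> \<real>\<^sub>\<ge>\<^sub>0"
    by (rule AE_nonneg[OF f1]) (use f(2) in eventually_elim, simp)
  have 2: "AE \<omega> in P. Linf_rep (\<Gamma> (cls (\<lambda>\<omega>. complex_of_real (r - f \<omega>)))) \<omega> \<in> \<real>\<^sub>\<ge>\<^sub>0"
    by (rule AE_nonneg[OF f2]) (use f(2) in eventually_elim, simp only: nonneg_Reals_of_real_iff, simp)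
  have 3: "AE \<omega> in P. Linf_rep (cls (\<lambda>_. complex_of_real r)) \<omega> = of_real r"
    by (rule Linf_rep_class) auto
  show ?thesis
    using 1 2 3 AE_add[OF f1 f2, unfolded r]
    by eventually_elim (auto simp: complex_nonneg_Reals_iff complex_eq_iff)
qed

definition \<rho> :: "'w set \<Rightarrow> 'w \<Rightarrow> real" where "\<rho> E \<omega> = Re (Linf_rep (\<Gamma> (cls (indicator E))) \<omega>)"

text \<open>The representative \<open>\<rho> E\<close> obeys the bounds only almost everywhere,
  whereas a weak Markov kernel must take values in [0, 1] at every point.\<close>

definition \<kappa> :: "'w set \<Rightarrow> 'w \<Rightarrow> real" where "\<kappa> E \<omega> = min 1 (max 0 (\<rho> E \<omega>))"

lemma indicator_of_real: "(indicator E :: 'w \<Rightarrow> complex) = (\<lambda>\<omega>. complex_of_real (indicator E \<omega>))"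
  by (auto simp: indicator_def fun_eq_iff)

lemma rho_bounds:
  assumes "E \<in> sets P"
  shows "AE \<omega> in P. Linf_rep (\<Gamma> (cls (indicator E))) \<omega> = of_real (\<rho> E \<omega>) \<and> 0 \<le> \<rho> E \<omega> \<and> \<rho> E \<omega> \<le> 1"
  using AE_unit_interval[of "indicator E" 1] assms unfolding indicator_of_real[symmetric]
  by (auto simp: \<rho>_def complex_eq_iff indicator_def elim!: eventually_mono)

lemma kappa_eq_rho:
  assumes "E \<in> sets P" shows "AE \<omega> in P. \<kappa> E \<omega> = \<rho> E \<omega>"
  using rho_bounds[OF assms] by eventually_elim (auto simp: \<kappa>_def)

lemma rho_measurable [measurable]: "E \<in> sets P \<Longrightarrow> \<rho> E \<in> borel_measurable P"
proof -
  assume E: "E \<in> sets P"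
  have "Linf_rep (\<Gamma> (cls (indicator E))) \<in> borel_measurable P"
    by (intro Linf_funs_measurable Linf_rep_in lin Linf_class_in Linf_funs_indicator E)
  then show ?thesis unfolding \<rho>_def by measurable
qed

lemma rho_add:
  assumes "E \<in> sets P" "F \<in> sets P" "E \<inter> F = {}"
  shows "AE \<omega> in P. \<rho> (E \<union> F) \<omega> = \<rho> E \<omega> + \<rho> F \<omega>"
proof -
  have "(indicator (E \<union> F) :: 'w \<Rightarrow> complex) = (\<lambda>\<omega>. indicator E \<omega> + indicator F \<omega>)"
    using assms(3) by (auto simp: indicator_def fun_eq_iff)
  then show ?thesis
    using AE_add[OF Linf_funs_indicator[OF assms(1)] Linf_funs_indicator[OF assms(2)]]
    unfolding \<rho>_def by simp (auto elim!: eventually_mono)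
qed

lemma indicator_selfadjoint: "E \<in> sets P \<Longrightarrow> cls (indicator E) \<in> selfadjoint_elems alg"
  using Linf_of_real_selfadjoint(1)[OF finite_measure_axioms, of "indicator E" 1]
  unfolding indicator_of_real[symmetric] by (auto simp: indicator_def)

lemma Gamma_indicator_selfadjoint: "E \<in> sets P \<Longrightarrow> \<Gamma> (cls (indicator E)) \<in> selfadjoint_elems alg"
  using rho_bounds[of E] unfolding selfadjoint_Linf_iff[OF finite_measure_axioms]
  by (auto intro!: lin elim!: eventually_mono)

text \<open>The indicators of the partial unions increase to the indicator of the union. Normality
  preserves this supremum, and by \<open>increasing_lub\<close> a supremum of an increasing sequence
  is its limit almost everywhere.\<close>

lemma rho_sums:
  assumes F: "range F \<subseteq> sets P" "disjoint_family F"
  shows "AE \<omega> in P. (\<lambda>n::nat. \<rho> (F n) \<omega>) sums \<rho> (\<Union>n. F n) \<omega>"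
proof -
  define G where "G n = (\<Union>i<n. F i)" for n
  have Fn: "F n \<in> sets P" for n using F by auto
  have G: "G n \<in> sets P" for n using Fn by (auto simp: G_def)
  have incG: "incseq G" unfolding G_def incseq_def by (intro allI impI UN_mono) auto
  have UG: "(\<Union>n. G n) = (\<Union>n. F n)" by (auto simp: G_def)
  have "G (Suc n) = G n \<union> F n" for n by (auto simp: G_def lessThan_Suc)
  moreover have "G n \<inter> F n = {}" for n
  proof -
    have "F i \<inter> F n = {}" if "i < n" for i
      using F(2) that unfolding disjoint_family_on_def by (metis UNIV_I less_irrefl)
    then show ?thesis by (auto simp: G_def)
  qed
  ultimately have step: "AE \<omega> in P. \<rho> (G (Suc n)) \<omega> = \<rho> (G n) \<omega> + \<rho> (F n) \<omega>" for n
    using rho_add[OF G Fn] by metis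
  have G0: "AE \<omega> in P. \<rho> (G 0) \<omega> = 0"
    using rho_add[of "{}" "{}"] by (auto simp: G_def elim!: eventually_mono)
  define c where "c n = \<Gamma> (cls (indicator (G n)))" for n
  have csa: "c n \<in> selfadjoint_elems alg" for n unfolding c_def by (rule Gamma_indicator_selfadjoint[OF G])
  have "AE \<omega> in P. Re (Linf_rep (c n) \<omega>) \<le> Re (Linf_rep (c (Suc n)) \<omega>)" for n
    using step[of n] rho_bounds[OF Fn[of n]] unfolding c_def \<rho>_def[symmetric] by eventually_elim simp
  then have inc: "le_alg alg (c n) (c (Suc n))" for n
    using le_Linf_iff_Re[OF finite_measure_axioms csa csa] by blast
  have ind_le: "le_alg alg (cls (indicator (G m))) (cls (indicator (G n)))" if "m \<le> n" for m n
  proof -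
    have sub: "G m \<subseteq> G n" using incG that by (rule incseqD)
    have "AE \<omega> in P. Linf_rep (cls (indicator (G n))) \<omega> - Linf_rep (cls (indicator (G m))) \<omega> \<in> \<real>\<^sub>\<ge>\<^sub>0"
      using Linf_rep_class(2)[OF Linf_funs_indicator[OF G[of n]]] Linf_rep_class(2)[OF Linf_funs_indicator[OF G[of m]]]
      by eventually_elim (use sub in \<open>auto simp: indicator_def\<close>)
    then show ?thesis using le_Linf_iff[OF finite_measure_axioms] G by blast
  qed
  have dir: "\<exists>c\<in>range (\<lambda>n. cls (indicator (G n))). le_alg alg a c \<and> le_alg alg b c"
    if ab: "a \<in> range (\<lambda>n. cls (indicator (G n)))" "b \<in> range (\<lambda>n. cls (indicator (G n)))" for a b
  proof -
    obtain m n where mn: "a = cls (indicator (G m))" "b = cls (indicator (G n))" using ab by auto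
    show ?thesis unfolding mn
      by (intro bexI[of _ "cls (indicator (G (max m n)))"] conjI ind_le) auto
  qed
  have "is_lub_alg alg (\<Gamma> ` range (\<lambda>n. cls (indicator (G n)))) (\<Gamma> (cls (indicator (\<Union>n. G n))))"
    by (rule normal[unfolded normal_map_def, THEN spec, THEN spec, THEN mp])
      (intro conjI ballI dir is_lub_increasing_indicators[OF finite_measure_axioms G incG];
       use indicator_selfadjoint[OF G] in auto)
  then have "is_lub_alg alg (range c) (\<Gamma> (cls (indicator (\<Union>n. F n))))"
    by (simp add: image_image c_def[abs_def] UG)
  from increasing_lub[OF finite_measure_axioms csa inc this]
  have lim: "AE \<omega> in P. (\<lambda>n. \<rho> (G n) \<omega>) \<longlonglongrightarrow> \<rho> (\<Union>n. F n) \<omega>"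
    by (simp add: c_def \<rho>_def)
  have "AE \<omega> in P. \<forall>n. \<rho> (G (Suc n)) \<omega> = \<rho> (G n) \<omega> + \<rho> (F n) \<omega>"
    unfolding AE_all_countable using step by blast
  then show ?thesis using G0 lim
  proof eventually_elim
    case (elim \<omega>)
    have "\<rho> (G n) \<omega> = (\<Sum>i<n. \<rho> (F i) \<omega>)" for n
      by (induction n) (use elim in auto)
    then show ?case using elim(3) by (simp add: sums_def)
  qed
qed

lemma ae_kernel_kappa: "ae_kernel P P \<kappa>"
proof
  show "0 \<le> \<kappa> E \<omega>" "\<kappa> E \<omega> \<le> 1" for E \<omega> by (auto simp: \<kappa>_def)
  show "\<kappa> E \<in> borel_measurable P" if "E \<in> sets P" for E
    using rho_measurable[OF that] unfolding \<kappa>_def by measurable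
  show "AE \<omega> in P. \<kappa> (space P) \<omega> = 1"
  proof -
    have "AE \<omega> in P. indicator (space P) \<omega> = (1::complex)" using AE_space by eventually_elim simp
    then have "cls (indicator (space P)) = cls (\<lambda>_. 1)" by (subst Linf_class_eq_iff) auto
    then have "\<Gamma> (cls (indicator (space P))) = cls (\<lambda>_. 1)" by (simp add: unital)
    moreover have "AE \<omega> in P. Linf_rep (cls (\<lambda>_. 1)) \<omega> = 1" by (rule Linf_rep_class) auto
    ultimately show ?thesis by (auto simp: \<kappa>_def \<rho>_def elim!: eventually_mono)
  qed
  show "AE \<omega> in P. (\<lambda>n. \<kappa> (F n) \<omega>) sums \<kappa> (\<Union>n. F n) \<omega>"
    if F: "range F \<subseteq> sets P" "disjoint_family F" for F :: "nat \<Rightarrow> 'w set"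
  proof -
    have "AE \<omega> in P. \<forall>n. \<kappa> (F n) \<omega> = \<rho> (F n) \<omega>"
      unfolding AE_all_countable using F kappa_eq_rho by blast
    moreover have "AE \<omega> in P. \<kappa> (\<Union>n. F n) \<omega> = \<rho> (\<Union>n. F n) \<omega>" using F by (intro kappa_eq_rho) auto
    ultimately show ?thesis using rho_sums[OF F] by eventually_elim simp
  qed
  show "AE \<omega> in P. \<kappa> Z \<omega> = 0" if Z: "Z \<in> null_sets P" for Z
  proof -
    have "AE \<omega> in P. \<omega> \<notin> Z" using Z by (rule AE_not_in)
    then have "AE \<omega> in P. indicator Z \<omega> = (indicator {} \<omega> :: complex)" by eventually_elim simp
    then have "cls (indicator Z) = cls (indicator {})" using Z by (subst Linf_class_eq_iff) auto
    then have "\<rho> Z = \<rho> {}" by (simp add: \<rho>_def fun_eq_iff)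
    moreover have "AE \<omega> in P. \<rho> {} \<omega> = 0" using rho_add[of "{}" "{}"] by (auto elim!: eventually_mono)
    ultimately show ?thesis by (auto simp: \<kappa>_def elim!: eventually_mono)
  qed
qed

text \<open>A dyadic partial sum of \<open>f\<close> is fixed by linearity. The error term lies
  between 0 and 2^(-n) and so does its image, being the image under a positive unital map; hence
  \<open>f\<close> and its image differ by at most 2^(-n) for every \<open>n\<close>.\<close>

lemma identity_of_indicators:
  assumes ind: "\<And>E. E \<in> sets P \<Longrightarrow> \<Gamma> (cls (indicator E)) = cls (indicator E)" and c: "c \<in> elems alg"
  shows "\<Gamma> c = c"
proof -
  have "c \<in> {c \<in> elems alg. \<Gamma> c = c}"
  proof (rule elems_Linf_span[OF _ _ _ _ c])
    fix f :: "'w \<Rightarrow> real" assume f: "f \<in> borel_measurable P" "\<And>\<omega>. 0 \<le> f \<omega> \<and> f \<omega> \<le> 1"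
    let ?F = "\<lambda>\<omega>. complex_of_real (f \<omega>)"
    have fL: "?F \<in> Linf_funs P" using f by (intro Linf_funs_of_real[where C = 1]) auto
    obtain B where B: "\<And>k::nat. B k \<in> sets P"
      "\<And>q n. q \<in> space P \<Longrightarrow> 0 \<le> f q - (\<Sum>k<n. (1/2)^(k+1) * indicator (B k) q)"
      "\<And>q n. q \<in> space P \<Longrightarrow> f q - (\<Sum>k<n. (1/2)^(k+1) * indicator (B k) q) \<le> (1/2)^n"
      using dyadic_expansion[OF f] by blast
    define s where "s n \<omega> = (\<Sum>k<n. (1/2)^(k+1) * indicator (B k) \<omega> :: real)" for n \<omega>
    have sm: "s n \<in> borel_measurable P" for n unfolding s_def using B(1) by measurable
    have s: "(\<lambda>\<omega>. complex_of_real (s n \<omega>)) \<in> Linf_funs P \<and>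
       \<Gamma> (cls (\<lambda>\<omega>. complex_of_real (s n \<omega>))) = cls (\<lambda>\<omega>. complex_of_real (s n \<omega>))" for n
    proof (induction n)
      case 0
      have "(\<lambda>\<omega>. complex_of_real (s 0 \<omega>)) = indicator {}" by (auto simp: s_def)
      then show ?case using ind[of "{}"] by simp
    next
      case (Suc n)
      let ?g = "\<lambda>\<omega>. complex_of_real ((1/2)^(n+1)) * indicator (B n) \<omega>"
      have eq: "(\<lambda>\<omega>. complex_of_real (s (Suc n) \<omega>)) = (\<lambda>\<omega>. complex_of_real (s n \<omega>) + ?g \<omega>)"
        by (auto simp: s_def fun_eq_iff indicator_def)
      have g: "?g \<in> Linf_funs P" by (rule Linf_funs_scale[OF Linf_funs_indicator[OF B(1)]])
      have g': "\<Gamma> (cls ?g) = cls ?g"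
        using lin(3)[OF Linf_class_in[OF Linf_funs_indicator[OF B(1)[of n]]], of "complex_of_real ((1/2)^(n+1))"]
        unfolding ind[OF B(1)] scale_Linf_class[OF Linf_funs_indicator[OF B(1)]] .
      show ?case
        unfolding eq using Suc g g' lin(2)[OF Linf_class_in Linf_class_in, OF conjunct1[OF Suc] g]
        by (simp only: Linf_funs_add plus_Linf_class)
    qed
    have "AE \<omega> in P. cmod (Linf_rep (\<Gamma> (cls ?F)) \<omega> - f \<omega>) \<le> (1/2)^n" for n
    proof -
      have dm: "(\<lambda>\<omega>. f \<omega> - s n \<omega>) \<in> borel_measurable P" using f(1) sm by measurable
      have db: "AE \<omega> in P. 0 \<le> f \<omega> - s n \<omega> \<and> f \<omega> - s n \<omega> \<le> (1/2)^n"
        using B(2,3) by (intro AE_I2) (auto simp: s_def)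
      have dL: "(\<lambda>\<omega>. complex_of_real (f \<omega> - s n \<omega>)) \<in> Linf_funs P"
        by (rule Linf_funs_of_real[OF dm, of "(1/2)^n"]) (use db in eventually_elim, simp)
      have eq: "(\<lambda>\<omega>. complex_of_real (s n \<omega>) + complex_of_real (f \<omega> - s n \<omega>)) = ?F" by auto
      show ?thesis
        using AE_add[OF conjunct1[OF s[of n]] dL, unfolded eq conjunct2[OF s[of n]]] AE_unit_interval[OF dm db]
          Linf_rep_class(2)[OF conjunct1[OF s[of n]]] db
      proof eventually_elim
        case (elim \<omega>)
        define z where "z = Linf_rep (\<Gamma> (cls (\<lambda>\<omega>. complex_of_real (f \<omega> - s n \<omega>)))) \<omega>"
        have z: "Im z = 0" "0 \<le> Re z" "Re z \<le> (1/2)^n" using elim(2) by (simp_all add: z_def)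
        have "Linf_rep (\<Gamma> (cls ?F)) \<omega> = of_real (s n \<omega>) + z"
          using elim(1,3) by (simp only: z_def)
        then have "Linf_rep (\<Gamma> (cls ?F)) \<omega> - f \<omega> = complex_of_real (Re z - (f \<omega> - s n \<omega>))"
          using z(1) by (simp add: complex_eq_iff)
        then have "cmod (Linf_rep (\<Gamma> (cls ?F)) \<omega> - f \<omega>) = \<bar>Re z - (f \<omega> - s n \<omega>)\<bar>"
          by (simp only: norm_of_real)
        then show ?case using z elim(4) by linarith
      qed
    qed
    then have "AE \<omega> in P. \<forall>n. cmod (Linf_rep (\<Gamma> (cls ?F)) \<omega> - f \<omega>) \<le> (1/2)^n"
      unfolding AE_all_countable by blast
    then have "AE \<omega> in P. Linf_rep (\<Gamma> (cls ?F)) \<omega> = ?F \<omega>"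
    proof eventually_elim
      case (elim \<omega>)
      have "(\<lambda>n. (1/2)^n :: real) \<longlonglongrightarrow> 0" by (rule LIMSEQ_power_zero) auto
      then have "cmod (Linf_rep (\<Gamma> (cls ?F)) \<omega> - f \<omega>) \<le> 0"
        using elim by (intro LIMSEQ_le_const) auto
      then show ?case by simp
    qed
    then have "AE \<omega> in P. Linf_rep (\<Gamma> (cls ?F)) \<omega> = Linf_rep (cls ?F) \<omega>"
      using Linf_rep_class(2)[OF fL] by eventually_elim simp
    then have "\<Gamma> (cls ?F) = cls ?F" 
      by (rule Linf_eqI[OF lin(1)[OF Linf_class_in[OF fL]] Linf_class_in[OF fL]])
    then show "cls ?F \<in> {c \<in> elems alg. \<Gamma> c = c}" using fL by auto
  qed (auto simp: lin plus_Linf_in scale_Linf_in)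
  then show ?thesis by simp
qed

end

section \<open>Kernel minimality and minimality of the QC channel\<close>

context vn_povm
begin

lemma self_pair: "two_povms A \<phi>\<^sub>0 S M S M"
  by (intro two_povms.intro vn_povm_axioms)

text \<open>The invariance of the QC channel under \<open>\<Gamma>\<close>, read on indicators, says
  that the kernel of \<open>\<Gamma>\<close> postprocesses \<open>M\<close> to itself. Minimality
  then makes \<open>\<Gamma>\<close> fix all indicators.\<close>

theorem kernel_minimal_imp_channel_minimal:
  assumes K: "kernel_minimal_sufficient S M"
  shows "minimal_sufficient (Linf_alg P) (operator_alg A) (qc_channel S M)"
  unfolding minimal_sufficient_def
proof (intro conjI allI impI ballI cp_channel_qc, elim conjE)
  fix \<Gamma> a assume \<Gamma>: "cp_channel (Linf_alg P) (Linf_alg P) \<Gamma>"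
    and inv: "\<forall>a\<in>elems (Linf_alg P). qc_channel S M (\<Gamma> a) = qc_channel S M a"
    and a: "a \<in> elems (Linf_alg P)"
  interpret G: Linf_channel P \<Gamma> by standard (rule \<Gamma>)
  interpret two_povms A \<phi>\<^sub>0 S M S M by (rule self_pair)
  have "postprocessing S M S M G.\<kappa>"
    unfolding postprocessing_def weak_markov_kernel_iff
  proof (intro conjI ballI G.ae_kernel_kappa)
    fix E assume E: "E \<in> sets S"
    then have EP: "E \<in> sets P" by simp
    have km: "G.\<kappa> E \<in> borel_measurable P" using G.ae_kernel_kappa EP by (rule ae_kernel.meas)
    let ?c = "Linf_class P (indicator E)"
    have c: "?c \<in> elems (Linf_alg P)" using EP by auto
    have "povm_integral S M (\<lambda>\<omega>. complex_of_real (G.\<kappa> E \<omega>)) = M E"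
    proof (rule povm_integral_eqI)
      show "(\<lambda>\<omega>. complex_of_real (G.\<kappa> E \<omega>)) \<in> borel_measurable S" using km by simp
      show "bounded_op (M E)" using bounded[OF M_in[OF E]] .
      fix x
      have "(LINT \<omega>|P. complex_of_real (G.\<kappa> E \<omega>) * of_real (dens x \<omega>))
          = (LINT \<omega>|P. Linf_rep (\<Gamma> ?c) \<omega> * of_real (dens x \<omega>))"
      proof (rule integral_cong_AE)
        show "AE \<omega> in P. complex_of_real (G.\<kappa> E \<omega>) * of_real (dens x \<omega>) = Linf_rep (\<Gamma> ?c) \<omega> * of_real (dens x \<omega>)"
          using G.kappa_eq_rho[OF EP] G.rho_bounds[OF EP] by eventually_elim simp
      qed (use km Linf_funs_measurable[OF Linf_rep_in[OF G.lin(1)[OF c]]] in measurable)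
      also have "\<dots> = cinner x (qc_channel S M ?c x)"
        using qc_channel(2)[OF G.lin(1)[OF c]] inv c by simp
      also have "\<dots> = (LINT \<omega>|P. Linf_rep ?c \<omega> * of_real (dens x \<omega>))" by (rule qc_channel(2)[OF c])
      also have "\<dots> = (LINT \<omega>|P. indicator E \<omega> * of_real (dens x \<omega>))"
      proof (rule integral_cong_AE)
        show "AE \<omega> in P. Linf_rep ?c \<omega> * complex_of_real (dens x \<omega>) = indicator E \<omega> * of_real (dens x \<omega>)"
          using Linf_rep_class(2)[OF Linf_funs_indicator[OF EP]] by eventually_elim simp
      qed (use EP Linf_funs_measurable[OF Linf_rep_in[OF c]] in measurable)
      also have "\<dots> = (LINT \<omega>|\<mu> x. indicator E \<omega>)"
        by (rule integral_mu[symmetric]) (use E in measurable)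
      also have "\<dots> = (LINT \<omega>|\<mu> x. of_real (indicator E \<omega>))" by (simp add: of_real_indicator)
      also have "\<dots> = of_real (LINT \<omega>|\<mu> x. indicator E \<omega>)" by (rule integral_complex_of_real)
      also have "\<dots> = cinner x (M E x)" using E by (simp add: cinner_M)
      finally show "cinner x (M E x) = (LINT \<omega>|P. complex_of_real (G.\<kappa> E \<omega>) * of_real (dens x \<omega>))" by simp
    qed
    then show "M E = povm_integral S M (\<lambda>\<omega>. complex_of_real (G.\<kappa> E \<omega>))" by simp
  qed
  then have fixed: "AE \<omega> in P. G.\<kappa> E \<omega> = indicator E \<omega>" if "E \<in> sets P" for E
    using K that unfolding kernel_minimal_sufficient_def povm_ae_iff by simp
  show "\<Gamma> a = a"
  proof (rule G.identity_of_indicators[OF _ a])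
    fix E assume E: "E \<in> sets P"
    have "AE \<omega> in P. Linf_rep (\<Gamma> (Linf_class P (indicator E))) \<omega> = Linf_rep (Linf_class P (indicator E)) \<omega>"
      using fixed[OF E] G.kappa_eq_rho[OF E] G.rho_bounds[OF E] Linf_rep_class(2)[OF Linf_funs_indicator[OF E]]
      by eventually_elim (auto simp: indicator_def)
    then show "\<Gamma> (Linf_class P (indicator E)) = Linf_class P (indicator E)"
      by (rule Linf_eqI[OF G.lin(1)[OF Linf_class_in[OF Linf_funs_indicator[OF E]]] Linf_class_in[OF Linf_funs_indicator[OF E]]])
  qed
qed

text \<open>The channel is built from its action on densities. The weight of a vector
  \<open>\<zeta>\<close> is transported by the kernel to a density \<open>H \<zeta>\<close>, and
  \<open>\<Gamma> c\<close> is the class whose form at \<open>\<zeta>\<close> is the integral of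
  \<open>c\<close> against \<open>H \<zeta>\<close>. On indicators this gives back the kernel, so
  triviality of the channel makes the kernel trivial.\<close>

theorem channel_minimal_imp_kernel_minimal:
  assumes min: "minimal_sufficient (Linf_alg P) (operator_alg A) (qc_channel S M)"
  shows "kernel_minimal_sufficient S M"
  unfolding kernel_minimal_sufficient_def povm_ae_iff
proof (intro allI impI ballI)
  fix \<kappa> E assume pp: "postprocessing S M S M \<kappa>" and E: "E \<in> sets S"
  interpret two_povms A \<phi>\<^sub>0 S M S M by (rule self_pair)
  interpret ae_kernel P P \<kappa> using pp by (simp add: postprocessing_iff)
  let ?A = "Linf_alg P"
  \<comment> \<open>The vector functional of \<open>\<zeta>\<close> on L^infinity is integration
    against this weight.\<close>
  let ?g = "\<lambda>\<zeta> \<omega>. ennreal ((cmod (\<zeta> \<omega>))\<^sup>2)"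
  have vm: "\<zeta> \<in> borel_measurable P" "integrable P (\<lambda>\<omega>. (cmod (\<zeta> \<omega>))\<^sup>2)" if "\<zeta> \<in> vecs ?A" for \<zeta>
    using that by (simp_all add: vecs_Linf)
  have "\<exists>h. h \<in> borel_measurable P \<and> (\<forall>\<omega>. 0 \<le> h \<omega>) \<and> density P (\<lambda>\<omega>. ennreal (h \<omega>)) = kernel_measure P P \<kappa> (?g \<zeta>)
      \<and> integrable P h" if z: "\<zeta> \<in> vecs ?A" for \<zeta>
  proof -
    have g1: "?g \<zeta> \<in> borel_measurable P" using vm(1)[OF z] by measurable
    have g2: "(\<integral>\<^sup>+\<omega>. ?g \<zeta> \<omega> \<partial>P) < \<infinity>" using vm(2)[OF z] by (simp add: nn_integral_eq_integral)
    show ?thesis using ex_density[OF P.finite_measure_axioms g1 g2] by blast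
  qed
  then obtain H where H: "\<And>\<zeta>. \<zeta> \<in> vecs ?A \<Longrightarrow> H \<zeta> \<in> borel_measurable P" "\<And>\<zeta> \<omega>. \<zeta> \<in> vecs ?A \<Longrightarrow> 0 \<le> H \<zeta> \<omega>"
    "\<And>\<zeta>. \<zeta> \<in> vecs ?A \<Longrightarrow> density P (\<lambda>\<omega>. ennreal (H \<zeta> \<omega>)) = kernel_measure P P \<kappa> (?g \<zeta>)"
    "\<And>\<zeta>. \<zeta> \<in> vecs ?A \<Longrightarrow> integrable P (H \<zeta>)"
    by metis
  have transfer: "mcoef ?A (Linf_class P (\<lambda>\<omega>. of_real (u \<omega>))) \<zeta> \<zeta> = of_real (LINT \<omega>|P. f \<omega> * H \<zeta> \<omega>)"
    if u: "u \<in> borel_measurable P" "\<And>\<omega>. \<omega> \<in> space P \<Longrightarrow> 0 \<le> u \<omega> \<and> u \<omega> \<le> 1"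
      and f: "f \<in> borel_measurable P" "\<And>\<omega>. 0 \<le> f \<omega> \<and> f \<omega> \<le> (1::real)"
      and eq: "\<And>g. g \<in> borel_measurable P \<Longrightarrow>
      (\<integral>\<^sup>+\<omega>. ennreal (u \<omega>) * g \<omega> \<partial>P) = (\<integral>\<^sup>+q. ennreal (f q) \<partial>kernel_measure P P \<kappa> g)"
      and z: "\<zeta> \<in> vecs ?A" for u f \<zeta>
  proof -
    have uL: "(\<lambda>\<omega>. complex_of_real (u \<omega>)) \<in> Linf_funs P"
      using u by (intro Linf_funs_of_real[where C = 1]) auto
    have zm [measurable]: "\<zeta> \<in> borel_measurable P" using vm(1)[OF z] .
    have g1: "?g \<zeta> \<in> borel_measurable P" by measurable
    have "mcoef ?A (Linf_class P (\<lambda>\<omega>. of_real (u \<omega>))) \<zeta> \<zeta> = (LINT \<omega>|P. of_real (u \<omega> * (cmod (\<zeta> \<omega>))\<^sup>2))"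
      unfolding mcoef_Linf_diag
    proof (rule integral_cong_AE)
      show "AE \<omega> in P. Linf_rep (Linf_class P (\<lambda>\<omega>. complex_of_real (u \<omega>))) \<omega> * complex_of_real ((cmod (\<zeta> \<omega>))\<^sup>2)
          = complex_of_real (u \<omega> * (cmod (\<zeta> \<omega>))\<^sup>2)"
        using Linf_rep_class(2)[OF uL] by eventually_elim simp
    qed (use u(1) Linf_funs_measurable[OF Linf_rep_class(1)[OF uL]] in measurable)
    also have "\<dots> = of_real (LINT \<omega>|P. u \<omega> * (cmod (\<zeta> \<omega>))\<^sup>2)" by (rule integral_complex_of_real)
    also have "(LINT \<omega>|P. u \<omega> * (cmod (\<zeta> \<omega>))\<^sup>2) = enn2real (\<integral>\<^sup>+\<omega>. ennreal (u \<omega> * (cmod (\<zeta> \<omega>))\<^sup>2) \<partial>P)"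
      using u by (intro integral_eq_nn_integral AE_I2) auto
    also have "(\<integral>\<^sup>+\<omega>. ennreal (u \<omega> * (cmod (\<zeta> \<omega>))\<^sup>2) \<partial>P) = (\<integral>\<^sup>+\<omega>. ennreal (u \<omega>) * ?g \<zeta> \<omega> \<partial>P)"
      using u by (intro nn_integral_cong ennreal_mult) auto
    also have "\<dots> = (\<integral>\<^sup>+q. ennreal (f q) \<partial>density P (\<lambda>\<omega>. ennreal (H \<zeta> \<omega>)))"
      unfolding eq[OF g1] H(3)[OF z] ..
    also have "\<dots> = (\<integral>\<^sup>+q. ennreal (f q * H \<zeta> q) \<partial>P)"
      using H(1,2)[OF z] f by (subst nn_integral_density) (auto simp: ennreal_mult mult.commute intro!: nn_integral_cong)
    also have "enn2real \<dots> = (LINT \<omega>|P. f \<omega> * H \<zeta> \<omega>)"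
      using H(1,2)[OF z] f by (intro integral_eq_nn_integral[symmetric] AE_I2) auto
    finally show ?thesis .
  qed
  have ex: "\<forall>c\<in>elems ?A. \<exists>b\<in>elems ?A. \<forall>\<zeta>\<in>vecs ?A. mcoef ?A b \<zeta> \<zeta> = (LINT \<omega>|P. Linf_rep c \<omega> * of_real (H \<zeta> \<omega>))"
  proof
    fix c assume c: "c \<in> elems ?A"
    show "\<exists>b\<in>elems ?A. \<forall>\<zeta>\<in>vecs ?A. mcoef ?A b \<zeta> \<zeta> = (LINT \<omega>|P. Linf_rep c \<omega> * of_real (H \<zeta> \<omega>))"
    proof (rule represent_all[OF P.quadratic_algebra_Linf H(4) _ c])
      fix f :: "'w \<Rightarrow> real" assume f: "f \<in> borel_measurable P" "\<And>\<omega>. 0 \<le> f \<omega> \<and> f \<omega> \<le> 1"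
      obtain u where u: "u \<in> borel_measurable P" "\<And>\<omega>. \<omega> \<in> space P \<Longrightarrow> 0 \<le> u \<omega> \<and> u \<omega> \<le> (1::real)"
        "\<And>g. g \<in> borel_measurable P \<Longrightarrow>
          (\<integral>\<^sup>+\<omega>. ennreal (u \<omega>) * g \<omega> \<partial>P) = (\<integral>\<^sup>+q. ennreal (f q) \<partial>kernel_measure P P \<kappa> g)"
        using apply_function[of f] f by blast
      have "Linf_class P (\<lambda>\<omega>. of_real (u \<omega>)) \<in> elems ?A"
        using u by (intro Linf_class_in Linf_funs_of_real[where C = 1]) auto
      then show "\<exists>b\<in>elems ?A. \<forall>\<zeta>\<in>vecs ?A. mcoef ?A b \<zeta> \<zeta> = of_real (LINT \<omega>|P. f \<omega> * H \<zeta> \<omega>)"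
        using transfer[OF u(1,2) f u(3)] by blast
    qed
  qed
  obtain \<Gamma> where \<Gamma>: "\<And>c. c \<in> elems ?A \<Longrightarrow> \<Gamma> c \<in> elems ?A"
    "\<And>c \<zeta>. c \<in> elems ?A \<Longrightarrow> \<zeta> \<in> vecs ?A \<Longrightarrow> mcoef ?A (\<Gamma> c) \<zeta> \<zeta> = (LINT \<omega>|P. Linf_rep c \<omega> * of_real (H \<zeta> \<omega>))"
    using bchoice[OF ex[unfolded Bex_def]] by blast
  have image: "mcoef ?A (Linf_class P (\<lambda>\<omega>. of_real (\<kappa> F \<omega>))) \<zeta> \<zeta> = of_real (LINT \<omega>|P. indicator F \<omega> * H \<zeta> \<omega>)"
    if F: "F \<in> sets P" and z: "\<zeta> \<in> vecs ?A" for F \<zeta>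
  proof (rule transfer[OF _ _ _ _ _ z])
    show "(\<integral>\<^sup>+\<omega>. ennreal (\<kappa> F \<omega>) * g \<omega> \<partial>P) = (\<integral>\<^sup>+q. ennreal (indicator F q) \<partial>kernel_measure P P \<kappa> g)"
      if "g \<in> borel_measurable P" for g
      using F by (simp add: emeasure_kernel_measure[OF that F, symmetric] ennreal_indicator)
  qed (use F meas bounds in \<open>auto simp: indicator_def\<close>)
  have "cp_channel ?A ?A \<Gamma>"
  proof (rule cp_channelI[OF P.finite_measure_axioms P.quadratic_algebra_Linf H(4) H(2) \<Gamma>])
    fix \<zeta> assume z: "\<zeta> \<in> vecs ?A"
    have k: "Linf_class P (\<lambda>\<omega>. complex_of_real (\<kappa> (space P) \<omega>)) = one_alg ?A"
      unfolding one_Linf using total meas[of "space P"] bounds[of "space P"]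
      by (subst Linf_class_eq_iff) (auto intro!: Linf_funs_of_real[where C = 1] elim!: eventually_mono)
    have "mcoef ?A (one_alg ?A) \<zeta> \<zeta> = of_real (LINT \<omega>|P. indicator (space P) \<omega> * H \<zeta> \<omega>)"
      unfolding k[symmetric] by (rule image[OF sets.top z])
    also have "(LINT \<omega>|P. indicator (space P) \<omega> * H \<zeta> \<omega>) = integral\<^sup>L P (H \<zeta>)"
      by (intro Bochner_Integration.integral_cong) auto
    finally show "mcoef ?A (one_alg ?A) \<zeta> \<zeta> = of_real (integral\<^sup>L P (H \<zeta>))" .
  qed
  moreover have "qc_channel S M (\<Gamma> c) = qc_channel S M c" if c: "c \<in> elems ?A" for c
  proof (rule eqI)
    fix x
    \<comment> \<open>With this vector the functional of \<open>x\<close> on operators becomes a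
      vector functional on L^infinity, since the weight of \<open>\<zeta>\<close> is
      \<open>dens x\<close>. The kernel preserves \<open>\<mu> x\<close>, so the transported density
      \<open>H \<zeta>\<close> is \<open>dens x\<close> again.\<close>
    define \<zeta> where "\<zeta> \<omega> = complex_of_real (sqrt (dens x \<omega>))" for \<omega>
    have sq: "(cmod (\<zeta> \<omega>))\<^sup>2 = dens x \<omega>" for \<omega> by (simp add: \<zeta>_def dens_nonneg)
    have "\<zeta> \<in> borel_measurable P" unfolding \<zeta>_def by measurable
    then have z: "\<zeta> \<in> vecs ?A" by (simp add: vecs_Linf sq dens_integrable)
    have "density P (\<lambda>\<omega>. ennreal (H \<zeta> \<omega>)) = density P (\<lambda>\<omega>. ennreal (dens x \<omega>))"
      unfolding H(3)[OF z] sq postprocessing_kernel_measure(1)[OF pp] density_dens ..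
    then have "AE \<omega> in P. ennreal (H \<zeta> \<omega>) = ennreal (dens x \<omega>)"
      using H(1)[OF z] by (intro P.density_unique) auto
    then have ae: "AE \<omega> in P. H \<zeta> \<omega> = dens x \<omega>"
      by eventually_elim (simp add: H(2)[OF z] dens_nonneg)
    have "cinner x (qc_channel S M (\<Gamma> c) x) = mcoef ?A (\<Gamma> c) \<zeta> \<zeta>"
      unfolding qc_channel(2)[OF \<Gamma>(1)[OF c]] mcoef_Linf_diag sq ..
    also have "\<dots> = (LINT \<omega>|P. Linf_rep c \<omega> * of_real (H \<zeta> \<omega>))" by (rule \<Gamma>(2)[OF c z])
    also have "\<dots> = (LINT \<omega>|P. Linf_rep c \<omega> * of_real (dens x \<omega>))"
    proof (rule integral_cong_AE)
      show "AE \<omega> in P. Linf_rep c \<omega> * complex_of_real (H \<zeta> \<omega>) = Linf_rep c \<omega> * of_real (dens x \<omega>)"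
        using ae by eventually_elim simp
    qed (use H(1)[OF z] Linf_funs_measurable[OF Linf_rep_in[OF c]] in measurable)
    also have "\<dots> = cinner x (qc_channel S M c x)" by (rule qc_channel(2)[OF c, symmetric])
    finally show "cinner x (qc_channel S M (\<Gamma> c) x) = cinner x (qc_channel S M c x)" .
  qed (use c \<Gamma> qc_channel in auto)
  ultimately have id: "\<Gamma> c = c" if "c \<in> elems ?A" for c
    using min that unfolding minimal_sufficient_def by blast
  have EP: "E \<in> sets P" using E by simp
  let ?k = "\<lambda>\<omega>. complex_of_real (\<kappa> E \<omega>)"
  have kL: "?k \<in> Linf_funs P"
    using meas[OF EP] bounds[OF EP] by (intro Linf_funs_of_real[where C = 1]) auto
  have cE: "Linf_class P (indicator E) \<in> elems ?A" using EP by auto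
  have "Linf_class P ?k = \<Gamma> (Linf_class P (indicator E))"
  proof (rule quadratic_algebra.eqI[OF P.quadratic_algebra_Linf])
    fix \<zeta> assume z: "\<zeta> \<in> vecs ?A"
    have "mcoef ?A (\<Gamma> (Linf_class P (indicator E))) \<zeta> \<zeta> = (LINT \<omega>|P. of_real (indicator E \<omega> * H \<zeta> \<omega>))"
      unfolding \<Gamma>(2)[OF cE z]
    proof (rule integral_cong_AE)
      show "AE \<omega> in P. Linf_rep (Linf_class P (indicator E)) \<omega> * complex_of_real (H \<zeta> \<omega>) = complex_of_real (indicator E \<omega> * H \<zeta> \<omega>)"
        using Linf_rep_class(2)[OF Linf_funs_indicator[OF EP]] by eventually_elim (simp add: of_real_indicator)
    qed (use H(1)[OF z] EP Linf_funs_measurable[OF Linf_rep_in[OF cE]] in measurable)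
    also have "\<dots> = of_real (LINT \<omega>|P. indicator E \<omega> * H \<zeta> \<omega>)" by (rule integral_complex_of_real)
    finally show "mcoef ?A (Linf_class P ?k) \<zeta> \<zeta> = mcoef ?A (\<Gamma> (Linf_class P (indicator E))) \<zeta> \<zeta>"
      using image[OF EP z] by simp
  qed (use kL \<Gamma>(1)[OF cE] in auto)
  then have "Linf_class P ?k = Linf_class P (indicator E)" using id[OF cE] by simp
  then have "AE \<omega> in P. ?k \<omega> = indicator E \<omega>"
    using Linf_class_eq_iff[OF kL Linf_funs_indicator[OF EP]] by simp
  then show "AE \<omega> in P. \<kappa> E \<omega> = indicator E \<omega>"
    by eventually_elim (auto simp: indicator_def split: if_splits)
qed

end

section \<open>Relabeling minimality\<close>

lemma AE_eq_of_set_nn_integrals: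
  fixes u v :: "'w \<Rightarrow> ennreal"
  assumes "finite_measure P" "u \<in> borel_measurable P" "v \<in> borel_measurable P"
    "\<And>B. B \<in> sets P \<Longrightarrow> (\<integral>\<^sup>+\<omega>. u \<omega> * indicator B \<omega> \<partial>P) = (\<integral>\<^sup>+\<omega>. v \<omega> * indicator B \<omega> \<partial>P)"
  shows "AE \<omega> in P. u \<omega> = v \<omega>"
  by (rule finite_measure.density_unique_finite_measure[OF assms(1-3)]) (use assms(4) in auto)

text \<open>For each \<open>E\<close> the function \<open>\<kappa>1 E\<close> is pushed through
  \<open>\<kappa>2\<close> by its binary digits, with an independent choice for every
  \<open>E\<close>. This is harmless: the identity against all weights determines the result up to a
  null set, and the laws of a weak kernel are only required almost everywhere, where weights that
  are indicators test them.\<close>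

lemma compose_kernels:
  fixes P :: "'w measure" and Q :: "'v measure" and R :: "'u measure"
  assumes P: "finite_measure P" and k1: "ae_kernel R Q \<kappa>1" and k2: "ae_kernel Q P \<kappa>2"
  obtains \<kappa> where "ae_kernel R P \<kappa>" "\<And>E g. E \<in> sets R \<Longrightarrow> g \<in> borel_measurable P \<Longrightarrow>
    (\<integral>\<^sup>+\<omega>. ennreal (\<kappa> E \<omega>) * g \<omega> \<partial>P) = (\<integral>\<^sup>+q. ennreal (\<kappa>1 E q) \<partial>kernel_measure Q P \<kappa>2 g)"
proof -
  interpret k1: ae_kernel R Q \<kappa>1 by fact
  interpret k2: ae_kernel Q P \<kappa>2 by fact
  have "\<forall>E\<in>sets R. \<exists>u. u \<in> borel_measurable P \<and> (\<forall>\<omega>\<in>space P. 0 \<le> u \<omega> \<and> u \<omega> \<le> (1::real)) \<and>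
    (\<forall>g\<in>borel_measurable P. (\<integral>\<^sup>+\<omega>. ennreal (u \<omega>) * g \<omega> \<partial>P) = (\<integral>\<^sup>+q. ennreal (\<kappa>1 E q) \<partial>kernel_measure Q P \<kappa>2 g))"
  proof
    fix E assume E: "E \<in> sets R"
    have b: "\<And>q. q \<in> space Q \<Longrightarrow> 0 \<le> \<kappa>1 E q \<and> \<kappa>1 E q \<le> 1" using k1.bounds[OF E] by blast
    show "\<exists>u. u \<in> borel_measurable P \<and> (\<forall>\<omega>\<in>space P. 0 \<le> u \<omega> \<and> u \<omega> \<le> (1::real)) \<and>
      (\<forall>g\<in>borel_measurable P. (\<integral>\<^sup>+\<omega>. ennreal (u \<omega>) * g \<omega> \<partial>P) = (\<integral>\<^sup>+q. ennreal (\<kappa>1 E q) \<partial>kernel_measure Q P \<kappa>2 g))"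
    proof (rule k2.apply_function[OF k1.meas[OF E] b])
      fix u assume u: "u \<in> borel_measurable P" "\<And>\<omega>. \<omega> \<in> space P \<Longrightarrow> 0 \<le> u \<omega> \<and> u \<omega> \<le> (1::real)"
        "\<And>g. g \<in> borel_measurable P \<Longrightarrow>
          (\<integral>\<^sup>+\<omega>. ennreal (u \<omega>) * g \<omega> \<partial>P) = (\<integral>\<^sup>+q. ennreal (\<kappa>1 E q) \<partial>kernel_measure Q P \<kappa>2 g)"
      show ?thesis by (intro exI[of _ u] conjI ballI u(1) u(2) u(3))
    qed
  qed
  from bchoice[OF this] obtain \<kappa> where \<kappa>0: "\<forall>E\<in>sets R. \<kappa> E \<in> borel_measurable P \<and>
      (\<forall>\<omega>\<in>space P. 0 \<le> \<kappa> E \<omega> \<and> \<kappa> E \<omega> \<le> (1::real)) \<and>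
    (\<forall>g\<in>borel_measurable P. (\<integral>\<^sup>+\<omega>. ennreal (\<kappa> E \<omega>) * g \<omega> \<partial>P) = (\<integral>\<^sup>+q. ennreal (\<kappa>1 E q) \<partial>kernel_measure Q P \<kappa>2 g))" ..
  have \<kappa>: "\<And>E. E \<in> sets R \<Longrightarrow> \<kappa> E \<in> borel_measurable P"
    "\<And>E \<omega>. E \<in> sets R \<Longrightarrow> \<omega> \<in> space P \<Longrightarrow> 0 \<le> \<kappa> E \<omega> \<and> \<kappa> E \<omega> \<le> (1::real)"
    "\<And>E g. E \<in> sets R \<Longrightarrow> g \<in> borel_measurable P \<Longrightarrow>
      (\<integral>\<^sup>+\<omega>. ennreal (\<kappa> E \<omega>) * g \<omega> \<partial>P) = (\<integral>\<^sup>+q. ennreal (\<kappa>1 E q) \<partial>kernel_measure Q P \<kappa>2 g)"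
    using \<kappa>0 by blast+
  \<comment> \<open>The laws of \<open>\<kappa>1\<close> hold almost everywhere for
    \<open>Q\<close>. Absolute continuity carries them to the measures against which the composite
    integrates.\<close>
  have ac: "AE q in kernel_measure Q P \<kappa>2 g. R' q" if "g \<in> borel_measurable P" "AE q in Q. R' q" for g R'
    using absolutely_continuous_AE[OF _ k2.absolutely_continuous_kernel_measure[OF that(1)] that(2)] by simp
  have ind: "(\<lambda>\<omega>. indicator B \<omega> :: ennreal) \<in> borel_measurable P" if "B \<in> sets P" for B
    using that by measurable
  have "ae_kernel R P \<kappa>"
  proof
    show "0 \<le> \<kappa> E \<omega>" "\<kappa> E \<omega> \<le> 1" if "E \<in> sets R" "\<omega> \<in> space P" for E \<omega> using \<kappa>(2)[OF that] by auto
    show "\<kappa> E \<in> borel_measurable P" if "E \<in> sets R" for E using \<kappa>(1)[OF that] .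
    show "AE \<omega> in P. \<kappa> (space R) \<omega> = 1"
    proof -
      have "AE \<omega> in P. ennreal (\<kappa> (space R) \<omega>) = 1"
      proof (rule AE_eq_of_set_nn_integrals[OF P])
        fix B assume B: "B \<in> sets P"
        have "(\<integral>\<^sup>+\<omega>. ennreal (\<kappa> (space R) \<omega>) * indicator B \<omega> \<partial>P)
            = (\<integral>\<^sup>+q. ennreal (\<kappa>1 (space R) q) \<partial>kernel_measure Q P \<kappa>2 (indicator B))"
          by (rule \<kappa>(3)[OF sets.top ind[OF B]])
        also have "\<dots> = (\<integral>\<^sup>+q. 1 \<partial>kernel_measure Q P \<kappa>2 (indicator B))"
          using ac[OF ind[OF B] k1.total] by (intro nn_integral_cong_AE) (auto elim!: eventually_mono)
        also have "\<dots> = (\<integral>\<^sup>+\<omega>. 1 * indicator B \<omega> \<partial>P)"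
          using k2.emeasure_space_kernel_measure[OF ind[OF B]] by simp
        finally show "(\<integral>\<^sup>+\<omega>. ennreal (\<kappa> (space R) \<omega>) * indicator B \<omega> \<partial>P) = (\<integral>\<^sup>+\<omega>. 1 * indicator B \<omega> \<partial>P)" .
      qed (use \<kappa>(1)[OF sets.top] in measurable)
      then show ?thesis by eventually_elim (simp add: ennreal_eq_1)
    qed
    show "AE \<omega> in P. (\<lambda>n. \<kappa> (F n) \<omega>) sums \<kappa> (\<Union>n. F n) \<omega>"
      if F: "range F \<subseteq> sets R" "disjoint_family F" for F :: "nat \<Rightarrow> 'u set"
    proof -
      have Fn: "F n \<in> sets R" for n using F by auto
      have U: "(\<Union>n. F n) \<in> sets R" using Fn by auto
      note [measurable] = \<kappa>(1)[OF U] \<kappa>(1)[OF Fn] k1.meas[OF Fn]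
      have "AE \<omega> in P. ennreal (\<kappa> (\<Union>n. F n) \<omega>) = (\<Sum>n. ennreal (\<kappa> (F n) \<omega>))"
      proof (rule AE_eq_of_set_nn_integrals[OF P])
        fix B assume B: "B \<in> sets P"
        have "(\<integral>\<^sup>+\<omega>. ennreal (\<kappa> (\<Union>n. F n) \<omega>) * indicator B \<omega> \<partial>P)
           = (\<integral>\<^sup>+q. ennreal (\<kappa>1 (\<Union>n. F n) q) \<partial>kernel_measure Q P \<kappa>2 (indicator B))"
          by (rule \<kappa>(3)[OF U ind[OF B]])
        also have "\<dots> = (\<integral>\<^sup>+q. (\<Sum>n. ennreal (\<kappa>1 (F n) q)) \<partial>kernel_measure Q P \<kappa>2 (indicator B))"
        proof (rule nn_integral_cong_AE)
          have "AE q in Q. ennreal (\<kappa>1 (\<Union>n. F n) q) = (\<Sum>n. ennreal (\<kappa>1 (F n) q))"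
            using k1.sigma_additive[OF F] AE_space
            by eventually_elim (rule suminf_ennreal_eq[symmetric], use k1.bounds(1)[OF Fn] in auto)
          then show "AE q in kernel_measure Q P \<kappa>2 (indicator B). ennreal (\<kappa>1 (\<Union>n. F n) q) = (\<Sum>n. ennreal (\<kappa>1 (F n) q))"
            by (rule ac[OF ind[OF B]])
        qed
        also have "\<dots> = (\<Sum>n. \<integral>\<^sup>+q. ennreal (\<kappa>1 (F n) q) \<partial>kernel_measure Q P \<kappa>2 (indicator B))"
          by (rule nn_integral_suminf) measurable
        also have "\<dots> = (\<Sum>n. \<integral>\<^sup>+\<omega>. ennreal (\<kappa> (F n) \<omega>) * indicator B \<omega> \<partial>P)"
          by (intro suminf_cong \<kappa>(3)[OF Fn ind[OF B], symmetric])
        also have "\<dots> = (\<integral>\<^sup>+\<omega>. (\<Sum>n. ennreal (\<kappa> (F n) \<omega>) * indicator B \<omega>) \<partial>P)"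
          by (rule nn_integral_suminf[symmetric]) (use B in measurable)
        also have "\<dots> = (\<integral>\<^sup>+\<omega>. (\<Sum>n. ennreal (\<kappa> (F n) \<omega>)) * indicator B \<omega> \<partial>P)"
          by (simp add: ennreal_suminf_multc)
        finally show "(\<integral>\<^sup>+\<omega>. ennreal (\<kappa> (\<Union>n. F n) \<omega>) * indicator B \<omega> \<partial>P)
           = (\<integral>\<^sup>+\<omega>. (\<Sum>n. ennreal (\<kappa> (F n) \<omega>)) * indicator B \<omega> \<partial>P)" .
      qed measurable
      then show ?thesis using AE_space
      proof eventually_elim
        case (elim \<omega>)
        have "(\<lambda>n. ennreal (\<kappa> (F n) \<omega>)) sums ennreal (\<kappa> (\<Union>n. F n) \<omega>)"
          unfolding elim(1) by (rule summable_sums) simp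
        then show ?case using \<kappa>(2)[OF Fn elim(2)] \<kappa>(2)[OF U elim(2)] by (subst (asm) sums_ennreal) auto
      qed
    qed
    show "AE \<omega> in P. \<kappa> Z \<omega> = 0" if Z: "Z \<in> null_sets R" for Z
    proof -
      have ZR: "Z \<in> sets R" using Z by auto
      have "AE \<omega> in P. ennreal (\<kappa> Z \<omega>) = 0"
      proof (rule AE_eq_of_set_nn_integrals[OF P])
        fix B assume B: "B \<in> sets P"
        have "(\<integral>\<^sup>+\<omega>. ennreal (\<kappa> Z \<omega>) * indicator B \<omega> \<partial>P)
            = (\<integral>\<^sup>+q. ennreal (\<kappa>1 Z q) \<partial>kernel_measure Q P \<kappa>2 (indicator B))"
          by (rule \<kappa>(3)[OF ZR ind[OF B]])
        also have "\<dots> = (\<integral>\<^sup>+q. 0 \<partial>kernel_measure Q P \<kappa>2 (indicator B))"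
          using ac[OF ind[OF B] k1.null[OF Z]] by (intro nn_integral_cong_AE) (auto elim!: eventually_mono)
        finally show "(\<integral>\<^sup>+\<omega>. ennreal (\<kappa> Z \<omega>) * indicator B \<omega> \<partial>P) = (\<integral>\<^sup>+\<omega>. 0 * indicator B \<omega> \<partial>P)" by simp
      qed (use \<kappa>(1)[OF ZR] in measurable)
      then show ?thesis using AE_space by eventually_elim (use \<kappa>(2)[OF ZR] in \<open>auto simp: ennreal_eq_0_iff intro: antisym\<close>)
    qed
  qed
  then show thesis using \<kappa>(3) by (rule that)
qed

lemma standard_borel_cong: "sets S = sets S' \<Longrightarrow> standard_borel S \<longleftrightarrow> standard_borel S'"
  using sets_eq_imp_space_eq[of S S'] by (simp add: standard_borel_def)

context vn_povm
begin

lemma space_nonempty: "space S \<noteq> {}"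
proof
  assume e: "space S = {}"
  have "measure P (space S) = 0" by (subst e) simp
  then show False using measure_P_space by simp
qed

text \<open>If \<open>\<kappa>1\<close> followed by \<open>\<kappa>2\<close> is the identity, then \<open>\<kappa>1 E\<close> takes only the values 0 and 1: it vanishes
  almost everywhere for the part of \<open>\<kappa>2\<close> over the complement of \<open>E\<close> and equals 1 for the part over \<open>E\<close>.\<close>

theorem kernel_minimal_imp_relabeling_minimal:
  assumes K: "kernel_minimal_sufficient S M" and sb: "standard_borel S"
  shows "relabeling_minimal_sufficient TYPE('v) A S M"
  unfolding relabeling_minimal_sufficient_def
proof (intro allI impI, elim conjE)
  fix S1 :: "'v measure" and N assume N: "povm A S1 N" and eq: "postprocessing_equivalent S1 N S M"
  have Y: "vn_povm A \<phi>\<^sub>0 S1 N" by (intro vn_povm.intro vn_povm_axioms.intro von_neumann_axioms state N)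
  interpret Y: vn_povm A \<phi>\<^sub>0 S1 N by (rule Y)
  have NM: "two_povms A \<phi>\<^sub>0 S1 N S M" and MN: "two_povms A \<phi>\<^sub>0 S M S1 N"
    by (intro two_povms.intro Y vn_povm_axioms)+
  obtain \<kappa>2 \<kappa>1 where pp2: "postprocessing S1 N S M \<kappa>2" and pp1: "postprocessing S M S1 N \<kappa>1"
    using eq unfolding postprocessing_equivalent_def postprocessing_le_def by blast
  have k2: "ae_kernel Y.P P \<kappa>2" using pp2 two_povms.postprocessing_iff[OF NM] by blast
  have k1: "ae_kernel P Y.P \<kappa>1" using pp1 two_povms.postprocessing_iff[OF MN] by blast
  interpret k1: ae_kernel P Y.P \<kappa>1 by (rule k1)
  interpret k2: ae_kernel Y.P P \<kappa>2 by (rule k2)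
  \<comment> \<open>The composite from \<open>M\<close> through \<open>N\<close> back to
    \<open>M\<close>. It preserves every \<open>\<mu> x\<close>, so kernel minimality applies to
    it.\<close>
  obtain \<kappa> where \<kappa>: "ae_kernel P P \<kappa>" "\<And>E g. E \<in> sets P \<Longrightarrow> g \<in> borel_measurable P \<Longrightarrow>
    (\<integral>\<^sup>+\<omega>. ennreal (\<kappa> E \<omega>) * g \<omega> \<partial>P) = (\<integral>\<^sup>+q. ennreal (\<kappa>1 E q) \<partial>kernel_measure Y.P P \<kappa>2 g)"
    using compose_kernels[OF P.finite_measure_axioms k1 k2] by metis
  interpret \<kappa>: ae_kernel P P \<kappa> by (rule \<kappa>(1))
  have "postprocessing S M S M \<kappa>"
  proof (rule two_povms.postprocessingI[OF self_pair \<kappa>(1)])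
    fix x
    have dm: "(\<lambda>\<omega>. ennreal (dens x \<omega>)) \<in> borel_measurable P" by measurable
    have dY: "(\<lambda>\<omega>. ennreal (Y.dens x \<omega>)) \<in> borel_measurable Y.P" using Y.dens_measurable by measurable
    show "kernel_measure P P \<kappa> (\<lambda>\<omega>. ennreal (dens x \<omega>)) = \<mu> x"
    proof (rule measure_eqI)
      fix E assume "E \<in> sets (kernel_measure P P \<kappa> (\<lambda>\<omega>. ennreal (dens x \<omega>)))"
      then have E: "E \<in> sets P" using \<kappa>.sets_kernel_measure by simp
      have kE: "\<kappa>1 E \<in> borel_measurable S1" using k1.meas[OF E] by simp
      have "emeasure (kernel_measure P P \<kappa> (\<lambda>\<omega>. ennreal (dens x \<omega>))) E = (\<integral>\<^sup>+\<omega>. ennreal (\<kappa> E \<omega>) * ennreal (dens x \<omega>) \<partial>P)"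
        by (rule \<kappa>.emeasure_kernel_measure[OF dm E])
      also have "\<dots> = (\<integral>\<^sup>+q. ennreal (\<kappa>1 E q) \<partial>Y.\<mu> x)"
        unfolding \<kappa>(2)[OF E dm] two_povms.postprocessing_kernel_measure(1)[OF NM pp2] ..
      also have "\<dots> = (\<integral>\<^sup>+q. ennreal (\<kappa>1 E q) * ennreal (Y.dens x q) \<partial>Y.P)"
        by (rule Y.nn_integral_mu) (use kE in measurable)
      also have "\<dots> = emeasure (kernel_measure P Y.P \<kappa>1 (\<lambda>\<omega>. ennreal (Y.dens x \<omega>))) E"
        by (rule k1.emeasure_kernel_measure[OF dY E, symmetric])
      also have "\<dots> = emeasure (\<mu> x) E" unfolding two_povms.postprocessing_kernel_measure(1)[OF MN pp1] ..
      finally show "emeasure (kernel_measure P P \<kappa> (\<lambda>\<omega>. ennreal (dens x \<omega>))) E = emeasure (\<mu> x) E" .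
    qed (simp add: \<kappa>.sets_kernel_measure)
  qed
  then have fixed: "AE \<omega> in P. \<kappa> E \<omega> = indicator E \<omega>" if "E \<in> sets P" for E
    using K that unfolding kernel_minimal_sufficient_def povm_ae_iff by simp
  \<comment> \<open>The integral of \<open>\<kappa>1 E\<close> against this part of
    \<open>\<kappa>2\<close> is the integral of the composite at \<open>E\<close> over the
    complement of \<open>E\<close>, where the composite vanishes.\<close>
  have vanish: "AE q in kernel_measure Y.P P \<kappa>2 (indicator (space P - E)). \<kappa>1 E q = 0" if E: "E \<in> sets P" for E
  proof -
    have C: "space P - E \<in> sets P" using E by (rule sets.compl_sets)
    have im: "(\<lambda>\<omega>. indicator (space P - E) \<omega> :: ennreal) \<in> borel_measurable P" using C by measurable
    have "(\<integral>\<^sup>+q. ennreal (\<kappa>1 E q) \<partial>kernel_measure Y.P P \<kappa>2 (indicator (space P - E)))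
        = (\<integral>\<^sup>+\<omega>. ennreal (\<kappa> E \<omega>) * indicator (space P - E) \<omega> \<partial>P)" by (rule \<kappa>(2)[OF E im, symmetric])
    also have "\<dots> = (\<integral>\<^sup>+\<omega>. 0 \<partial>P)"
      by (rule nn_integral_cong_AE, use fixed[OF E] in eventually_elim) (auto simp: indicator_def)
    finally have "(\<integral>\<^sup>+q. ennreal (\<kappa>1 E q) \<partial>kernel_measure Y.P P \<kappa>2 (indicator (space P - E))) = 0" by simp
    moreover have "(\<lambda>q. ennreal (\<kappa>1 E q)) \<in> borel_measurable (kernel_measure Y.P P \<kappa>2 (indicator (space P - E)))"
      using k1.meas[OF E] measurable_cong_sets[OF k2.sets_kernel_measure[of "indicator (space P - E)"] refl] by simp
    ultimately have "AE q in kernel_measure Y.P P \<kappa>2 (indicator (space P - E)). ennreal (\<kappa>1 E q) = 0"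
      using nn_integral_0_iff_AE by blast
    then show ?thesis using AE_space
      by eventually_elim (use k1.bounds(1)[OF E] k2.space_kernel_measure in \<open>auto simp: ennreal_eq_0_iff intro: antisym\<close>)
  qed
  have two: "AE q in Y.P. \<kappa>1 E q = 0 \<or> \<kappa>1 E q = 1" if E: "E \<in> sets P" for E
  proof -
    define B where "B = {q \<in> space Y.P. \<not> (\<kappa>1 E q = 0 \<or> \<kappa>1 E q = 1)}"
    have B: "B \<in> sets Y.P" unfolding B_def using k1.meas[OF E] by measurable
    have C: "space P - E \<in> sets P" using E by (rule sets.compl_sets)
    have E': "space P - (space P - E) = E" using sets.sets_into_space[OF E] by auto
    have im: "(\<lambda>\<omega>. indicator F \<omega> :: ennreal) \<in> borel_measurable P" if "F \<in> sets P" for F using that by measurable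
    have null: "emeasure (kernel_measure Y.P P \<kappa>2 (indicator F)) B = 0"
      if "F \<in> sets P" "AE q in kernel_measure Y.P P \<kappa>2 (indicator F). \<kappa>1 E q = 0 \<or> \<kappa>1 E q = 1" for F
    proof -
      have "AE q in kernel_measure Y.P P \<kappa>2 (indicator F). q \<notin> B"
        using that(2) by eventually_elim (auto simp: B_def)
      then show ?thesis using B k2.sets_kernel_measure by (subst (asm) AE_iff_measurable[of B]) (auto simp: B_def)
    qed
    have n1: "emeasure (kernel_measure Y.P P \<kappa>2 (indicator (space P - E))) B = 0"
      using vanish[OF E] by (intro null C) (auto elim: eventually_mono)
    have "AE q in kernel_measure Y.P P \<kappa>2 (indicator E). \<kappa>1 (space P - E) q = 1 - \<kappa>1 E q"
      using absolutely_continuous_AE[OF _ k2.absolutely_continuous_kernel_measure[OF im[OF E]] k1.compl[OF E]]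
        k2.sets_kernel_measure by blast
    moreover have "AE q in kernel_measure Y.P P \<kappa>2 (indicator E). \<kappa>1 (space P - E) q = 0"
      using vanish[OF C] unfolding E' .
    ultimately have "AE q in kernel_measure Y.P P \<kappa>2 (indicator E). \<kappa>1 E q = 0 \<or> \<kappa>1 E q = 1"
      by eventually_elim simp
    then have n2: "emeasure (kernel_measure Y.P P \<kappa>2 (indicator E)) B = 0" by (rule null[OF E])
    have kB: "\<kappa>2 B \<in> borel_measurable P" by (rule k2.meas[OF B])
    \<comment> \<open>The weights of \<open>E\<close> and of its complement add up to 1, and
      \<open>\<kappa>2\<close> carries \<open>P\<close> to \<open>Y.P\<close>. A set that is null
      for both parts is therefore null for \<open>Y.P\<close>.\<close>
    have "emeasure Y.P B = emeasure (kernel_measure Y.P P \<kappa>2 (\<lambda>\<omega>. 1)) B"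
      unfolding two_povms.postprocessing_kernel_measure(2)[OF NM pp2] ..
    also have "\<dots> = (\<integral>\<^sup>+\<omega>. ennreal (\<kappa>2 B \<omega>) * 1 \<partial>P)" by (rule k2.emeasure_kernel_measure[OF _ B]) simp
    also have "\<dots> = (\<integral>\<^sup>+\<omega>. ennreal (\<kappa>2 B \<omega>) * indicator E \<omega> + ennreal (\<kappa>2 B \<omega>) * indicator (space P - E) \<omega> \<partial>P)"
      by (intro nn_integral_cong) (auto simp: indicator_def)
    also have "\<dots> = emeasure (kernel_measure Y.P P \<kappa>2 (indicator E)) B + emeasure (kernel_measure Y.P P \<kappa>2 (indicator (space P - E))) B"
      unfolding k2.emeasure_kernel_measure[OF im[OF E] B] k2.emeasure_kernel_measure[OF im[OF C] B]
      by (rule nn_integral_add) (use kB E C in measurable)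
    finally have "emeasure Y.P B = 0" using n1 n2 by simp
    then have "B \<in> null_sets Y.P" using B by auto
    then have "AE q in Y.P. q \<notin> B" by (rule AE_not_in)
    then show ?thesis using AE_space by eventually_elim (auto simp: B_def)
  qed
  obtain f where f: "f \<in> measurable Y.P P" "\<And>E. E \<in> sets P \<Longrightarrow> AE q in Y.P. \<kappa>1 E q = indicator E (f q)"
  proof (rule k1.point_realization)
    show "standard_borel P" using sb standard_borel_cong[OF sets_P] by blast
    show "space P \<noteq> {}" using space_nonempty by simp
  qed (use two in auto)
  have fm: "f \<in> measurable S1 S" using f(1) measurable_cong_sets[OF Y.sets_P sets_P] by blast
  have "N (f -` E \<inter> space S1) = M E" if E: "E \<in> sets S" for E
  proof (rule eqI)
    have EP: "E \<in> sets P" using E by simp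
    have pre: "f -` E \<inter> space S1 \<in> sets S1" using measurable_sets[OF fm E] .
    show "N (f -` E \<inter> space S1) \<in> A" "M E \<in> A" using Y.M_in[OF pre] M_in[OF E] .
    fix x
    have ae: "AE q in Y.\<mu> x. \<kappa>1 E q = indicator E (f q)"
      using absolutely_continuous_AE[OF _ Y.absolutely_continuous_mu f(2)[OF EP]] by simp
    have fx: "f \<in> measurable (Y.\<mu> x) S" using fm measurable_cong_sets[OF Y.sets_P refl] by blast
    have "measure (Y.\<mu> x) (f -` E \<inter> space S1) = (LINT q|Y.\<mu> x. indicator (f -` E \<inter> space S1) q)"
      using pre by simp
    also have "\<dots> = (LINT q|Y.\<mu> x. indicator E (f q))"
      by (intro Bochner_Integration.integral_cong) (auto simp: indicator_def)
    also have "\<dots> = (LINT q|Y.\<mu> x. \<kappa>1 E q)"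
    proof (rule integral_cong_AE)
      show "AE q in Y.\<mu> x. indicator E (f q) = \<kappa>1 E q" using ae by eventually_elim simp
      show "\<kappa>1 E \<in> borel_measurable (Y.\<mu> x)" using k1.meas[OF EP] by simp
      show "(\<lambda>q. indicator E (f q) :: real) \<in> borel_measurable (Y.\<mu> x)" using fx E by measurable
    qed
    also have "\<dots> = measure (\<mu> x) E"
      using pp1 E unfolding two_povms.postprocessing_iff[OF MN] by simp
    finally show "cinner x (N (f -` E \<inter> space S1) x) = cinner x (M E x)"
      unfolding Y.cinner_M[OF pre] cinner_M[OF E] by simp
  qed
  with fm show "\<exists>f\<in>measurable S1 S. \<forall>E\<in>sets S. N (f -` E \<inter> space S1) = M E" by blast
qed

end

section \<open>The minimal sufficient statistic\<close>

text \<open>Strips \<open>k\<close> leading digits, each 0 or 1, from a ternary expansion and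
  rescales, so that the next digit can be read off by comparison with 1. As a Borel function of one
  real it decodes the statistic.\<close>

primrec ternary_shift :: "nat \<Rightarrow> real \<Rightarrow> real" where
  "ternary_shift 0 t = t"
| "ternary_shift (Suc k) t = 3 * (ternary_shift k t - (if 1 \<le> ternary_shift k t then 1 else 0))"

lemma ternary_shift_measurable [measurable]: "ternary_shift k \<in> borel_measurable borel"
  by (induction k) (simp_all, measurable)

text \<open>Base three makes the digits unique. A tail of the series is at most 3/2, hence
  contributes at most 1/2 after division by three and can never imitate a leading digit 1. In base
  two a tail of ones could.\<close>

lemma ternary_digit:
  assumes b: "\<And>k. b k = 0 \<or> b k = (1::real)"
  shows "1 \<le> ternary_shift k (\<Sum>j. b j * (1/3)^j) \<longleftrightarrow> b k = 1"
proof -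
  define s where "s k = (\<Sum>j. b (k + j) * (1/3)^j)" for k
  have geo: "(\<lambda>j. (1/3)^j) sums (3/2 :: real)" using geometric_sums[of "1/3 :: real"] by simp
  have sm: "summable (\<lambda>j. b (k + j) * (1/3)^j)" for k
  proof (rule summable_comparison_test'[OF sums_summable[OF geo], of 0])
    show "norm (b (k + j) * (1/3)^j) \<le> (1/3)^j" for j using b[of "k + j"] by auto
  qed
  have s0: "0 \<le> s k" for k unfolding s_def
  proof (rule suminf_nonneg[OF sm])
    show "0 \<le> b (k + j) * (1/3)^j" for j using b[of "k + j"] by auto
  qed
  have s1: "s k \<le> 3/2" for k
  proof -
    have "s k \<le> (\<Sum>j. (1/3)^j)"
      unfolding s_def
    proof (rule suminf_le[OF _ sm sums_summable[OF geo]])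
      show "b (k + j) * (1/3)^j \<le> (1/3)^j" for j using b[of "k + j"] by auto
    qed
    then show ?thesis using geo by (simp add: sums_iff)
  qed
  have step: "s k = b k + s (Suc k) / 3" for k
  proof -
    have "s k = b (k + 0) * (1/3)^0 + (\<Sum>j. b (k + Suc j) * (1/3)^Suc j)"
      unfolding s_def using suminf_split_head[OF sm[of k]] by simp
    also have "(\<Sum>j. b (k + Suc j) * (1/3)^Suc j) = (\<Sum>j. (1/3) * (b (Suc k + j) * (1/3)^j))"
      by (intro suminf_cong) simp
    also have "\<dots> = (1/3) * s (Suc k)" unfolding s_def by (rule suminf_mult[OF sm])
    finally show ?thesis by simp
  qed
  have digit: "1 \<le> s k \<longleftrightarrow> b k = 1" for k
    using b[of k] step[of k] s0[of "Suc k"] s1[of "Suc k"] by auto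
  have "ternary_shift k (\<Sum>j. b j * (1/3)^j) = s k"
  proof (induction k)
    case 0 show ?case by (simp add: s_def)
  next
    case (Suc k)
    then show ?case using digit[of k] b[of k] step[of k] by auto
  qed
  then show ?thesis using digit by simp
qed

lemma ae_kernel_of_map:
  assumes f: "f \<in> measurable P Q" and null: "\<And>Z. Z \<in> null_sets Q \<Longrightarrow> f -` Z \<inter> space P \<in> null_sets P"
  shows "ae_kernel Q P (\<lambda>E \<omega>. indicator E (f \<omega>))"
proof
  show "0 \<le> (indicator E (f \<omega>) :: real)" "(indicator E (f \<omega>) :: real) \<le> 1" for E \<omega> by (auto simp: indicator_def)
  show "(\<lambda>\<omega>. indicator E (f \<omega>)) \<in> borel_measurable P" if "E \<in> sets Q" for E
    using f that by measurable
  show "AE \<omega> in P. indicator (space Q) (f \<omega>) = (1::real)"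
    using AE_space by eventually_elim (use measurable_space[OF f] in simp)
  show "AE \<omega> in P. (\<lambda>n. indicator (F n) (f \<omega>) :: real) sums indicator (\<Union>n. F n) (f \<omega>)"
    if "disjoint_family F" for F :: "nat \<Rightarrow> _" using indicator_sums_disjoint[OF that] by (intro AE_I2)
  show "AE \<omega> in P. indicator Z (f \<omega>) = (0::real)" if Z: "Z \<in> null_sets Q" for Z
    using AE_not_in[OF null[OF Z]] AE_space by eventually_elim (auto simp: indicator_def)
qed

lemma kernel_measure_of_map:
  assumes f: "f \<in> measurable P Q" and k: "ae_kernel Q P (\<lambda>E \<omega>. indicator E (f \<omega>))" and g: "g \<in> borel_measurable P"
  shows "kernel_measure Q P (\<lambda>E \<omega>. indicator E (f \<omega>)) g = distr (density P g) Q f"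
proof (rule measure_eqI)
  interpret ae_kernel Q P "\<lambda>E \<omega>. indicator E (f \<omega>)" by fact
  show "sets (kernel_measure Q P (\<lambda>E \<omega>. indicator E (f \<omega>)) g) = sets (distr (density P g) Q f)" by simp
  fix E assume "E \<in> sets (kernel_measure Q P (\<lambda>E \<omega>. indicator E (f \<omega>)) g)"
  then have E: "E \<in> sets Q" by simp
  have pre: "f -` E \<inter> space P \<in> sets P" using measurable_sets[OF f E] .
  have "emeasure (distr (density P g) Q f) E = emeasure (density P g) (f -` E \<inter> space P)"
    using f E by (subst emeasure_distr) auto
  also have "\<dots> = (\<integral>\<^sup>+\<omega>. g \<omega> * indicator (f -` E \<inter> space P) \<omega> \<partial>P)"
    by (rule emeasure_density[OF g pre])
  also have "\<dots> = (\<integral>\<^sup>+\<omega>. ennreal (indicator E (f \<omega>)) * g \<omega> \<partial>P)"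
    by (intro nn_integral_cong) (auto simp: indicator_def)
  finally show "emeasure (kernel_measure Q P (\<lambda>E \<omega>. indicator E (f \<omega>)) g) E = emeasure (distr (density P g) Q f) E"
    using emeasure_kernel_measure[OF g E] by simp
qed

text \<open>Additivity splits both sets over their intersection, and the kernel vanishes on the null
  remainders.\<close>

lemma (in ae_kernel) eq_of_null_difference:
  assumes "E \<in> sets Q" "F \<in> sets Q" "E - F \<in> null_sets Q" "F - E \<in> null_sets Q"
  shows "AE \<omega> in P. \<kappa> E \<omega> = \<kappa> F \<omega>"
proof -
  have EF: "E \<inter> F \<in> sets Q" using assms by blast
  have "(E \<inter> F) \<union> (E - F) = E" "(E \<inter> F) \<union> (F - E) = F" "(E \<inter> F) \<inter> (E - F) = {}" "(E \<inter> F) \<inter> (F - E) = {}"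
    by auto
  then have "AE \<omega> in P. \<kappa> E \<omega> = \<kappa> (E \<inter> F) \<omega> + \<kappa> (E - F) \<omega>" "AE \<omega> in P. \<kappa> F \<omega> = \<kappa> (E \<inter> F) \<omega> + \<kappa> (F - E) \<omega>"
    using additive[OF EF, of "E - F"] additive[OF EF, of "F - E"] assms by auto
  then show ?thesis using null[OF assms(3)] null[OF assms(4)] by eventually_elim simp
qed

text \<open>A member of the dense set of functionals need not be a vector functional. Each is
  replaced by countably many vectors whose functionals approach it to within 1/(m+1); the passage
  through the functional costs a factor 2.\<close>

lemma (in von_neumann) separating_vectors:
  assumes "separable_predual A"
  obtains X :: "nat \<Rightarrow> 'h" where "\<And>x e. e > 0 \<Longrightarrow> \<exists>n. \<forall>T\<in>A.
    cmod (cinner x (T x) - cinner (X n) (T (X n))) \<le> e * onorm T"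
proof -
  define q where "q x T = cinner x (T x)" for x :: 'h and T
  obtain D where D: "countable D" "\<And>\<phi> e. \<phi> \<in> predual A \<Longrightarrow> e > 0 \<Longrightarrow> \<exists>\<psi>\<in>D. \<forall>T\<in>A. norm (\<phi> T - \<psi> T) \<le> e * onorm T"
    using assms unfolding separable_predual_def by blast
  have qp: "q x \<in> predual A" for x
  proof -
    define \<xi> where "\<xi> n = (if n = (0::nat) then x else 0)" for n
    have fin: "summable (\<lambda>n. (norm (\<xi> n))\<^sup>2)" by (rule summable_finite[of "{0}"]) (auto simp: \<xi>_def)
    have "(\<lambda>n. cinner (\<xi> n) (T (\<xi> n))) sums q x T" for T
    proof -
      have "(\<lambda>n. if n = 0 then cinner (\<xi> n) (T (\<xi> n)) else 0) = (\<lambda>n. cinner (\<xi> n) (T (\<xi> n)))"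
        by (auto simp: \<xi>_def fun_eq_iff)
      then show ?thesis using sums_single[of 0 "\<lambda>n. cinner (\<xi> n) (T (\<xi> n))"] by (simp add: q_def \<xi>_def)
    qed
    then show ?thesis using fin unfolding predual_def by blast
  qed
  \<comment> \<open>If no vector is that close, the choice is arbitrary and merely adds one more
    vector to the countable set.\<close>
  define p where "p \<psi> m = (SOME x. \<forall>T\<in>A. norm (q x T - \<psi> T) \<le> 1 / (real m + 1) * onorm T)" for \<psi> and m :: nat
  define C where "C = (\<lambda>(\<psi>, m). p \<psi> m) ` (D \<times> UNIV)"
  have near: "\<exists>y\<in>C. \<forall>T\<in>A. cmod (q x T - q y T) \<le> e * onorm T" if e: "e > 0" for x e
  proof -
    obtain m where m: "inverse (real (Suc m)) < e / 2" using reals_Archimedean[of "e / 2"] e by auto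
    have pos: "0 < 1 / (real m + 1)" by simp
    obtain \<psi> where \<psi>: "\<psi> \<in> D" "\<forall>T\<in>A. norm (q x T - \<psi> T) \<le> 1 / (real m + 1) * onorm T"
      using D(2)[OF qp[of x] pos] by blast
    have y: "\<forall>T\<in>A. norm (q (p \<psi> m) T - \<psi> T) \<le> 1 / (real m + 1) * onorm T"
      unfolding p_def by (rule someI) (rule \<psi>(2))
    have "cmod (q x T - q (p \<psi> m) T) \<le> e * onorm T" if T: "T \<in> A" for T
    proof -
      have on: "0 \<le> onorm T" using bounded[OF T] onorm_pos_le unfolding bounded_op_def by blast
      have "q x T - q (p \<psi> m) T = (q x T - \<psi> T) - (q (p \<psi> m) T - \<psi> T)" by simp
      then have "cmod (q x T - q (p \<psi> m) T) \<le> norm (q x T - \<psi> T) + norm (q (p \<psi> m) T - \<psi> T)"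
        by (metis norm_triangle_ineq4)
      also have "\<dots> \<le> 1 / (real m + 1) * onorm T + 1 / (real m + 1) * onorm T"
        using \<psi>(2) y T by (intro add_mono) blast+
      also have "\<dots> = (2 * inverse (real (Suc m))) * onorm T" by (simp add: inverse_eq_divide add.commute)
      also have "\<dots> \<le> e * onorm T" using m on by (intro mult_right_mono) auto
      finally show ?thesis .
    qed
    moreover have "p \<psi> m \<in> C" using \<psi>(1) unfolding C_def by force
    ultimately show ?thesis by blast
  qed
  have "C \<noteq> {}" using near[of 1 0] by auto
  moreover have "countable C" using D(1) unfolding C_def by auto
  ultimately have range: "range (from_nat_into C) = C" by (simp add: range_from_nat_into)
  show thesis
  proof (rule that[of "from_nat_into C"])
    fix x :: 'h and e :: real assume "e > 0"
    then obtain y where y: "y \<in> C" "\<forall>T\<in>A. cmod (q x T - q y T) \<le> e * onorm T" using near by blast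
    then obtain n where "y = from_nat_into C n" using range by (metis rangeE)
    then show "\<exists>n. \<forall>T\<in>A. cmod (cinner x (T x) - cinner (from_nat_into C n) (T (from_nat_into C n))) \<le> e * onorm T"
      using y(2) unfolding q_def by blast
  qed
qed

text \<open>The statistic encodes all sets \<open>{dens (X n) > q}\<close> in the ternary digits of one real number. By
  separability of the predual it is sufficient, so \<open>M\<close> is equivalent to its image under the statistic.
  Relabeling back gives a map \<open>\<Phi>\<close> that preserves \<open>M\<close> and factors through the statistic. Every kernel
  preserving \<open>M\<close> fixes the statistic, and \<open>\<Phi>\<close> itself is such a kernel.\<close>

context vn_povm
begin

context
  fixes X :: "nat \<Rightarrow> 'h"
  assumes X: "\<And>x e. e > 0 \<Longrightarrow> \<exists>n. \<forall>T\<in>A. cmod (cinner x (T x) - cinner (X n) (T (X n))) \<le> e * onorm T"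
begin

definition level :: "nat \<times> rat \<Rightarrow> 'w set" where
  "level p = {\<omega> \<in> space P. of_rat (snd p) < dens (X (fst p)) \<omega>}"

text \<open>The digit at place \<open>k\<close> is membership in the level set with code
  \<open>k\<close>, so one real number records all level sets of all the densities
  \<open>dens (X n)\<close>.\<close>

definition stat :: "'w \<Rightarrow> real" where
  "stat \<omega> = (\<Sum>k. indicator (level (from_nat k)) \<omega> * (1/3)^k)"

lemma level_sets: "level p \<in> sets P"
  unfolding level_def using dens_measurable by measurable

text \<open>Stated for an arbitrary measurable space \<open>W\<close>, because it is applied both to
  the given one and to the smaller one of all sets fixed by a kernel.\<close>

lemma stat_measurable:
  assumes "\<And>p. level p \<in> sets W" shows "stat \<in> borel_measurable W"
  unfolding stat_def using assms by measurable

lemma stat_decode: "\<omega> \<in> level p \<longleftrightarrow> 1 \<le> ternary_shift (to_nat p) (stat \<omega>)"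
  unfolding stat_def using ternary_digit[of "\<lambda>k. indicator (level (from_nat k)) \<omega>" "to_nat p"]
  by (auto simp: indicator_def)

text \<open>The supremum of all rationals below the density, decoded from the statistic. Negative
  rationals are harmless, as \<open>ennreal\<close> sends them to 0.\<close>

definition dens_of_stat :: "nat \<Rightarrow> real \<Rightarrow> ennreal" where
  "dens_of_stat n t = (SUP q. ennreal (of_rat q) * indicator {t. 1 \<le> ternary_shift (to_nat (n, q)) t} t)"

lemma dens_of_stat_measurable: "dens_of_stat n \<in> borel_measurable borel"
  unfolding dens_of_stat_def by measurable

lemma dens_of_stat:
  assumes w: "\<omega> \<in> space P" shows "dens_of_stat n (stat \<omega>) = ennreal (dens (X n) \<omega>)"
proof (rule antisym)
  have iff: "1 \<le> ternary_shift (to_nat (n, q)) (stat \<omega>) \<longleftrightarrow> of_rat q < dens (X n) \<omega>" for q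
    using stat_decode[of \<omega> "(n, q)"] w by (simp add: level_def)
  show "dens_of_stat n (stat \<omega>) \<le> ennreal (dens (X n) \<omega>)"
    unfolding dens_of_stat_def
    by (intro SUP_least) (auto simp: indicator_def iff intro: ennreal_leI)
  show "ennreal (dens (X n) \<omega>) \<le> dens_of_stat n (stat \<omega>)"
  proof (rule dense_le)
    fix y assume y: "y < ennreal (dens (X n) \<omega>)"
    then obtain r where r: "y = ennreal r" "0 \<le> r" by (cases y) auto
    then have "r < dens (X n) \<omega>" using y by (simp add: ennreal_less_iff)
    then obtain q where q: "r < of_rat q" "of_rat q < dens (X n) \<omega>" using of_rat_dense by blast
    have "y \<le> ennreal (of_rat q) * indicator {t. 1 \<le> ternary_shift (to_nat (n, q)) t} (stat \<omega>)"
      using q r by (simp add: iff ennreal_leI)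
    also have "\<dots> \<le> dens_of_stat n (stat \<omega>)" unfolding dens_of_stat_def by (rule SUP_upper) simp
    finally show "y \<le> dens_of_stat n (stat \<omega>)" .
  qed
qed

lemma stat_P: "stat \<in> borel_measurable P" and stat_S: "stat \<in> borel_measurable S"
  using level_sets by (auto intro: stat_measurable)

text \<open>The image of \<open>M\<close> under the statistic. Since it lives on the real line,
  relabeling minimality against real outcome spaces applies to it.\<close>

definition stat_povm :: "real set \<Rightarrow> 'h \<Rightarrow> 'h" where "stat_povm B = M (stat -` B \<inter> space S)"

lemma stat_pre: "B \<in> sets borel \<Longrightarrow> stat -` B \<inter> space S \<in> sets S"
  using stat_S by (rule measurable_sets)

lemma povm_stat: "povm A borel stat_povm"
  unfolding povm_def
proof (intro conjI ballI allI impI; (elim conjE)?)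
  fix B :: "real set" assume B: "B \<in> sets borel"
  show "stat_povm B \<in> A" "positive_op (stat_povm B)"
    using M_in[OF stat_pre[OF B]] M_nonneg[OF stat_pre[OF B]] bounded
    by (auto simp: stat_povm_def positive_op_def)
next
  show "stat_povm (space borel) = id" by (simp add: stat_povm_def M_space)
next
  fix F :: "nat \<Rightarrow> real set" and x y assume F: "range F \<subseteq> sets borel" "disjoint_family F"
  have "range (\<lambda>n. stat -` F n \<inter> space S) \<subseteq> sets S" using F(1) stat_pre by auto
  moreover have "disjoint_family (\<lambda>n. stat -` F n \<inter> space S)"
    using F(2) by (auto simp: disjoint_family_on_def)
  ultimately have "(\<lambda>n. cinner x (M (stat -` F n \<inter> space S) y)) sums cinner x (M (\<Union>n. stat -` F n \<inter> space S) y)"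
    by (rule M_sums)
  moreover have "(\<Union>n. stat -` F n \<inter> space S) = stat -` (\<Union>n. F n) \<inter> space S" by auto
  ultimately show "(\<lambda>n. cinner x (stat_povm (F n) y)) sums cinner x (stat_povm (\<Union>n. F n) y)"
    by (simp add: stat_povm_def)
qed

lemma vn_povm_stat: "vn_povm A \<phi>\<^sub>0 borel stat_povm"
  by (intro vn_povm.intro vn_povm_axioms.intro von_neumann_axioms state povm_stat)

interpretation Y: vn_povm A \<phi>\<^sub>0 "borel :: real measure" stat_povm by (rule vn_povm_stat)

lemma YP: "Y.P = distr P borel stat" and Ymu: "Y.\<mu> x = distr (\<mu> x) borel stat"
proof -
  show "Y.P = distr P borel stat"
  proof (rule measure_eqI)
    fix B assume "B \<in> sets Y.P"
    then have B: "B \<in> sets borel" by simp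
    have "emeasure (distr P borel stat) B = emeasure P (stat -` B \<inter> space P)"
      by (rule emeasure_distr[OF stat_P B])
    then show "emeasure Y.P B = emeasure (distr P borel stat) B"
      using Y.emeasure_P[OF B] emeasure_P[OF stat_pre[OF B]] by (simp add: stat_povm_def)
  qed simp
  show "Y.\<mu> x = distr (\<mu> x) borel stat"
  proof (rule measure_eqI)
    fix B assume "B \<in> sets (Y.\<mu> x)"
    then have B: "B \<in> sets borel" by simp
    have "stat \<in> borel_measurable (\<mu> x)" using stat_S by simp
    from emeasure_distr[OF this B]
    show "emeasure (Y.\<mu> x) B = emeasure (distr (\<mu> x) borel stat) B"
      using Y.emeasure_mu[OF B, of x] emeasure_mu[OF stat_pre[OF B], of x] by (simp add: stat_povm_def)
  qed simp
qed

section \<open>Equivalence of the POVM with its image under the statistic\<close>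

lemma stat_kernel: "ae_kernel Y.P P (\<lambda>B \<omega>. indicator B (stat \<omega>))"
proof (rule ae_kernel_of_map)
  show "stat \<in> measurable P Y.P" using stat_P measurable_cong_sets[OF refl Y.sets_P] by blast
  fix Z assume "Z \<in> null_sets Y.P"
  then show "stat -` Z \<inter> space P \<in> null_sets P" using null_sets_distr_iff[OF stat_P] unfolding YP by blast
qed

lemma stat_le: "postprocessing_le borel stat_povm S M"
proof -
  have pair: "two_povms A \<phi>\<^sub>0 borel stat_povm S M" by (intro two_povms.intro vn_povm_axioms vn_povm_stat)
  have sm: "stat \<in> measurable P Y.P" using stat_P measurable_cong_sets[OF refl Y.sets_P] by blast
  have "postprocessing borel stat_povm S M (\<lambda>B \<omega>. indicator B (stat \<omega>))"
  proof (rule two_povms.postprocessingI[OF pair stat_kernel])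
    fix x
    have "kernel_measure Y.P P (\<lambda>B \<omega>. indicator B (stat \<omega>)) (\<lambda>\<omega>. ennreal (dens x \<omega>))
      = distr (density P (\<lambda>\<omega>. ennreal (dens x \<omega>))) Y.P stat"
      using dens_measurable by (intro kernel_measure_of_map[OF sm stat_kernel]) measurable
    also have "\<dots> = distr (\<mu> x) borel stat"
      unfolding density_dens by (intro distr_cong) simp_all
    finally show "kernel_measure Y.P P (\<lambda>B \<omega>. indicator B (stat \<omega>)) (\<lambda>\<omega>. ennreal (dens x \<omega>)) = Y.\<mu> x"
      unfolding Ymu .
  qed
  then show ?thesis unfolding postprocessing_le_def by blast
qed

text \<open>Sufficiency of the statistic: the kernel is the conditional probability given \<open>stat\<close>.\<close>

lemma le_stat: "postprocessing_le S M borel stat_povm"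
proof -
  have pair: "two_povms A \<phi>\<^sub>0 S M borel stat_povm" by (intro two_povms.intro vn_povm_axioms vn_povm_stat)
  have sm: "stat \<in> measurable P Y.P" using stat_P measurable_cong_sets[OF refl Y.sets_P] by blast
  interpret j: ae_kernel Y.P P "\<lambda>B \<omega>. indicator B (stat \<omega>)" by (rule stat_kernel)
  have im: "(\<lambda>\<omega>. indicator E \<omega> :: ennreal) \<in> borel_measurable P" if "E \<in> sets S" for E using that by measurable
  have "\<exists>h. h \<in> borel_measurable Y.P \<and> (\<forall>q. 0 \<le> h q) \<and>
     density Y.P (\<lambda>q. ennreal (h q)) = distr (density P (indicator E)) Y.P stat \<and> integrable Y.P h" if E: "E \<in> sets S" for E
  proof -
    have fin: "(\<integral>\<^sup>+\<omega>. indicator E \<omega> \<partial>P) < \<infinity>" using E by (simp add: P.emeasure_eq_measure)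
    show ?thesis
    proof (rule j.ex_density[OF Y.P.finite_measure_axioms im[OF E] fin])
      fix h :: "real \<Rightarrow> real" assume h: "h \<in> borel_measurable Y.P" "\<And>q. 0 \<le> h q"
        "density Y.P (\<lambda>q. ennreal (h q)) = kernel_measure Y.P P (\<lambda>B \<omega>. indicator B (stat \<omega>)) (indicator E)" "integrable Y.P h"
      show ?thesis
        using h unfolding kernel_measure_of_map[OF sm stat_kernel im[OF E]] by blast
    qed
  qed
  then obtain h where h: "\<And>E. E \<in> sets S \<Longrightarrow> h E \<in> borel_measurable Y.P" "\<And>E q. E \<in> sets S \<Longrightarrow> 0 \<le> h E q"
    "\<And>E. E \<in> sets S \<Longrightarrow> density Y.P (\<lambda>q. ennreal (h E q)) = distr (density P (indicator E)) Y.P stat"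
    "\<And>E. E \<in> sets S \<Longrightarrow> integrable Y.P (h E)" by metis
  \<comment> \<open>The defining property of a conditional expectation: \<open>h E\<close>, composed
    with \<open>stat\<close>, represents the indicator of \<open>E\<close> against every function of
    the statistic.\<close>
  have hg: "(\<integral>\<^sup>+t. ennreal (h E t) * g t \<partial>Y.P) = (\<integral>\<^sup>+\<omega>. indicator E \<omega> * g (stat \<omega>) \<partial>P)"
    if E: "E \<in> sets S" and g: "g \<in> borel_measurable borel" for E g
  proof -
    have gY: "g \<in> borel_measurable Y.P" using g by simp
    have gs: "(\<lambda>\<omega>. g (stat \<omega>)) \<in> borel_measurable P" using measurable_compose[OF stat_P g] .
    have sd: "stat \<in> measurable (density P (indicator E)) Y.P" using sm by simp
    have "(\<integral>\<^sup>+t. ennreal (h E t) * g t \<partial>Y.P) = (\<integral>\<^sup>+t. g t \<partial>density Y.P (\<lambda>t. ennreal (h E t)))"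
      using h(1)[OF E] gY by (intro nn_integral_density[symmetric]) auto
    also have "\<dots> = (\<integral>\<^sup>+\<omega>. g (stat \<omega>) \<partial>density P (indicator E))"
      unfolding h(3)[OF E] by (rule nn_integral_distr[OF sd]) (use gY in simp)
    also have "\<dots> = (\<integral>\<^sup>+\<omega>. indicator E \<omega> * g (stat \<omega>) \<partial>P)"
      by (rule nn_integral_density[OF im[OF E] gs])
    finally show ?thesis .
  qed
  have hB: "(\<integral>\<^sup>+t. ennreal (h E t) * indicator B t \<partial>Y.P) = (\<integral>\<^sup>+\<omega>. indicator E \<omega> * indicator B (stat \<omega>) \<partial>P)"
    if "E \<in> sets S" "B \<in> sets borel" for E B
    using hg[OF that(1), of "indicator B"] that(2) by simp
  have YB: "(\<integral>\<^sup>+t. indicator B t \<partial>Y.P) = (\<integral>\<^sup>+\<omega>. indicator B (stat \<omega>) \<partial>P)" if "B \<in> sets borel" for B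
    unfolding YP by (rule nn_integral_distr[OF stat_P]) (use that in simp)
  have bs: "(\<lambda>\<omega>. indicator B (stat \<omega>) :: ennreal) \<in> borel_measurable P" if "B \<in> sets borel" for B
    using stat_P that by measurable
  have le1: "AE t in Y.P. h E t \<le> 1" if E: "E \<in> sets S" for E
  proof -
    \<comment> \<open>On this set \<open>h E\<close> exceeds 1, but its integral there is at most
      the finite measure of the set. The integral of the excess must therefore vanish.\<close>
    define B where "B = {t \<in> space borel. 1 < h E t}"
    have hb: "h E \<in> borel_measurable borel" using h(1)[OF E] by simp
    have B: "B \<in> sets borel" unfolding B_def using hb by measurable
    have fin: "(\<integral>\<^sup>+t. indicator B t \<partial>Y.P) \<noteq> \<infinity>" using B Y.P.emeasure_finite[of B] by simp
    have "(\<integral>\<^sup>+t. ennreal (h E t) * indicator B t \<partial>Y.P) \<le> (\<integral>\<^sup>+t. indicator B t \<partial>Y.P)"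
      unfolding hB[OF E B] YB[OF B] by (intro nn_integral_mono) (auto simp: indicator_def)
    moreover have "(\<integral>\<^sup>+t. ennreal (h E t) * indicator B t \<partial>Y.P)
       = (\<integral>\<^sup>+t. indicator B t \<partial>Y.P) + (\<integral>\<^sup>+t. ennreal (h E t - 1) * indicator B t \<partial>Y.P)"
    proof -
      have "(\<integral>\<^sup>+t. ennreal (h E t) * indicator B t \<partial>Y.P) = (\<integral>\<^sup>+t. indicator B t + ennreal (h E t - 1) * indicator B t \<partial>Y.P)"
      proof (rule nn_integral_cong)
        fix t
        have "ennreal (h E t) = 1 + ennreal (h E t - 1)" if "t \<in> B"
          using that ennreal_plus[of 1 "h E t - 1"] by (simp add: B_def)
        then show "ennreal (h E t) * indicator B t = indicator B t + ennreal (h E t - 1) * indicator B t"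
          by (simp add: indicator_def)
      qed
      then show ?thesis using hb B by (subst (asm) nn_integral_add) auto
    qed
    ultimately have "(\<integral>\<^sup>+t. indicator B t \<partial>Y.P) + (\<integral>\<^sup>+t. ennreal (h E t - 1) * indicator B t \<partial>Y.P)
        \<le> (\<integral>\<^sup>+t. indicator B t \<partial>Y.P) + 0" by (simp only: add_0_right)
    then have "(\<integral>\<^sup>+t. ennreal (h E t - 1) * indicator B t \<partial>Y.P) = 0"
      using fin unfolding ennreal_add_left_cancel_le by (simp only: le_zero_eq) blast
    then have "AE t in Y.P. ennreal (h E t - 1) * indicator B t = 0"
      using hb B by (subst (asm) nn_integral_0_iff_AE) auto
    then show ?thesis
      by eventually_elim (auto simp: B_def indicator_def ennreal_eq_0_iff split: if_splits)
  qed
  \<comment> \<open>The bound by 1 holds only almost everywhere for \<open>h E\<close>, and a kernel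
    needs it at every point.\<close>
  define \<kappa> where "\<kappa> E t = min 1 (h E t)" for E t
  have \<kappa>h: "AE t in Y.P. \<kappa> E t = h E t" if "E \<in> sets S" for E
    using le1[OF that] by eventually_elim (simp add: \<kappa>_def)
  have k: "ae_kernel P Y.P \<kappa>"
  proof
    show "0 \<le> \<kappa> E t" "\<kappa> E t \<le> 1" if "E \<in> sets P" for E t using h(2)[of E t] that by (auto simp: \<kappa>_def)
    show "\<kappa> E \<in> borel_measurable Y.P" if "E \<in> sets P" for E
      using h(1)[of E] that unfolding \<kappa>_def[abs_def] by simp
    show "AE t in Y.P. \<kappa> (space P) t = 1"
    proof -
      have S: "space P \<in> sets S" by simp
      have "AE t in Y.P. ennreal (h (space P) t) = 1"
      proof (rule AE_eq_of_set_nn_integrals[OF Y.P.finite_measure_axioms])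
        fix B assume "B \<in> sets Y.P"
        then have B: "B \<in> sets borel" by simp
        show "(\<integral>\<^sup>+t. ennreal (h (space P) t) * indicator B t \<partial>Y.P) = (\<integral>\<^sup>+t. 1 * indicator B t \<partial>Y.P)"
          unfolding hB[OF S B] mult_1 YB[OF B] by (intro nn_integral_cong) simp
      qed (use h(1)[OF S] in measurable)
      with \<kappa>h[OF S] show ?thesis by eventually_elim (simp add: ennreal_eq_1)
    qed
    show "AE t in Y.P. (\<lambda>n. \<kappa> (F n) t) sums \<kappa> (\<Union>n. F n) t"
      if F: "range F \<subseteq> sets P" "disjoint_family F" for F :: "nat \<Rightarrow> 'w set"
    proof -
      have Fn: "F n \<in> sets S" for n using F by auto
      have U: "(\<Union>n. F n) \<in> sets S" using Fn by auto
      note [measurable] = h(1)[OF U] h(1)[OF Fn]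
      have "AE t in Y.P. ennreal (h (\<Union>n. F n) t) = (\<Sum>n. ennreal (h (F n) t))"
      proof (rule AE_eq_of_set_nn_integrals[OF Y.P.finite_measure_axioms])
        fix B assume BY: "B \<in> sets Y.P"
        then have B: "B \<in> sets borel" by simp
        have "(\<integral>\<^sup>+t. ennreal (h (\<Union>n. F n) t) * indicator B t \<partial>Y.P)
          = (\<integral>\<^sup>+\<omega>. (\<Sum>n. indicator (F n) \<omega> * indicator B (stat \<omega>)) \<partial>P)"
          unfolding hB[OF U B]
        proof (rule nn_integral_cong)
          fix \<omega>
          have "(\<Sum>n. indicator (F n) \<omega> :: ennreal) = indicator (\<Union>n. F n) \<omega>"
            using F(2) by (rule suminf_indicator)
          then show "indicator (\<Union>n. F n) \<omega> * indicator B (stat \<omega>) = (\<Sum>n. indicator (F n) \<omega> * indicator B (stat \<omega>) :: ennreal)"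
            by (simp add: ennreal_suminf_multc)
        qed
        also have "\<dots> = (\<Sum>n. \<integral>\<^sup>+\<omega>. indicator (F n) \<omega> * indicator B (stat \<omega>) \<partial>P)"
          using im[OF Fn] bs[OF B] by (intro nn_integral_suminf borel_measurable_times_ennreal)
        also have "\<dots> = (\<Sum>n. \<integral>\<^sup>+t. ennreal (h (F n) t) * indicator B t \<partial>Y.P)"
          by (intro suminf_cong hB[OF Fn B, symmetric])
        also have "\<dots> = (\<integral>\<^sup>+t. (\<Sum>n. ennreal (h (F n) t) * indicator B t) \<partial>Y.P)"
          by (rule nn_integral_suminf[symmetric]) (use BY in measurable)
        also have "\<dots> = (\<integral>\<^sup>+t. (\<Sum>n. ennreal (h (F n) t)) * indicator B t \<partial>Y.P)"
          by (simp add: ennreal_suminf_multc)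
        finally show "(\<integral>\<^sup>+t. ennreal (h (\<Union>n. F n) t) * indicator B t \<partial>Y.P)
          = (\<integral>\<^sup>+t. (\<Sum>n. ennreal (h (F n) t)) * indicator B t \<partial>Y.P)" .
      qed measurable
      moreover have "AE t in Y.P. \<forall>n. \<kappa> (F n) t = h (F n) t" unfolding AE_all_countable using \<kappa>h[OF Fn] by blast
      ultimately show ?thesis using \<kappa>h[OF U]
      proof eventually_elim
        case (elim t)
        have "(\<lambda>n. ennreal (h (F n) t)) sums ennreal (h (\<Union>n. F n) t)"
          unfolding elim(1) by (rule summable_sums) simp
        then have "(\<lambda>n. h (F n) t) sums h (\<Union>n. F n) t" using h(2)[OF Fn] h(2)[OF U] by (subst (asm) sums_ennreal) auto
        then show ?case using elim by simp
      qed
    qed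
    show "AE t in Y.P. \<kappa> Z t = 0" if Z: "Z \<in> null_sets P" for Z
    proof -
      have ZS: "Z \<in> sets S" using Z by auto
      have "(\<integral>\<^sup>+t. ennreal (h Z t) * indicator UNIV t \<partial>Y.P) = (\<integral>\<^sup>+\<omega>. indicator Z \<omega> * indicator UNIV (stat \<omega>) \<partial>P)"
        by (rule hB[OF ZS]) simp
      also have "\<dots> = emeasure P Z" using ZS by simp
      also have "\<dots> = 0" using Z by auto
      finally have "(\<integral>\<^sup>+t. ennreal (h Z t) \<partial>Y.P) = 0" by simp
      then have "AE t in Y.P. ennreal (h Z t) = 0" using h(1)[OF ZS] by (subst (asm) nn_integral_0_iff_AE) auto
      with \<kappa>h[OF ZS] show ?thesis by eventually_elim (use h(2)[OF ZS] in \<open>auto simp: ennreal_eq_0_iff intro: antisym\<close>)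
    qed
  qed
  have "postprocessing S M borel stat_povm \<kappa>"
    unfolding postprocessing_def two_povms.weak_markov_kernel_iff[OF pair]
  proof (intro conjI ballI k)
    fix E assume E: "E \<in> sets S"
    have EP: "E \<in> sets P" using E by simp
    have km: "\<kappa> E \<in> borel_measurable borel" using ae_kernel.meas[OF k EP] by simp
    have kb: "0 \<le> \<kappa> E t \<and> \<kappa> E t \<le> 1" for t using h(2)[OF E] by (auto simp: \<kappa>_def)
    define G where "G = povm_integral borel stat_povm (\<lambda>t. complex_of_real (\<kappa> E t))"
    have G: "G \<in> A" unfolding G_def using km kb by (intro Y.unit_real(1)) auto
    have ME: "M E \<in> A" by (rule M_in[OF E])
    have Gx: "cinner x (G x) = of_real (LINT t|Y.\<mu> x. \<kappa> E t)" for x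
      unfolding G_def using km kb by (intro Y.unit_real(2)) auto
    \<comment> \<open>The density of each \<open>X n\<close> is a function of the statistic, so it
      may be moved through the conditional expectation. For general \<open>x\<close> this is not
      known, and the approximation by the vectors \<open>X n\<close> takes over.\<close>
    have onX: "cinner (X n) (G (X n)) = cinner (X n) (M E (X n))" for n
    proof -
      have gm: "(\<lambda>t. ennreal (\<kappa> E t)) \<in> borel_measurable borel" using km by measurable
      have sS: "stat \<in> borel_measurable (\<mu> (X n))" using stat_S by simp
      have ks: "(\<lambda>\<omega>. ennreal (\<kappa> E (stat \<omega>))) \<in> borel_measurable S" using measurable_compose[OF stat_S gm] .
      have kd: "(\<lambda>t. ennreal (\<kappa> E t) * dens_of_stat n t) \<in> borel_measurable borel"
        using gm dens_of_stat_measurable[of n] by (rule borel_measurable_times_ennreal)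
      have "(\<integral>\<^sup>+t. ennreal (\<kappa> E t) \<partial>Y.\<mu> (X n)) = (\<integral>\<^sup>+\<omega>. ennreal (\<kappa> E (stat \<omega>)) \<partial>\<mu> (X n))"
        unfolding Ymu by (rule nn_integral_distr[OF sS]) (use gm in simp)
      also have "\<dots> = (\<integral>\<^sup>+\<omega>. ennreal (\<kappa> E (stat \<omega>)) * ennreal (dens (X n) \<omega>) \<partial>P)"
        by (rule nn_integral_mu[OF ks])
      also have "\<dots> = (\<integral>\<^sup>+\<omega>. ennreal (\<kappa> E (stat \<omega>)) * dens_of_stat n (stat \<omega>) \<partial>P)"
        by (intro nn_integral_cong) (simp only: dens_of_stat)
      also have "\<dots> = (\<integral>\<^sup>+t. ennreal (\<kappa> E t) * dens_of_stat n t \<partial>Y.P)"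
        unfolding YP by (rule nn_integral_distr[OF stat_P, symmetric]) (use kd in simp)
      also have "\<dots> = (\<integral>\<^sup>+t. ennreal (h E t) * dens_of_stat n t \<partial>Y.P)"
        by (rule nn_integral_cong_AE, use \<kappa>h[OF E] in eventually_elim) simp
      also have "\<dots> = (\<integral>\<^sup>+\<omega>. indicator E \<omega> * dens_of_stat n (stat \<omega>) \<partial>P)"
        by (rule hg[OF E dens_of_stat_measurable])
      also have "\<dots> = (\<integral>\<^sup>+\<omega>. indicator E \<omega> * ennreal (dens (X n) \<omega>) \<partial>P)"
        by (intro nn_integral_cong) (simp only: dens_of_stat)
      also have "\<dots> = (\<integral>\<^sup>+\<omega>. indicator E \<omega> \<partial>\<mu> (X n))"
        by (rule nn_integral_mu[symmetric]) (use E in measurable)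
      also have "\<dots> = emeasure (\<mu> (X n)) E" using E by simp
      finally have "(\<integral>\<^sup>+t. ennreal (\<kappa> E t) \<partial>Y.\<mu> (X n)) = emeasure (\<mu> (X n)) E" .
      moreover have "(\<integral>\<^sup>+t. ennreal (\<kappa> E t) \<partial>Y.\<mu> (X n)) = ennreal (LINT t|Y.\<mu> (X n). \<kappa> E t)"
        by (rule nn_integral_eq_integral_unit[OF Y.finite_mu]) (use km kb in auto)
      moreover have "emeasure (\<mu> (X n)) E = ennreal (measure (\<mu> (X n)) E)"
        by (rule finite_measure.emeasure_eq_measure[OF finite_mu])
      moreover have "0 \<le> (LINT t|Y.\<mu> (X n). \<kappa> E t)" using kb by (intro integral_nonneg_AE AE_I2) auto
      ultimately have "(LINT t|Y.\<mu> (X n). \<kappa> E t) = measure (\<mu> (X n)) E" by simp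
      then show ?thesis by (simp add: Gx cinner_M[OF E])
    qed
    have "cinner x (M E x) = cinner x (G x)" for x
    proof -
      \<comment> \<open>The approximation by some \<open>X n\<close> is relative to the operator
        norm, so its accuracy is divided by \<open>K + 1\<close>; adding 1 avoids a division by
        zero.\<close>
      define K where "K = onorm (M E) + onorm G"
      have K: "0 \<le> K" unfolding K_def using bounded[OF ME] bounded[OF G] onorm_pos_le
        unfolding bounded_op_def by (intro add_nonneg_nonneg) blast+
      have "cmod (cinner x (M E x) - cinner x (G x)) \<le> 0 + e" if e: "e > 0" for e
      proof -
        have e': "0 < e / (K + 1)" using e K by simp
        obtain n where n: "\<forall>T\<in>A. cmod (cinner x (T x) - cinner (X n) (T (X n))) \<le> e / (K + 1) * onorm T"
          using X[OF e', of x] by blast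
        have "cinner x (M E x) - cinner x (G x) = (cinner x (M E x) - cinner (X n) (M E (X n)))
            - (cinner x (G x) - cinner (X n) (G (X n)))" by (simp add: onX)
        then have "cmod (cinner x (M E x) - cinner x (G x)) \<le> cmod (cinner x (M E x) - cinner (X n) (M E (X n)))
            + cmod (cinner x (G x) - cinner (X n) (G (X n)))" by (simp only: norm_triangle_ineq4)
        also have "\<dots> \<le> e / (K + 1) * onorm (M E) + e / (K + 1) * onorm G" using n ME G by (intro add_mono) blast+
        also have "\<dots> = e / (K + 1) * K" by (simp add: K_def distrib_left)
        also have "\<dots> \<le> e" using e K by (simp add: field_simps)
        finally show ?thesis by simp
      qed
      then have "cmod (cinner x (M E x) - cinner x (G x)) \<le> 0" by (rule field_le_epsilon)
      then show ?thesis by simp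
    qed
    then show "M E = povm_integral borel stat_povm (\<lambda>t. complex_of_real (\<kappa> E t))"
      unfolding G_def[symmetric] by (rule eqI[OF ME G])
  qed
  then show ?thesis unfolding postprocessing_le_def by blast
qed

text \<open>The sets fixed by \<open>\<kappa>\<close> form a sigma-algebra. By
  \<open>fixes_level_set\<close> it contains the level sets of the densities, as
  \<open>\<kappa>\<close> preserves both \<open>P\<close> and the measures of the vectors
  \<open>X n\<close>. Hence \<open>stat\<close> is measurable with respect to it.\<close>

lemma fixes_stat_preimages:
  assumes pp: "postprocessing S M S M \<kappa>" and B: "B \<in> sets borel"
  shows "AE \<omega> in P. \<kappa> (stat -` B \<inter> space P) \<omega> = indicator (stat -` B \<inter> space P) \<omega>"
proof -
  have k: "ae_kernel P P \<kappa>" and mu: "\<And>E x. E \<in> sets S \<Longrightarrow> measure (\<mu> x) E = (LINT \<omega>|\<mu> x. \<kappa> E \<omega>)"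
    using pp two_povms.postprocessing_iff[OF self_pair] by blast+
  interpret k: ae_kernel P P \<kappa> by (rule k)
  let ?G = "{E \<in> sets P. AE \<omega> in P. \<kappa> E \<omega> = indicator E \<omega>}"
  have G: "sigma_algebra (space P) ?G" by (rule k.sigma_algebra_realized[where f = "\<lambda>\<omega>. \<omega>"])
  \<comment> \<open>The zero measure only serves to turn the sigma-algebra of fixed sets into a
    measurable space.\<close>
  define W where "W = measure_of (space P) ?G (\<lambda>_. 0)"
  have W: "sets W = ?G" "space W = space P"
    unfolding W_def using sigma_algebra.sets_measure_of_eq[OF G] by (simp_all add: space_measure_of_conv)
  have "level p \<in> ?G" for p
  proof -
    have "AE \<omega> in P. \<kappa> {\<omega> \<in> space P. of_rat (snd p) < dens (X (fst p)) \<omega>} \<omega>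
      = indicator {\<omega> \<in> space P. of_rat (snd p) < dens (X (fst p)) \<omega>} \<omega>"
    proof (rule fixes_level_set[OF P.finite_measure_axioms k _ dens_integrable])
      fix E assume E: "E \<in> sets P"
      then have ES: "E \<in> sets S" by simp
      show "(LINT \<omega>|P. \<kappa> E \<omega>) = measure P E"
        by (rule two_povms.postprocessing_state[OF self_pair pp ES, symmetric])
      have kS: "\<kappa> E \<in> borel_measurable S" using k.meas[OF E] by simp
      have "(LINT \<omega>|P. \<kappa> E \<omega> * dens (X (fst p)) \<omega>) = (LINT \<omega>|\<mu> (X (fst p)). \<kappa> E \<omega>)"
        by (rule integral_mu_real[OF kS, symmetric])
      also have "\<dots> = (LINT \<omega>|\<mu> (X (fst p)). indicator E \<omega>)" using mu[OF ES, of "X (fst p)"] ES by simp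
      also have "\<dots> = (LINT \<omega>|P. indicator E \<omega> * dens (X (fst p)) \<omega>)"
        by (rule integral_mu_real) (use ES in measurable)
      finally show "(LINT \<omega>|P. \<kappa> E \<omega> * dens (X (fst p)) \<omega>) = (LINT \<omega>|P. indicator E \<omega> * dens (X (fst p)) \<omega>)" .
    qed
    then show ?thesis using level_sets[of p] unfolding level_def[symmetric] by blast
  qed
  then have "stat \<in> borel_measurable W" using W(1) by (intro stat_measurable) blast
  then have "stat -` B \<inter> space W \<in> sets W" using B by (rule measurable_sets)
  then show ?thesis unfolding W by blast
qed

text \<open>For a set \<open>E\<close> the preimage \<open>E'\<close> under \<open>\<Phi>\<close> is
  a preimage under the statistic, hence fixed by every kernel preserving \<open>M\<close>. Once
  \<open>E\<close> and \<open>E'\<close> are known to differ by null sets, \<open>E\<close> is fixed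
  too.\<close>

lemma relabeling_minimal_imp_kernel_minimal_aux:
  assumes R: "relabeling_minimal_sufficient TYPE(real) A S M"
  shows "kernel_minimal_sufficient S M"
proof -
  have "postprocessing_equivalent borel stat_povm S M"
    unfolding postprocessing_equivalent_def using stat_le le_stat by blast
  then obtain f where f: "f \<in> measurable borel S" "\<forall>E\<in>sets S. stat_povm (f -` E \<inter> space borel) = M E"
    using R povm_stat unfolding relabeling_minimal_sufficient_def by blast
  define \<Phi> where "\<Phi> \<omega> = f (stat \<omega>)" for \<omega>
  have fB: "f -` E \<in> sets borel" if "E \<in> sets S" for E using measurable_sets[OF f(1) that] by simp
  have \<Phi>m: "\<Phi> \<in> measurable P P"
    unfolding \<Phi>_def[abs_def] using measurable_compose[OF stat_P f(1)] measurable_cong_sets[OF refl sets_P] by blast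
  have pre: "\<Phi> -` E \<inter> space P = stat -` (f -` E) \<inter> space P" for E by (auto simp: \<Phi>_def)
  have \<Phi>M: "M (\<Phi> -` E \<inter> space P) = M E" if "E \<in> sets S" for E
  proof -
    have "stat_povm (f -` E \<inter> space borel) = M (\<Phi> -` E \<inter> space P)" unfolding pre stat_povm_def by simp
    then show ?thesis using f(2) that by simp
  qed
  have \<Phi>P: "emeasure P (\<Phi> -` E \<inter> space P) = emeasure P E" if E: "E \<in> sets P" for E
    using \<Phi>M[of E] E emeasure_P[of E] emeasure_P[of "\<Phi> -` E \<inter> space P"] measurable_sets[OF \<Phi>m E] by simp
  have kk: "ae_kernel P P (\<lambda>E \<omega>. indicator E (\<Phi> \<omega>))"
  proof (rule ae_kernel_of_map[OF \<Phi>m])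
    fix Z assume Z: "Z \<in> null_sets P"
    then have ZP: "Z \<in> sets P" by auto
    show "\<Phi> -` Z \<inter> space P \<in> null_sets P"
      using \<Phi>P[OF ZP] measurable_sets[OF \<Phi>m ZP] Z by (auto simp: null_sets_def)
  qed
  have pp\<Phi>: "postprocessing S M S M (\<lambda>E \<omega>. indicator E (\<Phi> \<omega>))"
  proof (rule two_povms.postprocessingI[OF self_pair kk])
    fix x
    have dm: "(\<lambda>\<omega>. ennreal (dens x \<omega>)) \<in> borel_measurable P" using dens_measurable by measurable
    show "kernel_measure P P (\<lambda>E \<omega>. indicator E (\<Phi> \<omega>)) (\<lambda>\<omega>. ennreal (dens x \<omega>)) = \<mu> x"
      unfolding kernel_measure_of_map[OF \<Phi>m kk dm] density_dens
    proof (rule measure_eqI)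
      fix E assume "E \<in> sets (distr (\<mu> x) P \<Phi>)"
      then have E: "E \<in> sets P" by simp
      have \<Phi>\<mu>: "\<Phi> \<in> measurable (\<mu> x) P" using \<Phi>m measurable_cong_sets[of P "\<mu> x" P P] by simp
      have pS: "\<Phi> -` E \<inter> space P \<in> sets S" using measurable_sets[OF \<Phi>m E] by simp
      have "emeasure (distr (\<mu> x) P \<Phi>) E = emeasure (\<mu> x) (\<Phi> -` E \<inter> space P)"
        using emeasure_distr[OF \<Phi>\<mu> E] by simp
      also have "\<dots> = emeasure (\<mu> x) E"
        using emeasure_mu[OF pS, of x] emeasure_mu[of E x] \<Phi>M[of E] E by simp
      finally show "emeasure (distr (\<mu> x) P \<Phi>) E = emeasure (\<mu> x) E" .
    qed simp
  qed
  show ?thesis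
    unfolding kernel_minimal_sufficient_def povm_ae_iff
  proof (intro allI impI ballI)
    fix \<kappa> E assume pp: "postprocessing S M S M \<kappa>" and ES: "E \<in> sets S"
    have E: "E \<in> sets P" using ES by simp
    have "ae_kernel P P \<kappa>" using pp two_povms.postprocessing_iff[OF self_pair] by blast
    then interpret k: ae_kernel P P \<kappa> .
    define E' where "E' = \<Phi> -` E \<inter> space P"
    have E': "E' \<in> sets P" unfolding E'_def using measurable_sets[OF \<Phi>m E] .
    have inv: "AE \<omega> in P. \<kappa>' E' \<omega> = indicator E' \<omega>" if "postprocessing S M S M \<kappa>'" for \<kappa>'
      unfolding E'_def pre by (rule fixes_stat_preimages[OF that fB[OF ES]])
    \<comment> \<open>The kernel of \<open>\<Phi>\<close> also fixes \<open>E'\<close>, so the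
      preimage of \<open>E'\<close> under \<open>\<Phi>\<close> is \<open>E'\<close> up to a null
      set, which by definition is the preimage of \<open>E\<close>.\<close>
    have same: "AE \<omega> in P. \<Phi> \<omega> \<in> E' \<longleftrightarrow> \<Phi> \<omega> \<in> E"
      using inv[OF pp\<Phi>] AE_space by eventually_elim (auto simp: E'_def indicator_def split: if_splits)
    \<comment> \<open>As \<open>\<Phi>\<close> preserves \<open>P\<close>, a set with null preimage
      is null. Applied to the differences of \<open>E\<close> and \<open>E'\<close>, this removes
      the map \<open>\<Phi>\<close> from the relation just obtained.\<close>
    have null: "D \<in> null_sets P" if D: "D \<in> sets P" "AE \<omega> in P. \<Phi> \<omega> \<notin> D" for D
    proof -
      have "AE \<omega> in P. \<omega> \<notin> \<Phi> -` D \<inter> space P" using D(2) by eventually_elim auto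
      moreover have "\<Phi> -` D \<inter> space P \<in> sets P" using measurable_sets[OF \<Phi>m D(1)] .
      ultimately have "emeasure P (\<Phi> -` D \<inter> space P) = 0"
        by (subst AE_iff_measurable[symmetric, where P = "\<lambda>\<omega>. \<omega> \<notin> \<Phi> -` D \<inter> space P"]) auto
      then show ?thesis using \<Phi>P[OF D(1)] D(1) by (auto simp: null_sets_def)
    qed
    have "E - E' \<in> null_sets P" "E' - E \<in> null_sets P"
      using E E' same by (auto intro!: null elim: eventually_mono)
    then have 1: "AE \<omega> in P. \<kappa> E \<omega> = \<kappa> E' \<omega>" and 2: "AE \<omega> in P. \<omega> \<notin> E - E'" and 3: "AE \<omega> in P. \<omega> \<notin> E' - E"
      using k.eq_of_null_difference[OF E E'] AE_not_in by blast+
    from 1 2 3 inv[OF pp] show "AE \<omega> in P. \<kappa> E \<omega> = indicator E \<omega>"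
      by eventually_elim (auto simp: indicator_def split: if_splits)
  qed
qed

end

theorem relabeling_minimal_imp_kernel_minimal:
  assumes "separable_predual A" "relabeling_minimal_sufficient TYPE(real) A S M"
  shows "kernel_minimal_sufficient S M"
proof (rule separating_vectors[OF assms(1)])
  fix X :: "nat \<Rightarrow> 'h"
  assume "\<And>x e. e > 0 \<Longrightarrow> \<exists>n. \<forall>T\<in>A. cmod (cinner x (T x) - cinner (X n) (T (X n))) \<le> e * onorm T"
  from relabeling_minimal_imp_kernel_minimal_aux[OF this assms(2)] show ?thesis .
qed

end

(* The type 'v is arbitrary: kernel minimal sufficiency implies relabeling minimal sufficiency
   against outcome spaces of every type. For the converse, outcome spaces with points in the reals
   already suffice. *)
theorem theorem4:
  fixes A :: "('h::chilbert_space \<Rightarrow> 'h) set"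
    and \<phi>\<^sub>0 :: "('h \<Rightarrow> 'h) \<Rightarrow> complex"
    and S :: "'w measure"
    and M :: "'w set \<Rightarrow> 'h \<Rightarrow> 'h"
  assumes "von_neumann_algebra A"
    and "sigma_finite_vn A"
    and "faithful_normal_state A \<phi>\<^sub>0"
    and "povm A S M"
  shows "(kernel_minimal_sufficient S M \<longleftrightarrow>
            minimal_sufficient (Linf_alg (povm_measure S M \<phi>\<^sub>0)) (operator_alg A) (qc_channel S M)) \<and>
         (separable_predual A \<and> standard_borel S \<longrightarrow>
            (kernel_minimal_sufficient S M \<longrightarrow> relabeling_minimal_sufficient TYPE('v) A S M) \<and>
            (relabeling_minimal_sufficient TYPE(real) A S M \<longrightarrow> kernel_minimal_sufficient S M))"
proof -
  interpret vn_povm A \<phi>\<^sub>0 S M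
    by (intro vn_povm.intro von_neumann.intro vn_povm_axioms.intro assms)
  show ?thesis
    using kernel_minimal_imp_channel_minimal channel_minimal_imp_kernel_minimal
      kernel_minimal_imp_relabeling_minimal[where 'v = 'v] relabeling_minimal_imp_kernel_minimal
    by blast
qed

end
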